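(* Let $q\ge 2$. There exists a residual subset $\Sigma^0\subset\tilde C^0_{per}$ such that the following holds. Let $h\in C([0,1],\mathbb{R}^2)$ with $\int_0^1h(t)\,dt=0$, let $H:[0,1]\to\mathbb{R}^2$ be a periodic $C^2$ function with $H''=-h$, and let $r$ be the number (assumed finite) of bounded connected components of $\mathbb{R}^2\setminus\mathrm{Im}(H)$. Then there is $\lambda_0>0$ such that for every $\lambda\ge\lambda_0$ with $\lambda h\in\Sigma^0$ the repulsive problem $$u''(t)-\frac{u(t)}{|u(t)|^{q+1}}=\lambda h(t),\qquad u(0)=u(1),\quad u'(0)=u'(1)$$ has at least $2r$ distinct solutions.
   Context: $\tilde C^0_{per}=\{x\in C([0,1],\mathbb{R}^2):\int_0^1x(t)\,dt=0\}$ with the sup norm; a residual set is one containing a countable intersection of open dense sets. Solutions are $C^2$ functions $u:[0,1]\to\mathbb{R}^2\setminus\{0\}$. "Periodic" for $H$ means $H(0)=H(1)$ and $H'(0)=H'(1)$. *)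

theory Defs
  imports "HOL-Analysis.Analysis"
begin

text \<open>
  The closed subspace of continuous functions on \<open>[0,1]\<close> with zero mean, under the sup metric.
  As for every \<^const>\<open>cfunspace\<close>, its points are extensional, that is, equal to
  \<^const>\<open>undefined\<close> outside \<open>[0,1]\<close>.
\<close>

definition C0_per :: "(real \<Rightarrow> real^2) metric" where
  "C0_per = submetric (cfunspace (top_of_set {0..1}) euclidean_metric)
              {x. integral {0..1} x = 0}"

lemma mspace_C0_per:
  "mspace C0_per =
     {x \<in> extensional {0..1}. continuous_on {0..1} x \<and> integral {0..1} x = 0}"
proof -
  have "bounded (x ` {0..1})" if "continuous_on {0..1} x" for x :: "real \<Rightarrow> real^2"
    using that by (simp add: compact_continuous_image compact_imp_bounded)
  then show ?thesis
    by (auto simp: C0_per_def mtopology_of_euclidean Met_TC.mbounded_def image_subset_iff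
        bounded_subset_cball)
qed

lemma mdist_C0_per:
  assumes "x \<in> mspace C0_per" "y \<in> mspace C0_per"
  shows "mdist C0_per x y = (SUP t\<in>{0..1}. norm (x t - y t))"
proof -
  have "x \<in> Metric_space.fspace UNIV dist {0..1}" "y \<in> Metric_space.fspace UNIV dist {0..1}"
    using assms cfunspace_subset_funspace[of "top_of_set {0..1::real}" "euclidean_metric :: (real^2) metric"]
    by (auto simp: C0_per_def)
  then show ?thesis
    by (simp add: C0_per_def mdist_cfunspace_eq_mdist_funspace Met_TC.fdist_def dist_norm)
qed

definition residual_in :: "'a topology \<Rightarrow> 'a set \<Rightarrow> bool" where
  "residual_in X S \<longleftrightarrow> S \<subseteq> topspace X \<and>
     (\<exists>U :: nat \<Rightarrow> 'a set. (\<forall>n. openin X (U n) \<and> X closure_of (U n) = topspace X)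
        \<and> (\<Inter>n. U n) \<subseteq> S)"

text \<open>The derivative relative to \<open>[0,1]\<close>, hence one-sided at the two end points.\<close>

definition deriv01 :: "(real \<Rightarrow> real^2) \<Rightarrow> real \<Rightarrow> real^2" where
  "deriv01 u t = vector_derivative u (at t within {0..1})"

definition C2_on01 :: "(real \<Rightarrow> real^2) \<Rightarrow> bool" where
  "C2_on01 u \<longleftrightarrow> u differentiable_on {0..1} \<and> deriv01 u differentiable_on {0..1} \<and>
     continuous_on {0..1} (deriv01 (deriv01 u))"

definition periodic01 :: "(real \<Rightarrow> real^2) \<Rightarrow> bool" where
  "periodic01 u \<longleftrightarrow> u 0 = u 1 \<and> deriv01 u 0 = deriv01 u 1"

text \<open>
  Solutions are taken extensional on \<open>[0,1]\<close>, so that distinct elements of this set are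
  distinct as functions on \<open>[0,1]\<close>.
\<close>

definition repulsive_solutions :: "real \<Rightarrow> (real \<Rightarrow> real^2) \<Rightarrow> (real \<Rightarrow> real^2) set" where
  "repulsive_solutions q p =
     {u \<in> extensional {0..1}. C2_on01 u \<and> (\<forall>t\<in>{0..1}. u t \<noteq> 0) \<and> periodic01 u \<and>
        (\<forall>t\<in>{0..1}. deriv01 (deriv01 u) t - (1 / norm (u t) powr (q + 1)) *\<^sub>R u t = p t)}"

definition bounded_components :: "(real^2) set \<Rightarrow> (real^2) set set" where
  "bounded_components S = {C \<in> components S. bounded C}"

end

theory Submission imports Defs begin

text \<open>
  Periodic solutions are the zeros of the shooting map \<open>shoot z p\<close>, the change over one period of
  the state \<open>z = (u(0), u'(0))\<close>.  For a generic forcing \<open>p\<close> these zeros are nondegenerate, by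
  Sard's theorem and the controllability of the linearised equation.  There is none for \<open>p = 0\<close>, and
  an a priori bound is uniform along \<open>s p\<close> with \<open>0 \<le> s \<le> 1\<close>; hence the degree of the shooting map
  is \<open>0\<close>, and as many of its zeros have positive as have negative Jacobian determinant.  It
  remains to find \<open>r\<close> zeros with nonnegative determinant.

  Substituting \<open>u = \<lambda> y\<close> makes the force small, of order \<open>\<lambda> powr -(q + 1)\<close>, so that \<open>y\<close> stays close
  to \<open>\<xi> - H\<close> with \<open>\<xi>\<close> constant, and the Lyapunov-Schmidt reduction of the action to the variable
  \<open>\<xi>\<close> is close to a negative multiple of \<open>\<integral> |\<xi> - H(t)| powr (1 - q) dt\<close>.  For \<open>q \<ge> 2\<close> this integral
  blows up when \<open>\<xi>\<close> approaches the curve, so the reduced action has a maximum in every bounded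
  component, and at a maximum the determinant is nonnegative.
\<close>

section \<open>Degree of maps of four-dimensional space\<close>

text \<open>The singular force is undefined at the origin and unbounded near it. Once it is
  truncated in a small disc, the shooting map is C1 on all of \<open>real^4\<close> with bounded
  derivative, as the degree argument requires: it compares bijections \<open>t I + F\<close> and
  \<open>t I + G\<close> of the whole space for large \<open>t\<close>. The price is that every zero
  counted must be shown to be an orbit that never enters the disc, with constants depending only on
  the size of the forcing; the virial identity and the energy provide them.

  Why a maximum yields a sign: eliminating the initial velocity by the condition that the position
  returns leaves a map of the plane. At a maximum of the reduced action its linearisation has a
  nonpositive quadratic form, and in the even dimension two the determinant is then nonnegative.
  Genericity makes this sign strict, and the balance of signs doubles the count.

  The residual set is a countable intersection because each condition is made open by confining the
  initial states to a compact ball and keeping the orbits at a fixed distance from the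
  origin.\<close>

lemma has_real_derivative_max_0_power:
  "((\<lambda>x::real. max 0 x ^ Suc (Suc n)) has_real_derivative real (Suc (Suc n)) * max 0 x ^ Suc n) (at x)"
proof -
  consider "x > 0" | "x < 0" | "x = 0" by linarith
  then show ?thesis
  proof cases
    case 1
    have "((\<lambda>x::real. x ^ Suc (Suc n)) has_real_derivative real (Suc (Suc n)) * max 0 x ^ Suc n) (at x)"
      using 1 DERIV_pow[of "Suc (Suc n)" x UNIV] by (simp only: max_absorb2[OF less_imp_le]) simp
    then show ?thesis
      by (rule has_field_derivative_transform_within_open[where S="{0<..}"]) (use 1 in auto)
  next
    case 2
    have "((\<lambda>x::real. 0) has_real_derivative real (Suc (Suc n)) * max 0 x ^ Suc n) (at x)"
      using 2 by simp
    then show ?thesis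
      by (rule has_field_derivative_transform_within_open[where S="{..<0}"]) (use 2 in auto)
  next
    case 3
    have "((\<lambda>h::real. max 0 h ^ Suc n) \<longlongrightarrow> max 0 0 ^ Suc n) (at 0)"
      by (intro tendsto_intros)
    moreover have "max 0 h ^ Suc n = max 0 h ^ Suc (Suc n) / h" if "h \<noteq> 0" for h :: real
      using that by (auto simp: max_def)
    ultimately have "((\<lambda>h::real. max 0 h ^ Suc (Suc n) / h) \<longlongrightarrow> 0) (at 0)"
      by (rule_tac Lim_transform_eventually[of "\<lambda>h. max 0 h ^ Suc n"]) (auto simp: eventually_at_filter)
    then show ?thesis
      using 3 by (simp add: DERIV_def)
  qed
qed

lemma has_real_derivative_max_0_square: "((\<lambda>x::real. (max 0 x)\<^sup>2) has_real_derivative 2 * max 0 x) (at x)"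
  and has_real_derivative_max_0_cube: "((\<lambda>x::real. (max 0 x)^3) has_real_derivative 3 * (max 0 x)\<^sup>2) (at x)"
  using has_real_derivative_max_0_power[of 0 x] has_real_derivative_max_0_power[of 1 x]
  by (simp_all add: numeral_2_eq_2 numeral_3_eq_3)

text \<open>The hat function of height \<open>\<rho>\<close> on \<open>[-\<rho>, \<rho>]\<close>,
  written as a second difference of \<open>max 0\<close> so that the primitive
  \<open>tent_int\<close> is the same second difference of half squares. The primitive climbs from 0
  to \<open>\<rho>^2\<close>.\<close>

definition tent :: "real \<Rightarrow> real \<Rightarrow> real" where
  "tent \<rho> t = max 0 (t + \<rho>) - 2 * max 0 t + max 0 (t - \<rho>)"

definition tent_int :: "real \<Rightarrow> real \<Rightarrow> real" where
  "tent_int \<rho> t = ((max 0 (t + \<rho>))^2 - 2 * (max 0 t)^2 + (max 0 (t - \<rho>))^2) / 2"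

lemma tent_int_deriv: "(tent_int \<rho> has_real_derivative tent \<rho> t) (at t)"
proof -
  have *: "((\<lambda>x::real. (max 0 (x + c))^2) has_real_derivative 2 * max 0 (t + c)) (at t)" for c
    using DERIV_shift[THEN iffD1, OF has_real_derivative_max_0_square[of "t + c"]] .
  show ?thesis
    unfolding tent_int_def[abs_def] tent_def
    by (rule derivative_eq_intros *[of \<rho>] *[of 0, simplified] *[of "- \<rho>", simplified] | simp)+
qed

lemma tent_cont: "continuous_on S (tent \<rho>)"
  unfolding tent_def by (intro continuous_intros)

lemma tent_nonneg: "\<rho> > 0 \<Longrightarrow> tent \<rho> t \<ge> 0"
  and tent_le: "\<rho> > 0 \<Longrightarrow> tent \<rho> t \<le> \<rho>"
  and tent_pos_iff: "\<rho> > 0 \<Longrightarrow> tent \<rho> t > 0 \<longleftrightarrow> \<bar>t\<bar> < \<rho>"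
  by (auto simp: tent_def max_def abs_if)

lemma tent_int_1: "\<rho> > 0 \<Longrightarrow> t \<ge> \<rho> \<Longrightarrow> tent_int \<rho> t = \<rho>^2"
  and tent_int_0: "\<rho> > 0 \<Longrightarrow> t \<le> -\<rho> \<Longrightarrow> tent_int \<rho> t = 0"
  by (auto simp: tent_int_def max_def power2_eq_square algebra_simps)

lemma tent_int_strict_mono:
  assumes "\<rho> > 0" "-\<rho> < s" "s < t" "t < \<rho>"
  shows "tent_int \<rho> s < tent_int \<rho> t"
  by (rule DERIV_pos_imp_increasing[OF assms(3)])
     (use assms tent_int_deriv[of \<rho>] tent_pos_iff[OF assms(1)] in \<open>force\<close>)

section \<open>Jacobian determinants of perturbations of the identity\<close>

abbreviation jac :: "(real^4 \<Rightarrow> real^4) \<Rightarrow> real" where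
  "jac f' \<equiv> det (matrix f')"

lemma prod_4: "prod f (UNIV::4 set) = f 1 * f 2 * f 3 * (f 4 :: 'a::comm_monoid_mult)"
  unfolding UNIV_4 by (simp add: ac_simps)

text \<open>A fifth difference annihilates polynomials of degree four.\<close>

lemma det_4_extrapolate:
  fixes A :: "real^4^4"
  shows "det A = 5 * det (\<tau> *\<^sub>R mat 1 + A) - 10 * det ((2 * \<tau>) *\<^sub>R mat 1 + A)
    + 10 * det ((3 * \<tau>) *\<^sub>R mat 1 + A) - 5 * det ((4 * \<tau>) *\<^sub>R mat 1 + A)
    + det ((5 * \<tau>) *\<^sub>R mat 1 + A)"
proof -
  \<comment> \<open>In each term of the Leibniz formula the four factors are affine in the shift, so
    their product is a polynomial of degree four and the difference formula applies term by
    term.\<close>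
  have lin4: "a * b * c * d = 5 * ((\<tau> * x + a) * (\<tau> * y + b) * (\<tau> * z + c) * (\<tau> * w + d))
     - 10 * ((2 * \<tau> * x + a) * (2 * \<tau> * y + b) * (2 * \<tau> * z + c) * (2 * \<tau> * w + d))
     + 10 * ((3 * \<tau> * x + a) * (3 * \<tau> * y + b) * (3 * \<tau> * z + c) * (3 * \<tau> * w + d))
     - 5 * ((4 * \<tau> * x + a) * (4 * \<tau> * y + b) * (4 * \<tau> * z + c) * (4 * \<tau> * w + d))
     + (5 * \<tau> * x + a) * (5 * \<tau> * y + b) * (5 * \<tau> * z + c) * (5 * \<tau> * w + d)"
    for a b c d x y z w :: real
    by (simp add: algebra_simps)
  have eq: "s * (\<Prod>i\<in>UNIV. A $ i $ \<pi> i) =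
     5 * (s * (\<Prod>i\<in>UNIV. (\<tau> *\<^sub>R mat 1 + A) $ i $ \<pi> i)) - 10 * (s * (\<Prod>i\<in>UNIV. ((2 * \<tau>) *\<^sub>R mat 1 + A) $ i $ \<pi> i))
     + 10 * (s * (\<Prod>i\<in>UNIV. ((3 * \<tau>) *\<^sub>R mat 1 + A) $ i $ \<pi> i))
     - 5 * (s * (\<Prod>i\<in>UNIV. ((4 * \<tau>) *\<^sub>R mat 1 + A) $ i $ \<pi> i))
     + s * (\<Prod>i\<in>UNIV. ((5 * \<tau>) *\<^sub>R mat 1 + A) $ i $ \<pi> i)" for \<pi> :: "4 \<Rightarrow> 4" and s :: real
    unfolding prod_4 vector_add_component vector_scaleR_component real_scaleR_def
    by (subst lin4[of _ _ _ _ "mat 1 $ 1 $ \<pi> 1" "mat 1 $ 2 $ \<pi> 2" "mat 1 $ 3 $ \<pi> 3" "mat 1 $ 4 $ \<pi> 4"])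
      (simp only: distrib_left right_diff_distrib mult.left_commute[of s])
  show ?thesis
    unfolding det_def
    by (simp only: sum_distrib_left sum_subtractf[symmetric] sum.distrib[symmetric], rule sum.cong[OF refl], rule eq)
qed

lemma continuous_on_jac:
  assumes "\<And>k. continuous_on S (\<lambda>x. F' x k)"
  shows "continuous_on S (\<lambda>x. jac (F' x))"
proof -
  have "continuous_on S (\<lambda>x. F' x k $ i)" for k i
    using continuous_on_component[OF assms] .
  then show ?thesis
    unfolding det_def matrix_def by (simp, intro continuous_intros assms)
qed

lemma jac_perturbed_id_pos:
  fixes A :: "real^4 \<Rightarrow> real^4"
  assumes "linear A" and A: "\<And>k. norm (A k) \<le> L * norm k" and "0 \<le> L" "L < t"
  shows "jac (\<lambda>k. t *\<^sub>R k + A k) > 0"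
proof -
  interpret linear A by fact
  let ?f = "\<lambda>s. jac (\<lambda>k. t *\<^sub>R k + s *\<^sub>R A k)"
  have nz: "?f s \<noteq> 0" if "s \<in> {0..1}" for s
  proof -
    have l: "linear (\<lambda>k. t *\<^sub>R k + s *\<^sub>R A k)"
      by unfold_locales (simp_all add: add scaleR algebra_simps)
    have "k = 0" if k: "t *\<^sub>R k + s *\<^sub>R A k = 0" for k
    proof -
      have "t *\<^sub>R k = - (s *\<^sub>R A k)" using k by (simp add: eq_neg_iff_add_eq_0)
      then have "norm (t *\<^sub>R k) = norm (s *\<^sub>R A k)" by simp
      then have "t * norm k = s * norm (A k)" using assms \<open>s \<in> _\<close> by simp
      also have "\<dots> \<le> 1 * (L * norm k)" using \<open>s \<in> _\<close> A by (intro mult_mono) auto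
      finally have "(t - L) * norm k \<le> 0" by (simp add: algebra_simps)
      then show ?thesis using assms by (simp add: mult_le_0_iff)
    qed
    then have "inj (\<lambda>k. t *\<^sub>R k + s *\<^sub>R A k)"
      using l linear_injective_0 by blast
    then show ?thesis
      using det_nz_iff_inj[of "\<lambda>k. t *\<^sub>R k + s *\<^sub>R A k"] l by (simp add: matrix_of_matrix_vector_mul)
  qed
  have c: "continuous_on {0..1} ?f"
    by (rule continuous_on_jac) (intro continuous_intros)
  have "matrix (\<lambda>k::real^4. t *\<^sub>R k) = t *\<^sub>R mat 1"
    by (simp add: matrix_def mat_def vec_eq_iff axis_def)
  then have "?f 0 = t ^ 4"
    by (simp add: det_diagonal mat_def prod_4 power4_eq_xxxx)
  then have "?f 0 > 0" using assms by simp
  show ?thesis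
  proof (rule ccontr)
    assume "\<not> ?thesis"
    then have "?f 1 \<le> 0" by simp
    then obtain s where "s \<in> {0..1}" "?f s = 0"
      using IVT2'[of ?f 1 0 0] \<open>?f 0 > 0\<close> c by fastforce
    then show False using nz by blast
  qed
qed

text \<open>Surjectivity is Banach's fixed point theorem for the map sending x to
  \<open>(y - F x) /\<^sub>R t\<close>, whose contraction constant is \<open>L / t\<close>.\<close>

lemma perturbed_id_bij:
  fixes F :: "real^4 \<Rightarrow> real^4"
  assumes lip: "\<And>x y. norm (F x - F y) \<le> L * norm (x - y)" and "0 \<le> L" "L < t"
  shows "bij (\<lambda>x. t *\<^sub>R x + F x)"
proof (rule bijI)
  show "inj (\<lambda>x. t *\<^sub>R x + F x)"
  proof (rule injI)
    fix x y assume "t *\<^sub>R x + F x = t *\<^sub>R y + F y"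
    then have "t *\<^sub>R (x - y) = F y - F x" by (simp add: algebra_simps)
    then have "t * norm (x - y) \<le> L * norm (x - y)"
      using lip[of y x] assms by (metis abs_of_nonneg less_le_trans norm_minus_commute norm_scaleR not_less order.strict_implies_order)
    then have "(t - L) * norm (x - y) \<le> 0" by (simp add: algebra_simps)
    then show "x = y" using assms by (simp add: mult_le_0_iff)
  qed
  show "surj (\<lambda>x. t *\<^sub>R x + F x)"
  proof -
   have "\<exists>x. y = t *\<^sub>R x + F x" for y
   proof -
    have "\<exists>!x\<in>UNIV. (y - F x) /\<^sub>R t = x"
    proof (rule Banach_fix[where c="L / t"])
      show "dist ((y - F u) /\<^sub>R t) ((y - F v) /\<^sub>R t) \<le> L / t * dist u v" for u v
      proof -
        have "(y - F u) /\<^sub>R t - (y - F v) /\<^sub>R t = (F v - F u) /\<^sub>R t"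
          by (simp add: algebra_simps)
        then show ?thesis
          using lip[of v u] assms by (simp add: dist_norm norm_minus_commute divide_simps)
      qed
    qed (use assms in \<open>auto simp: complete_UNIV\<close>)
    then obtain x where "(y - F x) /\<^sub>R t = x" by auto
    then have "t *\<^sub>R x = t *\<^sub>R ((y - F x) /\<^sub>R t)" by simp
    then have "t *\<^sub>R x + F x = y" using assms by simp
    then show "\<exists>x. y = t *\<^sub>R x + F x" by metis
   qed
   then show ?thesis by (auto simp: surj_def)
  qed
qed

lemma C1_Lipschitz:
  fixes F :: "real^4 \<Rightarrow> real^4"
  assumes "\<And>x. (F has_derivative F' x) (at x)" and "\<And>x k. norm (F' x k) \<le> L * norm k"
  shows "norm (F x - F y) \<le> L * norm (x - y)"
  by (rule differentiable_bound[where f'=F' and S=UNIV])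
     (use assms(2) in \<open>auto intro: onorm_le has_derivative_at_withinI[OF assms(1)]\<close>)

text \<open>The determinant is positive, so the change of variables formula holds without an
  absolute value, and the right-hand side becomes a polynomial in \<open>t\<close>.\<close>

lemma perturbed_id_image_measure:
  fixes F :: "real^4 \<Rightarrow> real^4"
  assumes der: "\<And>x. (F has_derivative F' x) (at x)" and cont: "\<And>k. continuous_on UNIV (\<lambda>x. F' x k)"
    and bd: "\<And>x k. norm (F' x k) \<le> L * norm k" and "0 \<le> L" "L < t"
  shows "measure lebesgue ((\<lambda>x. t *\<^sub>R x + F x) ` cbox a b)
      = integral (cbox a b) (\<lambda>x. det (t *\<^sub>R mat 1 + matrix (F' x)))"
proof -
  have lin: "linear (F' x)" for x by (rule has_derivative_linear[OF der])
  have eq: "det (t *\<^sub>R mat 1 + matrix (F' x)) = jac (\<lambda>k. t *\<^sub>R k + F' x k)" for x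
    by (rule arg_cong[of _ _ det]) (simp add: matrix_def mat_def vec_eq_iff axis_def)
  have pos: "\<bar>jac (\<lambda>k. t *\<^sub>R k + F' x k)\<bar> = jac (\<lambda>k. t *\<^sub>R k + F' x k)" for x
    by (rule abs_of_pos, rule jac_perturbed_id_pos[where L=L]) (simp_all add: lin bd assms)
  have "measure lebesgue ((\<lambda>x. t *\<^sub>R x + F x) ` cbox a b)
      = integral (cbox a b) (\<lambda>x. \<bar>jac (\<lambda>k. t *\<^sub>R k + F' x k)\<bar>)"
  proof (rule measure_differentiable_image_eq[where f' = "\<lambda>x k. t *\<^sub>R k + F' x k"])
    show "((\<lambda>x. t *\<^sub>R x + F x) has_derivative (\<lambda>k. t *\<^sub>R k + F' x k)) (at x within cbox a b)" for x
      by (rule has_derivative_at_withinI) (intro derivative_intros der)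
    show "inj_on (\<lambda>x. t *\<^sub>R x + F x) (cbox a b)"
      using perturbed_id_bij[OF C1_Lipschitz[OF der bd] \<open>0 \<le> L\<close> \<open>L < t\<close>] by (meson bij_is_inj inj_on_subset subset_UNIV)
    show "(\<lambda>x. \<bar>jac (\<lambda>k. t *\<^sub>R k + F' x k)\<bar>) integrable_on cbox a b"
      unfolding pos
      by (rule integrable_continuous, rule continuous_on_jac, intro continuous_on_add continuous_on_const)
        (rule continuous_on_subset[OF cont subset_UNIV])
  qed auto
  then show ?thesis by (simp only: pos eq)
qed

text \<open>Rogers' device: for large \<open>t\<close> both \<open>t I + F\<close> and \<open>t I + G\<close> are bijections of the whole
  space, so they map the box onto the same set, and the integral of the Jacobian determinant is a
  polynomial in \<open>t\<close>.\<close>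

lemma integral_jac_eq:
  fixes F G :: "real^4 \<Rightarrow> real^4"
  assumes derF: "\<And>x. (F has_derivative F' x) (at x)" and contF: "\<And>k. continuous_on UNIV (\<lambda>x. F' x k)"
    and derG: "\<And>x. (G has_derivative G' x) (at x)" and contG: "\<And>k. continuous_on UNIV (\<lambda>x. G' x k)"
    and bd: "\<And>x k. norm (F' x k) \<le> L * norm k"
    and eq: "\<And>x. x \<notin> cbox a b \<Longrightarrow> G x = F x"
  shows "integral (cbox a b) (\<lambda>x. jac (G' x)) = integral (cbox a b) (\<lambda>x. jac (F' x))"
proof -
  have linG: "linear (G' x)" for x by (rule has_derivative_linear[OF derG])
  have eq': "G' x = F' x" if "x \<notin> cbox a b" for x
  proof -
    have "(F has_derivative G' x) (at x)"
      by (rule has_derivative_transform_within_open[OF derG, of "- cbox a b"]) (use that eq in auto)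
    from has_derivative_unique[OF this derF] show ?thesis .
  qed
  have "\<exists>M. \<forall>x\<in>cbox a b. norm (G' x k) \<le> M" for k
  proof -
    have "compact ((\<lambda>x. G' x k) ` cbox a b)"
      by (intro compact_continuous_image continuous_on_subset[OF contG]) auto
    then have "bounded ((\<lambda>x. G' x k) ` cbox a b)" by (rule compact_imp_bounded)
    then show ?thesis unfolding bounded_iff by auto
  qed
  then obtain M where M: "\<And>k x. x \<in> cbox a b \<Longrightarrow> norm (G' x k) \<le> M k" by metis
  \<comment> \<open>One bound for both derivatives: off the box \<open>G'\<close> equals
    \<open>F'\<close>, and on the compact box \<open>G'\<close> is controlled by the bounds
    \<open>M\<close> of its values on the basis vectors.\<close>
  define K where "K = max 0 L + (\<Sum>i\<in>Basis. \<bar>M i\<bar>)"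
  have K0: "0 \<le> K" unfolding K_def by (intro add_nonneg_nonneg sum_nonneg) auto
  have sn: "(\<Sum>i\<in>Basis. \<bar>M i\<bar>) \<ge> 0" by (intro sum_nonneg) auto
  have bdF: "norm (F' x k) \<le> K * norm k" for x k
  proof (rule order_trans[OF bd])
    have "L \<le> K" unfolding K_def using sn max.cobounded2[of L 0] by linarith
    then show "L * norm k \<le> K * norm k" by (intro mult_right_mono) auto
  qed
  have bdG: "norm (G' x k) \<le> K * norm k" for x k
  proof (cases "x \<in> cbox a b")
    case True
    have "G' x k = (\<Sum>i\<in>Basis. (k \<bullet> i) *\<^sub>R G' x i)"
      using arg_cong[OF euclidean_representation[of k], of "G' x"]
      by (simp only: linear_sum[OF linG] linear_scale[OF linG])
    also have "norm \<dots> \<le> (\<Sum>i\<in>Basis. \<bar>M i\<bar> * norm k)"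
    proof (rule sum_norm_le)
      fix i :: "real^4" assume i: "i \<in> Basis"
      have "norm ((k \<bullet> i) *\<^sub>R G' x i) \<le> norm k * \<bar>M i\<bar>"
        using Basis_le_norm[OF i, of k] M[OF True, of i] by (auto intro!: mult_mono)
      then show "norm ((k \<bullet> i) *\<^sub>R G' x i) \<le> \<bar>M i\<bar> * norm k" by (simp add: mult.commute)
    qed
    also have "\<dots> \<le> K * norm k"
      by (auto simp: K_def sum_distrib_right[symmetric] intro!: mult_right_mono)
    finally show ?thesis .
  qed (use eq' bdF in simp)
  have same: "integral (cbox a b) (\<lambda>x. det (t *\<^sub>R mat 1 + matrix (G' x)))
      = integral (cbox a b) (\<lambda>x. det (t *\<^sub>R mat 1 + matrix (F' x)))" if t: "K < t" for t
  proof -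
    have "bij (\<lambda>x. t *\<^sub>R x + F x)" "bij (\<lambda>x. t *\<^sub>R x + G x)"
      using perturbed_id_bij[OF C1_Lipschitz[OF derF bdF] K0 t]
        perturbed_id_bij[OF C1_Lipschitz[OF derG bdG] K0 t] by auto
    moreover have "(\<lambda>x. t *\<^sub>R x + G x) ` (- cbox a b) = (\<lambda>x. t *\<^sub>R x + F x) ` (- cbox a b)"
      by (rule image_cong) (use eq in auto)
    ultimately have "(\<lambda>x. t *\<^sub>R x + G x) ` cbox a b = (\<lambda>x. t *\<^sub>R x + F x) ` cbox a b"
      by (simp add: bij_image_Compl_eq)
    then show ?thesis
      using perturbed_id_image_measure[OF derF contF bdF K0 t, of a b]
        perturbed_id_image_measure[OF derG contG bdG K0 t, of a b] by simp
  qed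
  \<comment> \<open>The integrals of interest belong to t = 0, where \<open>t I + F\<close> need not
    be injective. Extrapolation recovers them from the five shifts \<open>K + 1\<close>, ...,
    \<open>5 * (K + 1)\<close>, all of which exceed \<open>K\<close>.\<close>
  have rep: "integral (cbox a b) (\<lambda>x. jac (F' x)) =
      5 * integral (cbox a b) (\<lambda>x. det ((K + 1) *\<^sub>R mat 1 + matrix (F' x)))
    - 10 * integral (cbox a b) (\<lambda>x. det ((2 * (K + 1)) *\<^sub>R mat 1 + matrix (F' x)))
    + 10 * integral (cbox a b) (\<lambda>x. det ((3 * (K + 1)) *\<^sub>R mat 1 + matrix (F' x)))
    - 5 * integral (cbox a b) (\<lambda>x. det ((4 * (K + 1)) *\<^sub>R mat 1 + matrix (F' x)))
    + integral (cbox a b) (\<lambda>x. det ((5 * (K + 1)) *\<^sub>R mat 1 + matrix (F' x)))"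
    if cont: "\<And>k. continuous_on UNIV (\<lambda>x. F' x k)" for F' :: "real^4 \<Rightarrow> real^4 \<Rightarrow> real^4"
  proof -
    let ?e = "\<lambda>t x. det (t *\<^sub>R mat 1 + matrix (F' x))"
    have int: "?e t integrable_on cbox a b" for t
    proof -
      have "det (t *\<^sub>R mat 1 + matrix (F' x)) = jac (\<lambda>k. t *\<^sub>R k + F' x k)" for x
        by (rule arg_cong[of _ _ det]) (simp add: matrix_def mat_def vec_eq_iff axis_def)
      then show ?thesis
        by (simp only:, intro integrable_continuous continuous_on_jac continuous_on_add continuous_on_const)
          (rule continuous_on_subset[OF cont subset_UNIV])
    qed
    have "((\<lambda>x. 5 * ?e (K+1) x - 10 * ?e (2 * (K+1)) x + 10 * ?e (3 * (K+1)) x - 5 * ?e (4 * (K+1)) x + ?e (5 * (K+1)) x)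
       has_integral 5 * integral (cbox a b) (?e (K+1)) - 10 * integral (cbox a b) (?e (2 * (K+1)))
        + 10 * integral (cbox a b) (?e (3 * (K+1))) - 5 * integral (cbox a b) (?e (4 * (K+1)))
        + integral (cbox a b) (?e (5 * (K+1)))) (cbox a b)"
      by (intro has_integral_add has_integral_diff has_integral_mult_right integrable_integral int)
    then have "((\<lambda>x. jac (F' x)) has_integral 5 * integral (cbox a b) (?e (K+1)) - 10 * integral (cbox a b) (?e (2 * (K+1)))
        + 10 * integral (cbox a b) (?e (3 * (K+1))) - 5 * integral (cbox a b) (?e (4 * (K+1)))
        + integral (cbox a b) (?e (5 * (K+1)))) (cbox a b)"
      by (rule has_integral_eq[rotated]) (rule det_4_extrapolate[symmetric])
    then show ?thesis by (rule integral_unique)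
  qed
  have *: "K < c * (K + 1)" if "c \<ge> 1" for c
  proof -
    have "1 * (K + 1) \<le> c * (K + 1)" using that K0 by (intro mult_right_mono) auto
    then show ?thesis by simp
  qed
  show ?thesis
    unfolding rep[where F'=F', OF contF] rep[where F'=G', OF contG]
    unfolding same[OF *[OF one_le_numeral]] same[OF less_add_one] ..
qed

section \<open>Bump densities and the degree integral\<close>

definition bump :: "real \<Rightarrow> real^4 \<Rightarrow> real" where
  "bump \<rho> y = (\<Prod>i\<in>UNIV. tent \<rho> (y $ i))"

text \<open>The coordinatewise primitive of the tent. Its Jacobian determinant at \<open>y\<close>
  is \<open>bump \<rho> y\<close>, so \<open>bump \<rho> (f x) * jac f'\<close> is itself the
  Jacobian determinant of a map, namely of \<open>bump_map \<rho>\<close> after \<open>f\<close>.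
  This is what lets \<open>integral_jac_eq\<close> act on degree integrals.\<close>

definition bump_map :: "real \<Rightarrow> real^4 \<Rightarrow> real^4" where
  "bump_map \<rho> y = (\<chi> i. tent_int \<rho> (y $ i))"

lemma continuous_on_bump: "continuous_on S f \<Longrightarrow> continuous_on S (\<lambda>x. bump \<rho> (f x))"
  unfolding bump_def
  by (intro continuous_intros continuous_on_compose2[OF tent_cont[of UNIV]]) auto

lemma bump_nonneg: "\<rho> > 0 \<Longrightarrow> bump \<rho> y \<ge> 0"
  unfolding bump_def by (intro prod_nonneg) (simp add: tent_nonneg)

lemma bump_pos_iff: "\<rho> > 0 \<Longrightarrow> bump \<rho> y > 0 \<longleftrightarrow> (\<forall>i. \<bar>y $ i\<bar> < \<rho>)"
  using tent_nonneg[of \<rho>] tent_pos_iff[of \<rho>]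
  by (auto simp: bump_def less_le[of 0] prod_nonneg)

text \<open>The factor 4 is the dimension: the norm is at most the sum of the four coordinates. The
  multiples of \<open>4 * \<rho>\<close> below come from here.\<close>

lemma bump_eq_0:
  assumes "\<rho> > 0" "norm y \<ge> 4 * \<rho>"
  shows "bump \<rho> y = 0"
proof (rule ccontr)
  assume "bump \<rho> y \<noteq> 0"
  then have "\<bar>y $ i\<bar> < \<rho>" for i
    using bump_nonneg[OF assms(1), of y] bump_pos_iff[OF assms(1), of y] by (simp add: less_le)
  then have "(\<Sum>i\<in>UNIV. \<bar>y $ i\<bar>) < (\<Sum>i\<in>(UNIV :: 4 set). \<rho>)"
    by (intro sum_strict_mono) auto
  then show False using norm_le_l1_cart[of y] assms by simp
qed

lemma bump_map_deriv:
  "(bump_map \<rho> has_derivative (\<lambda>k. \<chi> i. tent \<rho> (y $ i) * k $ i)) (at y)"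
proof -
  have "((\<lambda>y. tent_int \<rho> (y $ i)) has_derivative (\<lambda>k. tent \<rho> (y $ i) * k $ i)) (at y)" for i
    using has_derivative_compose[OF bounded_linear_imp_has_derivative[OF bounded_linear_vec_nth[of i], of "at y"]
        tent_int_deriv[of \<rho> "y $ i", unfolded has_field_derivative_def]]
    by simp
  then show ?thesis
    unfolding bump_map_def[abs_def]
    by (subst has_derivative_componentwise_within) (auto simp: Basis_vec_def inner_axis)
qed

lemma bump_map_comp:
  assumes "(f has_derivative f') (at x)"
  shows "((\<lambda>x. bump_map \<rho> (f x)) has_derivative (\<lambda>k. \<chi> i. tent \<rho> (f x $ i) * f' k $ i)) (at x)"
    and "jac (\<lambda>k. \<chi> i. tent \<rho> (f x $ i) * f' k $ i) = bump \<rho> (f x) * jac f'"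
proof -
  show "((\<lambda>x. bump_map \<rho> (f x)) has_derivative (\<lambda>k. \<chi> i. tent \<rho> (f x $ i) * f' k $ i)) (at x)"
    using has_derivative_compose[OF assms bump_map_deriv[of \<rho> "f x"]] by simp
  have "linear (\<lambda>k. \<chi> i. tent \<rho> (f x $ i) * k $ i)"
    using has_derivative_linear[OF bump_map_deriv] .
  moreover have "linear f'" using has_derivative_linear[OF assms] .
  ultimately have "matrix (\<lambda>k. \<chi> i. tent \<rho> (f x $ i) * f' k $ i)
     = matrix (\<lambda>k. \<chi> i. tent \<rho> (f x $ i) * k $ i) ** matrix f'"
    using matrix_compose[of f' "\<lambda>k. \<chi> i. tent \<rho> (f x $ i) * k $ i"] by (simp add: o_def)
  moreover have "jac (\<lambda>k. \<chi> i. tent \<rho> (f x $ i) * k $ i) = bump \<rho> (f x)"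
    by (subst det_diagonal) (auto simp: matrix_def axis_def bump_def)
  ultimately show "jac (\<lambda>k. \<chi> i. tent \<rho> (f x $ i) * f' k $ i) = bump \<rho> (f x) * jac f'"
    by (simp add: det_mul)
qed

text \<open>Integrated over space, this density is \<open>bump_mass \<rho>\<close> times the degree of \<open>f\<close> on \<open>D\<close> once \<open>\<rho>\<close>
  is smaller than \<open>|f|\<close> on the boundary.\<close>

definition deg_density :: "real \<Rightarrow> (real^4) set \<Rightarrow> (real^4 \<Rightarrow> real^4) \<Rightarrow> (real^4 \<Rightarrow> real^4 \<Rightarrow> real^4) \<Rightarrow> real^4 \<Rightarrow> real" where
  "deg_density \<rho> D f f' x = (if x \<in> D then bump \<rho> (f x) * jac (f' x) else 0)"

lemma continuous_on_open_cover2: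
  assumes "open U" "open V" "U \<union> V = UNIV" "continuous_on U f" "continuous_on V f"
  shows "continuous_on UNIV f"
  using continuous_on_open_Un[OF assms(1,2,4,5)] assms(3) by simp

text \<open>Extending by zero creates no jump: near the frontier \<open>f\<close> is larger than
  \<open>4 * \<rho>\<close> and the bump has already vanished. Thus \<open>D\<close> and the open
  set \<open>V\<close>, on which the density is 0, cover the space.\<close>

lemma continuous_on_deg_density:
  assumes cf: "continuous_on UNIV f" and cf': "\<And>k. continuous_on UNIV (\<lambda>x. f' x k)"
    and D: "open D" and fr: "\<And>x. x \<in> frontier D \<Longrightarrow> norm (f x) > 4 * \<rho>" and "\<rho> > 0"
  shows "continuous_on UNIV (deg_density \<rho> D f f')"
proof -
  define V where "V = - closure D \<union> {x. norm (f x) > 4 * \<rho>}"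
  have "open {x. norm (f x) > 4 * \<rho>}"
    by (rule open_Collect_less) (intro continuous_intros cf)+
  then have 1: "open V" unfolding V_def by auto
  have 2: "D \<union> V = UNIV"
    using fr D unfolding V_def frontier_def by (auto simp: interior_open)
  have "continuous_on D (\<lambda>x. bump \<rho> (f x) * jac (f' x))"
    by (rule continuous_on_mult[OF continuous_on_bump[OF continuous_on_subset[OF cf subset_UNIV]]
          continuous_on_jac[OF continuous_on_subset[OF cf' subset_UNIV]]])
  then have 3: "continuous_on D (deg_density \<rho> D f f')"
    by (rule continuous_on_eq) (simp add: deg_density_def)
  have "deg_density \<rho> D f f' x = 0" if "x \<in> V" for x
    using that closure_subset[of D] bump_eq_0[OF \<open>\<rho> > 0\<close>, of "f x"] by (auto simp: deg_density_def V_def)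
  then have "continuous_on V (deg_density \<rho> D f f')"
    by (simp cong: continuous_on_cong)
  from continuous_on_open_cover2[OF D 1 2 3 this] show ?thesis .
qed

text \<open>A C1 function falling from 1 to 0 between \<open>c\<close> and \<open>3 * c\<close>. It
  is applied to the square \<open>f x \<bullet> f x\<close>, which is differentiable also at the
  zeros of \<open>f\<close>.\<close>

definition cutoff :: "real \<Rightarrow> real \<Rightarrow> real" where
  "cutoff c s = 1 - tent_int c (s - 2 * c) / c^2"

lemma cutoff:
  assumes "c > 0"
  shows "(cutoff c has_real_derivative - tent c (s - 2 * c) / c^2) (at s)"
    and "s \<le> c \<Longrightarrow> cutoff c s = 1" and "s \<ge> 3 * c \<Longrightarrow> cutoff c s = 0"
    and "0 \<le> cutoff c s" "cutoff c s \<le> 1"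
proof -
  have *: "((\<lambda>s. tent_int c (s - 2 * c)) has_real_derivative tent c (s - 2 * c)) (at s)"
    using DERIV_shift[of "tent_int c" "tent c (s - 2 * c)" s "- 2 * c"] tent_int_deriv[of c "s - 2 * c"] by simp
  show "(cutoff c has_real_derivative - tent c (s - 2 * c) / c^2) (at s)"
    unfolding cutoff_def[abs_def]
    using DERIV_diff[OF DERIV_const[of 1] DERIV_cdivide[OF *, of "c^2"]] by simp
  show "s \<le> c \<Longrightarrow> cutoff c s = 1" "s \<ge> 3 * c \<Longrightarrow> cutoff c s = 0"
    using assms tent_int_0[of c "s - 2 * c"] tent_int_1[of c "s - 2 * c"] by (auto simp: cutoff_def)
  have "mono (tent_int c)"
  proof (rule monoI)
    fix x y :: real assume "x \<le> y"
    then show "tent_int c x \<le> tent_int c y"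
      by (rule DERIV_nonneg_imp_nondecreasing) (use tent_int_deriv[of c] tent_nonneg[OF assms] in blast)
  qed
  then have "tent_int c t \<le> c^2" "0 \<le> tent_int c t" for t
    using tent_int_1[of c "max c t"] tent_int_0[of c "min (-c) t"] assms
      monoD[of "tent_int c" t "max c t"] monoD[of "tent_int c" "min (-c) t" t] by auto
  then show "0 \<le> cutoff c s" "cutoff c s \<le> 1"
    using assms by (auto simp: cutoff_def divide_simps)
qed


text \<open>The interpolation \<open>F\<close> equals \<open>g\<close> where \<open>f\<close> is
  small and \<open>f\<close> where \<open>f\<close> is large or outside \<open>D\<close>, so its
  bump composite differs from that of \<open>f\<close> only inside the box and has the same Jacobian
  integral. Where \<open>F\<close> may differ from \<open>g\<close> inside \<open>D\<close>, the
  values of \<open>f\<close>, \<open>g\<close> and \<open>F\<close> are all outside the support of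
  the bump, so the integral for \<open>F\<close> is also the one for \<open>g\<close>.\<close>

lemma degree_step:
  fixes f g :: "real^4 \<Rightarrow> real^4"
  assumes derf: "\<And>x. (f has_derivative f' x) (at x)" and contf: "\<And>k. continuous_on UNIV (\<lambda>x. f' x k)"
    and derg: "\<And>x. (g has_derivative g' x) (at x)" and contg: "\<And>k. continuous_on UNIV (\<lambda>x. g' x k)"
    and bd: "\<And>x k. norm (f' x k) \<le> L * norm k"
    and D: "open D" "D \<subseteq> cbox a b" and "\<rho> > 0"
    and fr: "\<And>x. x \<in> frontier D \<Longrightarrow> norm (f x) > 16 * \<rho>"
    and close: "\<And>x. x \<in> closure D \<Longrightarrow> norm (g x - f x) < 4 * \<rho>"
  shows "integral (cbox a b) (deg_density \<rho> D g g') = integral (cbox a b) (deg_density \<rho> D f f')"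
proof -
  \<comment> \<open>The switch from \<open>g\<close> to \<open>f\<close> begins at norm
    \<open>8 * \<rho>\<close>: subtracting the distance \<open>4 * \<rho>\<close> between
    \<open>f\<close> and \<open>g\<close> still leaves \<open>4 * \<rho>\<close>, where the bump
    vanishes. It is over at \<open>14 * \<rho>\<close>, since 14 * 14 = 196 is at least 3 * 64, and
    hence before the frontier value \<open>16 * \<rho>\<close>.\<close>
  define c where "c = (8 * \<rho>)^2"
  have "c > 0" using \<open>\<rho> > 0\<close> by (simp add: c_def)
  note cut = cutoff[OF \<open>c > 0\<close>]
  define wt where "wt x = (if x \<in> D then cutoff c (f x \<bullet> f x) else 0)" for x
  define wt' where "wt' x k = (if x \<in> D then - tent c (f x \<bullet> f x - 2 * c) / c^2 * (2 * (f x \<bullet> f' x k)) else 0)" for x k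
  define F where "F x = f x + wt x *\<^sub>R (g x - f x)" for x
  define F' where "F' x k = f' x k + wt x *\<^sub>R (g' x k - f' x k) + wt' x k *\<^sub>R (g x - f x)" for x k
  define V where "V = - closure D \<union> {x. norm (f x) > 14 * \<rho>}"
  have cf: "continuous_on UNIV f" and cg: "continuous_on UNIV g"
    using derf derg by (auto intro!: continuous_at_imp_continuous_on has_derivative_continuous)
  have "open {x. norm (f x) > 14 * \<rho>}"
    by (rule open_Collect_less) (intro continuous_intros cf)+
  then have V: "open V" unfolding V_def by auto
  have DV: "x \<in> V" if "x \<notin> D" for x
    using fr[of x] D that \<open>\<rho> > 0\<close> unfolding V_def frontier_def by (force simp: interior_open)
  have 0: "wt x = 0" "wt' x k = 0" if "x \<in> V" for x k
  proof -
    have "f x \<bullet> f x \<ge> 3 * c" if "x \<in> D"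
    proof -
      have "norm (f x) \<ge> 14 * \<rho>" using \<open>x \<in> V\<close> that closure_subset[of D] by (auto simp: V_def)
      then have "(norm (f x))^2 \<ge> (14 * \<rho>)^2" using \<open>\<rho> > 0\<close> by (intro power_mono) auto
      then show ?thesis by (simp add: c_def power2_norm_eq_inner power_mult_distrib) (use zero_le_power2[of \<rho>] in linarith)
    qed
    then show "wt x = 0" "wt' x k = 0"
      using \<open>c > 0\<close> cut(3)[of "f x \<bullet> f x"] tent_pos_iff[of c "f x \<bullet> f x - 2 * c"] tent_nonneg[of c "f x \<bullet> f x - 2 * c"]
      by (auto simp: wt_def wt'_def not_less)
  qed
  have 1: "wt x = 1" "wt' x k = 0" if "x \<in> D" "norm (f x) \<le> 8 * \<rho>" for x k
  proof -
    have "(norm (f x))^2 \<le> (8 * \<rho>)^2" using that(2) by (intro power_mono) auto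
    then have "f x \<bullet> f x \<le> c" by (simp add: c_def power2_norm_eq_inner)
    then show "wt x = 1" "wt' x k = 0"
      using \<open>c > 0\<close> that cut(2)[of "f x \<bullet> f x"] tent_pos_iff[of c "f x \<bullet> f x - 2 * c"] tent_nonneg[of c "f x \<bullet> f x - 2 * c"]
      by (auto simp: wt_def wt'_def not_less)
  qed
  have derF: "(F has_derivative F' x) (at x)" for x
  proof (cases "x \<in> D")
    case True
    have "((\<lambda>x. cutoff c (f x \<bullet> f x)) has_derivative (\<lambda>k. (- tent c (f x \<bullet> f x - 2 * c) / c^2) * (f x \<bullet> f' x k + f' x k \<bullet> f x))) (at x)"
      by (rule has_derivative_compose[OF has_derivative_inner[OF derf derf] cut(1)[unfolded has_field_derivative_def]])
    then have "((\<lambda>x. f x + cutoff c (f x \<bullet> f x) *\<^sub>R (g x - f x)) has_derivative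
       (\<lambda>k. f' x k + (cutoff c (f x \<bullet> f x) *\<^sub>R (g' x k - f' x k) + ((- tent c (f x \<bullet> f x - 2 * c) / c^2) * (f x \<bullet> f' x k + f' x k \<bullet> f x)) *\<^sub>R (g x - f x)))) (at x)"
      by (intro has_derivative_add has_derivative_scaleR has_derivative_diff derf derg)
    moreover have "(\<lambda>k. f' x k + (cutoff c (f x \<bullet> f x) *\<^sub>R (g' x k - f' x k) + ((- tent c (f x \<bullet> f x - 2 * c) / c^2) * (f x \<bullet> f' x k + f' x k \<bullet> f x)) *\<^sub>R (g x - f x))) = F' x"
      using True by (auto simp: F'_def wt_def wt'_def inner_commute algebra_simps)
    ultimately show ?thesis
      by (rule_tac has_derivative_transform_within_open[where s=D and f="\<lambda>x. f x + cutoff c (f x \<bullet> f x) *\<^sub>R (g x - f x)"])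
         (use True D in \<open>auto simp: F_def wt_def\<close>)
  next
    case False
    then have "F' x = f' x" using 0[OF DV[OF False]] by (auto simp: F'_def)
    then show ?thesis
      by (rule_tac has_derivative_transform_within_open[where s=V and f=f])
         (use DV[OF False] derf V 0 in \<open>auto simp: F_def\<close>)
  qed
  have contF: "continuous_on UNIV (\<lambda>x. F' x k)" for k
  proof (rule continuous_on_open_cover2[OF D(1) V])
    show "D \<union> V = UNIV" using DV by auto
    have sub: "continuous_on D f" "continuous_on D g" "continuous_on D (\<lambda>x. f' x k)" "continuous_on D (\<lambda>x. g' x k)"
      using cf cg contf[of k] contg[of k] by (auto elim: continuous_on_subset)
    have "continuous_on D (\<lambda>x. cutoff c (f x \<bullet> f x))"
      by (rule continuous_on_compose2[OF DERIV_continuous_on[of UNIV "cutoff c", OF cut(1)]])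
         (auto intro!: continuous_intros sub)
    moreover have "continuous_on D (\<lambda>x. tent c (f x \<bullet> f x - 2 * c))"
      by (rule continuous_on_compose2[OF tent_cont[of UNIV]]) (auto intro!: continuous_intros sub)
    ultimately have "continuous_on D (\<lambda>x. f' x k + cutoff c (f x \<bullet> f x) *\<^sub>R (g' x k - f' x k) + (- tent c (f x \<bullet> f x - 2 * c) / c^2 * (2 * (f x \<bullet> f' x k))) *\<^sub>R (g x - f x))"
      using \<open>c > 0\<close> sub by (intro continuous_intros) auto
    then show "continuous_on D (\<lambda>x. F' x k)"
      by (rule continuous_on_eq) (simp add: F'_def wt_def wt'_def)
    have "continuous_on V (\<lambda>x. f' x k)" using contf[of k] by (rule continuous_on_subset) auto
    then show "continuous_on V (\<lambda>x. F' x k)"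
      by (rule continuous_on_eq) (simp add: F'_def 0)
  qed
  have cF: "continuous_on UNIV F"
    using derF by (auto intro!: continuous_at_imp_continuous_on has_derivative_continuous)
  let ?T = "\<lambda>f f' x k. (\<chi> i. tent \<rho> (f x $ i) * f' x k $ i) :: real^4"
  have cT: "continuous_on UNIV (\<lambda>x. ?T h h' x k)" if "continuous_on UNIV h" "\<And>k. continuous_on UNIV (\<lambda>x. h' x k)" for h h' k
    by (rule continuous_on_vec_lambda, rule continuous_on_mult[OF continuous_on_compose2[OF tent_cont[of UNIV]] continuous_on_component[OF that(2)]])
       (auto intro: continuous_on_component that(1))
  have eqint: "integral (cbox a b) (\<lambda>x. jac (?T F F' x)) = integral (cbox a b) (\<lambda>x. jac (?T f f' x))"
  proof (rule integral_jac_eq[where F="\<lambda>x. bump_map \<rho> (f x)" and G="\<lambda>x. bump_map \<rho> (F x)" and L="\<rho> * L"])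
    show "((\<lambda>x. bump_map \<rho> (f x)) has_derivative ?T f f' x) (at x)"
      "((\<lambda>x. bump_map \<rho> (F x)) has_derivative ?T F F' x) (at x)" for x
      using bump_map_comp(1)[OF derf] bump_map_comp(1)[OF derF] by auto
    show "continuous_on UNIV (\<lambda>x. ?T f f' x k)" "continuous_on UNIV (\<lambda>x. ?T F F' x k)" for k
      using cT[of f f'] cT[of F F'] cf contf cF contF by auto
    show "norm (?T f f' x k) \<le> \<rho> * L * norm k" for x k
    proof -
      have "norm (?T f f' x k) \<le> norm (\<rho> *\<^sub>R f' x k)"
        by (rule norm_le_componentwise_cart)
           (use tent_nonneg[OF \<open>\<rho> > 0\<close>] tent_le[OF \<open>\<rho> > 0\<close>] \<open>\<rho> > 0\<close> in \<open>auto simp: abs_mult intro!: mult_right_mono\<close>)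
      also have "\<dots> \<le> \<rho> * (L * norm k)" using bd[of x k] \<open>\<rho> > 0\<close> by simp
      finally show ?thesis by (simp add: mult.assoc)
    qed
    show "bump_map \<rho> (F x) = bump_map \<rho> (f x)" if "x \<notin> cbox a b" for x
    proof -
      have "x \<notin> D" using that D by blast
      then show ?thesis using 0[OF DV[of x]] by (simp add: F_def)
    qed
  qed
  have pt: "deg_density \<rho> D g g' x - deg_density \<rho> D f f' x = jac (?T F F' x) - jac (?T f f' x)" for x
  proof -
    have e: "jac (?T F F' x) = bump \<rho> (F x) * jac (F' x)" "jac (?T f f' x) = bump \<rho> (f x) * jac (f' x)"
      using bump_map_comp(2)[OF derF] bump_map_comp(2)[OF derf] by auto
    consider "x \<notin> D" | "x \<in> D" "norm (f x) \<le> 8 * \<rho>" | "x \<in> D" "norm (f x) > 8 * \<rho>" by force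
    then show ?thesis
    proof cases
      case 1
      then have "F x = f x" "F' x = f' x" using 0[OF DV[of x]] by (auto simp: F_def F'_def)
      then show ?thesis unfolding e using 1 by (simp add: deg_density_def)
    next
      case 2
      then have "F x = g x" "F' x = g' x" using 1[of x] by (auto simp: F_def F'_def)
      then show ?thesis unfolding e using 2 by (simp add: deg_density_def)
    next
      case 3
      then have cl: "norm (g x - f x) < 4 * \<rho>" using close closure_subset by auto
      have "norm (F x - f x) \<le> 1 * norm (g x - f x)"
        unfolding F_def add_diff_cancel_left' norm_scaleR
        by (rule mult_right_mono) (use cut(4,5) in \<open>auto simp: wt_def\<close>)
      moreover have "norm (f x) \<le> norm (F x) + norm (F x - f x)" "norm (f x) \<le> norm (g x) + norm (g x - f x)"
        using norm_triangle_ineq4[of "F x" "F x - f x"] norm_triangle_ineq4[of "g x" "g x - f x"] by auto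
      ultimately have "norm (F x) \<ge> 4 * \<rho>" "norm (g x) \<ge> 4 * \<rho>" "norm (f x) \<ge> 4 * \<rho>"
        using 3 cl \<open>\<rho> > 0\<close> by linarith+
      then have "bump \<rho> (F x) = 0" "bump \<rho> (g x) = 0" "bump \<rho> (f x) = 0"
        using bump_eq_0[OF \<open>\<rho> > 0\<close>] by auto
      then show ?thesis unfolding e by (simp add: deg_density_def)
    qed
  qed
  have i1: "deg_density \<rho> D f f' integrable_on cbox a b"
    by (rule integrable_continuous, rule continuous_on_subset[OF continuous_on_deg_density[OF cf contf D(1) _ \<open>\<rho> > 0\<close>]])
       (use fr \<open>\<rho> > 0\<close> in force)+
  have "norm (g x) > 4 * \<rho>" if "x \<in> frontier D" for x
  proof -
    have "norm (g x - f x) < 4 * \<rho>" using close that by (auto simp: frontier_def)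
    moreover have "norm (f x) \<le> norm (g x) + norm (g x - f x)"
      using norm_triangle_ineq4[of "g x" "g x - f x"] by auto
    ultimately show ?thesis using fr[OF that] \<open>\<rho> > 0\<close> by linarith
  qed
  then have i2: "deg_density \<rho> D g g' integrable_on cbox a b"
    by (intro integrable_continuous continuous_on_subset[OF continuous_on_deg_density[OF cg contg D(1) _ \<open>\<rho> > 0\<close>]]) auto
  have i3: "(\<lambda>x. jac (?T h h' x)) integrable_on cbox a b"
    if "continuous_on UNIV h" "\<And>k. continuous_on UNIV (\<lambda>x. h' x k)" for h h'
    by (rule integrable_continuous, rule continuous_on_jac, rule continuous_on_subset[OF cT[OF that]]) auto
  have "integral (cbox a b) (deg_density \<rho> D g g') - integral (cbox a b) (deg_density \<rho> D f f')
      = integral (cbox a b) (\<lambda>x. deg_density \<rho> D g g' x - deg_density \<rho> D f f' x)"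
    by (rule integral_diff[OF i2 i1, symmetric])
  also have "\<dots> = integral (cbox a b) (\<lambda>x. jac (?T F F' x) - jac (?T f f' x))"
    by (simp only: pt)
  also have "\<dots> = 0"
    using integral_diff[OF i3[of F F'] i3[of f f']] cF contF cf contf eqint by simp
  finally show ?thesis by simp
qed

section \<open>Signed count of regular zeros\<close>

lemma local_inverse:
  fixes f :: "real^4 \<Rightarrow> real^4"
  assumes derf: "\<And>x. (f has_derivative f' x) (at x)" and contf: "\<And>k. continuous_on UNIV (\<lambda>x. f' x k)"
    and D: "open D" "z \<in> D" and nz: "jac (f' z) \<noteq> 0"
  obtains U s where "open U" "z \<in> U" "U \<subseteq> D" "s > 0" "inj_on f U" "ball (f z) s \<subseteq> f ` U"
    "\<And>x. x \<in> U \<Longrightarrow> sgn (jac (f' x)) = sgn (jac (f' z))"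
proof -
  define U0 where "U0 = D \<inter> {x. 0 < jac (f' z) * jac (f' x)}"
  have "open U0" unfolding U0_def
    by (intro open_Int D open_Collect_less continuous_intros continuous_on_jac contf)
  have "z \<in> U0" using D nz by (auto simp: U0_def zero_less_mult_iff)
  have bl: "bounded_linear (f' x)" for x using derf by (rule has_derivative_bounded_linear)
  define fb where "fb x = Blinfun (f' x)" for x
  have fb: "blinfun_apply (fb x) = f' x" for x
    unfolding fb_def by (rule bounded_linear_Blinfun_apply[OF bl])
  have "continuous_on U0 fb"
    by (rule continuous_on_blinfun_componentwise) (auto simp: fb intro: continuous_on_subset[OF contf])
  have lin: "linear (f' z)" using bl by (rule bounded_linear.linear)
  have "inj (f' z)"
    using nz det_nz_iff_inj[of "f' z"] lin by simp
  then obtain g where g: "linear g" "g \<circ> f' z = id" using linear_injective_left_inverse lin by blast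
  have inv: "Blinfun g o\<^sub>L fb z = id_blinfun"
    by (rule blinfun_eqI)
      (use g in \<open>simp add: fb bounded_linear_Blinfun_apply linear_conv_bounded_linear fun_eq_iff\<close>)
  obtain U V h h' where U: "open U" "U \<subseteq> U0" "z \<in> U" and V: "open V" "f z \<in> V" and hom: "homeomorphism U V f h"
    by (rule inverse_function_theorem[OF \<open>open U0\<close> _ \<open>continuous_on U0 fb\<close> \<open>z \<in> U0\<close> inv, of f])
       (use derf fb in auto)
  obtain s where "s > 0" "ball (f z) s \<subseteq> V" using V open_contains_ball by blast
  show ?thesis
  proof (rule that)
    show "inj_on f U" using hom by (metis homeomorphism_apply1 inj_on_inverseI)
    show "ball (f z) s \<subseteq> f ` U" using \<open>ball (f z) s \<subseteq> V\<close> homeomorphism_image1[OF hom] by simp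
    show "sgn (jac (f' x)) = sgn (jac (f' z))" if "x \<in> U" for x
    proof -
      have "0 < jac (f' z) * jac (f' x)" using that U by (auto simp: U0_def)
      then show ?thesis by (auto simp: zero_less_mult_iff)
    qed
  qed (use U \<open>s > 0\<close> in \<open>auto simp: U0_def\<close>)
qed

definition cube :: "real \<Rightarrow> (real^4) set" where
  "cube \<rho> = {y. \<forall>i. \<bar>y $ i\<bar> < \<rho>}"

text \<open>By the change of variables for \<open>bump_map\<close> this is the integral of
  \<open>bump \<rho>\<close> over the cube, the normalising constant of the degree integral; being
  positive, it can be divided out.\<close>

definition bump_mass :: "real \<Rightarrow> real" where
  "bump_mass \<rho> = measure lebesgue (bump_map \<rho> ` cube \<rho>)"

lemma cube:
  assumes "\<rho> > 0"
  shows "open (cube \<rho>)" "cube \<rho> \<subseteq> ball 0 (4 * \<rho>)" "inj_on (bump_map \<rho>) (cube \<rho>)"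
    "bump_map \<rho> ` cube \<rho> \<in> lmeasurable" "bump_mass \<rho> > 0"
proof -
  have "cube \<rho> = (\<Inter>i\<in>UNIV. {y. \<bar>y $ i\<bar> < \<rho>})" by (auto simp: cube_def)
  moreover have "open {y::real^4. \<bar>y $ i\<bar> < \<rho>}" for i
    by (intro open_Collect_less continuous_intros)
  ultimately show op: "open (cube \<rho>)" by auto
  show sub: "cube \<rho> \<subseteq> ball 0 (4 * \<rho>)"
  proof
    fix y assume "y \<in> cube \<rho>"
    then have "bump \<rho> y \<noteq> 0" using bump_pos_iff[OF assms, of y] by (simp add: cube_def)
    then show "y \<in> ball 0 (4 * \<rho>)" using bump_eq_0[OF assms, of y] by (auto simp: not_le[symmetric])
  qed
  show inj: "inj_on (bump_map \<rho>) (cube \<rho>)"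
  proof (rule inj_onI)
    fix x y assume xy: "x \<in> cube \<rho>" "y \<in> cube \<rho>" "bump_map \<rho> x = bump_map \<rho> y"
    have "x $ i = y $ i" for i
    proof -
      have "tent_int \<rho> (x $ i) = tent_int \<rho> (y $ i)"
        using xy(3) by (simp add: bump_map_def vec_eq_iff)
      moreover have "- \<rho> < x $ i" "x $ i < \<rho>" "- \<rho> < y $ i" "y $ i < \<rho>"
        using xy(1,2) by (auto simp: cube_def abs_less_iff minus_less_iff)
      ultimately show ?thesis
        using tent_int_strict_mono[OF assms, of "x $ i" "y $ i"] tent_int_strict_mono[OF assms, of "y $ i" "x $ i"]
        by linarith
    qed
    then show "x = y" by (simp add: vec_eq_iff)
  qed
  have cont: "continuous_on S (bump_map \<rho>)" for S
    using bump_map_deriv by (auto intro!: continuous_at_imp_continuous_on has_derivative_continuous)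
  have op': "open (bump_map \<rho> ` cube \<rho>)"
    by (rule invariance_of_domain[OF cont op inj])
  have "bounded (bump_map \<rho> ` cball 0 (4 * \<rho>))"
    by (intro compact_imp_bounded compact_continuous_image cont compact_cball)
  then have "bounded (bump_map \<rho> ` cube \<rho>)"
    by (rule bounded_subset) (use sub in auto)
  then show lm: "bump_map \<rho> ` cube \<rho> \<in> lmeasurable" using op' by (rule lmeasurable_open)
  have "0 \<in> cube \<rho>" using assms by (simp add: cube_def)
  then have "bump_map \<rho> ` cube \<rho> \<noteq> {}" by auto
  then have "measure lebesgue (bump_map \<rho> ` cube \<rho>) \<noteq> 0"
    using open_not_negligible[OF op'] lm negligible_iff_measure by blast
  then show "bump_mass \<rho> > 0" unfolding bump_mass_def by (simp add: less_le)
qed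

text \<open>For small \<rho> the set where the bump of \<open>f\<close> is positive splits into one
  neighbourhood per zero. On each, \<open>f\<close> is a diffeomorphism onto the cube with Jacobian
  of constant sign, so the contribution is that sign times the mass.\<close>

lemma integral_deg_density_regular:
  fixes f :: "real^4 \<Rightarrow> real^4"
  assumes derf: "\<And>x. (f has_derivative f' x) (at x)" and contf: "\<And>k. continuous_on UNIV (\<lambda>x. f' x k)"
    and D: "open D" "D \<subseteq> cbox a b"
    and fr: "\<And>x. x \<in> frontier D \<Longrightarrow> f x \<noteq> 0"
    and reg: "\<And>x. x \<in> D \<Longrightarrow> f x = 0 \<Longrightarrow> jac (f' x) \<noteq> 0"
  shows "finite {x\<in>D. f x = 0} \<and> (\<exists>\<rho>0>0. \<forall>\<rho>. 0 < \<rho> \<and> \<rho> < \<rho>0 \<longrightarrow>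
    integral (cbox a b) (deg_density \<rho> D f f') = (\<Sum>z\<in>{x\<in>D. f x = 0}. sgn (jac (f' z))) * bump_mass \<rho>)"
proof -
  let ?Z = "{x\<in>D. f x = 0}"
  have cf: "continuous_on S f" for S
    using derf by (auto intro!: continuous_at_imp_continuous_on has_derivative_continuous)
  have Dcl: "compact (closure D)" using bounded_subset[OF bounded_cbox D(2)] by (simp add: compact_closure)
  \<comment> \<open>Since \<open>f\<close> has no zero on the frontier, the zeros in the open set
    \<open>D\<close> are those in its closure, and hence form a compact set.\<close>
  have Zeq: "?Z = closure D \<inter> f -` {0}"
    using D fr closure_subset[of D] by (auto simp: frontier_def interior_open)
  have "compact ?Z"
    unfolding Zeq by (rule compact_Int_closed[OF Dcl closed_vimage[OF closed_singleton cf]])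
  have ex: "\<exists>U s. open U \<and> z \<in> U \<and> U \<subseteq> E \<and> s > 0 \<and> inj_on f U \<and> ball 0 s \<subseteq> f ` U \<and>
      (\<forall>x\<in>U. sgn (jac (f' x)) = sgn (jac (f' z)))" if "z \<in> ?Z" "open E" "z \<in> E" for z E
  proof -
    have "jac (f' z) \<noteq> 0" using that reg by auto
    from local_inverse[OF derf contf that(2,3) this] that show ?thesis by (metis (mono_tags, lifting) mem_Collect_eq)
  qed
  \<comment> \<open>Injectivity leaves a single zero in each \<open>U z\<close>, so a finite
    subcover of the compact zero set lists all zeros.\<close>
  have "finite ?Z"
  proof -
    obtain U where U: "\<And>z. z \<in> ?Z \<Longrightarrow> open (U z) \<and> z \<in> U z \<and> inj_on f (U z)"
      using ex[of _ D] D(1) by (metis (mono_tags, lifting) mem_Collect_eq)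
    obtain T where T: "T \<subseteq> ?Z" "finite T" "?Z \<subseteq> (\<Union>z\<in>T. U z)"
      using compactE_image[OF \<open>compact ?Z\<close>, of ?Z U] U by blast
    have "?Z \<subseteq> T"
    proof
      fix x assume x: "x \<in> ?Z"
      then obtain z where "z \<in> T" "x \<in> U z" using T by blast
      moreover have "inj_on f (U z)" "z \<in> U z" "f x = f z" using U T x \<open>z \<in> T\<close> by auto
      ultimately show "x \<in> T" by (metis inj_onD)
    qed
    then show ?thesis using T finite_subset by blast
  qed
  have "\<forall>z. \<exists>d>0. \<forall>x\<in>?Z. x \<noteq> z \<longrightarrow> d \<le> dist z x" using finite_set_avoid[OF \<open>finite ?Z\<close>] by blast
  from choice[OF this] obtain d where d: "\<And>z. d z > 0" "\<And>z x. x \<in> ?Z \<Longrightarrow> x \<noteq> z \<Longrightarrow> d z \<le> dist z x" by blast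
  have "\<forall>z\<in>?Z. \<exists>U s. open U \<and> z \<in> U \<and> U \<subseteq> D \<inter> ball z (d z / 2) \<and> s > 0 \<and> inj_on f U \<and> ball 0 s \<subseteq> f ` U \<and>
      (\<forall>x\<in>U. sgn (jac (f' x)) = sgn (jac (f' z)))"
  proof
    fix z assume "z \<in> ?Z"
    then show "\<exists>U s. open U \<and> z \<in> U \<and> U \<subseteq> D \<inter> ball z (d z / 2) \<and> s > 0 \<and> inj_on f U \<and> ball 0 s \<subseteq> f ` U \<and>
      (\<forall>x\<in>U. sgn (jac (f' x)) = sgn (jac (f' z)))"
      using ex[of z "D \<inter> ball z (d z / 2)"] D(1) d(1)[of z] by auto
  qed
  from bchoice[OF this] obtain U where "\<forall>z\<in>?Z. \<exists>s. open (U z) \<and> z \<in> U z \<and> U z \<subseteq> D \<inter> ball z (d z / 2) \<and> s > 0 \<and> inj_on f (U z) \<and> ball 0 s \<subseteq> f ` U z \<and>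
      (\<forall>x\<in>U z. sgn (jac (f' x)) = sgn (jac (f' z)))" ..
  from bchoice[OF this] obtain s where Us: "\<And>z. z \<in> ?Z \<Longrightarrow> open (U z) \<and> z \<in> U z \<and> U z \<subseteq> D \<inter> ball z (d z / 2) \<and> s z > 0 \<and> inj_on f (U z) \<and> ball 0 (s z) \<subseteq> f ` U z \<and>
      (\<forall>x\<in>U z. sgn (jac (f' x)) = sgn (jac (f' z)))"
    by blast
  have disj: "U z \<inter> U w = {}" if "z \<in> ?Z" "w \<in> ?Z" "z \<noteq> w" for z w
  proof (rule ccontr)
    assume "U z \<inter> U w \<noteq> {}"
    then obtain x where "x \<in> U z" "x \<in> U w" by blast
    then have "x \<in> ball z (d z / 2)" "x \<in> ball w (d w / 2)" using Us[OF that(1)] Us[OF that(2)] by blast+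
    then have "dist z x < d z / 2" "dist w x < d w / 2" by auto
    moreover have "d z \<le> dist z w" "d w \<le> dist z w" using d(2)[of w z] d(2)[of z w] that by (auto simp: dist_commute)
    ultimately show False using dist_triangle2[of z w x] by linarith
  qed
  \<comment> \<open>Away from the chosen neighbourhoods \<open>f\<close> is bounded below by some
    \<open>m\<close>. Taking \<open>s0\<close> below \<open>m\<close> and below all
    \<open>s z\<close> keeps the preimage of the cube inside the neighbourhoods, each of which is
    mapped over the whole cube.\<close>
  define K where "K = closure D - (\<Union>z\<in>?Z. U z)"
  have "compact K" unfolding K_def by (intro compact_diff Dcl open_UN) (use Us in auto)
  have "f x \<noteq> 0" if "x \<in> K" for x
  proof
    assume "f x = 0"
    then have "x \<in> ?Z" unfolding Zeq using that by (auto simp: K_def)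
    then show False using that Us by (auto simp: K_def)
  qed
  then have "\<exists>m>0. \<forall>x\<in>K. m \<le> norm (f x)"
  proof (cases "K = {}")
    case False
    have "continuous_on K (\<lambda>x. norm (f x))" by (intro continuous_intros cf)
    from continuous_attains_inf[OF \<open>compact K\<close> False this] show ?thesis
      using \<open>\<And>x. x \<in> K \<Longrightarrow> f x \<noteq> 0\<close> by (metis zero_less_norm_iff)
  qed (auto intro: exI[of _ 1])
  then obtain m where m: "m > 0" "\<And>x. x \<in> K \<Longrightarrow> m \<le> norm (f x)" by blast
  define s0 where "s0 = Min (insert m (s ` ?Z))"
  have s0: "s0 > 0" "s0 \<le> m" "\<And>z. z \<in> ?Z \<Longrightarrow> s0 \<le> s z"
    using \<open>finite ?Z\<close> m(1) Us by (auto simp: s0_def)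
  have main: "integral (cbox a b) (deg_density \<rho> D f f') = (\<Sum>z\<in>?Z. sgn (jac (f' z))) * bump_mass \<rho>"
    if \<rho>: "0 < \<rho>" "\<rho> < s0 / 4" for \<rho>
  proof -
    define W where "W z = U z \<inter> f -` cube \<rho>" for z
    let ?g = "\<lambda>x k. (\<chi> i. tent \<rho> (f x $ i) * f' x k $ i) :: real^4"
    have cs: "cube \<rho> \<subseteq> ball 0 s0" using cube(2)[OF \<rho>(1)] \<rho>(2) by auto
    have img: "f ` W z = cube \<rho>" if "z \<in> ?Z" for z
    proof -
      have "cube \<rho> \<subseteq> ball 0 (s z)" using cs s0(3)[OF that] by auto
      then have "cube \<rho> \<subseteq> f ` U z" using Us[OF that] by blast
      then show ?thesis by (auto simp: W_def)
    qed
    have WI: "((\<lambda>x. \<bar>jac (?g x)\<bar>) has_integral bump_mass \<rho>) (W z)" if "z \<in> ?Z" for z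
    proof -
      have op: "open (W z)" unfolding W_def
        using Us[OF that] cube(1)[OF \<rho>(1)] cf[of UNIV] by (intro open_Int open_vimage) auto
      have inj: "inj_on (\<lambda>x. bump_map \<rho> (f x)) (W z)"
      proof -
        have "inj_on f (W z)" using Us[OF that] by (auto simp: W_def intro: inj_on_subset)
        then show ?thesis using cube(3)[OF \<rho>(1)] img[OF that] comp_inj_on[of f "W z" "bump_map \<rho>"] by (simp add: o_def)
      qed
      have der: "((\<lambda>x. bump_map \<rho> (f x)) has_derivative ?g x) (at x within W z)" for x
        by (rule has_derivative_at_withinI[OF bump_map_comp(1)[OF derf]])
      have im2: "(\<lambda>x. bump_map \<rho> (f x)) ` W z = bump_map \<rho> ` cube \<rho>"
        using img[OF that] by (metis image_image)
      have meas: "W z \<in> sets lebesgue" using op by auto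
      have int: "(\<lambda>x. \<bar>jac (?g x)\<bar>) integrable_on W z"
        using measurable_differentiable_image_eq[OF meas der inj] cube(4)[OF \<rho>(1)] im2 by simp
      have "bump_mass \<rho> = integral (W z) (\<lambda>x. \<bar>jac (?g x)\<bar>)"
        using measure_differentiable_image_eq[OF meas der inj int] im2 by (simp add: bump_mass_def)
      then show ?thesis using int by (simp add: has_integral_integral)
    qed
    have Wsub: "W z \<subseteq> cbox a b" if "z \<in> ?Z" for z using Us[OF that] D(2) by (auto simp: W_def)
    have "((\<lambda>x. \<Sum>z\<in>?Z. if x \<in> W z then sgn (jac (f' z)) * \<bar>jac (?g x)\<bar> else 0) has_integral
        (\<Sum>z\<in>?Z. sgn (jac (f' z)) * bump_mass \<rho>)) (cbox a b)"
      by (rule has_integral_sum[OF \<open>finite ?Z\<close>]) (simp only: has_integral_restrict[OF Wsub], intro has_integral_mult_right WI)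
    moreover have "(\<Sum>z\<in>?Z. if x \<in> W z then sgn (jac (f' z)) * \<bar>jac (?g x)\<bar> else 0) = deg_density \<rho> D f f' x" for x
    proof (cases "\<exists>w\<in>?Z. x \<in> W w")
      case True
      then obtain w where w: "w \<in> ?Z" "x \<in> W w" by blast
      have "(\<Sum>z\<in>?Z. if x \<in> W z then sgn (jac (f' z)) * \<bar>jac (?g x)\<bar> else 0)
          = (\<Sum>z\<in>?Z. if z = w then sgn (jac (f' z)) * \<bar>jac (?g x)\<bar> else 0)"
        by (rule sum.cong[OF refl]) (use w disj in \<open>auto simp: W_def\<close>)
      also have "\<dots> = sgn (jac (f' w)) * \<bar>jac (?g x)\<bar>" using w \<open>finite ?Z\<close> by simp
      also have "\<dots> = sgn (jac (f' x)) * (bump \<rho> (f x) * \<bar>jac (f' x)\<bar>)"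
      proof -
        have "sgn (jac (f' x)) = sgn (jac (f' w))" using Us[OF w(1)] w(2) unfolding W_def by blast
        then show ?thesis
          unfolding bump_map_comp(2)[OF derf] abs_mult by (simp only: abs_of_nonneg[OF bump_nonneg[OF \<rho>(1)]])
      qed
      also have "\<dots> = bump \<rho> (f x) * jac (f' x)" by (metis mult.left_commute sgn_mult_abs)
      also have "\<dots> = deg_density \<rho> D f f' x" using w(2) Us[OF w(1)] unfolding deg_density_def W_def by (metis IntD1 subsetD)
      finally show ?thesis .
    next
      case False
      have "deg_density \<rho> D f f' x = 0"
      proof (rule ccontr)
        assume "deg_density \<rho> D f f' x \<noteq> 0"
        then have x: "x \<in> D" "bump \<rho> (f x) \<noteq> 0" by (auto simp: deg_density_def split: if_splits)
        then have fx: "f x \<in> cube \<rho>"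
          using bump_nonneg[OF \<rho>(1), of "f x"] bump_pos_iff[OF \<rho>(1), of "f x"] by (simp add: cube_def less_le)
        then have "norm (f x) < m" using cs s0(2) by force
        then have "x \<notin> K" using m(2)[of x] by linarith
        then obtain z where "z \<in> ?Z" "x \<in> U z" using x closure_subset[of D] unfolding K_def by blast
        then show False using False fx by (auto simp: W_def)
      qed
      then show ?thesis using False by (simp add: sum.neutral)
    qed
    ultimately have "(deg_density \<rho> D f f' has_integral (\<Sum>z\<in>?Z. sgn (jac (f' z)) * bump_mass \<rho>)) (cbox a b)"
      by (simp only: fun_eq_iff eta_contract_eq)
    then show ?thesis by (simp add: integral_unique sum_distrib_right)
  qed
  have "\<exists>\<rho>0>0. \<forall>\<rho>. 0 < \<rho> \<and> \<rho> < \<rho>0 \<longrightarrow> integral (cbox a b) (deg_density \<rho> D f f') = (\<Sum>z\<in>?Z. sgn (jac (f' z))) * bump_mass \<rho>"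
    by (rule exI[of _ "s0 / 4"]) (use s0(1) main in auto)
  with \<open>finite ?Z\<close> show ?thesis by blast
qed

text \<open>The degree integral is 0 at s = 0, where there are no zeros, and is carried to s = 1 in
  steps of length 1 / N, short enough by uniform continuity for \<open>degree_step\<close>. At s = 1
  it is a signed count times a positive mass. Regularity is demanded only at s = 1; the zeros in
  between may be degenerate.\<close>

lemma regular_zeros_balanced:
  fixes f :: "real \<Rightarrow> real^4 \<Rightarrow> real^4"
  assumes der: "\<And>s x. s \<in> {0..1} \<Longrightarrow> (f s has_derivative f' s x) (at x)"
    and cont': "\<And>s k. s \<in> {0..1} \<Longrightarrow> continuous_on UNIV (\<lambda>x. f' s x k)"
    and bd: "\<And>s x k. s \<in> {0..1} \<Longrightarrow> norm (f' s x k) \<le> L * norm k"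
    and cont: "continuous_on ({0..1} \<times> closure D) (\<lambda>(s, x). f s x)"
    and D: "open D" "bounded D"
    and fr: "\<And>s x. s \<in> {0..1} \<Longrightarrow> x \<in> frontier D \<Longrightarrow> f s x \<noteq> 0"
    and no_zero: "\<And>x. x \<in> D \<Longrightarrow> f 0 x \<noteq> 0"
    and reg: "\<And>x. x \<in> D \<Longrightarrow> f 1 x = 0 \<Longrightarrow> jac (f' 1 x) \<noteq> 0"
  shows "finite {x\<in>D. f 1 x = 0}"
    and "card {x\<in>D. f 1 x = 0 \<and> jac (f' 1 x) > 0} = card {x\<in>D. f 1 x = 0 \<and> jac (f' 1 x) < 0}"
proof -
  obtain a where a: "D \<subseteq> cbox (-a) a" using bounded_subset_cbox_symmetric[OF D(2)] by blast
  have c0: "compact (closure D)" using D(2) by (simp add: compact_closure)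
  let ?Z = "{x\<in>D. f 1 x = 0}"
  have int: "finite {x\<in>D. f s x = 0} \<and> (\<exists>\<rho>0>0. \<forall>\<rho>. 0 < \<rho> \<and> \<rho> < \<rho>0 \<longrightarrow>
    integral (cbox (-a) a) (deg_density \<rho> D (f s) (f' s)) = (\<Sum>z\<in>{x\<in>D. f s x = 0}. sgn (jac (f' s z))) * bump_mass \<rho>)"
    if "s \<in> {0..1}" "\<And>x. x \<in> D \<Longrightarrow> f s x = 0 \<Longrightarrow> jac (f' s x) \<noteq> 0" for s
    by (rule integral_deg_density_regular) (use that der cont' D a fr in auto)
  from int[of 1] reg obtain \<rho>1 where fin: "finite ?Z" and \<rho>1: "\<rho>1 > 0" "\<And>\<rho>. 0 < \<rho> \<Longrightarrow> \<rho> < \<rho>1 \<Longrightarrow>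
      integral (cbox (-a) a) (deg_density \<rho> D (f 1) (f' 1)) = (\<Sum>z\<in>?Z. sgn (jac (f' 1 z))) * bump_mass \<rho>"
    by auto
  have e0: "{x\<in>D. f 0 x = 0} = {}" using no_zero by auto
  from int[of 0] no_zero obtain \<rho>0 where \<rho>0: "\<rho>0 > 0" "\<And>\<rho>. 0 < \<rho> \<Longrightarrow> \<rho> < \<rho>0 \<Longrightarrow>
      integral (cbox (-a) a) (deg_density \<rho> D (f 0) (f' 0)) = 0"
    unfolding e0 by auto
  let ?K = "{0..1::real} \<times> frontier D"
  have "compact ?K" using c0 by (intro compact_Times compact_frontier_bounded D(2)) auto
  have "\<exists>m>0. \<forall>s\<in>{0..1}. \<forall>x\<in>frontier D. m \<le> norm (f s x)"
  proof (cases "?K = {}")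
    case False
    have "continuous_on ?K (\<lambda>(s, x). f s x)"
      by (rule continuous_on_subset[OF cont]) (auto simp: frontier_def)
    then have "continuous_on ?K (\<lambda>y. norm (f (fst y) (snd y)))"
      unfolding case_prod_unfold by (rule continuous_on_norm)
    from continuous_attains_inf[OF \<open>compact ?K\<close> False this]
    obtain y where y: "y \<in> ?K" "\<And>z. z \<in> ?K \<Longrightarrow> norm (f (fst y) (snd y)) \<le> norm (f (fst z) (snd z))" by blast
    show ?thesis
      by (rule exI[of _ "norm (f (fst y) (snd y))"]) (use fr y in force)
  qed (auto intro: exI[of _ 1])
  then obtain m where m: "m > 0" "\<And>s x. s \<in> {0..1} \<Longrightarrow> x \<in> frontier D \<Longrightarrow> m \<le> norm (f s x)" by blast
  \<comment> \<open>One width serves everywhere: below \<open>\<rho>0\<close> and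
    \<open>\<rho>1\<close> for the counts at the two ends, and below \<open>m / 16\<close> so that
    \<open>f s\<close> exceeds \<open>16 * \<rho>\<close> on the frontier for every s.\<close>
  define \<rho> where "\<rho> = min (min \<rho>0 \<rho>1) (m / 16) / 2"
  have \<rho>: "0 < \<rho>" "\<rho> < \<rho>0" "\<rho> < \<rho>1" "16 * \<rho> < m" using \<rho>0(1) \<rho>1(1) m(1) by (auto simp: \<rho>_def)
  have "uniformly_continuous_on ({0..1} \<times> closure D) (\<lambda>(s, x). f s x)"
    by (rule compact_uniformly_continuous[OF cont]) (intro compact_Times c0 compact_Icc)
  then obtain \<delta> where \<delta>: "\<delta> > 0" "\<And>y z. y \<in> {0..1} \<times> closure D \<Longrightarrow> z \<in> {0..1} \<times> closure D \<Longrightarrow> dist z y < \<delta>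
      \<Longrightarrow> dist ((\<lambda>(s, x). f s x) z) ((\<lambda>(s, x). f s x) y) < 4 * \<rho>"
    unfolding uniformly_continuous_on_def using \<rho>(1) by (metis mult_pos_pos zero_less_numeral)
  obtain N :: nat where N: "N > 0" "1 / real N < \<delta>"
    using \<delta>(1) by (metis inverse_eq_divide reals_Archimedean zero_less_Suc)
  let ?I = "\<lambda>s. integral (cbox (-a) a) (deg_density \<rho> D (f s) (f' s))"
  have "k \<le> N \<Longrightarrow> ?I (real k / real N) = 0" for k
  proof (induction k)
    case 0
    then show ?case using \<rho>0(2)[OF \<rho>(1,2)] by simp
  next
    case (Suc k)
    let ?s = "real k / real N" and ?t = "real (Suc k) / real N"
    have st: "?s \<in> {0..1}" "?t \<in> {0..1}" using Suc.prems by auto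
    have "?t - ?s = 1 / real N" by (simp add: diff_divide_distrib[symmetric])
    then have ds: "dist ?t ?s < \<delta>" using N by (simp add: dist_real_def)
    have "?I ?t = ?I ?s"
    proof (rule degree_step[where L=L])
      show "norm (f ?s x) > 16 * \<rho>" if "x \<in> frontier D" for x
        using m(2)[OF st(1) that] \<rho>(4) by linarith
      show "norm (f ?t x - f ?s x) < 4 * \<rho>" if "x \<in> closure D" for x
        using \<delta>(2)[of "(?s, x)" "(?t, x)"] that st ds by (simp add: dist_norm dist_Pair_Pair)
      show "(f ?s has_derivative f' ?s x) (at x)" "(f ?t has_derivative f' ?t x) (at x)" for x
        using der st by auto
      show "continuous_on UNIV (\<lambda>x. f' ?s x k)" "continuous_on UNIV (\<lambda>x. f' ?t x k)" for k
        using cont' st by auto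
      show "norm (f' ?s x k) \<le> L * norm k" for x k using bd st by auto
      show "open D" "D \<subseteq> cbox (-a) a" "\<rho> > 0" by fact+
    qed
    then show ?case using Suc by simp
  qed
  from this[of N] have "?I 1 = 0" using N(1) by simp
  then have "(\<Sum>z\<in>?Z. sgn (jac (f' 1 z))) = 0"
    using \<rho>1(2)[OF \<rho>(1,3)] cube(5)[OF \<rho>(1)] by simp
  moreover have "(\<Sum>z\<in>?Z. sgn (jac (f' 1 z))) = real (card {x\<in>?Z. jac (f' 1 x) > 0}) - real (card {x\<in>?Z. jac (f' 1 x) < 0})"
  proof -
    have "(\<Sum>z\<in>?Z. sgn (jac (f' 1 z))) = (\<Sum>z\<in>?Z. (if jac (f' 1 z) > 0 then 1 else 0) - (if jac (f' 1 z) < 0 then 1 else 0))"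
      by (rule sum.cong[OF refl]) (auto simp: sgn_if)
    then show ?thesis
      using fin by (simp add: sum_subtractf sum.If_cases Int_def)
  qed
  ultimately show "card {x\<in>D. f 1 x = 0 \<and> jac (f' 1 x) > 0} = card {x\<in>D. f 1 x = 0 \<and> jac (f' 1 x) < 0}"
    by (simp add: conj_assoc)
  show "finite ?Z" by (rule fin)
qed

section \<open>Forced second-order equations on the unit interval\<close>

text \<open>Continuous functions on \<open>[0,1]\<close> are represented by bounded continuous functions on the line
  that are constant on either side of the interval.\<close>

definition clamp01 :: "real \<Rightarrow> real" where
  "clamp01 t = max 0 (min 1 t)"

lemma clamp01: "clamp01 t \<in> {0..1}" "0 \<le> clamp01 t" "clamp01 t \<le> 1" "t \<in> {0..1} \<Longrightarrow> clamp01 t = t"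
  "clamp01 0 = 0" "clamp01 1 = 1" "clamp01 (clamp01 t) = clamp01 t"
  by (auto simp: clamp01_def)

lemma exp_cancel: "exp (- m * c) * exp (m * c) = (1::real)" "exp (m * c) * exp (- m * c) = (1::real)"
  by (simp_all add: exp_minus)

lemma continuous_on_clamp01: "continuous_on S clamp01"
  unfolding clamp01_def by (intro continuous_intros)

lemma bcontfun_clamp01:
  fixes f :: "real \<Rightarrow> 'a::real_normed_vector"
  assumes "continuous_on {0..1} f"
  shows "(\<lambda>t. f (clamp01 t)) \<in> bcontfun"
proof -
  have "continuous_on UNIV (\<lambda>t. f (clamp01 t))"
    by (rule continuous_on_compose2[OF assms continuous_on_clamp01]) (auto simp: clamp01)
  moreover have "bounded (f ` {0..1})"
    by (intro compact_imp_bounded compact_continuous_image assms compact_Icc)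
  then have "bounded (range (\<lambda>t. f (clamp01 t)))"
    by (rule bounded_subset) (use clamp01(1) in auto)
  ultimately show ?thesis by (simp add: bcontfun_def)
qed

definition ext01 :: "(real \<Rightarrow> 'a::real_normed_vector) \<Rightarrow> real \<Rightarrow>\<^sub>C 'a" where
  "ext01 f = Bcontfun (\<lambda>t. f (clamp01 t))"

lemma ext01_apply: "continuous_on {0..1} f \<Longrightarrow> ext01 f t = f (clamp01 t)"
  unfolding ext01_def by (simp add: Bcontfun_inverse bcontfun_clamp01)

lemma integrable_bcontfun: "(f :: real \<Rightarrow>\<^sub>C 'a::banach) integrable_on {a..b}"
  by (intro integrable_continuous_real) auto

definition primitive :: "(real \<Rightarrow>\<^sub>C 'a::banach) \<Rightarrow> real \<Rightarrow>\<^sub>C 'a" where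
  "primitive f = ext01 (\<lambda>t. integral {0..t} f)"

lemma primitive_apply: "primitive f t = integral {0..clamp01 t} f"
  unfolding primitive_def
  by (rule ext01_apply, rule indefinite_integral_continuous_1, rule integrable_bcontfun)

lemma primitive_clamp01: "primitive f (clamp01 t) = primitive f t"
  by (simp add: primitive_apply clamp01)

lemma primitive_0 [simp]: "primitive f 0 = 0" "t \<le> 0 \<Longrightarrow> primitive f t = 0"
  by (auto simp: primitive_apply clamp01_def)

lemma primitive_deriv:
  assumes "t \<in> {0..1}"
  shows "(primitive f has_vector_derivative f t) (at t within {0..1})"
proof (rule has_vector_derivative_transform[OF assms])
  show "((\<lambda>u. integral {0..u} f) has_vector_derivative f t) (at t within {0..1})"
    by (rule integral_has_vector_derivative) (use assms in auto)
qed (auto simp: primitive_apply clamp01)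

section \<open>Volterra equations in an exponentially weighted norm\<close>

lemma primitive_exp_bound:
  fixes h :: "real \<Rightarrow>\<^sub>C 'a::banach"
  assumes "\<And>s. s \<in> {0..1} \<Longrightarrow> norm (h s) \<le> M * exp (\<mu> * s)" "\<mu> > 0" "M \<ge> 0"
  shows "norm (primitive h t) \<le> M / \<mu> * exp (\<mu> * clamp01 t)"
proof -
  let ?c = "clamp01 t"
  have "((\<lambda>s. M / \<mu> * exp (\<mu> * s)) has_vector_derivative M * exp (\<mu> * x)) (at x within {0..?c})" for x
    unfolding has_real_derivative_iff_has_vector_derivative[symmetric]
    using \<open>\<mu> > 0\<close> by (auto intro!: derivative_eq_intros)
  from fundamental_theorem_of_calculus[OF clamp01(2) this]
  have int: "((\<lambda>s. M * exp (\<mu> * s)) has_integral (M / \<mu> * exp (\<mu> * ?c) - M / \<mu> * exp (\<mu> * 0))) {0..?c}" .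
  have "norm (primitive h t) \<le> M / \<mu> * exp (\<mu> * ?c) - M / \<mu> * exp (\<mu> * 0)"
    unfolding primitive_apply
    unfolding integral_unique[OF int, symmetric]
    by (rule integral_norm_bound_integral[OF integrable_bcontfun])
       (use int assms(1) clamp01(2,3)[of t] in auto)
  also have "\<dots> \<le> M / \<mu> * exp (\<mu> * ?c)" using assms by simp
  finally show ?thesis .
qed

lemma norm_primitive_le: "norm (primitive f t) \<le> norm f"
proof -
  have "norm (integral {0..clamp01 t} f) \<le> norm f * (clamp01 t - 0)"
    by (rule integral_bound) (auto simp: norm_bounded clamp01)
  also have "\<dots> \<le> norm f * 1" using clamp01(2,3)[of t] by (intro mult_left_mono) auto
  finally show ?thesis by (simp add: primitive_apply)
qed

lemma norm_primitive: "norm (primitive f) \<le> norm f"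
  by (rule norm_bound) (rule norm_primitive_le)

lemma bounded_linear_primitive: "bounded_linear primitive"
proof (rule bounded_linear_intro[where K=1])
  show "primitive (f + g) = primitive f + primitive g" for f g :: "real \<Rightarrow>\<^sub>C 'a"
  proof (rule bcontfun_eqI)
    fix t
    have "integral {0..clamp01 t} (\<lambda>x. f x + g x) = integral {0..clamp01 t} f + integral {0..clamp01 t} g"
      by (rule integral_add) (rule integrable_bcontfun)+
    then show "primitive (f + g) t = (primitive f + primitive g) t"
      by (simp add: primitive_apply plus_bcontfun.rep_eq)
  qed
  show "primitive (r *\<^sub>R f) = r *\<^sub>R primitive f" for r and f :: "real \<Rightarrow>\<^sub>C 'a"
    by (rule bcontfun_eqI) (simp add: primitive_apply scaleR_bcontfun.rep_eq)
  show "norm (primitive f) \<le> norm f * 1" for f :: "real \<Rightarrow>\<^sub>C 'a"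
    using norm_primitive_le by (auto intro!: norm_bound)
qed

lemmas linear_primitive = bounded_linear.linear[OF bounded_linear_primitive]
lemmas primitive_diff = linear_diff[OF linear_primitive]
  and primitive_add = linear_add[OF linear_primitive]

text \<open>Multiplication by the exponential, inverted by changing the sign of
  \<open>\<mu>\<close>. Conjugating with it turns a weighted sup norm into the ordinary one, so that
  Banach's theorem can be used on the complete type of bounded continuous functions.\<close>

definition weight :: "real \<Rightarrow> (real \<Rightarrow>\<^sub>C 'a::real_normed_vector) \<Rightarrow> real \<Rightarrow>\<^sub>C 'a" where
  "weight \<mu> u = Bcontfun (\<lambda>t. exp (\<mu> * clamp01 t) *\<^sub>R u t)"

lemma weight_apply: "weight \<mu> u t = exp (\<mu> * clamp01 t) *\<^sub>R u t"
proof -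
  have "(\<lambda>t. exp (\<mu> * clamp01 t) *\<^sub>R u t) \<in> bcontfun"
  proof (rule bcontfun_normI)
    show "continuous_on UNIV (\<lambda>t. exp (\<mu> * clamp01 t) *\<^sub>R u t)"
      by (intro continuous_intros continuous_on_clamp01) auto
    show "norm (exp (\<mu> * clamp01 t) *\<^sub>R u t) \<le> exp \<bar>\<mu>\<bar> * norm u" for t
    proof -
      have "\<mu> * clamp01 t \<le> \<bar>\<mu>\<bar> * 1"
        using clamp01(2,3)[of t] by (intro mult_mono) auto
      then show ?thesis using norm_bounded[of u t] by (auto intro!: mult_mono)
    qed
  qed
  then show ?thesis by (simp add: weight_def Bcontfun_inverse)
qed

text \<open>Bielecki's weight \<open>exp (- \<mu> t)\<close> makes the Volterra operator a contraction.\<close>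

lemma volterra_weighted:
  fixes N :: "(real \<Rightarrow>\<^sub>C 'a::banach) \<Rightarrow> real \<Rightarrow>\<^sub>C 'a" and u v :: "real \<Rightarrow>\<^sub>C 'a"
  assumes N: "\<And>u v s. norm (N u s - N v s) \<le> L * norm (u s - v s)" and "L \<ge> 0"
    and uv: "\<And>s. s \<in> {0..1} \<Longrightarrow> norm (u s - v s) \<le> M * exp ((2 * L + 1) * s)" and "M \<ge> 0"
  shows "norm (primitive (primitive (N u)) t - primitive (primitive (N v)) t) \<le> M / 2 * exp ((2 * L + 1) * clamp01 t)"
proof -
  let ?\<mu> = "2 * L + 1"
  \<comment> \<open>Each integration against \<open>exp (\<mu> t)\<close> gains a factor 1/\<mu>.
    With \<mu> = 2L + 1 the first gain gives L/\<mu> \<le> 1/2, and \<mu> \<ge> 1 makes the second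
    harmless.\<close>
  have \<mu>: "?\<mu> > 0" "?\<mu> \<ge> 1" using \<open>L \<ge> 0\<close> by auto
  have 1: "norm (primitive (N u - N v) s) \<le> L * M / ?\<mu> * exp (?\<mu> * clamp01 s)" for s
  proof (rule primitive_exp_bound[OF _ \<mu>(1)])
    fix s :: real assume s: "s \<in> {0..1}"
    have "norm ((N u - N v) s) \<le> L * norm (u s - v s)" using N by simp
    also have "\<dots> \<le> L * (M * exp (?\<mu> * s))" using uv[OF s] \<open>L \<ge> 0\<close> by (rule mult_left_mono)
    finally show "norm ((N u - N v) s) \<le> L * M * exp (?\<mu> * s)" by (simp add: mult.assoc)
  qed (use assms in auto)
  have "norm (primitive (N u - N v) s) \<le> L * M / ?\<mu> * exp (?\<mu> * s)" if "s \<in> {0..1}" for s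
    using 1[of s] clamp01(4)[OF that] by simp
  then have "norm (primitive (primitive (N u - N v)) t) \<le> L * M / ?\<mu> / ?\<mu> * exp (?\<mu> * clamp01 t)"
    by (rule primitive_exp_bound[OF _ \<mu>(1)]) (use assms \<mu> in auto)
  also have "\<dots> \<le> M / 2 * exp (?\<mu> * clamp01 t)"
  proof (rule mult_right_mono)
    have "L * M / ?\<mu> / ?\<mu> \<le> L * M / ?\<mu> / 1" using assms \<mu> by (intro divide_left_mono) auto
    also have "\<dots> \<le> M / 2" using assms by (simp add: field_simps)
    finally show "L * M / ?\<mu> / ?\<mu> \<le> M / 2" .
  qed simp
  finally show ?thesis by (simp add: primitive_diff)
qed

text \<open>The stability constant of the Volterra equation: 2 is 1 / (1 - 1/2) for a contraction by
  one half, and the exponential is the cost of removing the weight.\<close>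

definition vconst :: "real \<Rightarrow> real" where "vconst L = 2 * exp (2 * L + 1)"

lemma vconst_pos: "vconst L > 0" by (simp add: vconst_def)

text \<open>In the weighted norm the difference \<open>m\<close> of two solutions satisfies
  \<open>m \<le> norm (a - b) + m / 2\<close>. The case of equal inhomogeneities is
  uniqueness.\<close>

lemma volterra_stable:
  fixes N :: "(real \<Rightarrow>\<^sub>C 'a::banach) \<Rightarrow> real \<Rightarrow>\<^sub>C 'a"
  assumes N: "\<And>u v s. norm (N u s - N v s) \<le> L * norm (u s - v s)" and "L \<ge> 0"
    and u: "u = a + primitive (primitive (N u))" and v: "v = b + primitive (primitive (N v))"
  shows "norm (u - v) \<le> vconst L * norm (a - b)"
proof -
  let ?\<mu> = "2 * L + 1"
  define m where "m = norm (weight (- ?\<mu>) (u - v))"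
  have le: "norm (u t - v t) \<le> m * exp (?\<mu> * clamp01 t)" for t
  proof -
    have "norm (weight (- ?\<mu>) (u - v) t) \<le> m" unfolding m_def by (rule norm_bounded)
    then have "exp (- ?\<mu> * clamp01 t) * norm (u t - v t) \<le> m" by (simp add: weight_apply)
    then have "exp (?\<mu> * clamp01 t) * (exp (- ?\<mu> * clamp01 t) * norm (u t - v t)) \<le> exp (?\<mu> * clamp01 t) * m"
      by (intro mult_left_mono) auto
    then show ?thesis unfolding mult.assoc[symmetric] exp_cancel by (simp add: mult.commute)
  qed
  have le': "norm (u s - v s) \<le> m * exp (?\<mu> * s)" if "s \<in> {0..1}" for s
    using le[of s] clamp01(4)[OF that] by simp
  have "m \<le> norm (a - b) + m / 2"
    unfolding m_def
  proof (rule norm_bound, fold m_def)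
    fix t
    have "norm (primitive (primitive (N u)) t - primitive (primitive (N v)) t) \<le> m / 2 * exp (?\<mu> * clamp01 t)"
      by (rule volterra_weighted[OF N \<open>L \<ge> 0\<close> le']) (auto simp: m_def)
    moreover have "u t - v t = (a - b) t + (primitive (primitive (N u)) t - primitive (primitive (N v)) t)"
      using arg_cong[OF u, of "\<lambda>f. f t"] arg_cong[OF v, of "\<lambda>f. f t"] by simp
    ultimately have "norm (u t - v t) \<le> norm (a - b) + m / 2 * exp (?\<mu> * clamp01 t)"
      using norm_bounded[of "a - b" t]
        norm_triangle_ineq[of "(a - b) t" "primitive (primitive (N u)) t - primitive (primitive (N v)) t"]
      by simp
    then have "exp (- ?\<mu> * clamp01 t) * norm (u t - v t) \<le> exp (- ?\<mu> * clamp01 t) * (norm (a - b) + m / 2 * exp (?\<mu> * clamp01 t))"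
      by (intro mult_left_mono) auto
    also have "\<dots> = exp (- ?\<mu> * clamp01 t) * norm (a - b) + m / 2 * (exp (- ?\<mu> * clamp01 t) * exp (?\<mu> * clamp01 t))"
      by (simp add: algebra_simps)
    also have "\<dots> \<le> 1 * norm (a - b) + m / 2 * 1"
    proof (rule add_mono)
      show "exp (- ?\<mu> * clamp01 t) * norm (a - b) \<le> 1 * norm (a - b)"
        using mult_nonneg_nonneg[OF _ clamp01(2)[of t], of ?\<mu>] \<open>L \<ge> 0\<close>
        by (intro mult_right_mono) (auto simp del: left_diff_distrib simp: minus_mult_left[symmetric] algebra_simps)
      show "m / 2 * (exp (- ?\<mu> * clamp01 t) * exp (?\<mu> * clamp01 t)) \<le> m / 2 * 1"
        unfolding exp_cancel by simp
    qed
    finally show "norm (weight (- ?\<mu>) (u - v) t) \<le> norm (a - b) + m / 2" by (simp add: weight_apply)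
  qed
  then have m: "m \<le> 2 * norm (a - b)" by simp
  show ?thesis
  proof (rule norm_bound)
    fix t
    have "norm (u t - v t) \<le> m * exp (?\<mu> * clamp01 t)" by (rule le)
    also have "\<dots> \<le> 2 * norm (a - b) * exp (?\<mu> * 1)"
      using m \<open>L \<ge> 0\<close> clamp01(2,3)[of t] by (intro mult_mono) (auto simp: m_def intro!: mult_left_mono)
    finally show "norm ((u - v) t) \<le> vconst L * norm (a - b)" by (simp add: vconst_def mult_ac)
  qed
qed

lemma volterra_exists:
  fixes N :: "(real \<Rightarrow>\<^sub>C 'a::banach) \<Rightarrow> real \<Rightarrow>\<^sub>C 'a"
  assumes N: "\<And>u v s. norm (N u s - N v s) \<le> L * norm (u s - v s)" and "L \<ge> 0"
  shows "\<exists>!u. u = a + primitive (primitive (N u))"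
proof (rule ex_ex1I)
  let ?\<mu> = "2 * L + 1"
  \<comment> \<open>The unknown is the weighted solution \<open>w\<close>; \<open>weight\<close>
    with the opposite sign recovers the solution itself.\<close>
  let ?T = "\<lambda>w. weight (- ?\<mu>) (a + primitive (primitive (N (weight ?\<mu> w))))"
  have "\<exists>!w. ?T w = w"
  proof (rule banach_fix_type[where c="1/2"])
    show "\<forall>w v. dist (?T w) (?T v) \<le> 1 / 2 * dist w v"
    proof (intro allI)
      fix w v
      show "dist (?T w) (?T v) \<le> 1 / 2 * dist w v"
      proof (rule dist_bound)
        fix t
        have "norm (primitive (primitive (N (weight ?\<mu> w))) t - primitive (primitive (N (weight ?\<mu> v))) t)
           \<le> norm (w - v) / 2 * exp (?\<mu> * clamp01 t)"
        proof (rule volterra_weighted[OF N \<open>L \<ge> 0\<close>])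
          show "norm (weight ?\<mu> w s - weight ?\<mu> v s) \<le> norm (w - v) * exp (?\<mu> * s)" if "s \<in> {0..1}" for s
            using norm_bounded[of "w - v" s] clamp01(4)[OF that]
            by (simp add: weight_apply scaleR_diff_right[symmetric] mult.commute)
        qed auto
        then have "exp (- ?\<mu> * clamp01 t) * norm (primitive (primitive (N (weight ?\<mu> w))) t - primitive (primitive (N (weight ?\<mu> v))) t)
           \<le> exp (- ?\<mu> * clamp01 t) * (norm (w - v) / 2 * exp (?\<mu> * clamp01 t))"
          by (intro mult_left_mono) auto
        also have "\<dots> = norm (w - v) / 2 * (exp (- ?\<mu> * clamp01 t) * exp (?\<mu> * clamp01 t))" by simp
        also have "\<dots> = norm (w - v) / 2" unfolding exp_cancel by simp
        finally show "dist (?T w t) (?T v t) \<le> 1 / 2 * dist w v"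
          by (simp add: weight_apply dist_norm scaleR_diff_right[symmetric])
      qed
    qed
  qed auto
  then obtain w where w: "?T w = w" by blast
  have "weight ?\<mu> (weight (- ?\<mu>) f) = f" for f :: "real \<Rightarrow>\<^sub>C 'a"
    by (rule bcontfun_eqI) (simp only: weight_apply scaleR_scaleR exp_cancel scaleR_one)
  from this[of "a + primitive (primitive (N (weight ?\<mu> w)))"]
  have "weight ?\<mu> w = a + primitive (primitive (N (weight ?\<mu> w)))" unfolding w .
  then show "\<exists>u. u = a + primitive (primitive (N u))" by blast
next
  fix u v assume "u = a + primitive (primitive (N u))" "v = a + primitive (primitive (N v))"
  from volterra_stable[OF N \<open>L \<ge> 0\<close> this] show "u = v" by simp
qed

section \<open>Linear equations with an operator-valued coefficient\<close>

definition opmult :: "(real \<Rightarrow>\<^sub>C ('a::real_normed_vector \<Rightarrow>\<^sub>L 'b::real_normed_vector)) \<Rightarrow> (real \<Rightarrow>\<^sub>C 'a) \<Rightarrow> real \<Rightarrow>\<^sub>C 'b" where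
  "opmult A w = Bcontfun (\<lambda>t. blinfun_apply (A t) (w t))"

lemma opmult_apply: "opmult A w t = blinfun_apply (A t) (w t)"
proof -
  have "(\<lambda>t. blinfun_apply (A t) (w t)) \<in> bcontfun"
  proof (rule bcontfun_normI)
    show "continuous_on UNIV (\<lambda>t. blinfun_apply (A t) (w t))"
      by (intro continuous_intros) auto
    show "norm (blinfun_apply (A t) (w t)) \<le> norm A * norm w" for t
      by (rule order_trans[OF norm_blinfun]) (intro mult_mono norm_bounded norm_ge_zero)
  qed
  then show ?thesis by (simp add: opmult_def Bcontfun_inverse)
qed

lemma bounded_bilinear_opmult:
  "bounded_bilinear (opmult :: (real \<Rightarrow>\<^sub>C ('a::real_normed_vector \<Rightarrow>\<^sub>L 'b::real_normed_vector)) \<Rightarrow> _)"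
proof
  show "\<exists>K. \<forall>A w. norm (opmult (A :: real \<Rightarrow>\<^sub>C ('a \<Rightarrow>\<^sub>L 'b)) w) \<le> norm A * norm w * K"
  proof (intro exI[of _ 1] allI)
    fix A :: "real \<Rightarrow>\<^sub>C ('a \<Rightarrow>\<^sub>L 'b)" and w :: "real \<Rightarrow>\<^sub>C 'a"
    have "norm (opmult A w) \<le> norm A * norm w"
    proof (rule norm_bound)
      fix t show "norm (opmult A w t) \<le> norm A * norm w"
        unfolding opmult_apply
        by (rule order_trans[OF norm_blinfun]) (intro mult_mono norm_bounded norm_ge_zero)
    qed
    then show "norm (opmult A w) \<le> norm A * norm w * 1" by simp
  qed
qed (rule bcontfun_eqI, simp add: opmult_apply blinfun.bilinear_simps)+

lemma norm_opmult: "norm (opmult A w) \<le> norm A * norm w"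
proof (rule norm_bound)
  fix t show "norm (opmult A w t) \<le> norm A * norm w"
    unfolding opmult_apply
    by (rule order_trans[OF norm_blinfun]) (intro mult_mono norm_bounded norm_ge_zero)
qed

lemmas opmult_simps = bounded_bilinear.add_left[OF bounded_bilinear_opmult]
  bounded_bilinear.add_right[OF bounded_bilinear_opmult]
  bounded_bilinear.diff_left[OF bounded_bilinear_opmult]
  bounded_bilinear.diff_right[OF bounded_bilinear_opmult]
  bounded_bilinear.scaleR_right[OF bounded_bilinear_opmult]

type_synonym 'a curve_op = "real \<Rightarrow>\<^sub>C ('a \<Rightarrow>\<^sub>L 'a)"

definition lin_sol :: "'a::banach curve_op \<Rightarrow> (real \<Rightarrow>\<^sub>C 'a) \<Rightarrow> real \<Rightarrow>\<^sub>C 'a" where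
  "lin_sol A b = (THE w. w = b + primitive (primitive (opmult A w)))"

lemma opmult_lipschitz: "norm (opmult A u s - opmult A v s) \<le> norm A * norm (u s - v s)"
proof -
  have "opmult A u s - opmult A v s = blinfun_apply (A s) (u s - v s)"
    by (simp add: opmult_apply blinfun.bilinear_simps)
  then show ?thesis
    using order_trans[OF norm_blinfun[of "A s" "u s - v s"] mult_right_mono[OF norm_bounded[of A s] norm_ge_zero]] by simp
qed

lemma lin_sol_eq: "lin_sol A b = b + primitive (primitive (opmult A (lin_sol A b)))"
  unfolding lin_sol_def
  by (rule theI', rule volterra_exists[OF opmult_lipschitz]) simp

lemma lin_sol_unique: "w = b + primitive (primitive (opmult A w)) \<Longrightarrow> lin_sol A b = w"
  unfolding lin_sol_def by (rule the1_equality[OF volterra_exists[OF opmult_lipschitz norm_ge_zero]])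

lemma lin_sol_bound: "norm (lin_sol A b) \<le> vconst (norm A) * norm b"
proof -
  have "lin_sol A 0 = 0" by (rule lin_sol_unique) (simp add: bounded_bilinear.zero_right[OF bounded_bilinear_opmult] linear_0[OF linear_primitive])
  then show ?thesis
    using volterra_stable[OF opmult_lipschitz norm_ge_zero lin_sol_eq lin_sol_eq, of A b 0] by simp
qed

lemma bounded_linear_lin_sol: "bounded_linear (lin_sol A)"
proof (rule bounded_linear_intro[where K="vconst (norm A)"])
  show "lin_sol A (b + c) = lin_sol A b + lin_sol A c" for b c
  proof (rule lin_sol_unique)
    have "lin_sol A b + lin_sol A c = (b + primitive (primitive (opmult A (lin_sol A b)))) + (c + primitive (primitive (opmult A (lin_sol A c))))"
      by (rule arg_cong2[where f="(+)", OF lin_sol_eq lin_sol_eq])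
    then show "lin_sol A b + lin_sol A c = b + c + primitive (primitive (opmult A (lin_sol A b + lin_sol A c)))"
      by (rule trans) (simp only: opmult_simps primitive_add ac_simps)
  qed
  show "lin_sol A (r *\<^sub>R b) = r *\<^sub>R lin_sol A b" for r b
  proof (rule lin_sol_unique)
    have "r *\<^sub>R lin_sol A b = r *\<^sub>R (b + primitive (primitive (opmult A (lin_sol A b))))"
      by (rule arg_cong[OF lin_sol_eq])
    then show "r *\<^sub>R lin_sol A b = r *\<^sub>R b + primitive (primitive (opmult A (r *\<^sub>R lin_sol A b)))"
      by (rule trans) (simp only: opmult_simps linear_scale[OF linear_primitive] scaleR_add_right)
  qed
  show "norm (lin_sol A b) \<le> norm b * vconst (norm A)" for b
    using lin_sol_bound[of A b] by (simp add: mult.commute)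
qed

lemma vconst_mono: "K \<le> L \<Longrightarrow> vconst K \<le> vconst L"
  by (simp add: vconst_def)

lemma norm_primitive2: "norm (primitive (primitive f)) \<le> norm f"
  by (rule order_trans[OF norm_primitive norm_primitive])

text \<open>The solution for \<open>B\<close> also solves the equation for \<open>A\<close>, with an
  inhomogeneity changed by the double primitive of \<open>opmult (B - A)\<close> applied to it, so
  stability bounds the difference. Continuity in the coefficient makes the shooting map C1.\<close>

lemma lin_sol_diff_op:
  "norm (lin_sol A b - lin_sol B b) \<le> vconst (norm A) * (norm (A - B) * (vconst (norm B) * norm b))"
proof -
  let ?w = "lin_sol B b"
  have "?w = (b + primitive (primitive (opmult (B - A) ?w))) + primitive (primitive (opmult A ?w))"
    by (rule trans[OF lin_sol_eq]) (simp add: opmult_simps primitive_diff)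
  from volterra_stable[OF opmult_lipschitz norm_ge_zero lin_sol_eq[of A b] this]
  have "norm (lin_sol A b - ?w) \<le> vconst (norm A) * norm (primitive (primitive (opmult (B - A) ?w)))"
    by simp
  also have "\<dots> \<le> vconst (norm A) * (norm (A - B) * (vconst (norm B) * norm b))"
  proof (rule mult_left_mono)
    have "norm (primitive (primitive (opmult (B - A) ?w))) \<le> norm (opmult (B - A) ?w)" by (rule norm_primitive2)
    also have "\<dots> \<le> norm (B - A) * norm ?w" by (rule norm_opmult)
    also have "\<dots> \<le> norm (B - A) * (vconst (norm B) * norm b)" by (intro mult_left_mono lin_sol_bound) auto
    finally show "norm (primitive (primitive (opmult (B - A) ?w))) \<le> norm (A - B) * (vconst (norm B) * norm b)"
      by (simp add: norm_minus_commute)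
  qed (use vconst_pos[of "norm A"] in simp)
  finally show ?thesis .
qed

lemma continuous_on_lin_sol: "continuous_on UNIV (\<lambda>A. lin_sol A b)"
proof -
  have "((\<lambda>B. lin_sol B b) \<longlongrightarrow> lin_sol A b) (at A)" for A
  proof (rule Lim_null_comparison[THEN LIM_zero_cancel])
    show "\<forall>\<^sub>F B in at A. norm (lin_sol B b - lin_sol A b) \<le> vconst (norm B) * (norm (B - A) * (vconst (norm A) * norm b))"
      by (intro always_eventually allI lin_sol_diff_op)
    have "((\<lambda>B. vconst (norm B) * (norm (B - A) * (vconst (norm A) * norm b))) \<longlongrightarrow> vconst (norm A) * (norm (A - A) * (vconst (norm A) * norm b))) (at A)"
      unfolding vconst_def by (intro tendsto_intros)
    then show "((\<lambda>B. vconst (norm B) * (norm (B - A) * (vconst (norm A) * norm b))) \<longlongrightarrow> 0) (at A)" by simp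
  qed
  then show ?thesis by (simp add: continuous_on_def)
qed

section \<open>Differentiable dependence of solutions on the data\<close>

locale force =
  fixes G :: "'a::euclidean_space \<Rightarrow> 'a" and DG :: "'a \<Rightarrow> 'a \<Rightarrow>\<^sub>L 'a" and L :: real
  assumes G_deriv: "\<And>y. (G has_derivative blinfun_apply (DG y)) (at y)"
    and DG_cont: "continuous_on UNIV DG"
    and DG_bound: "\<And>y. norm (DG y) \<le> L"
begin

lemma L_nonneg: "L \<ge> 0" using DG_bound[of 0] norm_ge_zero[of "DG 0"] by linarith

lemma G_lipschitz: "norm (G x - G y) \<le> L * norm (x - y)"
  by (rule differentiable_bound[of UNIV G "\<lambda>y. blinfun_apply (DG y)"])
     (use G_deriv DG_bound in \<open>auto simp: norm_blinfun.rep_eq[symmetric] intro: has_derivative_at_withinI\<close>)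

lemma G_cont: "continuous_on S G"
  using G_deriv by (auto intro!: continuous_at_imp_continuous_on has_derivative_continuous)

definition force_along :: "(real \<Rightarrow>\<^sub>C 'a) \<Rightarrow> real \<Rightarrow>\<^sub>C 'a" where
  "force_along u = Bcontfun (\<lambda>t. G (u t))"

definition dforce_along :: "(real \<Rightarrow>\<^sub>C 'a) \<Rightarrow> 'a curve_op" where
  "dforce_along u = Bcontfun (\<lambda>t. DG (u t))"

lemma force_along_apply: "force_along u t = G (u t)"
proof -
  have "(\<lambda>t. G (u t)) \<in> bcontfun"
  proof (rule bcontfun_normI)
    show "continuous_on UNIV (\<lambda>t. G (u t))"
      by (rule continuous_on_compose2[OF G_cont[of UNIV]]) auto
    show "norm (G (u t)) \<le> norm (G 0) + L * norm u" for t
    proof -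
      have "norm (G (u t)) \<le> norm (G 0) + norm (G (u t) - G 0)" using norm_triangle_sub by blast
      also have "norm (G (u t) - G 0) \<le> L * norm (u t - 0)" by (rule G_lipschitz)
      also have "\<dots> \<le> L * norm u" using norm_bounded[of u t] L_nonneg by (intro mult_left_mono) auto
      finally show ?thesis by simp
    qed
  qed
  then show ?thesis by (simp add: force_along_def Bcontfun_inverse)
qed

lemma dforce_along_apply: "dforce_along u t = DG (u t)"
proof -
  have "(\<lambda>t. DG (u t)) \<in> bcontfun"
    by (rule bcontfun_normI[of _ L]) (use DG_bound in \<open>auto intro: continuous_on_compose2[OF DG_cont]\<close>)
  then show ?thesis by (simp add: dforce_along_def Bcontfun_inverse)
qed

lemma norm_dforce_along: "norm (dforce_along u) \<le> L"
  by (rule norm_bound) (simp add: dforce_along_apply DG_bound)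

text \<open>The range of \<open>u\<close> and its unit neighbourhood lie in a compact ball, on which
  \<open>DG\<close> is uniformly continuous. The uniformity in t is what makes composition with
  \<open>G\<close> differentiable for the sup norm.\<close>

lemma DG_uniform_near_range:
  fixes u :: "real \<Rightarrow>\<^sub>C 'a"
  assumes "e > 0"
  shows "\<exists>d>0. \<forall>t y. norm (y - u t) \<le> d \<longrightarrow> norm (DG y - DG (u t)) \<le> e"
proof -
  define R where "R = norm u + 1"
  have "uniformly_continuous_on (cball 0 R) DG"
    by (rule compact_uniformly_continuous[OF continuous_on_subset[OF DG_cont]]) auto
  then obtain d where d: "d > 0" "\<And>x y. x \<in> cball 0 R \<Longrightarrow> y \<in> cball 0 R \<Longrightarrow> dist y x < d \<Longrightarrow> dist (DG y) (DG x) < e"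
    unfolding uniformly_continuous_on_def using assms by blast
  show ?thesis
  proof (intro exI[of _ "min 1 (d / 2)"] conjI allI impI)
    show "min 1 (d / 2) > 0" using d by simp
    fix t y assume y: "norm (y - u t) \<le> min 1 (d / 2)"
    have "norm (u t) \<le> R" using norm_bounded[of u t] by (simp add: R_def)
    moreover have "norm y \<le> R" using norm_bounded[of u t] y norm_triangle_sub[of y "u t"] by (simp add: R_def)
    moreover have "dist y (u t) < d" using y d(1) by (simp add: dist_norm)
    ultimately show "norm (DG y - DG (u t)) \<le> e" using d(2)[of "u t" y] by (simp add: dist_norm)
  qed
qed

lemma continuous_on_dforce_along: "continuous_on UNIV dforce_along"
  unfolding continuous_on_iff
proof (intro ballI allI impI)
  fix u :: "real \<Rightarrow>\<^sub>C 'a" and e :: real assume "e > 0"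
  then obtain d where d: "d > 0" "\<And>t y. norm (y - u t) \<le> d \<Longrightarrow> norm (DG y - DG (u t)) \<le> e / 2"
    using DG_uniform_near_range[of "e / 2" u] by auto
  have "dist (dforce_along v) (dforce_along u) < e" if "dist v u < d" for v
  proof -
    have "dist (dforce_along v) (dforce_along u) \<le> e / 2"
    proof (rule dist_bound)
      fix t
      have "norm (v t - u t) \<le> d" using dist_fun_lt_imp_dist_val_lt[OF that, of t] by (simp add: dist_norm)
      then show "dist (dforce_along v t) (dforce_along u t) \<le> e / 2"
        using d(2) by (simp add: dforce_along_apply dist_norm)
    qed
    then show ?thesis using \<open>e > 0\<close> by simp
  qed
  then show "\<exists>d>0. \<forall>x'\<in>UNIV. dist x' u < d \<longrightarrow> dist (dforce_along x') (dforce_along u) < e"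
    using d(1) by blast
qed

lemma force_along_remainder:
  fixes u :: "real \<Rightarrow>\<^sub>C 'a"
  assumes "e > 0"
  shows "\<exists>d>0. \<forall>v. norm (v - u) \<le> d \<longrightarrow>
    norm (force_along v - force_along u - opmult (dforce_along u) (v - u)) \<le> e * norm (v - u)"
proof -
  obtain d where d: "d > 0" "\<And>t y. norm (y - u t) \<le> d \<Longrightarrow> norm (DG y - DG (u t)) \<le> e"
    using DG_uniform_near_range[OF assms, of u] by auto
  have "norm (force_along v - force_along u - opmult (dforce_along u) (v - u)) \<le> e * norm (v - u)"
    if v: "norm (v - u) \<le> d" for v
  proof (rule norm_bound)
    fix t
    have vt: "norm (v t - u t) \<le> d" using norm_bounded[of "v - u" t] v by simp
    have "norm ((G (v t) - DG (u t) (v t)) - (G (u t) - DG (u t) (u t))) \<le> e * norm (v t - u t)"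
    proof (rule differentiable_bound[of "cball (u t) d" "\<lambda>y. G y - DG (u t) y" "\<lambda>y. blinfun_apply (DG y - DG (u t))"])
      fix x assume "x \<in> cball (u t) d"
      then have "norm (DG x - DG (u t)) \<le> e" using d(2)[of x t] by (simp add: dist_norm norm_minus_commute)
      then show "onorm (blinfun_apply (DG x - DG (u t))) \<le> e" by (simp add: norm_blinfun.rep_eq)
      show "((\<lambda>y. G y - DG (u t) y) has_derivative blinfun_apply (DG x - DG (u t))) (at x within cball (u t) d)"
        by (rule has_derivative_at_withinI)
           (auto simp: minus_blinfun.rep_eq intro!: has_derivative_diff G_deriv
             bounded_linear_imp_has_derivative blinfun.bounded_linear_right)
    qed (use vt d(1) in \<open>auto simp: dist_norm norm_minus_commute\<close>)
    also have "\<dots> \<le> e * norm (v - u)"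
      using norm_bounded[of "v - u" t] assms by (intro mult_left_mono) auto
    finally show "norm ((force_along v - force_along u - opmult (dforce_along u) (v - u)) t) \<le> e * norm (v - u)"
      by (simp add: force_along_apply opmult_apply dforce_along_apply blinfun.bilinear_simps algebra_simps)
  qed
  then show ?thesis using d(1) by blast
qed

lemma has_derivative_force_along:
  "(force_along has_derivative opmult (dforce_along u)) (at u)"
  unfolding has_derivative_at_alt
proof (intro conjI allI impI)
  show "bounded_linear (opmult (dforce_along u))"
    by (rule bounded_bilinear.bounded_linear_right[OF bounded_bilinear_opmult])
  fix e :: real assume "e > 0"
  from force_along_remainder[OF this, of u]
  show "\<exists>d>0. \<forall>y. norm (y - u) < d \<longrightarrow> norm (force_along y - force_along u - opmult (dforce_along u) (y - u)) \<le> e * norm (y - u)"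
    by (auto intro: less_imp_le)
qed

definition sol :: "(real \<Rightarrow>\<^sub>C 'a) \<Rightarrow> real \<Rightarrow>\<^sub>C 'a" where
  "sol a = (THE u. u = a + primitive (primitive (force_along u)))"

lemma force_along_lipschitz: "norm (force_along u s - force_along v s) \<le> L * norm (u s - v s)"
  by (simp add: force_along_apply G_lipschitz)

lemma sol_eq: "sol a = a + primitive (primitive (force_along (sol a)))"
  unfolding sol_def
  by (rule theI', rule volterra_exists[OF force_along_lipschitz L_nonneg])

lemma sol_unique: "u = a + primitive (primitive (force_along u)) \<Longrightarrow> sol a = u"
  unfolding sol_def by (rule the1_equality[OF volterra_exists[OF force_along_lipschitz L_nonneg]])

lemma sol_lipschitz: "norm (sol a - sol b) \<le> vconst L * norm (a - b)"
  by (rule volterra_stable[OF force_along_lipschitz L_nonneg sol_eq sol_eq])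

text \<open>The error of the linear approximation is itself \<open>lin_sol\<close> of the double
  primitive of the Taylor remainder of \<open>force_along\<close>. The tolerance is divided by the
  square of \<open>vconst L\<close>: one factor for the Lipschitz constant of \<open>sol\<close>,
  one for the bound on \<open>lin_sol\<close>.\<close>

lemma has_derivative_sol: "(sol has_derivative lin_sol (dforce_along (sol a))) (at a)"
  unfolding has_derivative_at_alt
proof (intro conjI allI impI)
  let ?A = "dforce_along (sol a)" and ?K = "vconst L"
  show "bounded_linear (lin_sol ?A)" by (rule bounded_linear_lin_sol)
  fix e :: real assume "e > 0"
  then have "e / ?K^2 > 0" using vconst_pos[of L] by simp
  from force_along_remainder[OF this, of "sol a"] obtain d where d: "d > 0"
    "\<And>v. norm (v - sol a) \<le> d \<Longrightarrow> norm (force_along v - force_along (sol a) - opmult ?A (v - sol a)) \<le> e / ?K^2 * norm (v - sol a)"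
    by blast
  show "\<exists>d>0. \<forall>y. norm (y - a) < d \<longrightarrow> norm (sol y - sol a - lin_sol ?A (y - a)) \<le> e * norm (y - a)"
  proof (intro exI[of _ "d / ?K"] conjI allI impI)
    show "d / ?K > 0" using d vconst_pos[of L] by simp
    fix y assume y: "norm (y - a) < d / ?K"
    let ?w = "lin_sol ?A (y - a)"
    have l: "norm (sol y - sol a) \<le> ?K * norm (y - a)" by (rule sol_lipschitz)
    also have "\<dots> \<le> d" using y vconst_pos[of L] by (simp add: field_simps)
    finally have R: "norm (force_along (sol y) - force_along (sol a) - opmult ?A (sol y - sol a)) \<le> e / ?K^2 * norm (sol y - sol a)"
      by (rule d(2))
    let ?r = "sol y - sol a - ?w" and ?R = "force_along (sol y) - force_along (sol a) - opmult ?A (sol y - sol a)"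
    have "?r = (y + primitive (primitive (force_along (sol y)))) - (a + primitive (primitive (force_along (sol a))))
        - (y - a + primitive (primitive (opmult ?A ?w)))"
      by (intro arg_cong2[where f="(-)"] sol_eq lin_sol_eq)
    then have "?r = primitive (primitive ?R) + primitive (primitive (opmult ?A ?r))"
      by (rule trans) (simp add: primitive_diff opmult_simps)
    then have "?r = lin_sol ?A (primitive (primitive ?R))" by (rule lin_sol_unique[symmetric])
    then have "norm ?r \<le> vconst (norm ?A) * norm (primitive (primitive ?R))" using lin_sol_bound[of ?A "primitive (primitive ?R)"] by simp
    also have "\<dots> \<le> ?K * (e / ?K^2 * (?K * norm (y - a)))"
    proof (rule mult_mono)
      show "vconst (norm ?A) \<le> ?K" by (rule vconst_mono[OF norm_dforce_along])
      have "norm (primitive (primitive ?R)) \<le> norm ?R" by (rule norm_primitive2)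
      also have "\<dots> \<le> e / ?K^2 * norm (sol y - sol a)" by (rule R)
      also have "\<dots> \<le> e / ?K^2 * (?K * norm (y - a))" using l \<open>e / ?K^2 > 0\<close> by (intro mult_left_mono) auto
      finally show "norm (primitive (primitive ?R)) \<le> e / ?K^2 * (?K * norm (y - a))" .
    qed (use vconst_pos[of L] in auto)
    also have "\<dots> = e * norm (y - a)" using vconst_pos[of L] by (simp add: power2_eq_square)
    finally show "norm (sol y - sol a - ?w) \<le> e * norm (y - a)" .
  qed
qed

end

section \<open>The shooting map\<close>

text \<open>States \<open>(u, u')\<close> in the plane are packed into \<open>real^4\<close>.\<close>

definition pos :: "real^4 \<Rightarrow> real^2" where "pos z = (\<chi> i. if i = 1 then z $ 1 else z $ 2)"
definition vel :: "real^4 \<Rightarrow> real^2" where "vel z = (\<chi> i. if i = 1 then z $ 3 else z $ 4)"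
definition pack :: "real^2 \<Rightarrow> real^2 \<Rightarrow> real^4" where
  "pack x v = (\<chi> i. if i = 1 then x $ 1 else if i = 2 then x $ 2 else if i = 3 then v $ 1 else v $ 2)"

lemma pack_simps [simp]:
  "pos (pack x v) = x" "vel (pack x v) = v" "pack (pos z) (vel z) = z"
  by (simp_all add: pos_def vel_def pack_def vec_eq_iff forall_2 forall_4)

lemma pack_eq_0_iff: "pack x v = 0 \<longleftrightarrow> x = 0 \<and> v = 0"
  by (auto simp: pack_def vec_eq_iff forall_2 forall_4)

lemma norm_pos: "norm (pos z) \<le> norm z" and norm_vel: "norm (vel z) \<le> norm z"
  and norm_pack: "norm (pack x v) \<le> norm x + norm v"
proof -
  show "norm (pos z) \<le> norm z" "norm (vel z) \<le> norm z"
    unfolding norm_vec_def L2_set_def by (auto simp: pos_def vel_def sum_2 sum_4 intro!: real_sqrt_le_mono)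
  have "norm (pack x v) = sqrt ((norm x)^2 + (norm v)^2)"
    unfolding norm_vec_def L2_set_def by (simp add: pack_def sum_2 sum_4 sum_nonneg)
  also have "\<dots> \<le> norm x + norm v" by (rule sqrt_sum_squares_le_sum) auto
  finally show "norm (pack x v) \<le> norm x + norm v" .
qed

lemma bounded_linear_pos: "bounded_linear pos"
proof (rule bounded_linear_intro[where K=1])
  show "norm (pos x) \<le> norm x * 1" for x using norm_pos by simp
qed (simp_all add: vec_eq_iff pos_def)

lemma bounded_linear_vel: "bounded_linear vel"
proof (rule bounded_linear_intro[where K=1])
  show "norm (vel x) \<le> norm x * 1" for x using norm_vel by simp
qed (simp_all add: vec_eq_iff vel_def)

lemma bounded_linear_pack: "bounded_linear (\<lambda>x. pack (fst x) (snd x))"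
proof (rule bounded_linear_intro[where K=2])
  show "norm (pack (fst x) (snd x)) \<le> norm x * 2" for x
    using norm_pack[of "fst x" "snd x"] norm_fst_le[of "fst x" "snd x"] norm_snd_le[of "snd x" "fst x"] by simp
qed (auto simp: pack_def vec_eq_iff forall_4)

lemma norm_const_bcontfun_le: "norm (const_bcontfun x) \<le> norm x"
  by (rule norm_bound) simp

lemma bounded_linear_const_bcontfun: "bounded_linear const_bcontfun"
  by (rule bounded_linear_intro[where K=1])
     (auto intro!: bcontfun_eqI norm_bound)

lemma bounded_linear_eval: "bounded_linear (\<lambda>f. apply_bcontfun f t)"
  by (rule bounded_linear_intro[where K=1]) (auto simp: norm_bounded)

text \<open>The motion with state \<open>z\<close> and forcing \<open>p\<close> in the absence of
  \<open>G\<close>, x + t v plus the double primitive of \<open>p\<close>; it is the inhomogeneity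
  of the Volterra equation.\<close>

definition init :: "real^4 \<Rightarrow> (real \<Rightarrow>\<^sub>C (real^2)) \<Rightarrow> real \<Rightarrow>\<^sub>C (real^2)" where
  "init z p = const_bcontfun (pos z) + primitive (const_bcontfun (vel z) + primitive p)"

lemma bounded_linear_init: "bounded_linear (\<lambda>x. init (fst x) (snd x))"
  unfolding init_def
  by (intro bounded_linear_add bounded_linear_compose[OF bounded_linear_const_bcontfun]
      bounded_linear_compose[OF bounded_linear_pos] bounded_linear_compose[OF bounded_linear_vel]
      bounded_linear_compose[OF bounded_linear_primitive] bounded_linear_fst bounded_linear_snd)

lemma norm_init: "norm (init k 0) \<le> 2 * norm k"
proof -
  have "init k 0 = const_bcontfun (pos k) + primitive (const_bcontfun (vel k))"
    by (simp add: init_def linear_0[OF linear_primitive])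
  also have "norm \<dots> \<le> norm k + norm k"
    by (intro order_trans[OF norm_triangle_ineq] add_mono order_trans[OF norm_const_bcontfun_le norm_pos]
        order_trans[OF norm_primitive] order_trans[OF norm_const_bcontfun_le norm_vel])
  finally show ?thesis by simp
qed

lemma init_diff: "init z p - init z' p = init (z - z') 0"
  using bounded_linear.linear[OF bounded_linear_init, THEN linear_diff, of "(z, p)" "(z', p)"] by simp

text \<open>Here \<open>k\<close> perturbs the initial state and \<open>\<phi>\<close> the forcing.
  The coefficient \<open>A\<close> is left free, so that linearisations along different orbits can
  be compared and continuity in \<open>A\<close> can be stated.\<close>

definition lin_flow where "lin_flow A k \<phi> = lin_sol A (init k \<phi>)"
definition lin_vflow where
  "lin_vflow A k \<phi> = const_bcontfun (vel k) + primitive (opmult A (lin_flow A k \<phi>) + \<phi>)"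
definition lin_shoot :: "(real^2) curve_op \<Rightarrow> real^4 \<Rightarrow> (real \<Rightarrow>\<^sub>C (real^2)) \<Rightarrow> real^4" where
  "lin_shoot A k \<phi> = pack (lin_flow A k \<phi> 1 - pos k) (lin_vflow A k \<phi> 1 - vel k)"

lemma norm_lin_flow:
  assumes "norm A \<le> L"
  shows "norm (lin_flow A k 0) \<le> 2 * vconst L * norm k"
proof -
  have "norm (lin_flow A k 0) \<le> vconst (norm A) * norm (init k 0)"
    unfolding lin_flow_def by (rule lin_sol_bound)
  also have "\<dots> \<le> vconst L * (2 * norm k)"
    using norm_init vconst_pos[of L] by (intro mult_mono vconst_mono assms) auto
  finally show ?thesis by simp
qed

lemma bounded_linear_opmult_right: "bounded_linear g \<Longrightarrow> bounded_linear (\<lambda>x. opmult A (g x))"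
  by (rule bounded_linear_compose[OF bounded_bilinear.bounded_linear_right[OF bounded_bilinear_opmult]])

lemma bounded_linear_lin_flow: "bounded_linear (\<lambda>x. lin_flow A (fst x) (snd x))"
  unfolding lin_flow_def by (rule bounded_linear_compose[OF bounded_linear_lin_sol bounded_linear_init])

lemma bounded_linear_lin_vflow: "bounded_linear (\<lambda>x. lin_vflow A (fst x) (snd x))"
  unfolding lin_vflow_def
  by (intro bounded_linear_add bounded_linear_compose[OF bounded_linear_const_bcontfun]
      bounded_linear_compose[OF bounded_linear_vel] bounded_linear_opmult_right bounded_linear_lin_flow
      bounded_linear_compose[OF bounded_linear_primitive] bounded_linear_fst bounded_linear_snd)

lemma bounded_linear_lin_shoot: "bounded_linear (\<lambda>x. lin_shoot A (fst x) (snd x))"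
proof -
  have "bounded_linear (\<lambda>x. (lin_flow A (fst x) (snd x) 1 - pos (fst x), lin_vflow A (fst x) (snd x) 1 - vel (fst x)))"
    by (intro bounded_linear_Pair bounded_linear_sub bounded_linear_compose[OF bounded_linear_eval] bounded_linear_lin_flow bounded_linear_lin_vflow
      bounded_linear_compose[OF bounded_linear_pos] bounded_linear_compose[OF bounded_linear_vel] bounded_linear_fst)
  from bounded_linear_compose[OF bounded_linear_pack this] show ?thesis by (simp add: lin_shoot_def)
qed

lemma linear_lin_shoot_left: "linear (\<lambda>k. lin_shoot A k 0)"
proof -
  have "bounded_linear (\<lambda>k. (k :: real^4, 0 :: real \<Rightarrow>\<^sub>C (real^2)))"
    by (intro bounded_linear_Pair bounded_linear_ident bounded_linear_zero)
  from bounded_linear_compose[OF bounded_linear_lin_shoot this] show ?thesis by (simp add: bounded_linear.linear)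
qed

lemma continuous_on_lin_flow: "continuous_on UNIV (\<lambda>A. lin_flow A k \<phi>)"
  unfolding lin_flow_def by (rule continuous_on_lin_sol)

lemma continuous_on_lin_vflow: "continuous_on UNIV (\<lambda>A. lin_vflow A k \<phi>)"
  unfolding lin_vflow_def
  by (intro continuous_on_add continuous_on_const
      bounded_linear.continuous_on[OF bounded_linear_primitive]
      bounded_bilinear.continuous_on[OF bounded_bilinear_opmult] continuous_on_id continuous_on_lin_flow)

lemma continuous_on_lin_shoot: "continuous_on UNIV (\<lambda>A. lin_shoot A k \<phi>)"
proof -
  have "continuous_on UNIV (\<lambda>A. (lin_flow A k \<phi> 1 - pos k, lin_vflow A k \<phi> 1 - vel k))"
    by (intro continuous_intros bounded_linear.continuous_on[OF bounded_linear_eval] continuous_on_lin_flow continuous_on_lin_vflow)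
  from bounded_linear.continuous_on[OF bounded_linear_pack this] show ?thesis by (simp add: lin_shoot_def)
qed

lemma bcontfun_deriv_ode:
  fixes x v :: "'a::banach"
  assumes "u = const_bcontfun x + primitive w" "t \<in> {0..1}"
  shows "(u has_vector_derivative w t) (at t within {0..1})" "u 0 = x"
proof -
  have "((\<lambda>t. x + primitive w t) has_vector_derivative 0 + w t) (at t within {0..1})"
    by (intro has_vector_derivative_add has_vector_derivative_const primitive_deriv assms)
  then show "(u has_vector_derivative w t) (at t within {0..1})"
    unfolding assms(1) by (simp add: plus_bcontfun.rep_eq[abs_def])
  show "u 0 = x" unfolding assms(1) by simp
qed

lemma bcontfun_of_ode:
  fixes u w :: "real \<Rightarrow> 'a::banach" and w' :: "real \<Rightarrow>\<^sub>C 'a"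
  assumes "\<And>t. t \<in> {0..1} \<Longrightarrow> (u has_vector_derivative w t) (at t within {0..1})"
    and w: "\<And>t. t \<in> {0..1} \<Longrightarrow> w t = w' t"
  shows "ext01 u = const_bcontfun (u 0) + primitive w'"
proof (rule bcontfun_eqI)
  fix t
  have "continuous_on {0..1} u"
    by (rule continuous_on_vector_derivative[OF assms(1)])
  moreover have "(w has_integral u (clamp01 t) - u 0) {0..clamp01 t}"
  proof (rule fundamental_theorem_of_calculus)
    show "(u has_vector_derivative w x) (at x within {0..clamp01 t})" if "x \<in> {0..clamp01 t}" for x
      by (rule has_vector_derivative_within_subset[OF assms(1)]) (use that clamp01(2,3)[of t] in auto)
  qed (rule clamp01(2,3))
  then have "(w' has_integral u (clamp01 t) - u 0) {0..clamp01 t}"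
    by (rule has_integral_eq[rotated]) (use w clamp01(2,3)[of t] in auto)
  ultimately show "ext01 u t = (const_bcontfun (u 0) + primitive w') t"
    by (simp add: ext01_apply primitive_apply integral_unique)
qed

lemma clamp_invariant_primitive: "u = const_bcontfun x + primitive w \<Longrightarrow> u (clamp01 t) = u t"
  by (simp add: primitive_clamp01)

lemma lin_flow_eq: "lin_flow A k \<phi> = const_bcontfun (pos k) + primitive (lin_vflow A k \<phi>)"
proof -
  have "lin_flow A k \<phi> = init k \<phi> + primitive (primitive (opmult A (lin_flow A k \<phi>)))"
    unfolding lin_flow_def by (rule lin_sol_eq)
  also have "\<dots> = const_bcontfun (pos k) + primitive (lin_vflow A k \<phi>)"
    by (simp add: init_def lin_vflow_def primitive_add ac_simps)
  finally show ?thesis .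
qed

lemma lin_flow_unique:
  assumes "w = const_bcontfun (pos k) + primitive v" "v = const_bcontfun (vel k) + primitive (opmult A w + \<phi>)"
  shows "lin_flow A k \<phi> = w" "lin_vflow A k \<phi> = v"
proof -
  show *: "lin_flow A k \<phi> = w"
    unfolding lin_flow_def
  proof (rule lin_sol_unique)
    have "w = const_bcontfun (pos k) + primitive (const_bcontfun (vel k) + primitive (opmult A w + \<phi>))"
      using assms by simp
    also have "\<dots> = init k \<phi> + primitive (primitive (opmult A w))"
      by (simp add: init_def primitive_add ac_simps)
    finally show "w = init k \<phi> + primitive (primitive (opmult A w))" .
  qed
  show "lin_vflow A k \<phi> = v" unfolding lin_vflow_def * by (rule assms(2)[symmetric])
qed

locale planar_force = force G DG L for G :: "real^2 \<Rightarrow> real^2" and DG L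
begin

definition flow where "flow z p = sol (init z p)"
definition vflow where "vflow z p = const_bcontfun (vel z) + primitive (force_along (flow z p) + p)"
definition shoot where "shoot z p = pack (flow z p 1 - pos z) (vflow z p 1 - vel z)"
definition dflow where "dflow z p = dforce_along (flow z p)"

lemma flow_eq: "flow z p = const_bcontfun (pos z) + primitive (vflow z p)"
proof -
  have "flow z p = init z p + primitive (primitive (force_along (flow z p)))"
    unfolding flow_def by (rule sol_eq)
  also have "\<dots> = const_bcontfun (pos z) + primitive (vflow z p)"
    by (simp add: init_def vflow_def primitive_add ac_simps)
  finally show ?thesis .
qed

lemma flow_unique:
  assumes "u = const_bcontfun (pos z) + primitive v" "v = const_bcontfun (vel z) + primitive (force_along u + p)"
  shows "flow z p = u" "vflow z p = v"
proof -
  show *: "flow z p = u"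
    unfolding flow_def
  proof (rule sol_unique)
    have "u = const_bcontfun (pos z) + primitive (const_bcontfun (vel z) + primitive (force_along u + p))"
      using assms by simp
    also have "\<dots> = init z p + primitive (primitive (force_along u))"
      by (simp add: init_def primitive_add ac_simps)
    finally show "u = init z p + primitive (primitive (force_along u))" .
  qed
  show "vflow z p = v" unfolding vflow_def * by (rule assms(2)[symmetric])
qed

lemma flow_deriv:
  assumes "t \<in> {0..1}"
  shows "(flow z p has_vector_derivative vflow z p t) (at t within {0..1})"
    and "(vflow z p has_vector_derivative G (flow z p t) + p t) (at t within {0..1})"
    and "flow z p 0 = pos z" "vflow z p 0 = vel z"
  using bcontfun_deriv_ode[OF flow_eq assms] bcontfun_deriv_ode[OF vflow_def assms]
  by (auto simp: force_along_apply)

lemma flow_clamp01: "flow z p (clamp01 t) = flow z p t"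
  by (rule clamp_invariant_primitive[OF flow_eq])

lemma flow_of_ode:
  fixes p :: "real \<Rightarrow>\<^sub>C (real^2)"
  assumes "\<And>t. t \<in> {0..1} \<Longrightarrow> (u has_vector_derivative v t) (at t within {0..1})"
    and "\<And>t. t \<in> {0..1} \<Longrightarrow> (v has_vector_derivative G (u t) + p t) (at t within {0..1})"
  shows "t \<in> {0..1} \<Longrightarrow> flow (pack (u 0) (v 0)) p t = u t" "t \<in> {0..1} \<Longrightarrow> vflow (pack (u 0) (v 0)) p t = v t"
proof -
  have cu: "continuous_on {0..1} u" "continuous_on {0..1} v"
    by (rule continuous_on_vector_derivative[OF assms(1)], assumption)
      (rule continuous_on_vector_derivative[OF assms(2)], assumption)
  have eu: "ext01 u t = u (clamp01 t)" "ext01 v t = v (clamp01 t)" for t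
    using cu by (auto simp: ext01_apply)
  have 1: "ext01 u = const_bcontfun (u 0) + primitive (ext01 v)"
    by (rule bcontfun_of_ode[OF assms(1)]) (auto simp: eu clamp01)
  have 2: "ext01 v = const_bcontfun (v 0) + primitive (force_along (ext01 u) + p)"
    by (rule bcontfun_of_ode[OF assms(2)]) (auto simp: eu clamp01 force_along_apply)
  have "flow (pack (u 0) (v 0)) p = ext01 u" "vflow (pack (u 0) (v 0)) p = ext01 v"
    by (rule flow_unique[of "ext01 u" "pack (u 0) (v 0)" "ext01 v" p]; simp only: pack_simps, rule 1 2)+
  then show "t \<in> {0..1} \<Longrightarrow> flow (pack (u 0) (v 0)) p t = u t" "t \<in> {0..1} \<Longrightarrow> vflow (pack (u 0) (v 0)) p t = v t"
    by (auto simp: eu clamp01)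
qed

lemma has_derivative_flow:
  "((\<lambda>x. flow (fst x) (snd x)) has_derivative (\<lambda>k. lin_flow (dflow z p) (fst k) (snd k))) (at (z, p))"
proof -
  have "((\<lambda>x. sol (init (fst x) (snd x))) has_derivative (\<lambda>k. lin_sol (dforce_along (sol (init z p))) (init (fst k) (snd k)))) (at (z, p))"
    using has_derivative_compose[OF bounded_linear_imp_has_derivative[OF bounded_linear_init, of "at (z, p)"], of sol "lin_sol (dforce_along (sol (init z p)))"]
      has_derivative_sol[of "init z p"] by simp
  then show ?thesis by (simp add: flow_def lin_flow_def dflow_def)
qed

lemma has_derivative_vflow:
  "((\<lambda>x. vflow (fst x) (snd x)) has_derivative (\<lambda>k. lin_vflow (dflow z p) (fst k) (snd k))) (at (z, p))"
proof -
  have "((\<lambda>x. force_along (flow (fst x) (snd x))) has_derivative (\<lambda>k. opmult (dflow z p) (lin_flow (dflow z p) (fst k) (snd k)))) (at (z, p))"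
    using has_derivative_compose[OF has_derivative_flow, of force_along "opmult (dflow z p)"]
      has_derivative_force_along[of "flow z p"] by (simp add: dflow_def)
  then show ?thesis
    unfolding vflow_def lin_vflow_def
    by (intro has_derivative_add bounded_linear.has_derivative[OF bounded_linear_primitive]
      bounded_linear.has_derivative[OF bounded_linear_const_bcontfun]
      bounded_linear.has_derivative[OF bounded_linear_vel] has_derivative_fst has_derivative_snd has_derivative_ident)
qed

lemma has_derivative_shoot:
  "((\<lambda>x. shoot (fst x) (snd x)) has_derivative (\<lambda>k. lin_shoot (dflow z p) (fst k) (snd k))) (at (z, p))"
proof -
  have "((\<lambda>x. (flow (fst x) (snd x) 1 - pos (fst x), vflow (fst x) (snd x) 1 - vel (fst x))) has_derivative
     (\<lambda>k. (lin_flow (dflow z p) (fst k) (snd k) 1 - pos (fst k), lin_vflow (dflow z p) (fst k) (snd k) 1 - vel (fst k)))) (at (z, p))"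
    by (intro has_derivative_Pair has_derivative_diff bounded_linear.has_derivative[OF bounded_linear_eval]
      bounded_linear.has_derivative[OF bounded_linear_vel] bounded_linear.has_derivative[OF bounded_linear_pos]
      has_derivative_fst has_derivative_ident has_derivative_flow has_derivative_vflow)
  from bounded_linear.has_derivative[OF bounded_linear_pack this]
  show ?thesis by (simp add: shoot_def lin_shoot_def)
qed

lemma has_derivative_shoot_left: "((\<lambda>z. shoot z p) has_derivative (\<lambda>k. lin_shoot (dflow z p) k 0)) (at z)"
proof -
  have "((\<lambda>z. (z, p)) has_derivative (\<lambda>k. (k, 0))) (at z)" by (intro derivative_intros)
  from has_derivative_compose[OF this has_derivative_shoot] show ?thesis by simp
qed

lemma continuous_on_flow: "continuous_on UNIV (\<lambda>x. flow (fst x) (snd x))"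
  by (rule continuous_at_imp_continuous_on)
    (use has_derivative_continuous[OF has_derivative_flow[of "fst x" "snd x" for x]] in simp)

lemma continuous_on_shoot: "continuous_on UNIV (\<lambda>x. shoot (fst x) (snd x))"
  by (rule continuous_at_imp_continuous_on)
    (use has_derivative_continuous[OF has_derivative_shoot[of "fst x" "snd x" for x]] in simp)

lemma continuous_on_dflow: "continuous_on UNIV (\<lambda>x. dflow (fst x) (snd x))"
  unfolding dflow_def by (rule continuous_on_compose2[OF continuous_on_dforce_along continuous_on_flow]) auto

lemma continuous_on_lin_shoot_dflow: "continuous_on UNIV (\<lambda>x. lin_shoot (dflow (fst x) (snd x)) k \<phi>)"
  by (rule continuous_on_compose2[OF continuous_on_lin_shoot continuous_on_dflow]) auto

lemma norm_dflow: "norm (dflow z p) \<le> L"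
  unfolding dflow_def by (rule norm_dforce_along)

end

text \<open>The constant depends on the orbit only through \<open>L\<close>; such uniformity is what
  \<open>regular_zeros_balanced\<close> and the global Lipschitz bound of the shooting map call
  for.\<close>

lemma lin_shoot_bound:
  assumes "norm A \<le> L"
  shows "norm (lin_shoot A k 0) \<le> (4 + 2 * vconst L + 2 * L * vconst L) * norm k"
proof -
  have L: "0 \<le> L" using assms norm_ge_zero[of A] by linarith
  note f = norm_lin_flow[OF assms, of k]
  have "norm (opmult A (lin_flow A k 0)) \<le> L * (2 * vconst L * norm k)"
    by (rule order_trans[OF norm_opmult]) (intro mult_mono assms f L norm_ge_zero)
  then have v: "norm (lin_vflow A k 0) \<le> norm k + L * (2 * vconst L * norm k)"
    unfolding lin_vflow_def
    by (intro order_trans[OF norm_triangle_ineq] add_mono order_trans[OF norm_const_bcontfun_le norm_vel]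
        order_trans[OF norm_primitive]) simp
  have "norm (lin_shoot A k 0) \<le> norm (lin_flow A k 0 1 - pos k) + norm (lin_vflow A k 0 1 - vel k)"
    unfolding lin_shoot_def by (rule norm_pack)
  also have "\<dots> \<le> (norm (lin_flow A k 0) + norm k) + (norm (lin_vflow A k 0) + norm k)"
    by (intro add_mono order_trans[OF norm_triangle_ineq4] norm_bounded norm_pos norm_vel)
  also have "\<dots> \<le> 2 * vconst L * norm k + norm k + (norm k + L * (2 * vconst L * norm k) + norm k)"
    using f v by simp
  also have "\<dots> \<le> (4 + 2 * vconst L + 2 * L * vconst L) * norm k"
    by (simp add: algebra_simps)
  finally show ?thesis .
qed

section \<open>The truncated central force\<close>

text \<open>\<open>soften d\<close> is continuously differentiable, bounded below by a multiple of \<open>d\<^sup>2\<close>, and the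
  identity from \<open>d\<^sup>2\<close> on, so \<open>cforce q d\<close> is globally smooth and agrees with the singular force
  outside the disc of radius \<open>d\<close>.\<close>

definition soften :: "real \<Rightarrow> real \<Rightarrow> real" where
  "soften d s = s + (max 0 (d^2 - s))^2 / d^2"

definition soften' :: "real \<Rightarrow> real \<Rightarrow> real" where
  "soften' d s = 1 - 2 * max 0 (d^2 - s) / d^2"

definition cforce :: "real \<Rightarrow> real \<Rightarrow> real^2 \<Rightarrow> real^2" where
  "cforce q d y = (soften d (y \<bullet> y) powr (- (q + 1) / 2)) *\<^sub>R y"

definition cforce_deriv_fun :: "real \<Rightarrow> real \<Rightarrow> real^2 \<Rightarrow> real^2 \<Rightarrow> real^2" where
  "cforce_deriv_fun q d y k = (soften d (y \<bullet> y) powr (- (q + 1) / 2)) *\<^sub>R k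
     + (- (q + 1) * soften d (y \<bullet> y) powr (- (q + 1) / 2 - 1) * soften' d (y \<bullet> y) * (y \<bullet> k)) *\<^sub>R y"

definition cforce_deriv :: "real \<Rightarrow> real \<Rightarrow> real^2 \<Rightarrow> (real^2) \<Rightarrow>\<^sub>L (real^2)" where
  "cforce_deriv q d y = Blinfun (cforce_deriv_fun q d y)"

text \<open>The radial coefficient contributes 1, its derivative q + 1, and 3/4 d^2 is the lower
  bound of \<open>soften\<close>.\<close>

definition cforce_lip :: "real \<Rightarrow> real \<Rightarrow> real" where
  "cforce_lip q d = (q + 2) * (3 / 4 * d^2) powr (- (q + 1) / 2)"

lemma soften:
  assumes "d > 0"
  shows "soften d s \<ge> s" "s \<ge> 0 \<Longrightarrow> soften d s \<ge> 3 / 4 * d^2" "s \<ge> d^2 \<Longrightarrow> soften d s = s"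
    "s \<ge> d^2 \<Longrightarrow> soften' d s = 1" "s \<ge> 0 \<Longrightarrow> \<bar>soften' d s\<bar> \<le> 1"
    "(soften d has_real_derivative soften' d s) (at s)"
proof -
  have d2: "d^2 > 0" using assms by simp
  show "soften d s \<ge> s" using d2 by (simp add: soften_def)
  show "soften d s \<ge> 3 / 4 * d^2"
  proof (cases "s \<ge> d^2")
    case False
    have "d^2 * soften d s = d^2 * s + (d^2 - s)^2"
      using False d2 by (simp add: soften_def max_def distrib_left)
    \<comment> \<open>Completing the square: the minimum of \<open>soften d\<close> is attained at
      d^2 / 2, which explains the constant 3/4.\<close>
    also have "\<dots> = d^2 * (3 / 4 * d^2) + (s - d^2 / 2)^2"
      by (simp add: power2_eq_square algebra_simps)
    finally have "d^2 * (3 / 4 * d^2) \<le> d^2 * soften d s" by simp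
    then show ?thesis by (rule mult_left_le_imp_le) (rule d2)
  next
    case True
    then have "soften d s = s" by (simp add: soften_def)
    then show ?thesis using True d2 by linarith
  qed
  show "s \<ge> d^2 \<Longrightarrow> soften d s = s" "s \<ge> d^2 \<Longrightarrow> soften' d s = 1"
    by (auto simp: soften_def soften'_def)
  show "s \<ge> 0 \<Longrightarrow> \<bar>soften' d s\<bar> \<le> 1" using d2 by (auto simp: soften'_def abs_le_iff field_simps max_def)
  have "((\<lambda>s. (max 0 (d^2 - s))^2) has_real_derivative 2 * max 0 (d^2 - s) * (- 1)) (at s)"
    by (rule DERIV_chain2[OF has_real_derivative_max_0_square]) (auto intro!: derivative_eq_intros)
  from DERIV_add[OF DERIV_ident DERIV_cdivide[OF this, of "d^2"]]
  show "(soften d has_real_derivative soften' d s) (at s)"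
    unfolding soften_def[abs_def] soften'_def by simp
qed

lemma soften_pos: "d > 0 \<Longrightarrow> soften d (y \<bullet> y) > 0"
  by (rule less_le_trans[OF _ soften(2)]) auto

lemma cforce_eq:
  assumes "d > 0" "norm y \<ge> d"
  shows "cforce q d y = (1 / norm y powr (q + 1)) *\<^sub>R y"
proof -
  have "y \<bullet> y \<ge> d^2" using assms by (simp add: power2_norm_eq_inner[symmetric] power_mono)
  then have "soften d (y \<bullet> y) = norm y powr 2"
    using soften(3)[OF assms(1)] assms by (simp add: power2_norm_eq_inner)
  moreover have "2 * (- (q + 1) / 2) = - (q + 1)" by simp
  ultimately show ?thesis
    unfolding cforce_def by (simp only: powr_powr powr_minus_divide)
qed

lemma bounded_linear_cforce_deriv_fun: "bounded_linear (cforce_deriv_fun q d y)"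
  unfolding cforce_deriv_fun_def
  by (intro bounded_linear_add bounded_linear_scaleR_right bounded_linear_compose[OF bounded_linear_scaleR_left]
      bounded_linear_const_mult bounded_linear_inner_right)

lemma cforce_deriv_apply: "blinfun_apply (cforce_deriv q d y) = cforce_deriv_fun q d y"
  unfolding cforce_deriv_def by (rule bounded_linear_Blinfun_apply[OF bounded_linear_cforce_deriv_fun])

lemma planar_force_cforce:
  assumes "q \<ge> 2" "d > 0"
  shows "planar_force (cforce q d) (cforce_deriv q d) (cforce_lip q d)"
proof
  let ?a = "- (q + 1) / 2"
  show "(cforce q d has_derivative blinfun_apply (cforce_deriv q d y)) (at y)" for y
  proof -
    have "((\<lambda>x. x powr ?a) has_real_derivative ?a * soften d (y \<bullet> y) powr (?a - 1)) (at (soften d (y \<bullet> y)))"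
      using soften_pos[OF assms(2)] by (rule has_real_derivative_powr)
    from DERIV_chain2[OF this soften(6)[OF assms(2)]]
    have "((\<lambda>s. soften d s powr ?a) has_real_derivative ?a * soften d (y \<bullet> y) powr (?a - 1) * soften' d (y \<bullet> y)) (at (y \<bullet> y))" .
    then have "((\<lambda>y. soften d (y \<bullet> y) powr ?a) has_derivative
        (\<lambda>k. ?a * soften d (y \<bullet> y) powr (?a - 1) * soften' d (y \<bullet> y) * (y \<bullet> k + k \<bullet> y))) (at y)"
      unfolding has_field_derivative_def
      by (rule has_derivative_compose[OF has_derivative_inner[OF has_derivative_ident has_derivative_ident]])
    from has_derivative_scaleR[OF this has_derivative_ident]
    have "(cforce q d has_derivative (\<lambda>k. soften d (y \<bullet> y) powr ?a *\<^sub>R k +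
        (?a * soften d (y \<bullet> y) powr (?a - 1) * soften' d (y \<bullet> y) * (y \<bullet> k + k \<bullet> y)) *\<^sub>R y)) (at y)"
      by (simp add: cforce_def[abs_def])
    moreover have "(\<lambda>k. soften d (y \<bullet> y) powr ?a *\<^sub>R k +
        (?a * soften d (y \<bullet> y) powr (?a - 1) * soften' d (y \<bullet> y) * (y \<bullet> k + k \<bullet> y)) *\<^sub>R y) = cforce_deriv_fun q d y"
      by (rule ext) (simp add: cforce_deriv_fun_def inner_commute)
    ultimately show ?thesis by (simp add: cforce_deriv_apply)
  qed
  have cs: "continuous_on UNIV (\<lambda>y::real^2. soften d (y \<bullet> y))" "continuous_on UNIV (\<lambda>y::real^2. soften' d (y \<bullet> y))"
    unfolding soften_def soften'_def using assms by (auto intro!: continuous_intros)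
  have cp: "continuous_on UNIV (\<lambda>y::real^2. soften d (y \<bullet> y) powr c)" for c
    by (intro continuous_on_powr cs continuous_on_const) (metis less_irrefl soften_pos[OF assms(2)])
  show "continuous_on UNIV (cforce_deriv q d)"
  proof (rule continuous_on_blinfun_componentwise)
    fix i :: "real^2"
    show "continuous_on UNIV (\<lambda>x. blinfun_apply (cforce_deriv q d x) i)"
      unfolding cforce_deriv_apply cforce_deriv_fun_def
      by (intro continuous_intros cp cs)
  qed
  show "norm (cforce_deriv q d y) \<le> cforce_lip q d" for y
  proof (rule norm_blinfun_bound)
    let ?s = "soften d (y \<bullet> y)"
    have s: "?s > 0" "?s \<ge> 3 / 4 * d^2" "norm y^2 \<le> ?s" "\<bar>soften' d (y \<bullet> y)\<bar> \<le> 1"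
      using soften_pos[OF assms(2)] soften[OF assms(2), of "y \<bullet> y"] by (auto simp: power2_norm_eq_inner)
    have p: "?s powr ?a \<le> (3 / 4 * d^2) powr ?a"
      by (rule powr_mono2') (use assms s in auto)
    show "0 \<le> cforce_lip q d" using assms by (simp add: cforce_lip_def)
    fix k
    have "norm ((- (q + 1) * ?s powr (?a - 1) * soften' d (y \<bullet> y) * (y \<bullet> k)) *\<^sub>R y)
        = (q + 1) * ?s powr (?a - 1) * \<bar>soften' d (y \<bullet> y)\<bar> * \<bar>y \<bullet> k\<bar> * norm y"
      using assms by (simp add: abs_mult)
    also have "\<dots> \<le> (q + 1) * ?s powr (?a - 1) * 1 * (norm y * norm k) * norm y"
      using assms s Cauchy_Schwarz_ineq2[of y k] by (intro mult_mono) auto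
    also have "\<dots> = (q + 1) * ?s powr (?a - 1) * norm y^2 * norm k" by (simp add: power2_eq_square mult_ac)
    \<comment> \<open>Since \<open>soften\<close> is at least the squared norm, it absorbs the two
      factors \<open>norm y\<close> and restores the exponent lost by differentiation.\<close>
    also have "\<dots> \<le> (q + 1) * ?s powr (?a - 1) * ?s * norm k"
      using assms s by (intro mult_right_mono mult_left_mono) auto
    also have "\<dots> = (q + 1) * ?s powr ?a * norm k"
      using s(1) powr_add[of ?s "?a - 1" 1] by simp
    finally have b: "norm ((- (q + 1) * ?s powr (?a - 1) * soften' d (y \<bullet> y) * (y \<bullet> k)) *\<^sub>R y) \<le> (q + 1) * ?s powr ?a * norm k" .
    have "norm (cforce_deriv_fun q d y k) \<le> ?s powr ?a * norm k + (q + 1) * ?s powr ?a * norm k"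
      unfolding cforce_deriv_fun_def by (rule order_trans[OF norm_triangle_ineq]) (use b in simp)
    also have "\<dots> = (q + 2) * ?s powr ?a * norm k" by (simp add: algebra_simps)
    also have "\<dots> \<le> cforce_lip q d * norm k"
      unfolding cforce_lip_def using p assms by (intro mult_right_mono mult_left_mono) auto
    finally show "norm (blinfun_apply (cforce_deriv q d y) k) \<le> cforce_lip q d * norm k"
      by (simp add: cforce_deriv_apply)
  qed
qed

lemma cforce_deriv_eq:
  assumes "d > 0" "norm y \<ge> d"
  shows "cforce_deriv_fun q d y k = (norm y powr (- (q + 1))) *\<^sub>R k - ((q + 1) * norm y powr (- (q + 3)) * (y \<bullet> k)) *\<^sub>R y"
proof -
  have "y \<bullet> y \<ge> d^2" using assms by (simp add: power2_norm_eq_inner[symmetric] power_mono)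
  then have s: "soften d (y \<bullet> y) = norm y powr 2" "soften' d (y \<bullet> y) = 1"
    using soften(3,4)[OF assms(1)] assms by (auto simp: power2_norm_eq_inner)
  have e: "2 * (- (q + 1) / 2) = - (q + 1)" "2 * (- (q + 1) / 2 - 1) = - (q + 3)" by (auto simp: field_simps)
  show ?thesis unfolding cforce_deriv_fun_def s powr_powr e
    by (simp only: mult_minus_left scaleR_minus_left mult_1_right diff_conv_add_uminus)
qed

text \<open>The derivative of the central force multiplies tangential vectors by |y| to the power
  -(q + 1) and radial ones by -q times that, so it is invertible. Controllability of the linearised
  equation rests on this.\<close>

lemma cforce_deriv_inj:
  assumes "d > 0" "norm y \<ge> d" "q \<ge> 2" "cforce_deriv_fun q d y k = 0"
  shows "k = 0"
proof -
  have y: "norm y > 0" using assms by linarith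
  have eq: "(norm y powr (- (q + 1))) *\<^sub>R k = ((q + 1) * norm y powr (- (q + 3)) * (y \<bullet> k)) *\<^sub>R y"
    using assms(4) unfolding cforce_deriv_eq[OF assms(1,2)] by simp
  from arg_cong[OF this, of "inner y"]
  have "norm y powr (- (q + 1)) * (y \<bullet> k) = (q + 1) * (norm y powr (- (q + 3)) * norm y powr 2) * (y \<bullet> k)"
    using y by (simp add: power2_norm_eq_inner mult_ac)
  also have "norm y powr (- (q + 3)) * norm y powr 2 = norm y powr (- (q + 1))"
    unfolding powr_add[symmetric] by (rule arg_cong[where f="\<lambda>c. norm y powr c"]) simp
  finally have "norm y powr (- (q + 1)) * (q * (y \<bullet> k)) = 0" by (simp add: algebra_simps)
  then have "y \<bullet> k = 0" using y assms(3) by simp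
  then show ?thesis using eq y by simp
qed

lemma planar_force_scale:
  assumes "planar_force G DG L" "\<epsilon> > 0"
  shows "planar_force (\<lambda>y. \<epsilon> *\<^sub>R G y) (\<lambda>y. \<epsilon> *\<^sub>R DG y) (\<epsilon> * L)"
proof -
  interpret planar_force G DG L by fact
  show ?thesis
  proof
    show "((\<lambda>y. \<epsilon> *\<^sub>R G y) has_derivative blinfun_apply (\<epsilon> *\<^sub>R DG y)) (at y)" for y
      using has_derivative_scaleR_right[OF G_deriv, of \<epsilon>] by (simp add: scaleR_blinfun.rep_eq)
    show "continuous_on UNIV (\<lambda>y. \<epsilon> *\<^sub>R DG y)" by (intro continuous_intros DG_cont)
    show "norm (\<epsilon> *\<^sub>R DG y) \<le> \<epsilon> * L" for y using DG_bound assms(2) by simp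
  qed
qed

section \<open>A priori bounds and counting of periodic solutions\<close>

text \<open>Kinetic energy plus the potential |x| to the power 1 - q, over q - 1. Both terms are
  nonnegative, so one bound controls the speed and the distance from the origin together. The
  potential is written through \<open>x \<bullet> x\<close> for ease of differentiation.\<close>

definition energy :: "real \<Rightarrow> real^2 \<Rightarrow> real^2 \<Rightarrow> real" where
  "energy q x v = (v \<bullet> v) / 2 + (x \<bullet> x) powr ((1 - q) / 2) / (q - 1)"

lemma has_real_derivative_inner:
  assumes "(u has_vector_derivative u') (at t within S)" "(v has_vector_derivative v') (at t within S)"
  shows "((\<lambda>t. u t \<bullet> v t) has_real_derivative u t \<bullet> v' + u' \<bullet> v t) (at t within S)"
  unfolding has_field_derivative_def
  by (rule has_derivative_eq_rhs[OF has_derivative_inner[OF assms[unfolded has_vector_derivative_def]]])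
     (simp add: fun_eq_iff algebra_simps)

lemma energy_deriv:
  assumes u: "(u has_vector_derivative v t) (at t within S)"
    and v: "(v has_vector_derivative (1 / norm (u t) powr (q + 1)) *\<^sub>R u t + p) (at t within S)"
    and "u t \<noteq> 0" "q > 1"
  shows "((\<lambda>t. energy q (u t) (v t)) has_real_derivative v t \<bullet> p) (at t within S)"
proof -
  let ?x = "u t \<bullet> u t" and ?a = "(1 - q) / 2"
  have x: "?x > 0" using assms(3) by simp
  have "((\<lambda>t. u t \<bullet> u t) has_real_derivative 2 * (u t \<bullet> v t)) (at t within S)"
    using has_real_derivative_inner[OF u u] by (simp add: inner_commute)
  from DERIV_chain2[OF has_real_derivative_powr[OF x, of ?a] this]
  have 1: "((\<lambda>t. (u t \<bullet> u t) powr ?a) has_real_derivative ?a * ?x powr (?a - 1) * (2 * (u t \<bullet> v t))) (at t within S)" .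
  have 2: "((\<lambda>t. v t \<bullet> v t) has_real_derivative 2 * (v t \<bullet> ((1 / norm (u t) powr (q + 1)) *\<^sub>R u t + p))) (at t within S)"
    using has_real_derivative_inner[OF v v] by (simp add: inner_commute)
  have "?x = norm (u t) powr 2" using x by (simp add: power2_norm_eq_inner)
  moreover have "2 * (?a - 1) = - (q + 1)" by simp
  ultimately have "?x powr (?a - 1) = norm (u t) powr (- (q + 1))" by (simp only: powr_powr)
  then have 3: "?x powr (?a - 1) = 1 / norm (u t) powr (q + 1)" by (simp only: powr_minus_divide)
  have "(1 - q) / 2 * N * (2 * c) / (q - 1) = - (N * c)" for N c
    using assms(4) by (simp add: field_simps)
  then have 4: "2 * (v t \<bullet> ((1 / norm (u t) powr (q + 1)) *\<^sub>R u t + p)) / 2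
      + ?a * (1 / norm (u t) powr (q + 1)) * (2 * (u t \<bullet> v t)) / (q - 1) = v t \<bullet> p"
    by (simp only: inner_add_right inner_scaleR_right) (simp add: inner_commute add_divide_distrib)
  show ?thesis
    using DERIV_add[OF DERIV_cdivide[OF 2, of 2] DERIV_cdivide[OF 1, of "q - 1"]]
    unfolding energy_def 3 4 .
qed


lemma energy_bounds:
  assumes "q > 1"
  shows "(v \<bullet> v) / 2 \<le> energy q x v" "(x \<bullet> x) powr ((1 - q) / 2) / (q - 1) \<le> energy q x v" "0 \<le> energy q x v"
  using assms by (auto simp: energy_def intro!: add_nonneg_nonneg)

lemma energy_continuous:
  assumes "continuous_on S u" "continuous_on S v" "\<And>t. t \<in> S \<Longrightarrow> u t \<noteq> 0" "q > 1"
  shows "continuous_on S (\<lambda>t. energy q (u t) (v t))"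
  unfolding energy_def using assms by (intro continuous_intros) auto

lemma increment_bound:
  fixes f :: "real \<Rightarrow> 'a::euclidean_space"
  assumes der: "\<And>t. t \<in> {0..1} \<Longrightarrow> (f has_vector_derivative f' t) (at t within {0..1})"
    and cont: "continuous_on {0..1} f'" and st: "s \<in> {0..1}" "t \<in> {0..1}"
  shows "norm (f t - f s) \<le> integral {0..1} (\<lambda>t. norm (f' t))"
proof -
  have *: "norm (f t - f s) \<le> integral {0..1} (\<lambda>t. norm (f' t))" if "s \<le> t" "s \<in> {0..1}" "t \<in> {0..1}" for s t
  proof -
    have sub: "{s..t} \<subseteq> {0..1}" using that by auto
    have int: "(\<lambda>t. norm (f' t)) integrable_on {s..t}" "(\<lambda>t. norm (f' t)) integrable_on {0..1}" "f' integrable_on {s..t}"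
      by (intro integrable_continuous_real continuous_on_norm continuous_on_subset[OF cont sub] cont)+
    have "(f' has_integral f t - f s) {s..t}"
      by (rule fundamental_theorem_of_calculus[OF that(1)])
        (rule has_vector_derivative_within_subset[OF der sub], use sub in auto)
    then have "norm (f t - f s) = norm (integral {s..t} f')" by (simp add: integral_unique)
    also have "\<dots> \<le> integral {s..t} (\<lambda>t. norm (f' t))" by (rule integral_norm_bound_integral[OF int(3,1)]) simp
    also have "\<dots> \<le> integral {0..1} (\<lambda>t. norm (f' t))" by (rule integral_subset_le[OF sub int(1,2)]) simp
    finally show ?thesis .
  qed
  show ?thesis using *[of s t] *[of t s] st by (cases "s \<le> t") (auto simp: norm_minus_commute)
qed

text \<open>The virial identity bounds the total variation \<open>m\<close> of \<open>u\<close> by a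
  function of \<open>P\<close> alone. If \<open>norm (u 0)\<close> exceeded \<open>m\<close>, the
  repulsive force would always point into the half-plane of \<open>u 0\<close>, although its mean
  over a period is zero. The energy is at most its virial bound at its minimum and varies by at most
  \<open>P * m\<close>.\<close>

lemma apriori:
  fixes u v p :: "real \<Rightarrow> real^2"
  assumes q: "q \<ge> 2"
    and u: "\<And>t. t \<in> {0..1} \<Longrightarrow> (u has_vector_derivative v t) (at t within {0..1})"
    and v: "\<And>t. t \<in> {0..1} \<Longrightarrow> (v has_vector_derivative (1 / norm (u t) powr (q + 1)) *\<^sub>R u t + p t) (at t within {0..1})"
    and nz: "\<And>t. t \<in> {0..1} \<Longrightarrow> u t \<noteq> 0"
    and per: "u 0 = u 1" "v 0 = v 1"
    and p: "continuous_on {0..1} p" "\<And>t. t \<in> {0..1} \<Longrightarrow> norm (p t) \<le> P" "integral {0..1} p = 0"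
  shows "norm (u 0) \<le> 1 / 2 + P^2 / 2"
    and "t \<in> {0..1} \<Longrightarrow> energy q (u t) (v t) \<le> P^2 / 2 + P * (1 / 2 + P^2 / 2)"
proof -
  let ?g = "\<lambda>t. (1 / norm (u t) powr (q + 1)) *\<^sub>R u t" and ?W = "\<lambda>t. (u t \<bullet> u t) powr ((1 - q) / 2)"
  have P0: "P \<ge> 0" using order_trans[OF norm_ge_zero p(2)[of 0]] by simp
  have cu: "continuous_on {0..1} u" by (rule continuous_on_vector_derivative[OF u])
  have cv: "continuous_on {0..1} v" by (rule continuous_on_vector_derivative[OF v])
  have cg: "continuous_on {0..1} ?g" using nz by (intro continuous_intros cu) auto
  have cW: "continuous_on {0..1} ?W" using nz by (intro continuous_intros cu) auto
  note int = integrable_continuous_real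
  define m where "m = integral {0..1} (\<lambda>t. norm (v t))"
  have um: "norm (u t - u s) \<le> m" if "s \<in> {0..1}" "t \<in> {0..1}" for s t
    unfolding m_def by (rule increment_bound[OF u cv that])
  have ug: "u t \<bullet> ?g t = ?W t" if "t \<in> {0..1}" for t
  proof -
    have n: "norm (u t) > 0" using nz[OF that] by simp
    have "?W t = (norm (u t) powr 2) powr ((1 - q) / 2)" using n by (simp add: power2_norm_eq_inner)
    also have "\<dots> = norm (u t) powr (2 - (q + 1))"
      unfolding powr_powr by (rule arg_cong[where f="\<lambda>c. norm (u t) powr c"]) (simp add: field_simps)
    also have "\<dots> = norm (u t) powr 2 / norm (u t) powr (q + 1)" by (rule powr_diff)
    also have "\<dots> = u t \<bullet> ?g t" using n by (simp add: power2_norm_eq_inner)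
    finally show ?thesis by simp
  qed
  have "((\<lambda>t. v t \<bullet> v t + ?W t + u t \<bullet> p t) has_integral u 1 \<bullet> v 1 - u 0 \<bullet> v 0) {0..1}"
  proof (rule fundamental_theorem_of_calculus)
    fix t :: real assume t: "t \<in> {0..1}"
    have "((\<lambda>t. u t \<bullet> v t) has_vector_derivative u t \<bullet> (?g t + p t) + v t \<bullet> v t) (at t within {0..1})"
      using has_real_derivative_inner[OF u[OF t] v[OF t]]
      by (simp add: has_real_derivative_iff_has_vector_derivative)
    then show "((\<lambda>t. u t \<bullet> v t) has_vector_derivative v t \<bullet> v t + ?W t + u t \<bullet> p t) (at t within {0..1})"
      unfolding inner_add_right ug[OF t] by (simp add: algebra_simps)
  qed simp
  \<comment> \<open>Integrating the derivative of u \<bullet> v over a period gives zero; the term u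
    \<bullet> G is exactly \<open>?W\<close>.\<close>
  then have virial: "integral {0..1} (\<lambda>t. v t \<bullet> v t + ?W t + u t \<bullet> p t) = 0"
    using per by (simp add: integral_unique)
  have "((\<lambda>t. u 0 \<bullet> p t) has_integral u 0 \<bullet> integral {0..1} p) {0..1}"
    using has_integral_linear[OF integrable_integral[OF int[OF p(1)]] bounded_linear_inner_right[of "u 0"]] by (simp add: o_def)
  then have u0p: "integral {0..1} (\<lambda>t. u 0 \<bullet> p t) = 0" using p(3) by (simp add: integral_unique)
  have i1: "(\<lambda>t. v t \<bullet> v t + ?W t) integrable_on {0..1}" by (intro int continuous_intros cv cW)
  have i2: "(\<lambda>t. u t \<bullet> p t) integrable_on {0..1}" by (intro int continuous_intros cu p(1))
  have i3: "(\<lambda>t. u 0 \<bullet> p t) integrable_on {0..1}" by (intro int continuous_intros p(1))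
  have i4: "(\<lambda>t. (v t \<bullet> v t) / 2 + ?W t) integrable_on {0..1}" by (intro int continuous_intros cv cW) auto
  have i5: "(\<lambda>t. P * norm (v t)) integrable_on {0..1}" by (intro int continuous_intros cv)
  have "integral {0..1} (\<lambda>t. v t \<bullet> v t + ?W t) = - integral {0..1} (\<lambda>t. u t \<bullet> p t)"
    using virial integral_add[OF i1 i2] by simp
  \<comment> \<open>The zero mean of \<open>p\<close> allows \<open>u t\<close> to be replaced by
    \<open>u t - u 0\<close>, which is bounded by \<open>m\<close> wherever the orbit lies.\<close>
  also have "\<dots> = - integral {0..1} (\<lambda>t. (u t - u 0) \<bullet> p t)"
    using integral_diff[OF i2 i3] u0p by (simp add: inner_diff_left)
  also have "\<dots> \<le> norm (integral {0..1} (\<lambda>t. (u t - u 0) \<bullet> p t))" by simp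
  also have "\<dots> \<le> integral {0..1} (\<lambda>t::real. m * P)"
  proof (rule integral_norm_bound_integral)
    show "(\<lambda>t. (u t - u 0) \<bullet> p t) integrable_on {0..1}" by (intro int continuous_intros cu p(1))
    show "norm ((u t - u 0) \<bullet> p t) \<le> m * P" if "t \<in> {0..1}" for t
      using order_trans[OF Cauchy_Schwarz_ineq2[of "u t - u 0" "p t"]
          mult_mono[OF um[of 0 t] p(2)[OF that]]] that order_trans[OF norm_ge_zero um[of 0 t]] by simp
  qed (rule integrable_const_ivl)
  also have "\<dots> = integral {0..1} (\<lambda>t. P * norm (v t))" by (simp add: m_def)
  finally have I1: "integral {0..1} (\<lambda>t. v t \<bullet> v t + ?W t) \<le> integral {0..1} (\<lambda>t. P * norm (v t))" .
  \<comment> \<open>Young's inequality, so that half of the kinetic term survives on the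
    left.\<close>
  have pw: "v t \<bullet> v t + ?W t - P * norm (v t) \<ge> (v t \<bullet> v t) / 2 + ?W t - P^2 / 2" for t
    using zero_le_power2[of "norm (v t) - P"] by (simp add: power2_diff power2_norm_eq_inner field_simps)
  have "integral {0..1} (\<lambda>t. ((v t \<bullet> v t) / 2 + ?W t) - P^2 / 2) \<le> integral {0..1} (\<lambda>t. (v t \<bullet> v t + ?W t) - P * norm (v t))"
    by (rule integral_le[OF integrable_diff[OF i4 integrable_const_ivl] integrable_diff[OF i1 i5]]) (use pw in auto)
  then have I2: "integral {0..1} (\<lambda>t. (v t \<bullet> v t) / 2 + ?W t) \<le> P^2 / 2"
    using I1 integral_diff[OF i1 i5] integral_diff[OF i4 integrable_const_ivl, of "P^2 / 2"] by simp
  have "m \<le> integral {0..1} (\<lambda>t. 1 / 2 + ((v t \<bullet> v t) / 2 + ?W t))"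
    unfolding m_def
  proof (rule integral_le)
    show "(\<lambda>t. norm (v t)) integrable_on {0..1}" by (intro int continuous_intros cv)
    show "(\<lambda>t. 1 / 2 + ((v t \<bullet> v t) / 2 + ?W t)) integrable_on {0..1}" by (intro integrable_add i4 integrable_const_ivl)
    show "norm (v t) \<le> 1 / 2 + ((v t \<bullet> v t) / 2 + ?W t)" for t
    proof -
      have "0 \<le> (norm (v t) - 1)^2" by simp
      then have "norm (v t) \<le> 1 / 2 + (v t \<bullet> v t) / 2" by (simp add: power2_diff power2_norm_eq_inner)
      moreover have "?W t \<ge> 0" by simp
      ultimately show ?thesis by linarith
    qed
  qed
  also have "\<dots> \<le> 1 / 2 + P^2 / 2" using I2 integral_add[OF integrable_const_ivl i4, of "1 / 2"] by simp
  finally have m: "m \<le> 1 / 2 + P^2 / 2" .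
  show "norm (u 0) \<le> 1 / 2 + P^2 / 2"
  proof (rule ccontr)
    assume "\<not> norm (u 0) \<le> 1 / 2 + P\<^sup>2 / 2"
    then have big: "norm (u 0) > m" using m by simp
    have "((\<lambda>t. ?g t + p t) has_integral v 1 - v 0) {0..1}"
      by (rule fundamental_theorem_of_calculus) (use v in auto)
    then have "integral {0..1} (\<lambda>t. ?g t + p t) = 0" using per by (simp add: integral_unique)
    then have "integral {0..1} ?g = 0" using integral_add[OF int[OF cg] int[OF p(1)]] p(3) by simp
    then have 0: "((\<lambda>t. u 0 \<bullet> ?g t) has_integral 0) {0..1}"
      using has_integral_linear[OF integrable_integral[OF int[OF cg]] bounded_linear_inner_right[of "u 0"]] by (simp add: o_def)
    have pos: "u 0 \<bullet> ?g t > 0" if "t \<in> {0..1}" for t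
    proof -
      have "\<bar>u 0 \<bullet> (u t - u 0)\<bar> \<le> norm (u 0) * m"
        by (rule order_trans[OF Cauchy_Schwarz_ineq2 mult_left_mono[OF um]]) (use that in auto)
      moreover have "norm (u 0) * m < norm (u 0) * norm (u 0)"
        using big order_trans[OF norm_ge_zero um[of 0 0]] by (intro mult_strict_left_mono) auto
      moreover have "u 0 \<bullet> u t = norm (u 0) * norm (u 0) + u 0 \<bullet> (u t - u 0)"
        by (simp add: inner_diff_right power2_norm_eq_inner[symmetric] power2_eq_square)
      ultimately have "u 0 \<bullet> u t > 0" by linarith
      then show ?thesis using nz[OF that] by simp
    qed
    have c: "continuous_on (cbox 0 1) (\<lambda>t. u 0 \<bullet> ?g t)" unfolding cbox_interval by (intro continuous_on_inner continuous_on_const cg)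
    have "u 0 \<bullet> ?g 0 = 0"
      by (rule has_integral_0_cbox_imp_0[OF c]) (use 0 pos in \<open>auto intro: less_imp_le\<close>)
    then show False using pos[of 0] by simp
  qed
  let ?E = "\<lambda>t. energy q (u t) (v t)"
  \<comment> \<open>At a minimum over time the energy is below its mean, and the mean is below the
    virial integral because q - 1 \<ge> 1.\<close>
  have cE: "continuous_on {0..1} ?E" using q nz by (intro energy_continuous cu cv) auto
  obtain t0 where t0: "t0 \<in> {0..1}" "\<And>t. t \<in> {0..1} \<Longrightarrow> ?E t0 \<le> ?E t"
    using continuous_attains_inf[OF _ _ cE] by auto
  have "?E t0 = integral {0..1} (\<lambda>t::real. ?E t0)" by simp
  also have "\<dots> \<le> integral {0..1} (\<lambda>t. (v t \<bullet> v t) / 2 + ?W t)"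
  proof (rule integral_le[OF _ i4])
    fix t :: real assume "t \<in> {0..1}"
    then have "?E t0 \<le> ?E t" by (rule t0)
    also have "\<dots> \<le> (v t \<bullet> v t) / 2 + ?W t"
    proof -
      have "?W t / (q - 1) \<le> ?W t / 1" using q by (intro divide_left_mono) auto
      then show ?thesis by (simp add: energy_def)
    qed
    finally show "?E t0 \<le> (v t \<bullet> v t) / 2 + ?W t" .
  qed (rule integrable_const_ivl)
  finally have Et0: "?E t0 \<le> P^2 / 2" using I2 by simp
  show "energy q (u t) (v t) \<le> P^2 / 2 + P * (1 / 2 + P^2 / 2)" if t: "t \<in> {0..1}"
  proof -
    have "norm (?E t - ?E t0) \<le> integral {0..1} (\<lambda>t. norm (v t \<bullet> p t))"
    proof (rule increment_bound[OF _ _ t0(1) t])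
      show "(?E has_vector_derivative v t \<bullet> p t) (at t within {0..1})" if "t \<in> {0..1}" for t
        unfolding has_real_derivative_iff_has_vector_derivative[symmetric]
        by (rule energy_deriv[OF u[OF that] v[OF that] nz[OF that]]) (use q in simp)
      show "continuous_on {0..1} (\<lambda>t. v t \<bullet> p t)" by (intro continuous_intros cv p(1))
    qed
    also have "\<dots> \<le> integral {0..1} (\<lambda>t. P * norm (v t))"
    proof (rule integral_le[OF _ i5])
      show "(\<lambda>t. norm (v t \<bullet> p t)) integrable_on {0..1}" by (intro int continuous_intros cv p(1))
      show "norm (v t \<bullet> p t) \<le> P * norm (v t)" if "t \<in> {0..1}" for t
        using order_trans[OF Cauchy_Schwarz_ineq2[of "v t" "p t"] mult_left_mono[OF p(2)[OF that] norm_ge_zero]]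
        by (simp add: mult.commute)
    qed
    also have "\<dots> = P * m" by (simp add: m_def)
    also have "\<dots> \<le> P * (1 / 2 + P^2 / 2)" using m P0 by (rule mult_left_mono)
    finally show ?thesis using Et0 by simp
  qed
qed

section \<open>Periodic orbits as zeros of the truncated shooting map\<close>

abbreviation "cflow q d \<equiv> planar_force.flow (cforce q d)"
abbreviation "cvflow q d \<equiv> planar_force.vflow (cforce q d)"
abbreviation "cshoot q d \<equiv> planar_force.shoot (cforce q d)"
abbreviation "cdflow q d \<equiv> planar_force.dflow (cforce q d) (cforce_deriv q d)"

text \<open>The clearance of the orbit equals the truncation radius, so the orbit never meets the
  altered part of the force and solves the singular equation.\<close>

definition periodic_data :: "real \<Rightarrow> (real \<Rightarrow>\<^sub>C (real^2)) \<Rightarrow> real \<Rightarrow> real^4 \<Rightarrow> bool" where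
  "periodic_data q p d z \<longleftrightarrow> (\<forall>t. norm (cflow q d z p t) \<ge> d) \<and> cshoot q d z p = 0"

definition shoot_jac :: "real \<Rightarrow> (real \<Rightarrow>\<^sub>C (real^2)) \<Rightarrow> real \<Rightarrow> real^4 \<Rightarrow> real" where
  "shoot_jac q p d z = jac (\<lambda>k. lin_shoot (cdflow q d z p) k 0)"

text \<open>An orbit staying outside the larger disc solves the equation for both truncations, hence
  is the orbit of both. Orbits found with different radii can thus be compared at the smaller
  one.\<close>

lemma cflow_antimono:
  assumes "q \<ge> 2" "0 < d'" "d' \<le> d" "\<And>t. norm (cflow q d z p t) \<ge> d"
  shows "cflow q d' z p = cflow q d z p" "cvflow q d' z p = cvflow q d z p"
    "cshoot q d' z p = cshoot q d z p" "cdflow q d' z p = cdflow q d z p"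
proof -
  interpret A: planar_force "cforce q d" "cforce_deriv q d" "cforce_lip q d"
    by (rule planar_force_cforce) (use assms in auto)
  interpret B: planar_force "cforce q d'" "cforce_deriv q d'" "cforce_lip q d'"
    by (rule planar_force_cforce) (use assms in auto)
  have n: "norm (A.flow z p t) \<ge> d'" for t using assms(3,4) order_trans by blast
  have "B.force_along (A.flow z p) = A.force_along (A.flow z p)"
  proof (rule bcontfun_eqI)
    fix t
    show "B.force_along (A.flow z p) t = A.force_along (A.flow z p) t"
      unfolding A.force_along_apply B.force_along_apply
      using cforce_eq[OF _ n[of t], of q] cforce_eq[OF _ assms(4)[of t], of q] assms(2,3) by simp
  qed
  then have v: "A.vflow z p = const_bcontfun (vel z) + primitive (B.force_along (A.flow z p) + p)"
    by (simp add: A.vflow_def)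
  show 1: "B.flow z p = A.flow z p" "B.vflow z p = A.vflow z p"
    using B.flow_unique[OF A.flow_eq v] by auto
  show "B.shoot z p = A.shoot z p" by (simp add: A.shoot_def B.shoot_def 1)
  show "B.dflow z p = A.dflow z p"
  proof (rule bcontfun_eqI, rule blinfun_eqI)
    fix t k
    show "blinfun_apply (B.dflow z p t) k = blinfun_apply (A.dflow z p t) k"
      unfolding A.dflow_def B.dflow_def A.dforce_along_apply B.dforce_along_apply 1 cforce_deriv_apply
      using cforce_deriv_eq[OF _ n[of t], of q] cforce_deriv_eq[OF _ assms(4)[of t], of q] assms(2,3) by simp
  qed
qed

lemma periodic_data_antimono:
  assumes "q \<ge> 2" "0 < d'" "d' \<le> d" "periodic_data q p d z"
  shows "periodic_data q p d' z" "shoot_jac q p d' z = shoot_jac q p d z"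
proof -
  have n: "norm (cflow q d z p t) \<ge> d" for t using assms(4) by (simp add: periodic_data_def)
  note eq = cflow_antimono[OF assms(1-3) n]
  show "shoot_jac q p d' z = shoot_jac q p d z" unfolding shoot_jac_def eq ..
  show "periodic_data q p d' z"
    using assms(3,4) unfolding periodic_data_def eq by (auto intro: order_trans)
qed

lemma periodic_data_ode:
  assumes "q \<ge> 2" "0 < d" "periodic_data q p d z" "t \<in> {0..1}"
  shows "(cflow q d z p has_vector_derivative cvflow q d z p t) (at t within {0..1})"
    and "(cvflow q d z p has_vector_derivative (1 / norm (cflow q d z p t) powr (q + 1)) *\<^sub>R cflow q d z p t + p t) (at t within {0..1})"
    and "cflow q d z p t \<noteq> 0"
    and "cflow q d z p 0 = pos z" "cflow q d z p 1 = pos z" "cvflow q d z p 0 = vel z" "cvflow q d z p 1 = vel z"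
proof -
  interpret A: planar_force "cforce q d" "cforce_deriv q d" "cforce_lip q d"
    by (rule planar_force_cforce) (use assms in auto)
  have n: "norm (A.flow z p t) \<ge> d" using assms(3) by (simp add: periodic_data_def)
  show "(A.flow z p has_vector_derivative A.vflow z p t) (at t within {0..1})" by (rule A.flow_deriv[OF assms(4)])
  show "(A.vflow z p has_vector_derivative (1 / norm (A.flow z p t) powr (q + 1)) *\<^sub>R A.flow z p t + p t) (at t within {0..1})"
    using A.flow_deriv(2)[OF assms(4), of z p] unfolding cforce_eq[OF assms(2) n] .
  show "A.flow z p t \<noteq> 0" using n assms(2) by auto
  show 0: "A.flow z p 0 = pos z" "A.vflow z p 0 = vel z" by (rule A.flow_deriv[OF assms(4)])+
  show "A.flow z p 1 = pos z" "A.vflow z p 1 = vel z"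
    using assms(3) by (auto simp: periodic_data_def A.shoot_def pack_eq_0_iff)
qed

lemma periodic_data_apriori:
  assumes "q \<ge> 2" "0 < d" "periodic_data q p d z" "norm p \<le> P" "integral {0..1} p = 0"
  shows "norm (pos z) \<le> 1 / 2 + P^2 / 2" "energy q (pos z) (vel z) \<le> P^2 / 2 + P * (1 / 2 + P^2 / 2)" "pos z \<noteq> 0"
proof -
  note o = periodic_data_ode[OF assms(1-3)]
  have nz: "cflow q d z p t \<noteq> 0" if "t \<in> {0..1}" for t using o(3)[OF that] .
  have pp: "norm (p t) \<le> P" for t using norm_bounded[of p t] assms(4) by simp
  have i: "continuous_on {0..1} p" by auto
  have z: "(0::real) \<in> {0..1}" by simp
  have per: "cflow q d z p 0 = cflow q d z p 1" "cvflow q d z p 0 = cvflow q d z p 1"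
    unfolding o(4-7)[OF z] by auto
  show "norm (pos z) \<le> 1 / 2 + P^2 / 2"
    using apriori(1)[OF assms(1) o(1,2) nz per i pp assms(5)] unfolding o(4)[OF z] .
  show "energy q (pos z) (vel z) \<le> P^2 / 2 + P * (1 / 2 + P^2 / 2)"
    using apriori(2)[OF assms(1) o(1,2) nz per i pp assms(5) z] unfolding o(4,6)[OF z] .
  show "pos z \<noteq> 0" using nz[OF z] unfolding o(4)[OF z] .
qed

text \<open>First exit argument: until the orbit reaches the circle of radius \<open>d\<close> the truncated force is the
  true one, and the energy bound keeps it strictly outside.\<close>

lemma orbit_away:
  assumes q: "q \<ge> 2" and d: "0 < d" and z: "pos z \<noteq> 0" "energy q (pos z) (vel z) \<le> C" and p: "norm p \<le> P"
    and dC: "(C + 1) * exp P < (d^2) powr ((1 - q) / 2) / (q - 1)"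
  shows "norm (cflow q d z p t) > d"
proof -
  interpret A: planar_force "cforce q d" "cforce_deriv q d" "cforce_lip q d"
    by (rule planar_force_cforce) (use assms in auto)
  let ?u = "A.flow z p" and ?v = "A.vflow z p"
  have P0: "P \<ge> 0" using order_trans[OF norm_ge_zero p] .
  \<comment> \<open>Inside the disc the potential term alone would exceed the energy allowed by
    \<open>dC\<close>.\<close>
  have far: "norm x > d" if "x \<noteq> 0" "energy q x v + 1 \<le> (C + 1) * exp P" for x v
  proof (rule ccontr)
    assume "\<not> norm x > d"
    then have "norm x ^ 2 \<le> d^2" by (intro power_mono) auto
    then have "x \<bullet> x \<le> d^2" by (simp add: power2_norm_eq_inner)
    then have "(d^2) powr ((1 - q) / 2) \<le> (x \<bullet> x) powr ((1 - q) / 2)"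
      by (intro powr_mono2') (use q that in auto)
    then have "(d^2) powr ((1 - q) / 2) / (q - 1) \<le> (x \<bullet> x) powr ((1 - q) / 2) / (q - 1)"
      using q by (intro divide_right_mono) auto
    also have "\<dots> \<le> energy q x v" by (rule energy_bounds) (use q in simp)
    finally show False using that(2) dC by linarith
  qed
  have C0: "C + 1 > 0" using energy_bounds(3)[of q "pos z" "vel z"] z(2) q by simp
  have "(C + 1) * 1 \<le> (C + 1) * exp P" using C0 P0 by (intro mult_left_mono) auto
  then have start: "norm (pos z) > d" using far[OF z(1), of "vel z"] z(2) by simp
  have ode: "(?u has_vector_derivative ?v t) (at t within {0..1})" "(?v has_vector_derivative cforce q d (?u t) + p t) (at t within {0..1})"
    "?u 0 = pos z" "?v 0 = vel z" if "t \<in> {0..1}" for t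
    using A.flow_deriv[OF that] by auto
  have main: "norm (?u t) > d" if "t \<in> {0..1}" for t
  proof (rule ccontr)
    assume neg: "\<not> norm (?u t) > d"
    define T where "T = {0..1} \<inter> {t. norm (?u t) \<le> d}"
    have T: "t \<in> T" "compact T" unfolding T_def
      using that neg by (auto intro!: compact_Int_closed closed_Collect_le continuous_intros)
    obtain b where b: "b \<in> T" "\<And>s. s \<in> T \<Longrightarrow> b \<le> s"
      using compact_attains_inf[OF T(2)] T(1) by auto
    have b01: "b \<in> {0..1}" and bd: "norm (?u b) \<le> d" using b(1) by (auto simp: T_def)
    have "b \<noteq> 0" using bd start ode(3)[of 0] by auto
    then have b0: "b > 0" using b01 by simp
    have out: "norm (?u s) > d" if "0 \<le> s" "s < b" for s
    proof (rule ccontr)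
      assume "\<not> norm (?u s) > d"
      then have "s \<in> T" using that b01 by (simp add: T_def)
      then show False using b(2)[of s] that by simp
    qed
    have "norm (?u b) \<ge> d"
    proof (rule tendsto_lowerbound)
      show "((\<lambda>s. norm (?u s)) \<longlongrightarrow> norm (?u b)) (at_left b)"
        using continuous_on_apply_bcontfun[of UNIV ?u]
        by (intro tendsto_norm) (auto simp: continuous_on_def intro: tendsto_within_subset)
      show "\<forall>\<^sub>F s in at_left b. d \<le> norm (?u s)"
        unfolding eventually_at_left[OF b0] using out b0 by (intro exI[of _ 0]) (auto intro: less_imp_le)
    qed simp
    then have outb: "norm (?u s) \<ge> d" if "s \<in> {0..b}" for s
      using out[of s] that by (cases "s = b") auto
    \<comment> \<open>Gronwall for energy + 1: the 1 is added because \<open>norm v\<close> \<le>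
      energy + 1, which bounds the derivative v \<bullet> p by P (energy + 1).\<close>
    define E where "E s = (energy q (?u s) (?v s) + 1) * exp (- P * s)" for s
    have "E b \<le> E 0"
    proof (rule DERIV_nonpos_imp_decreasing_open[where f=E and a=0 and b=b])
      show "0 \<le> b" using b0 by simp
      have "continuous_on {0..b} (\<lambda>s. energy q (?u s) (?v s))"
        using outb d q by (intro energy_continuous) (auto, fastforce)
      then show "continuous_on {0..b} E" unfolding E_def by (intro continuous_intros)
      fix s assume s: "0 < s" "s < b"
      then have s01: "s \<in> {0<..<1}" using b01 by auto
      have at: "at s within {0..1} = at s" using s01 by (simp add: at_within_Icc_at)
      have nu: "norm (?u s) \<ge> d" "?u s \<noteq> 0" using outb[of s] s d by auto
      have "((\<lambda>s. energy q (?u s) (?v s)) has_real_derivative ?v s \<bullet> p s) (at s within {0..1})"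
        by (rule energy_deriv) (use ode(1,2)[of s] s01 nu q cforce_eq[OF d nu(1), of q] in auto)
      then have "((\<lambda>s. energy q (?u s) (?v s)) has_real_derivative ?v s \<bullet> p s) (at s)" unfolding at .
      then have "(E has_real_derivative (?v s \<bullet> p s) * exp (- P * s) + exp (- P * s) * (- P) * (energy q (?u s) (?v s) + 1)) (at s)"
        unfolding E_def[abs_def] by (auto intro!: derivative_eq_intros)
      moreover have "(?v s \<bullet> p s) * exp (- P * s) + exp (- P * s) * (- P) * (energy q (?u s) (?v s) + 1) \<le> 0"
      proof -
        have "?v s \<bullet> p s \<le> norm (?v s) * norm (p s)" by (rule norm_cauchy_schwarz)
        also have "\<dots> \<le> norm (?v s) * P" using norm_bounded[of p s] p by (intro mult_left_mono) auto
        also have "norm (?v s) \<le> energy q (?u s) (?v s) + 1"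
        proof -
          have "0 \<le> (norm (?v s) - 1)^2" by simp
          then have "norm (?v s) \<le> 1 / 2 + (?v s \<bullet> ?v s) / 2" by (simp add: power2_diff power2_norm_eq_inner)
          then show ?thesis using energy_bounds(1)[of q "?v s" "?u s"] q by simp
        qed
        finally have "?v s \<bullet> p s \<le> (energy q (?u s) (?v s) + 1) * P" using P0 by (simp add: mult_right_mono)
        then have "exp (- P * s) * (?v s \<bullet> p s) \<le> exp (- P * s) * ((energy q (?u s) (?v s) + 1) * P)"
          by (intro mult_left_mono) auto
        then show ?thesis by (simp add: algebra_simps)
      qed
      ultimately show "\<exists>y. (E has_real_derivative y) (at s) \<and> y \<le> 0" by blast
    qed
    then have "(energy q (?u b) (?v b) + 1) * exp (- P * b) \<le> C + 1"
      using z(2) ode(3,4)[of 0] by (simp add: E_def)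
    then have "(energy q (?u b) (?v b) + 1) * exp (- P * b) * exp (P * b) \<le> (C + 1) * exp (P * b)"
      by (intro mult_right_mono) auto
    then have "energy q (?u b) (?v b) + 1 \<le> (C + 1) * exp (P * b)" unfolding mult.assoc exp_cancel by simp
    also have "\<dots> \<le> (C + 1) * exp P"
      using C0 P0 b01 by (intro mult_left_mono) (auto simp: mult_left_le)
    finally have e: "energy q (?u b) (?v b) + 1 \<le> (C + 1) * exp P" .
    have "?u b \<noteq> 0" using \<open>norm (?u b) \<ge> d\<close> d by auto
    then have "norm (?u b) > d" using e by (rule far)
    then show False using bd by simp
  qed
  show ?thesis using main[OF clamp01(1)[of t]] by (simp add: A.flow_clamp01)
qed

text \<open>At radius 1/N the potential without the factor 1/(q - 1) equals
  \<open>N powr (q - 1)\<close>, at least N as q \<ge> 2. A single N serves both as inverse radius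
  and as bound for the states, matching the form of the generic conditions.\<close>

lemma large_nat_bounds:
  assumes "q \<ge> 2"
  obtains n where "c \<le> real (Suc n)" "c < ((1 / real (Suc n))^2) powr ((1 - q) / 2) / (q - 1)"
proof -
  obtain n where n: "max c ((q - 1) * c) < real n" using reals_Archimedean2 by blast
  let ?N = "real (Suc n)"
  have N: "?N \<ge> 1" "c \<le> ?N" "(q - 1) * c < ?N" using n by auto
  have "((1 / ?N)^2) = ?N powr (- 2)" by (simp add: powr_minus_divide power_one_over)
  then have "((1 / ?N)^2) powr ((1 - q) / 2) = ?N powr (- 2 * ((1 - q) / 2))" by (simp only: powr_powr)
  also have "\<dots> = ?N powr (q - 1)" by (rule arg_cong[where f="\<lambda>c. ?N powr c"]) simp
  finally have e: "((1 / ?N)^2) powr ((1 - q) / 2) = ?N powr (q - 1)" .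
  have "?N powr 1 \<le> ?N powr (q - 1)" using N assms by (intro powr_mono) auto
  then have "(q - 1) * c < ?N powr (q - 1)" using N by simp
  then have "c < ?N powr (q - 1) / (q - 1)" using assms by (simp add: field_simps)
  then show thesis using that[of n] N(2) unfolding e by blast
qed

text \<open>\<open>D\<close> is cut out by the a priori inequalities with a margin, so that zeros
  along the whole homotopy \<open>s *\<^sub>R p\<close> avoid its frontier. All states in
  \<open>K\<close> are zeros with positive determinant; the balance yields at least as many with
  negative determinant, disjoint from the former.\<close>

lemma periodic_count:
  fixes p :: "real \<Rightarrow>\<^sub>C (real^2)"
  assumes q: "q \<ge> 2" and p: "integral {0..1} p = 0"
    and nondeg: "\<And>n z. norm z \<le> real (Suc n) \<Longrightarrow> periodic_data q p (1 / real (Suc n)) z \<Longrightarrow> shoot_jac q p (1 / real (Suc n)) z \<noteq> 0"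
    and K: "\<And>z. z \<in> K \<Longrightarrow> \<exists>d>0. periodic_data q p d z \<and> shoot_jac q p d z > 0"
  shows "\<exists>Z d. finite Z \<and> card Z = 2 * card K \<and> d > 0 \<and> (\<forall>z\<in>Z. periodic_data q p d z)"
proof -
  define P where "P = norm p"
  define M where "M = 1 / 2 + P^2 / 2"
  \<comment> \<open>The added 1, like the one in \<open>M + 1\<close> below, turns the a priori
    bounds into strict inequalities.\<close>
  define C where "C = P^2 / 2 + P * M + 1"
  have P0: "P \<ge> 0" by (simp add: P_def)
  have M0: "M > 0" by (simp add: M_def add_pos_nonneg)
  have q1: "q > 1" using q by simp
  \<comment> \<open>The first bound keeps orbits starting in the closure of \<open>D\<close> outside
    the disc of radius 1 / (n + 1); the second makes n + 1 a bound for the norms of all states in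
    \<open>D\<close>.\<close>
  obtain n where n: "max ((C + 1) * exp P) (M + 2 + C) \<le> real (Suc n)"
    "max ((C + 1) * exp P) (M + 2 + C) < ((1 / real (Suc n))^2) powr ((1 - q) / 2) / (q - 1)"
    using large_nat_bounds[OF q] by blast
  define d where "d = 1 / real (Suc n)"
  have d: "d > 0" by (simp add: d_def)
  have dC: "(C + 1) * exp P < (d^2) powr ((1 - q) / 2) / (q - 1)" using n(2) by (simp add: d_def)
  interpret A: planar_force "cforce q d" "cforce_deriv q d" "cforce_lip q d"
    by (rule planar_force_cforce[OF q d])
  define D where "D = {z. pos z \<noteq> 0 \<and> norm (pos z) < M + 1 \<and> energy q (pos z) (vel z) < C}"
  have cpos: "continuous_on S pos" and cvel: "continuous_on S vel" for S
    using bounded_linear.continuous_on[OF bounded_linear_pos continuous_on_id]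
      bounded_linear.continuous_on[OF bounded_linear_vel continuous_on_id] by auto
  have cE: "continuous_on {z. pos z \<noteq> 0} (\<lambda>z. energy q (pos z) (vel z))"
    by (rule energy_continuous[OF cpos cvel _ q1]) auto
  have opos: "open {z. pos z \<noteq> 0}"
    by (intro open_Collect_neq cpos continuous_on_const)
  have oE: "open ({z. pos z \<noteq> 0} \<inter> (\<lambda>z. energy q (pos z) (vel z)) -` {..<C})"
    by (rule continuous_open_preimage[OF cE opos open_lessThan])
  have "open {z. norm (pos z) < M + 1}"
    by (intro open_Collect_less continuous_intros cpos)
  then have "open ({z. norm (pos z) < M + 1} \<inter> ({z. pos z \<noteq> 0} \<inter> (\<lambda>z. energy q (pos z) (vel z)) -` {..<C}))"
    using oE by (rule open_Int)
  moreover have "{z. norm (pos z) < M + 1} \<inter> ({z. pos z \<noteq> 0} \<inter> (\<lambda>z. energy q (pos z) (vel z)) -` {..<C}) = D"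
    by (auto simp: D_def)
  ultimately have oD: "open D" by simp
  have nD: "norm z \<le> real (Suc n)" if "z \<in> D" for z
  proof -
    have "0 \<le> (norm (vel z) - 1)^2" by simp
    then have "norm (vel z) \<le> 1 / 2 + (vel z \<bullet> vel z) / 2" by (simp add: power2_diff power2_norm_eq_inner)
    also have "\<dots> \<le> 1 / 2 + C" using energy_bounds(1)[OF q1, of "vel z" "pos z"] that by (simp add: D_def)
    finally have "norm (vel z) \<le> 1 / 2 + C" .
    moreover have "norm z \<le> norm (pos z) + norm (vel z)" using norm_pack[of "pos z" "vel z"] by simp
    ultimately show ?thesis using that n(1) by (simp add: D_def)
  qed
  have "bounded D" unfolding bounded_iff using nD by blast
  \<comment> \<open>A positive distance from the origin is needed before passing to the closure,
    where \<open>pos z = 0\<close> would make the energy meaningless. It is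
    \<open>orbit_away\<close> at time 0 with zero forcing.\<close>
  have Dfar: "norm (pos z) \<ge> d" if "z \<in> D" for z
  proof -
    have "norm (A.flow z 0 0) > d"
      by (rule orbit_away[OF q d _ _ _ dC]) (use that P0 in \<open>auto simp: D_def\<close>)
    then show ?thesis using A.flow_deriv(3)[of 0 z 0] by simp
  qed
  have cl: "pos z \<noteq> 0" "norm (pos z) \<le> M + 1" "energy q (pos z) (vel z) \<le> C" if z: "z \<in> closure D" for z
  proof -
    obtain x where x: "\<And>n. x n \<in> D" "x \<longlonglongrightarrow> z" using z closure_sequential by blast
    have l: "(\<lambda>n. pos (x n)) \<longlonglongrightarrow> pos z"
      using bounded_linear.tendsto[OF bounded_linear_pos x(2)] .
    have "norm (pos z) \<ge> d"
      by (rule tendsto_lowerbound[OF tendsto_norm[OF l]]) (use Dfar x(1) in \<open>auto intro!: always_eventually\<close>)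
    then show nz: "pos z \<noteq> 0" using d by auto
    show "norm (pos z) \<le> M + 1"
      by (rule tendsto_upperbound[OF tendsto_norm[OF l]]) (use x(1) in \<open>auto simp: D_def intro!: always_eventually less_imp_le\<close>)
    have "(\<lambda>n. energy q (pos (x n)) (vel (x n))) \<longlonglongrightarrow> energy q (pos z) (vel z)"
      by (rule continuous_on_tendsto_compose[OF cE x(2)]) (use nz x(1) in \<open>auto simp: D_def\<close>)
    then show "energy q (pos z) (vel z) \<le> C"
      by (rule tendsto_upperbound) (use x(1) in \<open>auto simp: D_def intro!: always_eventually less_imp_le\<close>)
  qed
  have ns: "norm (s *\<^sub>R p) \<le> P" if "s \<in> {0..1}" for s
    using that mult_right_mono[of s 1 "norm p"] by (simp add: P_def)
  have isp: "integral {0..1} (s *\<^sub>R p) = 0" for s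
    using p by (simp add: scaleR_bcontfun.rep_eq[abs_def] integral_cmul)
  have per: "periodic_data q (s *\<^sub>R p) d z" if "s \<in> {0..1}" "z \<in> closure D" "A.shoot z (s *\<^sub>R p) = 0" for s z
    using orbit_away[OF q d cl(1,3)[OF that(2)] ns[OF that(1)] dC] that(3)
    by (auto simp: periodic_data_def intro: less_imp_le)
  have inD: "z \<in> D" if "s \<in> {0..1}" "d' > 0" "periodic_data q (s *\<^sub>R p) d' z" for s z d'
    using periodic_data_apriori[OF q that(2,3) ns[OF that(1)] isp] by (auto simp: D_def M_def C_def)
  let ?f = "\<lambda>s z. A.shoot z (s *\<^sub>R p)" and ?f' = "\<lambda>s z k. lin_shoot (A.dflow z (s *\<^sub>R p)) k 0"
  have fin: "finite {z\<in>D. ?f 1 z = 0}"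
    and bal: "card {z\<in>D. ?f 1 z = 0 \<and> jac (?f' 1 z) > 0} = card {z\<in>D. ?f 1 z = 0 \<and> jac (?f' 1 z) < 0}"
  proof -
    let ?L = "4 + 2 * vconst (cforce_lip q d) + 2 * cforce_lip q d * vconst (cforce_lip q d)"
    have 1: "(?f s has_derivative ?f' s z) (at z)" for s z by (rule A.has_derivative_shoot_left)
    have 2: "continuous_on UNIV (\<lambda>z. ?f' s z k)" for s k
      by (rule continuous_on_compose2[OF A.continuous_on_lin_shoot_dflow, of UNIV "\<lambda>z. (z, s *\<^sub>R p)", simplified])
        (intro continuous_intros)
    have 3: "norm (?f' s z k) \<le> ?L * norm k" for s z k
      by (rule lin_shoot_bound[OF A.norm_dflow])
    have 4: "continuous_on ({0..1} \<times> closure D) (\<lambda>(s, z). ?f s z)"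
      unfolding case_prod_unfold
      by (rule continuous_on_compose2[OF A.continuous_on_shoot, of _ "\<lambda>x. (snd x, fst x *\<^sub>R p)", simplified])
        (intro continuous_intros)
    \<comment> \<open>A zero in the closure is a genuine periodic orbit by \<open>per\<close>, and
      the a priori bounds then place it in the open set \<open>D\<close>.\<close>
    have 5: "?f s z \<noteq> 0" if "s \<in> {0..1}" "z \<in> frontier D" for s z
    proof
      assume "?f s z = 0"
      then have "z \<in> D" using inD[OF that(1) d per[OF that(1)]] that(2) by (auto simp: frontier_def)
      then show False using that(2) oD by (simp add: frontier_def interior_open)
    qed
    \<comment> \<open>Without forcing the a priori bound with P = 0 makes the energy at most 0,
      whereas the potential is strictly positive.\<close>
    have 6: "?f 0 z \<noteq> 0" if "z \<in> D" for z
    proof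
      assume "?f 0 z = 0"
      then have "periodic_data q (0 *\<^sub>R p) d z" using that closure_subset by (intro per) auto
      then have "energy q (pos z) (vel z) \<le> 0" "pos z \<noteq> 0"
        using periodic_data_apriori[OF q d, of "0 *\<^sub>R p" z 0] by auto
      moreover have "(pos z \<bullet> pos z) powr ((1 - q) / 2) / (q - 1) > 0" using \<open>pos z \<noteq> 0\<close> q1 by simp
      ultimately show False using energy_bounds(2)[OF q1, of "pos z" "vel z"] by linarith
    qed
    have 7: "jac (?f' 1 z) \<noteq> 0" if "z \<in> D" "?f 1 z = 0" for z
    proof -
      have "periodic_data q p d z" using per[of 1 z] that closure_subset by auto
      then show ?thesis using nondeg[OF nD[OF that(1)]] by (simp add: shoot_jac_def d_def)
    qed
    show "finite {z\<in>D. ?f 1 z = 0}"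
      by (rule regular_zeros_balanced(1)[of ?f ?f', OF 1 2 3 4 oD \<open>bounded D\<close> 5 6 7])
    show "card {z\<in>D. ?f 1 z = 0 \<and> jac (?f' 1 z) > 0} = card {z\<in>D. ?f 1 z = 0 \<and> jac (?f' 1 z) < 0}"
      by (rule regular_zeros_balanced(2)[of ?f ?f', OF 1 2 3 4 oD \<open>bounded D\<close> 5 6 7])
  qed
  let ?pl = "{z\<in>D. ?f 1 z = 0 \<and> jac (?f' 1 z) > 0}" and ?mi = "{z\<in>D. ?f 1 z = 0 \<and> jac (?f' 1 z) < 0}"
  have finpm: "finite ?pl" "finite ?mi" using fin by (auto elim: finite_subset[rotated])
  have "K \<subseteq> ?pl"
  proof
    fix z assume "z \<in> K"
    then obtain d1 where d1: "d1 > 0" "periodic_data q p d1 z" "shoot_jac q p d1 z > 0" using K by blast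
    have zD: "z \<in> D" using inD[of 1 d1 z] d1 by simp
    \<comment> \<open>The states in \<open>K\<close> come with radii of their own. They are compared
      with the common radius \<open>d\<close> through the smaller of the two truncations.\<close>
    let ?e = "min d d1"
    have away: "norm (A.flow z p t) \<ge> d" for t
      using orbit_away[OF q d _ _ _ dC, of z p t] zD by (auto simp: D_def P_def intro: less_imp_le)
    have e: "0 < ?e" "?e \<le> d1" "?e \<le> d" using d d1 by auto
    note eq = cflow_antimono[OF q e(1,3) away]
    have "periodic_data q p ?e z" "shoot_jac q p ?e z > 0"
      using periodic_data_antimono[OF q e(1,2) d1(2)] d1(3) by auto
    then show "z \<in> ?pl" using zD unfolding periodic_data_def shoot_jac_def eq by simp
  qed
  then have "card K \<le> card ?pl" "card K \<le> card ?mi"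
    using card_mono[OF finpm(1)] bal by auto
  moreover have "card (?pl \<union> ?mi) = card ?pl + card ?mi"
    by (rule card_Un_disjoint[OF finpm]) auto
  ultimately have "2 * card K \<le> card (?pl \<union> ?mi)" by simp
  then obtain Z where Z: "Z \<subseteq> ?pl \<union> ?mi" "card Z = 2 * card K" "finite Z"
    by (rule obtain_subset_with_card_n)
  have "periodic_data q p d z" if "z \<in> Z" for z
    using per[of 1 z] Z(1) that closure_subset[of D] by auto
  then show ?thesis using Z d by blast
qed

section \<open>From initial states to solutions of the boundary value problem\<close>

lemma deriv01_eq:
  assumes "(u has_vector_derivative v) (at t within {0..1})" "t \<in> {0..1}"
  shows "deriv01 u t = v"
  unfolding deriv01_def
  by (rule vector_derivative_within[OF _ assms(1)]) (use assms(2) in \<open>auto simp: trivial_limit_within islimpt_Icc\<close>)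

lemma repulsive_solution_of_periodic_data:
  assumes q: "q \<ge> 2" and d: "d > 0" and z: "periodic_data q p d z"
  shows "(\<lambda>t\<in>{0..1}. cflow q d z p t) \<in> repulsive_solutions q p"
    and "cflow q d z p 0 = pos z" "deriv01 (\<lambda>t\<in>{0..1}. cflow q d z p t) 0 = vel z"
proof -
  note o = periodic_data_ode[OF q d z]
  let ?u = "\<lambda>t\<in>{0..1}. cflow q d z p t" and ?v = "cvflow q d z p"
  let ?a = "\<lambda>t. (1 / norm (cflow q d z p t) powr (q + 1)) *\<^sub>R cflow q d z p t + p t"
  have 01: "(0::real) \<in> {0..1}" "(1::real) \<in> {0..1}" by auto
  have u: "(?u has_vector_derivative ?v t) (at t within {0..1})" if "t \<in> {0..1}" for t
    by (rule has_vector_derivative_transform[OF that _ o(1)[OF that]]) auto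
  have du: "deriv01 ?u t = ?v t" if "t \<in> {0..1}" for t
    by (rule deriv01_eq[OF u[OF that] that])
  have v: "(deriv01 ?u has_vector_derivative ?a t) (at t within {0..1})" if "t \<in> {0..1}" for t
    by (rule has_vector_derivative_transform[OF that du o(2)[OF that]])
  have dv: "deriv01 (deriv01 ?u) t = ?a t" if "t \<in> {0..1}" for t
    by (rule deriv01_eq[OF v[OF that] that])
  have "continuous_on {0..1} ?a"
    using o(3) by (intro continuous_intros) auto
  then have "continuous_on {0..1} (deriv01 (deriv01 ?u))"
    by (rule continuous_on_eq) (simp add: dv)
  moreover have "?u differentiable_on {0..1}" "deriv01 ?u differentiable_on {0..1}"
    unfolding differentiable_on_def using u v
    by (meson differentiableI_vector)+
  ultimately have "C2_on01 ?u" by (simp add: C2_on01_def)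
  moreover have "periodic01 ?u"
    using o(4-7)[OF 01(1)] by (simp add: periodic01_def du)
  ultimately show "?u \<in> repulsive_solutions q p"
    using o(3) by (auto simp: repulsive_solutions_def dv)
  show "cflow q d z p 0 = pos z" "deriv01 ?u 0 = vel z" using o(4,6)[OF 01(1)] du[OF 01(1)] by auto
qed

text \<open>The initial state is recovered from the solution as its value and its one-sided
  derivative at 0, so distinct states give distinct solutions.\<close>

lemma repulsive_solutions_card:
  assumes q: "q \<ge> 2" and Z: "finite Z" "d > 0" "\<And>z. z \<in> Z \<Longrightarrow> periodic_data q p d z"
  shows "\<exists>S \<subseteq> repulsive_solutions q p. finite S \<and> card S = card Z"
proof -
  let ?F = "\<lambda>z. \<lambda>t\<in>{0..1}. cflow q d z p t"
  have "inj_on ?F Z"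
  proof (rule inj_onI)
    fix x y assume xy: "x \<in> Z" "y \<in> Z" "?F x = ?F y"
    have *: "?F z 0 = pos z" "deriv01 (?F z) 0 = vel z" if "z \<in> Z" for z
      using repulsive_solution_of_periodic_data(2,3)[OF q Z(2) Z(3)[OF that]] by auto
    have "?F x 0 = ?F y 0" "deriv01 (?F x) 0 = deriv01 (?F y) 0" by (simp_all only: xy(3))
    then have "pos x = pos y" "vel x = vel y" unfolding *[OF xy(1)] *[OF xy(2)] .
    then show "x = y" by (metis pack_simps(3))
  qed
  then have "card (?F ` Z) = card Z" by (rule card_image)
  moreover have "?F ` Z \<subseteq> repulsive_solutions q p"
    using repulsive_solution_of_periodic_data(1)[OF q Z(2) Z(3)] by auto
  ultimately show ?thesis using Z(1) by blast
qed

section \<open>Generic nondegeneracy\<close>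

lemma linear_near_id_bij:
  fixes B :: "'a::euclidean_space \<Rightarrow> 'a"
  assumes "linear B" "\<And>m. norm (B m - m) \<le> 1 / 2 * norm m"
  shows "bij B" "norm m \<le> 2 * norm (B m)"
proof -
  have *: "norm m \<le> 2 * norm (B m)" for m
    using assms(2)[of m] norm_triangle_ineq4[of "B m" "B m - m"] by simp
  then show "norm m \<le> 2 * norm (B m)" .
  have "inj B" unfolding linear_injective_0[OF assms(1)]
    using * by (metis norm_le_zero_iff norm_zero mult_zero_right)
  then show "bij B" using linear_inj_imp_surj[OF assms(1)] by (simp add: bij_def)
qed

text \<open>The weight \<open>w\<close> is supported so close to t = 1/2 that \<open>A t\<close> is
  nearly the injective \<open>A (1/2)\<close>; the weighted integral of \<open>A\<close> is then
  close to a positive multiple of it. As \<open>w\<close> and \<open>v\<close> vanish at both ends,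
  adding a multiple of \<open>w\<close> to a path changes neither end state.\<close>

lemma weighted_integral_bij:
  fixes A :: "(real^2) curve_op"
  assumes inj: "\<And>k. blinfun_apply (A (1/2)) k = 0 \<Longrightarrow> k = 0"
  shows "\<exists>w v a :: real \<Rightarrow> real. (\<forall>t. (w has_real_derivative v t) (at t)) \<and> (\<forall>t. (v has_real_derivative a t) (at t)) \<and>
    continuous_on UNIV a \<and> w 0 = 0 \<and> v 0 = 0 \<and> w 1 = 0 \<and> v 1 = 0 \<and>
    (\<forall>y. \<exists>e. integral {0..1} (\<lambda>t. w t *\<^sub>R blinfun_apply (A t) e) = y)"
proof -
  let ?B = "blinfun_apply (A (1/2))"
  have linB: "linear ?B" by (simp add: blinfun.bounded_linear_right bounded_linear.linear)
  obtain b where b: "b > 0" "\<And>k. b * norm k \<le> norm (?B k)"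
    using linear_inj_bounded_below_pos[of ?B] linB inj by (metis linear_injective_0)
  have "continuous_on UNIV (apply_bcontfun A)" by simp
  then obtain h where h: "h > 0" "\<And>t. dist t (1/2) < h \<Longrightarrow> dist (A t) (A (1/2)) < b / 2"
    unfolding continuous_on_iff using b(1) by (metis UNIV_I half_gt_zero)
  define \<eta> where "\<eta> = min (1/4) h"
  have \<eta>: "0 < \<eta>" "\<eta> \<le> 1/4" "\<eta> \<le> h" using h by (auto simp: \<eta>_def)
  \<comment> \<open>A parabola, positive exactly within \<eta> of 1/2; the cube of its positive part
    has the continuous second derivative \<open>a\<close>.\<close>
  define s where "s t = \<eta>^2 - (t - 1/2)^2" for t :: real
  define w where "w t = (max 0 (s t))^3" for t
  define v where "v t = 3 * (max 0 (s t))^2 * (- 2 * (t - 1/2))" for t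
  define a where "a t = 3 * (2 * max 0 (s t) * (- 2 * (t - 1/2))) * (- 2 * (t - 1/2)) + 3 * (max 0 (s t))^2 * (- 2)" for t
  have ds: "(s has_real_derivative - 2 * (t - 1/2)) (at t)" for t
    unfolding s_def[abs_def] by (auto intro!: derivative_eq_intros)
  have dw: "(w has_real_derivative v t) (at t)" for t
    unfolding w_def[abs_def] v_def by (rule DERIV_chain2[OF has_real_derivative_max_0_cube ds])
  have dsq: "((\<lambda>t. (max 0 (s t))^2) has_real_derivative 2 * max 0 (s t) * (- 2 * (t - 1/2))) (at t)" for t
    by (rule DERIV_chain2[OF has_real_derivative_max_0_square ds])
  have dl: "((\<lambda>t. - 2 * (t - 1/2)) has_real_derivative - 2) (at t)" for t :: real
    by (auto intro!: derivative_eq_intros)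
  have dv: "(v has_real_derivative a t) (at t)" for t
    unfolding v_def[abs_def] a_def
    by (rule DERIV_cong[OF DERIV_mult[OF DERIV_cmult[OF dsq, of 3] dl]]) (simp add: algebra_simps)
  have cs: "continuous_on S s" for S unfolding s_def[abs_def] by (intro continuous_intros)
  have cw: "continuous_on S w" for S unfolding w_def[abs_def] by (intro continuous_intros cs)
  have ca: "continuous_on UNIV a" unfolding a_def[abs_def] by (intro continuous_intros cs)
  have s0: "s t \<le> 0" if "\<not> \<bar>t - 1/2\<bar> < \<eta>" for t
  proof -
    have "\<eta>^2 \<le> \<bar>t - 1/2\<bar>^2" using that \<eta> by (intro power_mono) auto
    then show ?thesis by (simp add: s_def)
  qed
  have ends: "s 0 \<le> 0" "s 1 \<le> 0" using \<eta> by (auto intro!: s0)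
  have w0: "w t = 0" if "\<not> \<bar>t - 1/2\<bar> < \<eta>" for t using s0[OF that] by (simp add: w_def)
  have wpos: "w t \<ge> 0" for t by (simp add: w_def)
  define c where "c = integral {0..1} w"
  note int = integrable_continuous_real
  have "c > 0"
  proof -
    have "c \<ge> 0" unfolding c_def by (intro integral_nonneg int cw) (use wpos in auto)
    moreover have "c \<noteq> 0"
    proof
      assume "c = 0"
      then have "(w has_integral 0) (cbox 0 1)" using integrable_integral[OF int[OF cw[of "{0..1}"]]] unfolding c_def by simp
      then have "w (1/2) = 0" by (intro has_integral_0_cbox_imp_0[OF cw, of 0 1 "1/2"]) (use wpos in auto)
      then show False using \<eta>(1) by (simp add: w_def s_def)
    qed
    ultimately show ?thesis by simp
  qed
  let ?T = "\<lambda>e. integral {0..1} (\<lambda>t. w t *\<^sub>R blinfun_apply (A t) e)"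
  have cA: "continuous_on {0..1} (\<lambda>t. w t *\<^sub>R blinfun_apply (A t) e)" for e
    by (intro continuous_intros cw) auto
  have linT: "linear ?T"
  proof
    fix x y :: "real^2" and r :: real
    show "?T (x + y) = ?T x + ?T y"
      using integral_add[OF int[OF cA[of x]] int[OF cA[of y]]] by (simp add: blinfun.bilinear_simps scaleR_add_right)
    show "?T (r *\<^sub>R x) = r *\<^sub>R ?T x"
      using integral_cmul[of "{0..1}" r "\<lambda>t. w t *\<^sub>R blinfun_apply (A t) x"]
      by (simp add: blinfun.bilinear_simps mult.commute)
  qed
  have "e = 0" if "?T e = 0" for e
  proof -
    have i1: "(\<lambda>t. w t *\<^sub>R ?B e) integrable_on {0..1}" by (intro int continuous_intros cw)
    have "norm (?T e - integral {0..1} (\<lambda>t. w t *\<^sub>R ?B e)) = norm (integral {0..1} (\<lambda>t. w t *\<^sub>R blinfun_apply (A t) e - w t *\<^sub>R ?B e))"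
      by (simp add: integral_diff[OF int[OF cA] i1])
    also have "\<dots> \<le> integral {0..1} (\<lambda>t. w t * (b / 2 * norm e))"
    proof (rule integral_norm_bound_integral)
      show "(\<lambda>t. w t *\<^sub>R blinfun_apply (A t) e - w t *\<^sub>R ?B e) integrable_on {0..1}"
        by (intro integrable_diff int cA i1)
      show "(\<lambda>t. w t * (b / 2 * norm e)) integrable_on {0..1}" by (intro int continuous_intros cw)
      fix t :: real assume "t \<in> {0..1}"
      show "norm (w t *\<^sub>R blinfun_apply (A t) e - w t *\<^sub>R ?B e) \<le> w t * (b / 2 * norm e)"
      proof (cases "\<bar>t - 1/2\<bar> < \<eta>")
        case True
        then have "norm (A t - A (1/2)) \<le> b / 2" using h(2)[of t] \<eta>(3) by (simp add: dist_norm)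
        then have "norm (blinfun_apply (A t - A (1/2)) e) \<le> b / 2 * norm e"
          by (rule order_trans[OF norm_blinfun mult_right_mono]) simp
        from mult_left_mono[OF this wpos[of t]] show ?thesis
          using wpos[of t] by (simp add: scaleR_diff_right[symmetric] blinfun.bilinear_simps)
      qed (simp add: w0)
    qed
    also have "\<dots> = c * (b / 2 * norm e)" by (simp add: c_def)
    finally have "norm (c *\<^sub>R ?B e) \<le> c * (b / 2 * norm e)"
      using that integral_unique[OF has_integral_scaleR_left[OF integrable_integral[OF int[OF cw[of "{0..1}"]]], of "?B e"]]
      by (simp add: c_def[symmetric])
    then have "norm (?B e) \<le> b / 2 * norm e" using \<open>c > 0\<close> by simp
    with b(2)[of e] have "b * norm e \<le> b / 2 * norm e" by linarith
    then show "e = 0" using b(1) by simp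
  qed
  then have "inj ?T" unfolding linear_injective_0[OF linT] by blast
  then have "surj ?T" by (rule linear_inj_imp_surj[OF linT])
  then have T: "\<exists>e. ?T e = y" for y
    unfolding surj_def by (auto dest!: spec[of _ y] intro: sym)
  have "w 0 = 0" "w 1 = 0" "v 0 = 0" "v 1 = 0" using ends by (auto simp: w_def v_def)
  then show ?thesis
    using dw dv ca T by (intro exI[of _ w] exI[of _ v] exI[of _ a]) simp
qed

text \<open>The path is prescribed and the control read off: for a C2 path \<open>W\<close> from the
  zero state to the state \<open>y\<close>, the control is W'' - A W. Its mean is \<open>v1\<close>
  minus the integral of A W, and is made zero by adding \<open>w\<close> times a suitable
  vector.\<close>

lemma controllable:
  fixes A :: "(real^2) curve_op"
  assumes inj: "\<And>k. blinfun_apply (A (1/2)) k = 0 \<Longrightarrow> k = 0"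
  shows "\<exists>\<phi> :: real \<Rightarrow>\<^sub>C (real^2). integral {0..1} (apply_bcontfun \<phi>) = 0 \<and> (\<forall>t. apply_bcontfun \<phi> (clamp01 t) = apply_bcontfun \<phi> t) \<and> lin_shoot A 0 \<phi> = y"
proof -
  obtain w v a :: "real \<Rightarrow> real" where bump: "\<And>t. (w has_real_derivative v t) (at t)" "\<And>t. (v has_real_derivative a t) (at t)"
    "continuous_on UNIV a" "w 0 = 0" "v 0 = 0" "w 1 = 0" "v 1 = 0"
    "\<And>y. \<exists>e. integral {0..1} (\<lambda>t. w t *\<^sub>R blinfun_apply (A t) e) = y"
    using weighted_integral_bij[of A, OF inj] by blast
  define x1 v1 where "x1 = pos y" and "v1 = vel y"
  \<comment> \<open>The cubic Hermite interpolant: zero value and slope at 0, value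
    \<open>x1\<close> and slope \<open>v1\<close> at 1. \<open>V0\<close> and \<open>A0\<close> are
    its derivatives.\<close>
  define W0 where "W0 t = (3 * t^2 - 2 * t^3) *\<^sub>R x1 + (t^3 - t^2) *\<^sub>R v1" for t :: real
  define V0 where "V0 t = (6 * t - 6 * t^2) *\<^sub>R x1 + (3 * t^2 - 2 * t) *\<^sub>R v1" for t :: real
  define A0 where "A0 t = (6 - 12 * t) *\<^sub>R x1 + (6 * t - 2) *\<^sub>R v1" for t :: real
  have cW0: "continuous_on S W0" for S unfolding W0_def[abs_def] by (intro continuous_intros)
  note int = integrable_continuous_real
  have cA: "continuous_on {0..1} (\<lambda>t. blinfun_apply (A t) (W0 t))" by (intro continuous_intros cW0) auto
  \<comment> \<open>This \<open>e\<close> makes the integral of A W equal to \<open>v1\<close>, the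
    integral of W''.\<close>
  obtain e where e: "integral {0..1} (\<lambda>t. w t *\<^sub>R blinfun_apply (A t) e) = v1 - integral {0..1} (\<lambda>t. blinfun_apply (A t) (W0 t))"
    using bump(8) by blast
  define W where "W t = W0 t + w t *\<^sub>R e" for t
  define V where "V t = V0 t + v t *\<^sub>R e" for t
  define Q where "Q t = A0 t + a t *\<^sub>R e" for t
  have cw: "continuous_on S w" for S
    by (rule continuous_at_imp_continuous_on) (use bump(1) DERIV_isCont in blast)
  have scl: "((\<lambda>t. f t *\<^sub>R c) has_vector_derivative f' *\<^sub>R c) (at t within {0..1})"
    if "(f has_real_derivative f') (at t)" for f f' t and c :: "real^2"
    using bounded_linear.has_vector_derivative[OF bounded_linear_scaleR_left
      has_field_derivative_at_within[OF that, unfolded has_real_derivative_iff_has_vector_derivative]] .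
  have d1: "((\<lambda>t. 3 * t^2 - 2 * t^3) has_real_derivative 6 * t - 6 * t^2) (at t)"
    "((\<lambda>t. t^3 - t^2) has_real_derivative 3 * t^2 - 2 * t) (at t)"
    "((\<lambda>t. 6 * t - 6 * t^2) has_real_derivative 6 - 12 * t) (at t)"
    "((\<lambda>t. 3 * t^2 - 2 * t) has_real_derivative 6 * t - 2) (at t)" for t :: real
    by (auto intro!: derivative_eq_intros simp: power2_eq_square)
  have dWV: "(W has_vector_derivative V t) (at t within {0..1})" for t
    unfolding W_def[abs_def] V_def W0_def V0_def
    by (intro has_vector_derivative_add scl d1 bump(1))
  have dVQ: "(V has_vector_derivative Q t) (at t within {0..1})" for t
    unfolding V_def[abs_def] Q_def V0_def A0_def
    by (intro has_vector_derivative_add scl d1 bump(2))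
  have cW: "continuous_on {0..1} W" and cV: "continuous_on {0..1} V"
    by (rule continuous_on_vector_derivative[OF dWV]) (rule continuous_on_vector_derivative[OF dVQ])
  have cQ: "continuous_on {0..1} Q"
    unfolding Q_def[abs_def] A0_def by (intro continuous_intros continuous_on_subset[OF bump(3)]) auto
  have cAW: "continuous_on {0..1} (\<lambda>t. blinfun_apply (A t) (W t))" by (intro continuous_intros cW) auto
  have ends: "W 0 = 0" "V 0 = 0" "W 1 = x1" "V 1 = v1"
    by (simp_all add: W_def V_def W0_def V0_def bump)
  define \<phi> where "\<phi> = ext01 (\<lambda>t. Q t - blinfun_apply (A t) (W t))"
  have phi: "\<phi> t = Q (clamp01 t) - blinfun_apply (A (clamp01 t)) (W (clamp01 t))" for t
    unfolding \<phi>_def by (rule ext01_apply) (intro continuous_on_diff cQ cAW)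
  have eW: "ext01 W t = W (clamp01 t)" and eV: "ext01 V t = V (clamp01 t)" for t
    by (rule ext01_apply[OF cW]) (rule ext01_apply[OF cV])
  have 1: "ext01 W = const_bcontfun (W 0) + primitive (ext01 V)"
    by (rule bcontfun_of_ode[OF dWV]) (simp add: eV clamp01)
  have 2: "ext01 V = const_bcontfun (V 0) + primitive (opmult A (ext01 W) + \<phi>)"
    by (rule bcontfun_of_ode[OF dVQ]) (simp add: eW phi opmult_apply clamp01)
  have z: "pos 0 = 0" "vel 0 = 0" by (simp_all add: pos_def vel_def vec_eq_iff)
  have "lin_flow A 0 \<phi> = ext01 W" "lin_vflow A 0 \<phi> = ext01 V"
    by (rule lin_flow_unique[OF 1[unfolded ends z(1)[symmetric]] 2[unfolded ends z(2)[symmetric]]])+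
  then have "lin_shoot A 0 \<phi> = y"
    by (simp add: lin_shoot_def z eW eV clamp01 ends x1_def v1_def)
  moreover have "integral {0..1} \<phi> = 0"
  proof -
    have "(Q has_integral V 1 - V 0) {0..1}"
      by (rule fundamental_theorem_of_calculus) (auto intro: dVQ)
    then have IQ: "integral {0..1} Q = v1" by (simp add: integral_unique ends)
    have cwA: "continuous_on {0..1} (\<lambda>t. w t *\<^sub>R blinfun_apply (A t) e)" by (intro continuous_intros cw) auto
    have "integral {0..1} (\<lambda>t. blinfun_apply (A t) (W t)) = v1"
      using integral_add[OF int[OF cA] int[OF cwA]] e by (simp add: W_def blinfun.bilinear_simps)
    then have "integral {0..1} (\<lambda>t. Q t - blinfun_apply (A t) (W t)) = 0"
      using integral_diff[OF int[OF cQ] int[OF cAW]] IQ by simp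
    moreover have "integral {0..1} \<phi> = integral {0..1} (\<lambda>t. Q t - blinfun_apply (A t) (W t))"
      by (rule integral_cong) (simp add: phi clamp01)
    ultimately show ?thesis by simp
  qed
  moreover have "\<phi> (clamp01 t) = \<phi> t" for t by (simp add: phi clamp01)
  ultimately show ?thesis by blast
qed

lemma lin_shoot_add: "lin_shoot A k \<phi> = lin_shoot A k 0 + lin_shoot A 0 \<phi>"
  using linear_add[OF bounded_linear.linear[OF bounded_linear_lin_shoot[of A]], of "(k, 0)" "(0, \<phi>)"] by simp

lemma linear_lin_shoot_right: "linear (\<lambda>\<phi>. lin_shoot A 0 \<phi>)"
proof -
  have "bounded_linear (\<lambda>\<phi> :: real \<Rightarrow>\<^sub>C (real^2). (0 :: real^4, \<phi>))"
    by (intro bounded_linear_Pair bounded_linear_ident bounded_linear_zero)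
  from bounded_linear_compose[OF bounded_linear_lin_shoot this] show ?thesis by (simp add: bounded_linear.linear)
qed

context planar_force
begin

lemma shoot_lipschitz: "\<exists>M\<ge>0. \<forall>z z' p. norm (shoot z p - shoot z' p) \<le> M * norm (z - z')"
proof (intro exI conjI allI)
  let ?M = "4 + 2 * vconst L + 2 * L * vconst L"
  show "?M \<ge> 0" using vconst_pos[of L] L_nonneg by (intro add_nonneg_nonneg mult_nonneg_nonneg) auto
  show "norm (shoot z p - shoot z' p) \<le> ?M * norm (z - z')" for z z' p
    by (rule C1_Lipschitz[OF has_derivative_shoot_left lin_shoot_bound[OF norm_dflow]])
qed

text \<open>Near \<open>(z0, p0)\<close> the equation \<open>shoot z (p + \<Sum>i. c i \<phi> i) = 0\<close> determines \<open>c\<close> as a function of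
  \<open>z\<close>, and its degenerate zeros are critical points of this function, so Sard's theorem applies.\<close>

lemma local_density:
  assumes inj: "\<And>k. blinfun_apply (DG (flow z0 p0 (1/2))) k = 0 \<Longrightarrow> k = 0"
  shows "\<exists>r>0. \<forall>p \<eta>. norm (p - p0) < r \<and> \<eta> > 0 \<longrightarrow>
    (\<exists>\<psi> :: real \<Rightarrow>\<^sub>C (real^2). norm \<psi> < \<eta> \<and> integral {0..1} (apply_bcontfun \<psi>) = 0 \<and>
      (\<forall>t. apply_bcontfun \<psi> (clamp01 t) = apply_bcontfun \<psi> t) \<and>
      (\<forall>z\<in>cball z0 r. shoot z (p + \<psi>) = 0 \<longrightarrow> jac (\<lambda>k. lin_shoot (dflow z (p + \<psi>)) k 0) \<noteq> 0))"
proof -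
  let ?A0 = "dflow z0 p0"
  have "k = 0" if "blinfun_apply (?A0 (1/2)) k = 0" for k
    using that inj by (simp add: dflow_def dforce_along_apply)
  then have "\<forall>i. \<exists>\<phi> :: real \<Rightarrow>\<^sub>C (real^2). integral {0..1} (apply_bcontfun \<phi>) = 0 \<and>
      (\<forall>t. apply_bcontfun \<phi> (clamp01 t) = apply_bcontfun \<phi> t) \<and> lin_shoot ?A0 0 \<phi> = axis i 1"
    using controllable[of ?A0] by blast
  \<comment> \<open>Four controls moving the end state in the four coordinate directions: at the
    base point the derivative of the shooting map in the parameter \<open>c\<close> is the
    identity.\<close>
  from choice[OF this] obtain \<phi> :: "4 \<Rightarrow> real \<Rightarrow>\<^sub>C (real^2)" where \<phi>: "\<And>i. integral {0..1} (apply_bcontfun (\<phi> i)) = 0"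
    "\<And>i t. apply_bcontfun (\<phi> i) (clamp01 t) = apply_bcontfun (\<phi> i) t" "\<And>i. lin_shoot ?A0 0 (\<phi> i) = axis i 1" by blast
  define Lc where "Lc c = (\<Sum>i\<in>UNIV. (c $ i) *\<^sub>R \<phi> i)" for c :: "real^4"
  define K where "K = (\<Sum>i\<in>UNIV. norm (\<phi> i))"
  have K0: "K \<ge> 0" unfolding K_def by (intro sum_nonneg) auto
  have Lc_bound: "norm (Lc c) \<le> K * norm c" for c
    unfolding Lc_def K_def sum_distrib_right
    by (rule sum_norm_le) (simp add: mult.commute[of _ "norm c"] mult_right_mono component_le_norm_cart)
  have Lc_lin: "bounded_linear Lc"
    by (rule bounded_linear_intro[where K=K])
      (use Lc_bound in \<open>auto simp: Lc_def scaleR_add_left sum.distrib scaleR_sum_right mult.commute\<close>)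
  have Lc_int: "integral {0..1} (apply_bcontfun (Lc c)) = 0" for c
  proof -
    have "apply_bcontfun (Lc c) = (\<lambda>t. \<Sum>i\<in>UNIV. (c $ i) *\<^sub>R apply_bcontfun (\<phi> i) t)"
      unfolding Lc_def sum_4 by (simp add: fun_eq_iff)
    moreover have "((\<lambda>t. \<Sum>i\<in>UNIV. (c $ i) *\<^sub>R apply_bcontfun (\<phi> i) t) has_integral (\<Sum>i\<in>(UNIV :: 4 set). (c $ i) *\<^sub>R 0)) {0..1}"
    proof (rule has_integral_sum)
      show "((\<lambda>t. (c $ i) *\<^sub>R apply_bcontfun (\<phi> i) t) has_integral (c $ i) *\<^sub>R 0) {0..1}" for i
        using integrable_integral[OF integrable_bcontfun[of "\<phi> i" 0 1]] unfolding \<phi>(1) by (rule has_integral_cmul)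
    qed simp
    ultimately show ?thesis by (simp add: integral_unique)
  qed
  have Lc_clamp: "apply_bcontfun (Lc c) (clamp01 t) = apply_bcontfun (Lc c) t" for c t
    unfolding Lc_def sum_4 by (simp add: \<phi>(2))
  define B where "B x m = lin_shoot (dflow (fst x) (snd x)) 0 (Lc m)" for x :: "(real^4) \<times> (real \<Rightarrow>\<^sub>C (real^2))" and m
  have linB: "linear (B x)" for x
    unfolding B_def using linear_compose[OF bounded_linear.linear[OF Lc_lin] linear_lin_shoot_right] by (simp add: o_def)
  \<comment> \<open>\<open>S\<close> measures how far the derivative in the parameter is from the
    identity. It vanishes at the base point and is continuous, so within distance \<open>R\<close>
    that derivative is 1/2-close to the identity.\<close>
  define S where "S x = (\<Sum>i\<in>UNIV. norm (lin_shoot (dflow (fst x) (snd x)) 0 (\<phi> i) - axis i 1))" for x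
  have "continuous_on UNIV S"
    unfolding S_def by (intro continuous_intros continuous_on_lin_shoot_dflow)
  moreover have "S (z0, p0) = 0" by (simp add: S_def \<phi>(3))
  ultimately obtain R where R: "R > 0" "\<And>x. dist x (z0, p0) < R \<Longrightarrow> \<bar>S x\<bar> < 1 / 2"
    unfolding continuous_on_iff dist_real_def by (metis UNIV_I diff_zero half_gt_zero zero_less_one)
  have B_near: "norm (B x m - m) \<le> 1 / 2 * norm m" if "dist x (z0, p0) < R" for x m
  proof -
    have "B x m = (\<Sum>i\<in>UNIV. (m $ i) *\<^sub>R lin_shoot (dflow (fst x) (snd x)) 0 (\<phi> i))"
      unfolding B_def Lc_def by (simp add: linear_sum[OF linear_lin_shoot_right] linear_scale[OF linear_lin_shoot_right])
    moreover have "m = (\<Sum>i\<in>UNIV. (m $ i) *\<^sub>R axis i 1)"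
      using basis_expansion[of m] by (simp add: scalar_mult_eq_scaleR)
    ultimately have "B x m - m = (\<Sum>i\<in>UNIV. (m $ i) *\<^sub>R (lin_shoot (dflow (fst x) (snd x)) 0 (\<phi> i) - axis i 1))"
      by (simp add: scaleR_diff_right sum_subtractf)
    also have "norm \<dots> \<le> (\<Sum>i\<in>UNIV. norm m * norm (lin_shoot (dflow (fst x) (snd x)) 0 (\<phi> i) - axis i 1))"
      by (rule sum_norm_le) (simp add: mult_right_mono component_le_norm_cart)
    also have "\<dots> = norm m * S x" by (simp add: S_def sum_distrib_left)
    also have "\<dots> \<le> norm m * (1 / 2)" using R(2)[OF that] by (intro mult_left_mono) auto
    finally show ?thesis by simp
  qed
  define r where "r = R / 4"
  \<comment> \<open>The radii make the three displacements, in state, forcing and control, at most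
    R/4 each, so the pair stays within \<open>R\<close> of the base point.\<close>
  define c0 where "c0 = R / (4 * (K + 1))"
  have r: "r > 0" and c0: "c0 > 0" using R(1) K0 by (auto simp: r_def c0_def)
  have Kc0: "K * c0 < R / 4"
  proof -
    have "K * c0 < (K + 1) * c0" using c0 by simp
    also have "\<dots> = R / 4" using K0 by (simp add: c0_def divide_simps)
    finally show ?thesis .
  qed
  have near: "dist (z, p + Lc c) (z0, p0) < R" if "z \<in> cball z0 r" "norm (p - p0) < r" "norm c \<le> c0" for z p c
  proof -
    have "norm (Lc c) \<le> K * c0" using Lc_bound[of c] mult_left_mono[OF that(3) K0] by linarith
    then have "norm (p + Lc c - p0) < r + R / 4"
      using that(2) Kc0 norm_triangle_ineq[of "p - p0" "Lc c"] by (simp add: algebra_simps)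
    moreover have "norm (z - z0) \<le> r" using that(1) by (simp add: dist_norm norm_minus_commute)
    ultimately show ?thesis
      using norm_Pair_le[of "z - z0" "p + Lc c - p0"] R(1) by (simp add: dist_norm r_def)
  qed
  obtain M where M: "M \<ge> 0" "\<And>z z' p. norm (shoot z p - shoot z' p) \<le> M * norm (z - z')"
    using shoot_lipschitz by blast
  have "\<exists>\<psi>. norm \<psi> < \<eta> \<and> integral {0..1} (apply_bcontfun \<psi>) = 0 \<and> (\<forall>t. apply_bcontfun \<psi> (clamp01 t) = apply_bcontfun \<psi> t) \<and>
      (\<forall>z\<in>cball z0 r. shoot z (p + \<psi>) = 0 \<longrightarrow> jac (\<lambda>k. lin_shoot (dflow z (p + \<psi>)) k 0) \<noteq> 0)"
    if p: "norm (p - p0) < r" and \<eta>: "\<eta> > 0" for p \<eta>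
  proof -
    define H where "H z c = shoot z (p + Lc c)" for z c
    define J where "J z c = jac (\<lambda>k. lin_shoot (dflow z (p + Lc c)) k 0)" for z c
    \<comment> \<open>For fixed state the map from \<open>c\<close> to \<open>H z c\<close> is the
      identity plus a 1/2-contraction, hence injective with an inverse of Lipschitz constant
      2.\<close>
    have expand: "norm (c' - c) \<le> 2 * norm (H z c' - H z c)"
      if "z \<in> cball z0 r" "norm c \<le> c0" "norm c' \<le> c0" for z c c'
    proof -
      have "norm ((H z c' - c') - (H z c - c)) \<le> 1 / 2 * norm (c' - c)"
      proof (rule differentiable_bound[of "cball 0 c0" "\<lambda>c. H z c - c" "\<lambda>c m. B (z, p + Lc c) m - m"])
        fix c assume "c \<in> cball (0 :: real^4) c0"
        then have c: "norm c \<le> c0" by simp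
        have "((\<lambda>c. (z, p + Lc c)) has_derivative (\<lambda>m. (0, Lc m))) (at c)"
          by (rule derivative_eq_intros bounded_linear.has_derivative[OF Lc_lin] refl | simp)+
        from has_derivative_compose[OF this has_derivative_shoot]
        have "((\<lambda>c. H z c) has_derivative B (z, p + Lc c)) (at c)" by (simp add: H_def B_def[abs_def])
        then show "((\<lambda>c. H z c - c) has_derivative (\<lambda>m. B (z, p + Lc c) m - m)) (at c within cball 0 c0)"
          by (intro has_derivative_at_withinI[OF has_derivative_diff] has_derivative_ident)
        show "onorm (\<lambda>m. B (z, p + Lc c) m - m) \<le> 1 / 2"
          by (rule onorm_le[OF B_near[OF near[OF that(1) p c]]])
      qed (use that in auto)
      then show ?thesis
        using norm_triangle_ineq4[of "H z c' - H z c" "(H z c' - c') - (H z c - c)"] by (simp add: algebra_simps)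
    qed
    \<comment> \<open>The states that are degenerate zeros for some small parameter;
      \<open>\<gamma>\<close> assigns that parameter, unique by \<open>expand\<close>.\<close>
    define Z where "Z = {z \<in> cball z0 r. \<exists>c. norm c \<le> c0 \<and> H z c = 0 \<and> J z c = 0}"
    have "\<forall>z\<in>Z. \<exists>c. norm c \<le> c0 \<and> H z c = 0 \<and> J z c = 0" by (auto simp: Z_def)
    from bchoice[OF this] obtain \<gamma> where \<gamma>: "\<And>z. z \<in> Z \<Longrightarrow> norm (\<gamma> z) \<le> c0 \<and> H z (\<gamma> z) = 0 \<and> J z (\<gamma> z) = 0" by blast
    define N where "N z k = lin_shoot (dflow z (p + Lc (\<gamma> z))) k 0" for z k
    \<comment> \<open>Implicit differentiation of H z (\<gamma> z) = 0, with \<open>N\<close> the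
      derivative in the state and \<open>B\<close> the one in the parameter.\<close>
    define \<gamma>' where "\<gamma>' z k = - inv (B (z, p + Lc (\<gamma> z))) (N z k)" for z k
    have linN: "linear (N z)" for z unfolding N_def by (rule linear_lin_shoot_left)
    have Bz: "bij (B (z, p + Lc (\<gamma> z)))" "norm m \<le> 2 * norm (B (z, p + Lc (\<gamma> z)) m)"
      "linear (inv (B (z, p + Lc (\<gamma> z))))" if "z \<in> Z" for z m
    proof -
      have "norm (B (z, p + Lc (\<gamma> z)) m - m) \<le> 1 / 2 * norm m" for m
        by (rule B_near[OF near[OF _ p]]) (use that \<gamma>[OF that] in \<open>auto simp: Z_def\<close>)
      note b = linear_near_id_bij[OF linB this]
      show "bij (B (z, p + Lc (\<gamma> z)))" "norm m \<le> 2 * norm (B (z, p + Lc (\<gamma> z)) m)" by (rule b)+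
      have "inj (B (z, p + Lc (\<gamma> z)))" using b(1) by (rule bij_is_inj)
      then obtain g where g: "linear g" "g \<circ> B (z, p + Lc (\<gamma> z)) = id"
        using linear_injective_left_inverse[OF linB] by blast
      have "inv (B (z, p + Lc (\<gamma> z))) = g"
        using g(2) b(1) by (metis bij_is_surj inv_unique_comp surj_iff comp_assoc comp_id id_comp)
      then show "linear (inv (B (z, p + Lc (\<gamma> z))))" using g(1) by simp
    qed
    \<comment> \<open>Degeneracy of the zero means that \<open>N z\<close> is singular, hence so is
      \<open>\<gamma>' z\<close>. Differentiability of \<open>\<gamma>\<close> within the set
      \<open>Z\<close> is enough for Sard's theorem.\<close>
    have "negligible (\<gamma> ` Z)"
    proof (rule baby_Sard)
      fix z assume z: "z \<in> Z"
      let ?P = "p + Lc (\<gamma> z)" and ?B = "B (z, p + Lc (\<gamma> z))"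
      have lin\<gamma>': "linear (\<gamma>' z)"
        unfolding \<gamma>'_def using linear_compose_neg[OF linear_compose[OF linN Bz(3)[OF z]]] by (simp add: o_def)
      show "(\<gamma> has_derivative \<gamma>' z) (at z within Z)"
        unfolding has_derivative_within_alt
      proof (intro conjI allI impI)
        show "bounded_linear (\<gamma>' z)" using lin\<gamma>' by (simp add: linear_conv_bounded_linear)
        fix e :: real assume e: "e > 0"
        \<comment> \<open>By \<open>expand\<close> the parameter moves by at most
          \<open>2 * M\<close> times the state, so \<open>C\<close> bounds the combined displacement
          of state and forcing in terms of that of the state.\<close>
        define C where "C = 1 + K * (2 * M)"
        have C: "C > 0" using K0 M(1) by (simp add: C_def add_pos_nonneg)
        define e' where "e' = e / (2 * C)"
        have e': "e' > 0" using e C by (simp add: e'_def)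
        from conjunct2[OF has_derivative_shoot[of z ?P, unfolded has_derivative_at_alt], rule_format, OF e']
        obtain \<delta> where \<delta>: "\<delta> > 0" "\<And>y. norm (y - (z, ?P)) < \<delta> \<Longrightarrow>
            norm (shoot (fst y) (snd y) - shoot z ?P - lin_shoot (dflow z ?P) (fst (y - (z, ?P))) (snd (y - (z, ?P)))) \<le> e' * norm (y - (z, ?P))"
          unfolding fst_conv snd_conv by blast
        show "\<exists>\<delta>>0. \<forall>y\<in>Z. norm (y - z) < \<delta> \<longrightarrow> norm (\<gamma> y - \<gamma> z - \<gamma>' z (y - z)) \<le> e * norm (y - z)"
        proof (intro exI[of _ "\<delta> / C"] conjI ballI impI)
          show "\<delta> / C > 0" using \<delta>(1) C by simp
          fix y assume y: "y \<in> Z" "norm (y - z) < \<delta> / C"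
          let ?k = "y - z" and ?m = "\<gamma> y - \<gamma> z"
          have "norm ?m \<le> 2 * norm (H y (\<gamma> y) - H y (\<gamma> z))"
            by (rule expand) (use y z \<gamma> in \<open>auto simp: Z_def\<close>)
          also have "\<dots> = 2 * norm (shoot y ?P - shoot z ?P)"
            using \<gamma>[OF y(1)] \<gamma>[OF z] by (simp add: H_def)
          also have "\<dots> \<le> 2 * (M * norm ?k)" using M(2) by simp
          finally have m: "norm ?m \<le> 2 * M * norm ?k" by simp
          have d: "(y, p + Lc (\<gamma> y)) - (z, ?P) = (?k, Lc ?m)"
            by (simp add: linear_diff[OF bounded_linear.linear[OF Lc_lin]])
          have "norm (?k, Lc ?m) \<le> norm ?k + K * (2 * M * norm ?k)"
            using norm_Pair_le[of ?k "Lc ?m"] Lc_bound[of ?m] mult_left_mono[OF m K0] by linarith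
          also have "\<dots> = C * norm ?k" by (simp add: C_def algebra_simps)
          finally have nd: "norm (?k, Lc ?m) \<le> C * norm ?k" .
          also have "\<dots> < \<delta>" using y(2) C by (simp add: field_simps)
          finally have "norm ((y, p + Lc (\<gamma> y)) - (z, ?P)) < \<delta>" unfolding d .
          from \<delta>(2)[OF this] have "norm (- lin_shoot (dflow z ?P) ?k (Lc ?m)) \<le> e' * norm (?k, Lc ?m)"
            using \<gamma>[OF y(1)] \<gamma>[OF z] unfolding d by (simp add: H_def)
          then have "norm (lin_shoot (dflow z ?P) ?k (Lc ?m)) \<le> e' * (C * norm ?k)"
            unfolding norm_minus_cancel by (rule order_trans) (rule mult_left_mono[OF nd], use e' in simp)
          moreover have "lin_shoot (dflow z ?P) ?k (Lc ?m) = N z ?k + ?B ?m"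
            by (subst lin_shoot_add) (simp add: N_def B_def)
          ultimately have err: "norm (N z ?k + ?B ?m) \<le> e' * (C * norm ?k)" by simp
          have "?B (?m - \<gamma>' z ?k) = N z ?k + ?B ?m"
            using Bz(1)[OF z] by (simp add: \<gamma>'_def linear_add[OF linB] bij_is_surj surj_f_inv_f)
          then have "norm (?m - \<gamma>' z ?k) \<le> 2 * (e' * (C * norm ?k))"
            using Bz(2)[OF z, of "?m - \<gamma>' z ?k"] err by simp
          also have "\<dots> = e * norm ?k" using C by (simp add: e'_def)
          finally show "norm (?m - \<gamma>' z ?k) \<le> e * norm ?k" .
        qed
      qed
      have "jac (N z) = 0" using \<gamma>[OF z] by (simp add: J_def N_def[abs_def])
      then have "\<not> inj (N z)" using det_nz_iff_inj[OF linN[of z]] by simp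
      then obtain x y where xy: "x \<noteq> y" "N z x = N z y" by (auto simp: inj_def)
      then have "\<gamma>' z x = \<gamma>' z y" by (simp add: \<gamma>'_def)
      then have "\<not> inj (\<gamma>' z)" using xy(1) by (auto simp: inj_def)
      then have "jac (\<gamma>' z) = 0" using det_nz_iff_inj[OF lin\<gamma>'] by simp
      then show "rank (matrix (\<gamma>' z)) < CARD(4)" using det_eq_0_rank by blast
    qed simp
    moreover have "\<not> negligible (ball (0 :: real^4) (min c0 (\<eta> / (K + 1))))"
    proof (rule open_not_negligible)
      have "\<eta> / (K + 1) > 0" using \<eta> K0 by (intro divide_pos_pos) auto
      then show "ball (0 :: real^4) (min c0 (\<eta> / (K + 1))) \<noteq> {}" using c0 by simp
    qed simp
    \<comment> \<open>A parameter as small as desired that no degenerate state uses; the radius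
      \<eta> / (K + 1) keeps the resulting forcing below \<eta>.\<close>
    ultimately obtain c where c: "c \<in> ball 0 (min c0 (\<eta> / (K + 1)))" "c \<notin> \<gamma> ` Z"
      by (meson negligible_subset subsetI)
    have nc: "norm c < c0" "norm c < \<eta> / (K + 1)" using c(1) by auto
    have "norm (Lc c) \<le> (K + 1) * norm c"
      using Lc_bound[of c] norm_ge_zero[of c] unfolding distrib_right mult_1_left by linarith
    also have "\<dots> < \<eta>" using nc(2) K0 by (simp add: field_simps)
    finally have small: "norm (Lc c) < \<eta>" .
    have "jac (\<lambda>k. lin_shoot (dflow z (p + Lc c)) k 0) \<noteq> 0" if z: "z \<in> cball z0 r" "shoot z (p + Lc c) = 0" for z
    proof
      assume "jac (\<lambda>k. lin_shoot (dflow z (p + Lc c)) k 0) = 0"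
      then have "z \<in> Z" using z nc(1) by (auto simp: Z_def H_def J_def intro!: exI[of _ c])
      moreover have "norm (\<gamma> z - c) \<le> 2 * norm (H z (\<gamma> z) - H z c)"
        by (rule expand) (use z nc(1) \<gamma>[OF \<open>z \<in> Z\<close>] in auto)
      then have "\<gamma> z = c" using \<gamma>[OF \<open>z \<in> Z\<close>] z(2) by (simp add: H_def)
      ultimately show False using c(2) by blast
    qed
    then show ?thesis
      using small Lc_int Lc_clamp by (intro exI[of _ "Lc c"]) auto
  qed
  then show ?thesis using r by blast
qed

end

section \<open>Closedness and density of the generic conditions\<close>

lemma closed_projection:
  fixes S :: "'a::metric_space set" and X :: "('a \<times> 'b::metric_space) set"
  assumes "compact S" "closed X"
  shows "closed {p. \<exists>z\<in>S. (z, p) \<in> X}"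
  unfolding closed_sequential_limits
proof (intro allI impI)
  fix f l assume *: "(\<forall>n. f n \<in> {p. \<exists>z\<in>S. (z, p) \<in> X}) \<and> f \<longlonglongrightarrow> l"
  then have "\<forall>n. \<exists>z. z \<in> S \<and> (z, f n) \<in> X" by blast
  from choice[OF this] obtain g where g: "\<And>n. g n \<in> S" "\<And>n. (g n, f n) \<in> X" by blast
  from assms(1)[unfolded compact_def, rule_format, of g] g(1)
  obtain z r where z: "z \<in> S" "strict_mono r" "(g \<circ> r) \<longlonglongrightarrow> z" by blast
  have "(f \<circ> r) \<longlonglongrightarrow> l" using * z(2) by (intro LIMSEQ_subseq_LIMSEQ) auto
  with z(3) have "(\<lambda>n. ((g \<circ> r) n, (f \<circ> r) n)) \<longlonglongrightarrow> (z, l)" by (rule tendsto_Pair)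
  then have "(z, l) \<in> X" by (rule closed_sequentially[OF assms(2), rotated]) (use g(2) in simp)
  then show "l \<in> {p. \<exists>z\<in>S. (z, p) \<in> X}" using z(1) by blast
qed

context planar_force
begin

lemma continuous_on_shoot_jac: "continuous_on UNIV (\<lambda>x. jac (\<lambda>k. lin_shoot (dflow (fst x) (snd x)) k 0))"
  by (rule continuous_on_jac) (rule continuous_on_lin_shoot_dflow)

lemma closed_degenerate:
  "closed {x. shoot (fst x) (snd x) = 0 \<and> jac (\<lambda>k. lin_shoot (dflow (fst x) (snd x)) k 0) = 0}"
  by (intro closed_Collect_conj closed_Collect_eq continuous_on_shoot continuous_on_shoot_jac continuous_on_const)

lemma closed_far: "closed {x. \<forall>t. norm (flow (fst x) (snd x) t) \<ge> d}"
  by (intro closed_Collect_all closed_Collect_le continuous_on_const continuous_on_norm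
      bounded_linear.continuous_on[OF bounded_linear_eval] continuous_on_flow)

end

text \<open>With states in a compact ball and a fixed clearance, this is a projection of a closed
  set along a compact factor, hence closed.\<close>

definition degenerate_forcing :: "real \<Rightarrow> real \<Rightarrow> real \<Rightarrow> (real \<Rightarrow>\<^sub>C (real^2)) set" where
  "degenerate_forcing q d N = {p. \<exists>z\<in>cball 0 N. periodic_data q p d z \<and> shoot_jac q p d z = 0}"

lemma closed_degenerate_forcing:
  assumes "q \<ge> 2" "d > 0"
  shows "closed (degenerate_forcing q d N)"
proof -
  interpret planar_force "cforce q d" "cforce_deriv q d" "cforce_lip q d"
    by (rule planar_force_cforce) (use assms in auto)
  have "closed ({x. \<forall>t. norm (flow (fst x) (snd x) t) \<ge> d} \<inter> {x. shoot (fst x) (snd x) = 0 \<and> jac (\<lambda>k. lin_shoot (dflow (fst x) (snd x)) k 0) = 0})"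
    by (intro closed_Int closed_far closed_degenerate)
  from closed_projection[OF compact_cball[of 0 N] this] show ?thesis
    by (simp add: degenerate_forcing_def periodic_data_def shoot_jac_def conj_assoc)
qed

text \<open>\<open>local_density\<close> removes degeneracy near a single orbit. Compactness leaves
  finitely many neighbourhoods, treated one after another by perturbations so small that earlier
  gains persist and no periodic orbit appears outside the neighbourhoods.\<close>

lemma degenerate_forcing_dense_complement:
  fixes p0 :: "real \<Rightarrow>\<^sub>C (real^2)"
  assumes q: "q \<ge> 2" and d: "d > 0" and \<eta>: "\<eta> > 0"
  shows "\<exists>\<psi> :: real \<Rightarrow>\<^sub>C (real^2). norm \<psi> < \<eta> \<and> integral {0..1} (apply_bcontfun \<psi>) = 0 \<and>
      (\<forall>t. apply_bcontfun \<psi> (clamp01 t) = apply_bcontfun \<psi> t) \<and> p0 + \<psi> \<notin> degenerate_forcing q d N"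
proof -
  interpret planar_force "cforce q d" "cforce_deriv q d" "cforce_lip q d"
    by (rule planar_force_cforce[OF q d])
  \<comment> \<open>The admissible perturbations, those that come from zero-mean functions on [0,1]
    extended constantly.\<close>
  define Zc where "Zc = {\<psi> :: real \<Rightarrow>\<^sub>C (real^2). integral {0..1} (apply_bcontfun \<psi>) = 0 \<and> (\<forall>t. apply_bcontfun \<psi> (clamp01 t) = apply_bcontfun \<psi> t)}"
  have Zc_0: "0 \<in> Zc" by (simp add: Zc_def)
  have Zc_add: "\<psi> + \<psi>' \<in> Zc" if "\<psi> \<in> Zc" "\<psi>' \<in> Zc" for \<psi> \<psi>'
  proof -
    have "integral {0..1} (\<lambda>t. apply_bcontfun \<psi> t + apply_bcontfun \<psi>' t) = integral {0..1} (apply_bcontfun \<psi>) + integral {0..1} (apply_bcontfun \<psi>')"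
      by (rule integral_add) (rule integrable_bcontfun)+
    moreover have "apply_bcontfun (\<psi> + \<psi>') = (\<lambda>t. apply_bcontfun \<psi> t + apply_bcontfun \<psi>' t)" by (simp add: fun_eq_iff)
    ultimately show ?thesis using that by (simp add: Zc_def)
  qed
  define nd where "nd p z \<longleftrightarrow> (shoot z p = 0 \<longrightarrow> jac (\<lambda>k. lin_shoot (dflow z p) k 0) \<noteq> 0)" for p z
  \<comment> \<open>Only states that are periodic for \<open>p0\<close> itself need a neighbourhood;
    other states in the ball are excluded at the end by closedness.\<close>
  define K where "K = {z \<in> cball 0 N. periodic_data q p0 d z}"
  have cl: "closed ({x. \<forall>t. norm (flow (fst x) (snd x) t) \<ge> d} \<inter> {x. shoot (fst x) (snd x) = 0})"
    by (intro closed_Int closed_far closed_Collect_eq continuous_on_shoot continuous_on_const)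
  have pd: "periodic_data q p d z \<longleftrightarrow> (z, p) \<in> {x. \<forall>t. norm (flow (fst x) (snd x) t) \<ge> d} \<inter> {x. shoot (fst x) (snd x) = 0}" for z p
    by (simp add: periodic_data_def)
  have "closed ((\<lambda>z. (z, p0)) -` ({x. \<forall>t. norm (flow (fst x) (snd x) t) \<ge> d} \<inter> {x. shoot (fst x) (snd x) = 0}))"
    by (rule closed_vimage[OF cl]) (intro continuous_intros)
  then have "compact (cball 0 N \<inter> (\<lambda>z. (z, p0)) -` ({x. \<forall>t. norm (flow (fst x) (snd x) t) \<ge> d} \<inter> {x. shoot (fst x) (snd x) = 0}))"
    by (intro compact_Int_closed compact_cball)
  moreover have "cball 0 N \<inter> (\<lambda>z. (z, p0)) -` ({x. \<forall>t. norm (flow (fst x) (snd x) t) \<ge> d} \<inter> {x. shoot (fst x) (snd x) = 0}) = K"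
    unfolding K_def pd by auto
  ultimately have "compact K" by simp
  have "\<forall>z\<in>K. \<exists>r>0. \<forall>p \<eta>. norm (p - p0) < r \<and> \<eta> > 0 \<longrightarrow>
    (\<exists>\<psi>. norm \<psi> < \<eta> \<and> \<psi> \<in> Zc \<and> (\<forall>z'\<in>cball z r. nd (p + \<psi>) z'))"
  proof
    fix z assume "z \<in> K"
    then have "norm (flow z p0 (1/2)) \<ge> d" by (simp add: K_def periodic_data_def)
    then have "k = 0" if "blinfun_apply (cforce_deriv q d (flow z p0 (1/2))) k = 0" for k
      using cforce_deriv_inj[OF d _ q] that by (simp add: cforce_deriv_apply)
    from local_density[OF this]
    show "\<exists>r>0. \<forall>p \<eta>. norm (p - p0) < r \<and> \<eta> > 0 \<longrightarrow>
      (\<exists>\<psi>. norm \<psi> < \<eta> \<and> \<psi> \<in> Zc \<and> (\<forall>z'\<in>cball z r. nd (p + \<psi>) z'))"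
      unfolding Zc_def nd_def by auto
  qed
  from bchoice[OF this] obtain r where r: "\<And>z. z \<in> K \<Longrightarrow> r z > 0"
    "\<And>z p \<eta>. z \<in> K \<Longrightarrow> norm (p - p0) < r z \<Longrightarrow> \<eta> > 0 \<Longrightarrow> \<exists>\<psi>. norm \<psi> < \<eta> \<and> \<psi> \<in> Zc \<and> (\<forall>z'\<in>cball z (r z). nd (p + \<psi>) z')"
    by blast
  have "K \<subseteq> (\<Union>z\<in>K. ball z (r z))" using r(1) by force
  then obtain T where T: "T \<subseteq> K" "finite T" "K \<subseteq> (\<Union>z\<in>T. ball z (r z))"
    using compactE_image[OF \<open>compact K\<close>, of K "\<lambda>z. ball z (r z)"] by auto
  have step: "\<forall>\<eta>>0. \<exists>\<psi>\<in>Zc. norm \<psi> < \<eta> \<and> (\<forall>z\<in>T. \<forall>z'\<in>cball z (r z). nd (p0 + \<psi>) z')"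
    using T(2) T(1)
  proof (induction T rule: finite_induct)
    case empty
    show ?case using Zc_0 by (auto intro!: bexI[of _ 0])
  next
    case (insert x T)
    show ?case
    proof (intro allI impI)
      fix \<eta> :: real assume "\<eta> > 0"
      have x: "x \<in> K" "r x > 0" using insert.prems r(1) by auto
      have "min (\<eta> / 2) (r x) > 0" using \<open>\<eta> > 0\<close> x by simp
      then obtain \<psi> where \<psi>: "\<psi> \<in> Zc" "norm \<psi> < min (\<eta> / 2) (r x)" "\<forall>z\<in>T. \<forall>z'\<in>cball z (r z). nd (p0 + \<psi>) z'"
        using insert.IH insert.prems by blast
      define S where "S = (\<Union>z\<in>T. cball z (r z))"
      have "compact S" unfolding S_def by (intro compact_UN insert.hyps) auto
      \<comment> \<open>Nondegeneracy on the compact set \<open>S\<close> treated so far is an open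
        condition on the forcing, which fixes how small the next perturbation has to be.\<close>
      from closed_projection[OF this closed_degenerate]
      have "closed {p. \<exists>z\<in>S. \<not> nd p z}" by (simp add: nd_def)
      then have "open (- {p. \<exists>z\<in>S. \<not> nd p z})" by (rule open_Compl)
      moreover have "p0 + \<psi> \<in> - {p. \<exists>z\<in>S. \<not> nd p z}" using \<psi>(3) by (auto simp: S_def)
      ultimately obtain \<rho> where \<rho>: "\<rho> > 0" "ball (p0 + \<psi>) \<rho> \<subseteq> - {p. \<exists>z\<in>S. \<not> nd p z}"
        by (meson open_contains_ball)
      have "norm (p0 + \<psi> - p0) < r x" "min (\<eta> / 2) \<rho> > 0" using \<psi>(2) \<rho>(1) \<open>\<eta> > 0\<close> by auto
      from r(2)[OF x(1) this] obtain \<psi>' where \<psi>': "norm \<psi>' < min (\<eta> / 2) \<rho>" "\<psi>' \<in> Zc" "\<forall>z'\<in>cball x (r x). nd (p0 + \<psi> + \<psi>') z'"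
        by blast
      have "p0 + \<psi> + \<psi>' \<in> ball (p0 + \<psi>) \<rho>" using \<psi>'(1) by (simp add: dist_norm)
      then have "\<forall>z\<in>S. nd (p0 + \<psi> + \<psi>') z" using \<rho>(2) by blast
      then have "\<forall>z\<in>insert x T. \<forall>z'\<in>cball z (r z). nd (p0 + (\<psi> + \<psi>')) z'"
        using \<psi>'(3) by (auto simp: S_def add.assoc)
      moreover have "norm (\<psi> + \<psi>') < \<eta>" using norm_triangle_ineq[of \<psi> \<psi>'] \<psi>(2) \<psi>'(1) by simp
      ultimately show "\<exists>\<psi>\<in>Zc. norm \<psi> < \<eta> \<and> (\<forall>z\<in>insert x T. \<forall>z'\<in>cball z (r z). nd (p0 + \<psi>) z')"
        using Zc_add[OF \<psi>(1) \<psi>'(2)] by blast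
    qed
  qed
  \<comment> \<open>Outside the finite cover \<open>p0\<close> has no periodic state, and by
    compactness neither do nearby forcings.\<close>
  have "compact (cball 0 N - (\<Union>z\<in>T. ball z (r z)))" by (intro compact_diff compact_cball open_UN) auto
  from closed_projection[OF this cl]
  have "closed {p. \<exists>z\<in>cball 0 N - (\<Union>z\<in>T. ball z (r z)). periodic_data q p d z}" unfolding pd .
  then have "open (- {p. \<exists>z\<in>cball 0 N - (\<Union>z\<in>T. ball z (r z)). periodic_data q p d z})" by (rule open_Compl)
  moreover have "p0 \<in> - {p. \<exists>z\<in>cball 0 N - (\<Union>z\<in>T. ball z (r z)). periodic_data q p d z}"
    using T(3) by (auto simp: K_def)
  ultimately obtain \<rho> where \<rho>: "\<rho> > 0" "ball p0 \<rho> \<subseteq> - {p. \<exists>z\<in>cball 0 N - (\<Union>z\<in>T. ball z (r z)). periodic_data q p d z}"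
    by (meson open_contains_ball)
  have "min \<eta> \<rho> > 0" using \<eta> \<rho> by simp
  with step obtain \<psi> where \<psi>: "\<psi> \<in> Zc" "norm \<psi> < min \<eta> \<rho>" "\<forall>z\<in>T. \<forall>z'\<in>cball z (r z). nd (p0 + \<psi>) z'" by blast
  have "p0 + \<psi> \<notin> degenerate_forcing q d N"
  proof
    assume "p0 + \<psi> \<in> degenerate_forcing q d N"
    then obtain z where z: "z \<in> cball 0 N" "periodic_data q (p0 + \<psi>) d z" "shoot_jac q (p0 + \<psi>) d z = 0"
      by (auto simp: degenerate_forcing_def)
    have "p0 + \<psi> \<in> ball p0 \<rho>" using \<psi>(2) by (simp add: dist_norm)
    then have "z \<in> (\<Union>z\<in>T. ball z (r z))" using \<rho>(2) z(1,2) by blast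
    then have "nd (p0 + \<psi>) z" using \<psi>(3) by force
    then show False using z by (simp add: nd_def periodic_data_def shoot_jac_def)
  qed
  then show ?thesis using \<psi> by (auto simp: Zc_def)
qed

text \<open>The same number bounds the state and the inverse clearance, so each periodic orbit is
  subject to all conditions from some n on.\<close>

definition generic_forcing :: "real \<Rightarrow> nat \<Rightarrow> (real \<Rightarrow> real^2) set" where
  "generic_forcing q n = {x \<in> mspace C0_per. ext01 x \<notin> degenerate_forcing q (1 / real (Suc n)) (real (Suc n))}"

lemma mspace_C0_perD:
  assumes "x \<in> mspace C0_per"
  shows "continuous_on {0..1} x" "integral {0..1} x = 0" "x \<in> extensional {0..1}"
  using assms by (auto simp: mspace_C0_per)

lemma dist_ext01_le:
  assumes "x \<in> mspace C0_per" "y \<in> mspace C0_per"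
  shows "dist (ext01 x) (ext01 y) \<le> mdist C0_per x y"
proof (rule dist_bound)
  fix t
  have "continuous_on {0..1} (\<lambda>t. norm (x t - y t))"
    using mspace_C0_perD(1)[OF assms(1)] mspace_C0_perD(1)[OF assms(2)] by (intro continuous_intros)
  then have "bdd_above ((\<lambda>t. norm (x t - y t)) ` {0..1})"
    by (intro bounded_imp_bdd_above compact_imp_bounded compact_continuous_image compact_Icc)
  then have "norm (x (clamp01 t) - y (clamp01 t)) \<le> (SUP t\<in>{0..1}. norm (x t - y t))"
    by (intro cSUP_upper clamp01(1))
  then show "dist (ext01 x t) (ext01 y t) \<le> mdist C0_per x y"
    unfolding mdist_C0_per[OF assms] using assms by (simp add: ext01_apply mspace_C0_perD dist_norm)
qed

lemma openin_generic_forcing: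
  assumes "q \<ge> 2"
  shows "openin (mtopology_of C0_per) (generic_forcing q n)"
proof -
  interpret M: Metric_space "mspace C0_per" "mdist C0_per" by (rule Metric_space_mspace_mdist)
  let ?B = "degenerate_forcing q (1 / real (Suc n)) (real (Suc n))"
  have "open (- ?B)" by (intro open_Compl closed_degenerate_forcing assms) simp
  show ?thesis
    unfolding mtopology_of_def M.openin_mtopology
  proof (intro conjI allI impI)
    show "generic_forcing q n \<subseteq> mspace C0_per" by (auto simp: generic_forcing_def)
    fix x assume x: "x \<in> generic_forcing q n"
    then have xM: "x \<in> mspace C0_per" "ext01 x \<in> - ?B" by (auto simp: generic_forcing_def)
    then obtain r where r: "r > 0" "ball (ext01 x) r \<subseteq> - ?B"
      using \<open>open (- ?B)\<close> open_contains_ball by blast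
    have "M.mball x r \<subseteq> generic_forcing q n"
    proof
      fix y assume "y \<in> M.mball x r"
      then have y: "y \<in> mspace C0_per" "mdist C0_per x y < r" by auto
      then have "ext01 y \<in> ball (ext01 x) r" using dist_ext01_le[OF xM(1) y(1)] by simp
      then show "y \<in> generic_forcing q n" using r(2) y(1) by (auto simp: generic_forcing_def)
    qed
    then show "\<exists>r>0. M.mball x r \<subseteq> generic_forcing q n" using r(1) by blast
  qed
qed

lemma dense_generic_forcing:
  assumes "q \<ge> 2"
  shows "mtopology_of C0_per closure_of generic_forcing q n = topspace (mtopology_of C0_per)"
proof -
  interpret M: Metric_space "mspace C0_per" "mdist C0_per" by (rule Metric_space_mspace_mdist)
  have "\<exists>y\<in>generic_forcing q n. y \<in> M.mball x r" if x: "x \<in> mspace C0_per" and r: "r > 0" for x r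
  proof -
    obtain \<psi> :: "real \<Rightarrow>\<^sub>C (real^2)" where \<psi>: "norm \<psi> < r" "integral {0..1} (apply_bcontfun \<psi>) = 0"
      "\<And>t. apply_bcontfun \<psi> (clamp01 t) = apply_bcontfun \<psi> t"
      "ext01 x + \<psi> \<notin> degenerate_forcing q (1 / real (Suc n)) (real (Suc n))"
      using degenerate_forcing_dense_complement[OF assms _ r, of "1 / real (Suc n)" "ext01 x" "real (Suc n)"] by auto
    define y where "y = (\<lambda>t\<in>{0..1}. x t + apply_bcontfun \<psi> t)"
    have cx: "continuous_on {0..1} x" and ix: "integral {0..1} x = 0" using mspace_C0_perD[OF x] by auto
    have cy: "continuous_on {0..1} y"
      unfolding y_def by (subst continuous_on_cong[OF refl, where g="\<lambda>t. x t + apply_bcontfun \<psi> t"]) (auto intro!: continuous_intros cx)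
    have "integral {0..1} y = integral {0..1} (\<lambda>t. x t + apply_bcontfun \<psi> t)"
      by (rule integral_cong) (simp add: y_def)
    also have "\<dots> = 0"
      using integral_add[OF integrable_continuous_real[OF cx] integrable_bcontfun[of \<psi>]] ix \<psi>(2) by simp
    finally have yM: "y \<in> mspace C0_per" using cy by (simp add: mspace_C0_per y_def)
    have "ext01 y = ext01 x + \<psi>"
      by (rule bcontfun_eqI) (simp add: ext01_apply[OF cy] ext01_apply[OF cx], simp add: y_def clamp01 \<psi>(3))
    then have "y \<in> generic_forcing q n" using yM \<psi>(4) by (simp add: generic_forcing_def)
    moreover have "mdist C0_per x y \<le> norm \<psi>"
      unfolding mdist_C0_per[OF x yM]
      by (rule cSUP_least) (use norm_bounded[of \<psi>] in \<open>auto simp: y_def\<close>)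
    ultimately show ?thesis using x yM \<psi>(1) by (intro bexI[of _ y]) auto
  qed
  then have "M.mtopology closure_of generic_forcing q n = mspace C0_per"
    unfolding M.metric_closure_of by auto
  then show ?thesis by (simp add: mtopology_of_def)
qed

lemma residual_generic_forcing:
  assumes "q \<ge> 2"
  shows "residual_in (mtopology_of C0_per) (\<Inter>n. generic_forcing q n)"
  unfolding residual_in_def
proof (intro conjI exI[of _ "generic_forcing q"] allI subset_refl)
  show "(\<Inter>n. generic_forcing q n) \<subseteq> topspace (mtopology_of C0_per)"
    by (auto simp: generic_forcing_def)
qed (auto intro: openin_generic_forcing[OF assms] simp: dense_generic_forcing[OF assms] simp del: topspace_mtopology_of)

section \<open>Periodic solutions from bounded components\<close>

lemma det_4:
  "det (A :: 'a::comm_ring_1^4^4) =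
    A$1$1 * (A$2$2 * (A$3$3 * A$4$4 - A$3$4 * A$4$3) - A$2$3 * (A$3$2 * A$4$4 - A$3$4 * A$4$2) + A$2$4 * (A$3$2 * A$4$3 - A$3$3 * A$4$2))
  - A$1$2 * (A$2$1 * (A$3$3 * A$4$4 - A$3$4 * A$4$3) - A$2$3 * (A$3$1 * A$4$4 - A$3$4 * A$4$1) + A$2$4 * (A$3$1 * A$4$3 - A$3$3 * A$4$1))
  + A$1$3 * (A$2$1 * (A$3$2 * A$4$4 - A$3$4 * A$4$2) - A$2$2 * (A$3$1 * A$4$4 - A$3$4 * A$4$1) + A$2$4 * (A$3$1 * A$4$2 - A$3$2 * A$4$1))
  - A$1$4 * (A$2$1 * (A$3$2 * A$4$3 - A$3$3 * A$4$2) - A$2$2 * (A$3$1 * A$4$3 - A$3$3 * A$4$1) + A$2$3 * (A$3$1 * A$4$2 - A$3$2 * A$4$1))"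
proof -
  have f1234: "finite {2::4, 3, 4}" "1 \<notin> {2::4, 3, 4}"
    and f234: "finite {3::4, 4}" "2 \<notin> {3::4, 4}"
    and f34: "finite {4::4}" "3 \<notin> {4::4}"
    by auto
  show ?thesis
    unfolding det_def UNIV_4
    unfolding sum_over_permutations_insert[OF f1234]
    unfolding sum_over_permutations_insert[OF f234]
    unfolding sum_over_permutations_insert[OF f34]
    unfolding permutes_sing
    by (simp add: sign_swap_id permutation_swap_id permutation_compose sign_compose sign_id swap_id_eq algebra_simps)
qed

lemma axis_4_pack:
  "axis 1 1 = pack (axis 1 1) 0" "axis 2 1 = pack (axis 2 1) 0"
  "axis 3 1 = pack 0 (axis 1 1)" "axis 4 1 = pack 0 (axis 2 1)"
  by (simp_all add: pack_def axis_def vec_eq_iff forall_4)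

lemma matrix_entry: "matrix f $ i $ j = f (axis j 1) $ i"
  by (simp add: matrix_def)

lemma pack_component:
  "pack x v $ 1 = x $ 1" "pack x v $ 2 = x $ 2" "pack x v $ 3 = v $ 1" "pack x v $ 4 = v $ 2"
  by (simp_all add: pack_def)

lemma component_pos_vel: "z $ 1 = pos z $ 1" "z $ 2 = pos z $ 2" "z $ 3 = vel z $ 1" "z $ 4 = vel z $ 2"
  by (simp_all add: pos_def vel_def)

lemma pack_add: "pack x v + pack x' v' = pack (x + x') (v + v')"
  by (simp add: pack_def vec_eq_iff)

lemma pack_scaleR: "c *\<^sub>R pack x v = pack (c *\<^sub>R x) (c *\<^sub>R v)"
  by (simp add: pack_def vec_eq_iff)

lemma pack_diff: "pack x v - pack x' v' = pack (x - x') (v - v')"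
  by (simp add: pack_def vec_eq_iff)

lemma pos_linear: "pos (x + y) = pos x + pos y" "pos (x - y) = pos x - pos y" "pos (c *\<^sub>R x) = c *\<^sub>R pos x" "pos 0 = 0"
  by (simp_all add: pos_def vec_eq_iff)

lemma vel_linear: "vel (x + y) = vel x + vel y" "vel (x - y) = vel x - vel y" "vel (c *\<^sub>R x) = c *\<^sub>R vel x" "vel 0 = 0"
  by (simp_all add: vel_def vec_eq_iff)

text \<open>The Schur complement: \<open>m\<close> solves the position equation for the velocity.\<close>

lemma jac_schur:
  fixes D :: "real^4 \<Rightarrow> real^4" and m :: "real^2 \<Rightarrow> real^2"
  assumes D: "linear D" and m: "linear m" and Dm: "\<And>e. pos (D (pack e (m e))) = 0"
  shows "jac D = det (matrix (\<lambda>f. pos (D (pack 0 f)))) * det (matrix (\<lambda>e. vel (D (pack e (m e)))))"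
proof -
  \<comment> \<open>A shear of determinant 1. After it the position block of the first two columns
    is zero by \<open>Dm\<close>; interchanging two blocks of size two costs no sign.\<close>
  define X where "X z = pack (pos z) (vel z + m (pos z))" for z
  have "linear X"
    by (rule linearI) (simp_all add: X_def pack_add pack_scaleR pos_linear vel_linear linear_add[OF m] linear_scale[OF m] algebra_simps)
  have X: "X (pack e 0) = pack e (m e)" "X (pack 0 f) = pack 0 f" for e f
    by (simp_all add: X_def linear_0[OF m])
  have "jac X = 1"
    unfolding det_4 matrix_entry axis_4_pack X pack_component by (simp add: axis_def)
  moreover have "jac (D \<circ> X) = det (matrix (\<lambda>f. pos (D (pack 0 f)))) * det (matrix (\<lambda>e. vel (D (pack e (m e)))))"
    unfolding det_4 det_2 matrix_entry
    unfolding o_def axis_4_pack X component_pos_vel Dm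
    by (simp add: algebra_simps)
  moreover have "jac (D \<circ> X) = jac D * jac X"
    by (simp add: matrix_compose[OF \<open>linear X\<close> D] det_mul)
  ultimately show ?thesis by simp
qed

text \<open>No symmetry of \<open>S\<close> is assumed: the quadratic form gives 4ad \<ge> (b +
  c)^2, and (b + c)^2 = (b - c)^2 + 4bc.\<close>

lemma det_2_psd:
  fixes S :: "real^2 \<Rightarrow> real^2"
  assumes S: "linear S" and psd: "\<And>e. e \<bullet> S e \<ge> 0"
  shows "det (matrix S) \<ge> 0"
proof -
  define a b c d where "a = S (axis 1 1) $ 1" and "b = S (axis 2 1) $ 1" and "c = S (axis 1 1) $ 2" and "d = S (axis 2 1) $ 2"
  have form: "x * x * a + x * y * (b + c) + y * y * d \<ge> 0" for x y
  proof -
    have v: "(vector [x, y] :: real^2) = x *\<^sub>R axis 1 1 + y *\<^sub>R axis 2 1"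
      by (simp add: vec_eq_iff forall_2 axis_def)
    have "S (vector [x, y]) = x *\<^sub>R S (axis 1 1) + y *\<^sub>R S (axis 2 1)"
      unfolding v by (simp add: linear_add[OF S] linear_scale[OF S])
    then have "(vector [x, y] :: real^2) \<bullet> S (vector [x, y]) = x * x * a + x * y * (b + c) + y * y * d"
      by (simp add: inner_vec_def sum_2 a_def b_def c_def d_def algebra_simps)
    then show ?thesis using psd[of "vector [x, y]"] by simp
  qed
  have a: "a \<ge> 0" and d: "d \<ge> 0" using form[of 1 0] form[of 0 1] by simp_all
  have "4 * a * d \<ge> (b + c)^2"
  proof (cases "a = 0")
    case True
    have "b + c = 0"
    proof (rule ccontr)
      assume n: "b + c \<noteq> 0"
      have "- (d + 1) / (b + c) * (b + c) + d \<ge> 0" using form[of "- (d + 1) / (b + c)" 1] True by simp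
      then show False using n by simp
    qed
    then show ?thesis using True by simp
  next
    case False
    have "(b + c) * (b + c) * a - (b + c) * (2 * a) * (b + c) + (2 * a) * (2 * a) * d \<ge> 0"
      using form[of "- (b + c)" "2 * a"] by (simp add: algebra_simps)
    moreover have "(b + c) * (b + c) * a - (b + c) * (2 * a) * (b + c) + (2 * a) * (2 * a) * d = a * (4 * a * d - (b + c)^2)"
      by (simp add: algebra_simps power2_eq_square)
    ultimately have "a * (4 * a * d - (b + c)^2) \<ge> 0" by simp
    then show ?thesis using a False by (simp add: zero_le_mult_iff)
  qed
  then have "4 * (a * d - b * c) \<ge> (b - c)^2" by (simp add: algebra_simps power2_eq_square)
  from order_trans[OF zero_le_power2 this] have "a * d - b * c \<ge> 0" by simp
  then show ?thesis by (simp add: det_2 matrix_def a_def b_def c_def d_def)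
qed

text \<open>This is where the even dimension of the reduced variable enters: a nonpositive form at a
  maximum has the determinant of the opposite, nonnegative one.\<close>

lemma det_2_neg: "linear S \<Longrightarrow> det (matrix (\<lambda>e::real^2. - S e)) = det (matrix S)" for S :: "real^2 \<Rightarrow> real^2"
  by (simp add: det_2 matrix_def)

section \<open>The potential of the curve in a bounded component\<close>

definition potential :: "real \<Rightarrow> (real \<Rightarrow> real^2) \<Rightarrow> real^2 \<Rightarrow> real" where
  "potential q H \<xi> = integral {0..1} (\<lambda>t. norm (\<xi> - H t) powr (1 - q))"

lemma continuous_potential_integrand:
  assumes "continuous_on {0..1} H" "\<xi> \<notin> H ` {0..1}"
  shows "continuous_on {0..1} (\<lambda>t. norm (\<xi> - H t) powr c)"
  using assms by (intro continuous_intros) auto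

text \<open>Near \<open>t0\<close> the distance to the curve is at most d + \<Lambda> |t - t0| and
  at most 1, so with q - 1 \<ge> 1 the integrand dominates the reciprocal of this bound. Its
  integral grows like - ln d, so q = 2 is just enough for divergence.\<close>

lemma potential_lower_bound:
  assumes q: "q \<ge> 2" and lip: "\<And>s t. s \<in> {0..1} \<Longrightarrow> t \<in> {0..1} \<Longrightarrow> norm (H s - H t) \<le> \<Lambda> * \<bar>s - t\<bar>" and \<Lambda>: "\<Lambda> \<ge> 1"
    and cH: "continuous_on {0..1} H" and \<xi>: "\<xi> \<notin> H ` {0..1}" and t0: "t0 \<in> {0..1}" "norm (\<xi> - H t0) \<le> d" and d: "0 < d" "d \<le> 1/2"
  shows "potential q H \<xi> \<ge> (ln (1/2) - ln d) / \<Lambda>"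
proof -
  \<comment> \<open>Of length at most 1/2, the interval fits into [0,1] on one side of
    \<open>t0\<close>; and \<Lambda> \<tau> = 1/2 together with d \<le> 1/2 keeps the distance at
    most 1.\<close>
  define \<tau> where "\<tau> = 1 / (2 * \<Lambda>)"
  have \<tau>: "\<tau> > 0" "\<tau> \<le> 1/2" "\<Lambda> * \<tau> = 1/2" using \<Lambda> by (auto simp: \<tau>_def field_simps)
  let ?f = "\<lambda>t. 1 / (d + \<Lambda> * \<bar>t - t0\<bar>)"
  have "\<exists>a b. a \<le> b \<and> {a..b} \<subseteq> {0..1} \<and> (\<forall>t\<in>{a..b}. \<bar>t - t0\<bar> \<le> \<tau>) \<and> (?f has_integral (ln (d + 1/2) - ln d) / \<Lambda>) {a..b}"
  proof (cases "t0 \<le> 1/2")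
    case True
    have "((\<lambda>t. 1 / (d + \<Lambda> * (t - t0))) has_integral ln (d + \<Lambda> * (t0 + \<tau> - t0)) / \<Lambda> - ln (d + \<Lambda> * (t0 - t0)) / \<Lambda>) {t0..t0 + \<tau>}"
    proof (rule fundamental_theorem_of_calculus)
      fix t assume t: "t \<in> {t0..t0 + \<tau>}"
      have pos: "d + \<Lambda> * (t - t0) > 0" using d \<Lambda> t by (intro add_pos_nonneg) auto
      then show "((\<lambda>t. ln (d + \<Lambda> * (t - t0)) / \<Lambda>) has_vector_derivative 1 / (d + \<Lambda> * (t - t0))) (at t within {t0..t0 + \<tau>})"
        unfolding has_real_derivative_iff_has_vector_derivative[symmetric]
        using \<Lambda> pos by (auto intro!: derivative_eq_intros)
    qed (use \<tau> in simp)
    then have "((\<lambda>t. 1 / (d + \<Lambda> * (t - t0))) has_integral (ln (d + 1/2) - ln d) / \<Lambda>) {t0..t0 + \<tau>}"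
      using \<tau>(3) by (simp add: diff_divide_distrib)
    then have "(?f has_integral (ln (d + 1/2) - ln d) / \<Lambda>) {t0..t0 + \<tau>}"
      by (rule has_integral_eq[rotated]) auto
    then show ?thesis using True \<tau> t0 by (intro exI[of _ t0] exI[of _ "t0 + \<tau>"]) auto
  next
    case False
    have "((\<lambda>t. 1 / (d + \<Lambda> * (t0 - t))) has_integral - ln (d + \<Lambda> * (t0 - t0)) / \<Lambda> - (- ln (d + \<Lambda> * (t0 - (t0 - \<tau>))) / \<Lambda>)) {t0 - \<tau>..t0}"
    proof (rule fundamental_theorem_of_calculus)
      fix t assume t: "t \<in> {t0 - \<tau>..t0}"
      have pos: "d + \<Lambda> * (t0 - t) > 0" using d \<Lambda> t by (intro add_pos_nonneg) auto
      then show "((\<lambda>t. - ln (d + \<Lambda> * (t0 - t)) / \<Lambda>) has_vector_derivative 1 / (d + \<Lambda> * (t0 - t))) (at t within {t0 - \<tau>..t0})"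
        unfolding has_real_derivative_iff_has_vector_derivative[symmetric]
        using \<Lambda> pos by (auto intro!: derivative_eq_intros)
    qed (use \<tau> in simp)
    then have "((\<lambda>t. 1 / (d + \<Lambda> * (t0 - t))) has_integral (ln (d + 1/2) - ln d) / \<Lambda>) {t0 - \<tau>..t0}"
      using \<tau>(3) by (simp add: diff_divide_distrib)
    then have "(?f has_integral (ln (d + 1/2) - ln d) / \<Lambda>) {t0 - \<tau>..t0}"
      by (rule has_integral_eq[rotated]) auto
    then show ?thesis using False \<tau> t0 by (intro exI[of _ "t0 - \<tau>"] exI[of _ t0]) auto
  qed
  then obtain a b where ab: "a \<le> b" "{a..b} \<subseteq> {0..1}" "\<And>t. t \<in> {a..b} \<Longrightarrow> \<bar>t - t0\<bar> \<le> \<tau>"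
    "(?f has_integral (ln (d + 1/2) - ln d) / \<Lambda>) {a..b}" by blast
  note c = continuous_potential_integrand[OF cH \<xi>, of "1 - q"]
  have "(ln (1/2) - ln d) / \<Lambda> \<le> (ln (d + 1/2) - ln d) / \<Lambda>"
    using d \<Lambda> by (intro divide_right_mono diff_right_mono) auto
  also have "\<dots> = integral {a..b} ?f" using ab(4) by (simp add: integral_unique)
  also have "\<dots> \<le> integral {a..b} (\<lambda>t. norm (\<xi> - H t) powr (1 - q))"
  proof (rule integral_le)
    show "?f integrable_on {a..b}" using ab(4) by blast
    show "(\<lambda>t. norm (\<xi> - H t) powr (1 - q)) integrable_on {a..b}"
      by (intro integrable_continuous_real continuous_on_subset[OF c] ab(2))
    fix t assume t: "t \<in> {a..b}"
    then have t01: "t \<in> {0..1}" using ab(2) by auto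
    have n: "norm (\<xi> - H t) > 0" using \<xi> t01 by auto
    have "norm (\<xi> - H t) \<le> norm (\<xi> - H t0) + norm (H t0 - H t)"
      using norm_triangle_ineq[of "\<xi> - H t0" "H t0 - H t"] by simp
    also have "\<dots> \<le> d + \<Lambda> * \<bar>t - t0\<bar>" using t0(2) lip[OF t0(1) t01] by (simp add: abs_minus_commute)
    finally have le: "norm (\<xi> - H t) \<le> d + \<Lambda> * \<bar>t - t0\<bar>" .
    also have "\<dots> \<le> d + \<Lambda> * \<tau>" using ab(3)[OF t] \<Lambda> by simp
    finally have le1: "norm (\<xi> - H t) \<le> 1" using \<tau>(3) d by simp
    have "?f t \<le> 1 / norm (\<xi> - H t)" by (rule divide_left_mono[OF le]) (use less_le_trans[OF n le] n in \<open>auto intro!: mult_pos_pos\<close>)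
    also have "\<dots> = norm (\<xi> - H t) powr (- 1)" using n by (simp add: powr_minus_divide)
    also have "\<dots> \<le> norm (\<xi> - H t) powr (1 - q)" using q le1 n by (intro powr_mono') auto
    finally show "?f t \<le> norm (\<xi> - H t) powr (1 - q)" .
  qed
  also have "\<dots> \<le> potential q H \<xi>"
    unfolding potential_def
    by (rule integral_subset_le[OF ab(2)])
      (auto intro!: integrable_continuous_real continuous_on_subset[OF c] ab(2))
  finally show ?thesis .
qed

text \<open>A component can only be left across the curve, so its points at distance at least
  \<delta> form a compact set when it is bounded. The high values reach as far as
  \<open>2 * \<delta>\<close>, so a minimiser over that set stays off its edge, even after a small
  perturbation of the functional.\<close>

lemma potential_well:
  assumes q: "q \<ge> 2" and lip: "\<And>s t. s \<in> {0..1} \<Longrightarrow> t \<in> {0..1} \<Longrightarrow> norm (H s - H t) \<le> \<Lambda> * \<bar>s - t\<bar>" and \<Lambda>: "\<Lambda> \<ge> 1"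
    and cH: "continuous_on {0..1} H" and C: "C \<in> bounded_components (- (H ` {0..1}))"
  shows "\<exists>\<xi>0 \<delta>. \<delta> > 0 \<and> \<xi>0 \<in> C \<and> infdist \<xi>0 (H ` {0..1}) \<ge> \<delta> \<and> open C \<and>
    compact {\<xi>\<in>C. infdist \<xi> (H ` {0..1}) \<ge> \<delta>} \<and>
    (\<forall>\<xi>\<in>C. infdist \<xi> (H ` {0..1}) < 2 * \<delta> \<longrightarrow> potential q H \<xi> > potential q H \<xi>0 + 1)"
proof -
  let ?I = "H ` {0..1}"
  have I: "compact ?I" "?I \<noteq> {}" using cH by (auto intro!: compact_continuous_image)
  have C': "C \<in> components (- ?I)" "bounded C" using C by (auto simp: bounded_components_def)
  have "open (- ?I)" using compact_imp_closed[OF I(1)] by (rule open_Compl)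
  then have "open C" using C'(1) by (rule open_components)
  obtain \<xi>0 where \<xi>0: "\<xi>0 \<in> C" using in_components_nonempty[OF C'(1)] by blast
  have sub: "C \<subseteq> - ?I" using in_components_subset[OF C'(1)] .
  define N where "N = potential q H \<xi>0 + 1"
  \<comment> \<open>Chosen so that the logarithmic lower bound at distance \<open>d0\<close> is at
    least |N| + 1.\<close>
  define d0 where "d0 = min (1/2) (exp (- (\<Lambda> * (\<bar>N\<bar> + 1) - ln (1/2))))"
  have d0: "d0 > 0" "d0 \<le> 1/2" by (auto simp: d0_def)
  have "ln d0 \<le> - (\<Lambda> * (\<bar>N\<bar> + 1) - ln (1/2))"
    using d0(1) by (metis d0_def exp_gt_zero ln_exp ln_mono min.cobounded2)
  then have "\<Lambda> * (\<bar>N\<bar> + 1) \<le> ln (1/2) - ln d0" by simp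
  then have "\<bar>N\<bar> + 1 \<le> (ln (1/2) - ln d0) / \<Lambda>" using \<Lambda> by (simp add: pos_le_divide_eq mult.commute)
  then have big: "(ln (1/2) - ln d0) / \<Lambda> > N" by linarith
  have "infdist \<xi>0 ?I > 0"
    using infdist_pos_not_in_closed[OF compact_imp_closed[OF I(1)] I(2)] \<xi>0 sub by auto
  define \<delta> where "\<delta> = min (infdist \<xi>0 ?I) (d0 / 2)"
  have \<delta>: "\<delta> > 0" "\<delta> \<le> infdist \<xi>0 ?I" "2 * \<delta> \<le> d0" using \<open>infdist \<xi>0 ?I > 0\<close> d0 by (auto simp: \<delta>_def)
  have near: "potential q H \<xi> > N" if \<xi>: "\<xi> \<in> C" "infdist \<xi> ?I < 2 * \<delta>" for \<xi>
  proof -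
    obtain y where y: "y \<in> ?I" "infdist \<xi> ?I = dist \<xi> y"
      using infdist_attains_inf[OF compact_imp_closed[OF I(1)] I(2)] by blast
    then obtain t0 where t0: "t0 \<in> {0..1}" "y = H t0" by blast
    have "norm (\<xi> - H t0) \<le> d0" using y(2) t0(2) \<xi>(2) \<delta>(3) by (simp add: dist_norm)
    moreover have "\<xi> \<notin> ?I" using \<xi>(1) sub by blast
    ultimately show ?thesis
      using potential_lower_bound[OF q lip \<Lambda> cH _ t0(1) _ d0] big by (meson less_le_trans)
  qed
  \<comment> \<open>A component is closed relative to the complement of the curve; keeping a
    distance from the curve makes it closed in the plane.\<close>
  have "closedin (top_of_set (- ?I)) C" by (rule closedin_component[OF C'(1)])
  then obtain T where T: "closed T" "C = - ?I \<inter> T" unfolding closedin_closed by blast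
  have "{\<xi>\<in>C. infdist \<xi> ?I \<ge> \<delta>} = T \<inter> {\<xi>. \<delta> \<le> infdist \<xi> ?I}"
  proof -
    have "infdist \<xi> ?I = 0" if "\<xi> \<in> ?I" for \<xi> using that by (rule infdist_zero)
    then show ?thesis using T(2) \<delta>(1) by fastforce
  qed
  moreover have "closed {\<xi>. \<delta> \<le> infdist \<xi> ?I}"
    by (intro closed_Collect_le continuous_on_const continuous_on_infdist continuous_on_id)
  ultimately have "closed {\<xi>\<in>C. infdist \<xi> ?I \<ge> \<delta>}" using T(1) by auto
  moreover have "bounded {\<xi>\<in>C. infdist \<xi> ?I \<ge> \<delta>}" using C'(2) by (rule bounded_subset) auto
  ultimately have "compact {\<xi>\<in>C. infdist \<xi> ?I \<ge> \<delta>}" by (simp add: compact_eq_bounded_closed)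
  then show ?thesis
    using \<delta> \<xi>0 near \<open>open C\<close> unfolding N_def by blast
qed

section \<open>Lyapunov-Schmidt reduction for a weak force\<close>

lemma lin_shoot_pos:
  assumes "norm A \<le> L" "L \<le> 1"
  shows "norm (pos (lin_shoot A k 0) - vel k) \<le> 2 * vconst 1 * L * norm k"
proof -
  have L: "0 \<le> L" using assms norm_ge_zero[of A] by linarith
  let ?y = "lin_flow A k 0"
  have "norm ?y \<le> 2 * vconst 1 * norm k" by (rule norm_lin_flow) (use assms in simp)
  note f = this
  have "lin_flow A k 0 1 = pos k + primitive (const_bcontfun (vel k) + primitive (opmult A ?y)) 1"
    by (subst lin_flow_eq) (simp add: lin_vflow_def)
  also have "\<dots> = pos k + vel k + primitive (primitive (opmult A ?y)) 1"
    by (simp add: primitive_add) (simp add: primitive_apply clamp01)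
  finally have "pos (lin_shoot A k 0) - vel k = primitive (primitive (opmult A ?y)) 1"
    by (simp add: lin_shoot_def)
  also have "norm \<dots> \<le> norm (opmult A ?y)"
    by (rule order_trans[OF norm_bounded norm_primitive2])
  also have "\<dots> \<le> L * (2 * vconst 1 * norm k)"
    by (rule order_trans[OF norm_opmult]) (intro mult_mono assms f L norm_ge_zero)
  finally show ?thesis by (simp add: mult_ac)
qed

lemma increment_le:
  fixes f :: "real \<Rightarrow> 'a::real_normed_vector"
  assumes "\<And>t. t \<in> {0..1} \<Longrightarrow> (f has_vector_derivative f' t) (at t within {0..1})"
    and "\<And>t. t \<in> {0..1} \<Longrightarrow> norm (f' t) \<le> B" and t: "t \<in> {0..1}"
  shows "norm (f t - f 0) \<le> B"
proof -
  have B: "0 \<le> B" using assms(2)[OF t] norm_ge_zero[of "f' t"] by linarith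
  have "norm (f t - f 0) \<le> B * norm (t - 0)"
  proof (rule differentiable_bound[where f'="\<lambda>t h. h *\<^sub>R f' t" and S="{0..1}"])
    show "(f has_derivative (\<lambda>h. h *\<^sub>R f' x)) (at x within {0..1})" if "x \<in> {0..1}" for x
      using assms(1)[OF that] by (simp add: has_vector_derivative_def)
    show "onorm (\<lambda>h. h *\<^sub>R f' x) \<le> B" if "x \<in> {0..1}" for x
      by (rule onorm_bound[OF B]) (use assms(2)[OF that] in \<open>simp add: mult.commute[of B] mult_left_mono\<close>)
  qed (use t in auto)
  also have "\<dots> \<le> B" using t B by (simp add: mult_left_le)
  finally show ?thesis .
qed

lemma gradient_remainder:
  fixes U :: "'a::real_inner \<Rightarrow> real"
  assumes U: "\<And>y. y \<in> S \<Longrightarrow> (U has_derivative (\<lambda>k. G y \<bullet> k)) (at y)"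
    and G: "\<And>x y. norm (G x - G y) \<le> L * norm (x - y)" and L: "L \<ge> 0"
    and S: "convex S" "a \<in> S" "b \<in> S"
  shows "\<bar>U b - U a - G a \<bullet> (b - a)\<bar> \<le> L * (norm (b - a))\<^sup>2"
proof -
  have sub: "closed_segment a b \<subseteq> S" using S by (rule closed_segment_subset[rotated 2])
  have "norm ((U b - G a \<bullet> b) - (U a - G a \<bullet> a)) \<le> (L * norm (b - a)) * norm (b - a)"
  proof (rule differentiable_bound[where f="\<lambda>y. U y - G a \<bullet> y" and f'="\<lambda>y k. G y \<bullet> k - G a \<bullet> k" and S="closed_segment a b"])
    show "((\<lambda>y. U y - G a \<bullet> y) has_derivative (\<lambda>k. G y \<bullet> k - G a \<bullet> k)) (at y within closed_segment a b)"
      if y: "y \<in> closed_segment a b" for y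
      by (intro has_derivative_at_withinI[OF has_derivative_diff[OF U has_derivative_inner_right[OF has_derivative_ident]]])
        (use sub y in auto)
    show "onorm (\<lambda>k. G y \<bullet> k - G a \<bullet> k) \<le> L * norm (b - a)" if y: "y \<in> closed_segment a b" for y
    proof (rule onorm_bound)
      show "0 \<le> L * norm (b - a)" using L by simp
      fix k
      have "norm (G y \<bullet> k - G a \<bullet> k) \<le> norm (G y - G a) * norm k"
        using Cauchy_Schwarz_ineq2[of "G y - G a" k] by (simp add: inner_diff_left)
      also have "\<dots> \<le> (L * norm (b - a)) * norm k"
        using segment_bound(1)[OF y] L by (intro mult_right_mono order_trans[OF G] mult_left_mono) auto
      finally show "norm (G y \<bullet> k - G a \<bullet> k) \<le> L * norm (b - a) * norm k" .
    qed
  qed auto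
  then show ?thesis by (simp add: inner_diff_right power2_eq_square algebra_simps)
qed

text \<open>\<open>H\<close> is minus a second primitive of the forcing \<open>f\<close>, so an orbit \<open>y\<close> of the weakly perturbed
  equation satisfies \<open>y + H \<approx> const\<close>.\<close>

locale weak_force = planar_force G DG L for G DG L +
  fixes U :: "real^2 \<Rightarrow> real" and H H1 :: "real \<Rightarrow> real^2" and f :: "real \<Rightarrow>\<^sub>C (real^2)" and \<rho> M :: real
  assumes H: "t \<in> {0..1} \<Longrightarrow> (H has_vector_derivative H1 t) (at t within {0..1})"
    and H1: "t \<in> {0..1} \<Longrightarrow> (H1 has_vector_derivative - f t) (at t within {0..1})"
    and H_per: "H 1 = H 0" "H1 1 = H1 0"
    and U: "norm y \<ge> \<rho> \<Longrightarrow> (U has_derivative (\<lambda>k. G y \<bullet> k)) (at y)"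
    and G_bound: "norm (G y) \<le> M" and M_small: "2 * M \<le> \<rho>" and \<rho>: "\<rho> > 0"
    and L_small: "L \<le> 1" "4 * vconst 1 * L \<le> 1"
begin

lemma M_nonneg: "M \<ge> 0" using G_bound[of 0] norm_ge_zero[of "G 0"] by linarith

lemma has_derivative_pos_shoot:
  "((\<lambda>z. pos (shoot z f)) has_derivative (\<lambda>k. pos (lin_shoot (dflow z f) k 0))) (at z)"
  by (rule bounded_linear.has_derivative[OF bounded_linear_pos has_derivative_shoot_left])

text \<open>In the absence of a force the position changes over one period by the velocity;
  \<open>L_small\<close> keeps the error of this approximation below one half, the contraction
  constant used below.\<close>

lemma pos_lin_shoot: "norm (pos (lin_shoot (dflow z f) k 0) - vel k) \<le> 1 / 2 * norm k"
proof -
  have "norm (pos (lin_shoot (dflow z f) k 0) - vel k) \<le> (2 * vconst 1 * L) * norm k"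
    by (rule lin_shoot_pos[OF norm_dflow L_small(1)])
  also have "\<dots> \<le> 1 / 2 * norm k" using L_small(2) by (intro mult_right_mono) auto
  finally show ?thesis .
qed

lemma pos_shoot_near:
  "norm ((pos (shoot z f) - vel z) - (pos (shoot z' f) - vel z')) \<le> 1 / 2 * norm (z - z')"
proof (rule differentiable_bound[where f'="\<lambda>z k. pos (lin_shoot (dflow z f) k 0) - vel k" and S=UNIV])
  show "((\<lambda>z. pos (shoot z f) - vel z) has_derivative (\<lambda>k. pos (lin_shoot (dflow x f) k 0) - vel k)) (at x within UNIV)" for x
    by (intro has_derivative_diff has_derivative_pos_shoot bounded_linear_imp_has_derivative bounded_linear_vel)
  show "onorm (\<lambda>k. pos (lin_shoot (dflow x f) k 0) - vel k) \<le> 1 / 2" for x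
    by (rule onorm_le) (rule pos_lin_shoot)
qed auto

text \<open>The first half of the reduction: returning to the same position determines the initial
  velocity, since subtracting \<open>pos (shoot _ f)\<close> from the velocity leaves a contraction
  by one half.\<close>

lemma ex1_start: "\<exists>!w. pos (shoot (pack x w) f) = 0"
proof -
  let ?T = "\<lambda>w. w - pos (shoot (pack x w) f)"
  have "\<exists>!w. ?T w = w"
  proof (rule banach_fix_type[where c="1/2"])
    show "\<forall>v w. dist (?T v) (?T w) \<le> 1 / 2 * dist v w"
    proof (intro allI)
      fix v w
      have "dist (?T v) (?T w) = norm ((pos (shoot (pack x v) f) - vel (pack x v)) - (pos (shoot (pack x w) f) - vel (pack x w)))"
        unfolding dist_norm by (subst norm_minus_commute) (simp add: algebra_simps)
      also have "\<dots> \<le> 1 / 2 * norm (pack x v - pack x w)" by (rule pos_shoot_near)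
      also have "\<dots> \<le> 1 / 2 * dist v w"
        using norm_pack[of 0 "v - w"] by (simp add: pack_diff dist_norm)
      finally show "dist (?T v) (?T w) \<le> 1 / 2 * dist v w" .
    qed
  qed auto
  then show ?thesis by simp
qed

text \<open>The initial state at \<open>\<xi> - H 0\<close> whose orbit returns to the same position at time \<open>1\<close>; the
  velocity need not return, and \<open>kick\<close> below is its jump.\<close>

definition start :: "real^2 \<Rightarrow> real^4" where
  "start \<xi> = pack (\<xi> - H 0) (THE w. pos (shoot (pack (\<xi> - H 0) w) f) = 0)"

lemma start: "pos (start \<xi>) = \<xi> - H 0" "pos (shoot (start \<xi>) f) = 0"
  using theI'[OF ex1_start, of "\<xi> - H 0"] by (simp_all add: start_def)

lemma start_lipschitz: "norm (start \<xi> - start \<xi>') \<le> 2 * norm (\<xi> - \<xi>')"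
proof -
  let ?v = "vel (start \<xi>) - vel (start \<xi>')"
  have "norm ?v \<le> 1 / 2 * norm (start \<xi> - start \<xi>')"
    using pos_shoot_near[of "start \<xi>" "start \<xi>'"] by (simp add: start norm_minus_commute)
  moreover have "start \<xi> - start \<xi>' = pack (\<xi> - \<xi>') ?v"
    using pack_diff[of "pos (start \<xi>)" "vel (start \<xi>)" "pos (start \<xi>')" "vel (start \<xi>')", unfolded pack_simps] by (simp add: start(1))
  ultimately show ?thesis
    using norm_pack[of "\<xi> - \<xi>'" ?v] by simp
qed

text \<open>\<open>disp\<close> is the orbit y itself. \<open>speed\<close> is the derivative of y +
  H, in which the forcing has cancelled, so that it changes only through the weak force.\<close>

definition disp where "disp \<xi> = flow (start \<xi>) f"
definition speed where "speed \<xi> t = vflow (start \<xi>) f t + H1 t"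
definition kick where "kick \<xi> = vel (shoot (start \<xi>) f)"

lemma disp_deriv: "t \<in> {0..1} \<Longrightarrow> ((\<lambda>t. disp \<xi> t + H t) has_vector_derivative speed \<xi> t) (at t within {0..1})"
  unfolding disp_def speed_def by (intro has_vector_derivative_add flow_deriv H)

lemma speed_deriv:
  assumes "t \<in> {0..1}" shows "(speed \<xi> has_vector_derivative G (disp \<xi> t)) (at t within {0..1})"
  using has_vector_derivative_add[OF flow_deriv(2)[OF assms] H1[OF assms], of "start \<xi>" f]
  by (simp add: disp_def speed_def[abs_def])

lemma disp_ends: "disp \<xi> 0 + H 0 = \<xi>" "disp \<xi> 1 + H 1 = \<xi>" "kick \<xi> = speed \<xi> 1 - speed \<xi> 0"
proof -
  show "disp \<xi> 0 + H 0 = \<xi>" using flow_deriv(3)[of 0 "start \<xi>" f] by (simp add: disp_def start)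
  show "disp \<xi> 1 + H 1 = \<xi>" using start(2)[of \<xi>] by (simp add: disp_def shoot_def start H_per)
  show "kick \<xi> = speed \<xi> 1 - speed \<xi> 0"
    using flow_deriv(4)[of 0 "start \<xi>" f] by (simp add: kick_def shoot_def speed_def H_per)
qed

lemma speed_bound:
  assumes "t \<in> {0..1}"
  shows "norm (speed \<xi> t) \<le> 2 * M" "norm (disp \<xi> t + H t - \<xi>) \<le> 2 * M"
proof -
  have d: "norm (speed \<xi> s - speed \<xi> 0) \<le> M" if "s \<in> {0..1}" for s
    by (rule increment_le[OF speed_deriv G_bound that])
  \<comment> \<open>As y + H has equal values at both ends, subtracting
    \<open>t *\<^sub>R speed \<xi> 0\<close> leaves a function whose increment is minus the initial
    speed and whose derivative is at most \<open>M\<close>.\<close>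
  have "norm ((disp \<xi> 1 + H 1 - 1 *\<^sub>R speed \<xi> 0) - (disp \<xi> 0 + H 0 - 0 *\<^sub>R speed \<xi> 0)) \<le> M"
  proof (rule increment_le[where f'="\<lambda>t. speed \<xi> t - 1 *\<^sub>R speed \<xi> 0"])
    show "((\<lambda>t. disp \<xi> t + H t - t *\<^sub>R speed \<xi> 0) has_vector_derivative speed \<xi> t - 1 *\<^sub>R speed \<xi> 0) (at t within {0..1})"
      if "t \<in> {0..1}" for t
      by (intro has_vector_derivative_diff disp_deriv[OF that]) (auto intro!: derivative_eq_intros simp: has_vector_derivative_def)
  qed (use d in auto)
  then have 0: "norm (speed \<xi> 0) \<le> M" by (simp add: disp_ends)
  have s: "norm (speed \<xi> t) \<le> 2 * M" if "t \<in> {0..1}" for t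
    using 0 d[OF that] norm_triangle_ineq[of "speed \<xi> t - speed \<xi> 0" "speed \<xi> 0"] by simp
  then show "norm (speed \<xi> t) \<le> 2 * M" using assms by blast
  from increment_le[OF disp_deriv s assms]
  show "norm (disp \<xi> t + H t - \<xi>) \<le> 2 * M" by (simp add: disp_ends)
qed

lemma disp_away:
  assumes "t \<in> {0..1}" "norm (\<xi> - H t) \<ge> c + 2 * M" shows "norm (disp \<xi> t) \<ge> c"
proof -
  have "norm (\<xi> - H t) \<le> norm (disp \<xi> t) + norm (\<xi> - H t - disp \<xi> t)"
    using norm_triangle_ineq[of "disp \<xi> t" "\<xi> - H t - disp \<xi> t"] by simp
  also have "norm (\<xi> - H t - disp \<xi> t) = norm (disp \<xi> t + H t - \<xi>)"
    by (subst norm_minus_commute) (simp add: algebra_simps)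
  finally show ?thesis using speed_bound(2)[OF assms(1), of \<xi>] assms(2) by linarith
qed

lemma disp_lipschitz: "norm (disp \<xi>' - disp \<xi>) \<le> 4 * vconst 1 * norm (\<xi>' - \<xi>)"
proof -
  have "norm (disp \<xi>' - disp \<xi>) \<le> vconst L * norm (init (start \<xi>' - start \<xi>) 0)"
    unfolding disp_def flow_def init_diff[of _ f, symmetric] by (rule sol_lipschitz)
  also have "\<dots> \<le> vconst 1 * (2 * (2 * norm (\<xi>' - \<xi>)))"
    using vconst_pos[of 1] start_lipschitz[of \<xi>' \<xi>]
    by (intro mult_mono vconst_mono L_small order_trans[OF norm_init]) auto
  finally show ?thesis by simp
qed

lemma speed_lipschitz:
  assumes "t \<in> {0..1}" shows "norm (speed \<xi>' t - speed \<xi> t) \<le> 3 * norm (\<xi>' - \<xi>)"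
proof -
  let ?F = "force_along (disp \<xi>') - force_along (disp \<xi>)"
  have eq: "speed \<xi>' t - speed \<xi> t = vel (start \<xi>' - start \<xi>) + primitive ?F t"
    by (simp add: speed_def vflow_def disp_def primitive_add primitive_diff vel_linear)
  have *: "norm (speed \<xi>' t - speed \<xi> t) \<le> norm (start \<xi>' - start \<xi>) + norm ?F"
    unfolding eq
    by (rule order_trans[OF norm_triangle_ineq add_mono[OF norm_vel order_trans[OF norm_bounded norm_primitive]]])
  have "norm ?F \<le> L * norm (disp \<xi>' - disp \<xi>)"
  proof (rule norm_bound)
    fix s
    show "norm (apply_bcontfun ?F s) \<le> L * norm (disp \<xi>' - disp \<xi>)"
      unfolding minus_bcontfun.rep_eq
      by (rule order_trans[OF force_along_lipschitz mult_left_mono[OF norm_bounded[of "disp \<xi>' - disp \<xi>" s, unfolded minus_bcontfun.rep_eq] L_nonneg]])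
  qed
  also have "L * norm (disp \<xi>' - disp \<xi>) \<le> L * (4 * vconst 1 * norm (\<xi>' - \<xi>))" by (intro mult_left_mono disp_lipschitz L_nonneg)
  also have "\<dots> \<le> 1 * norm (\<xi>' - \<xi>)"
    using mult_right_mono[OF L_small(2), of "norm (\<xi>' - \<xi>)"] by (simp add: mult_ac)
  finally show ?thesis using * start_lipschitz[of \<xi>' \<xi>] by linarith
qed

text \<open>The Lagrangian action of the equation x'' = G(x - H) for x = y + H. The potential enters
  with a plus sign because \<open>U\<close> has gradient \<open>G\<close>.\<close>

definition action where
  "action \<xi> = integral {0..1} (\<lambda>t. (speed \<xi> t \<bullet> speed \<xi> t) / 2 + U (disp \<xi> t))"

lemma continuous_on_speed: "continuous_on {0..1} (speed \<xi>)"
  by (rule continuous_on_vector_derivative[OF speed_deriv])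

lemma continuous_on_U_disp:
  assumes "\<And>t. t \<in> {0..1} \<Longrightarrow> norm (\<xi> - H t) \<ge> 2 * \<rho>"
  shows "continuous_on {0..1} (\<lambda>t. U (disp \<xi> t))"
proof (rule continuous_on_compose2[where g=U and t="{y. norm y \<ge> \<rho>}"])
  show "continuous_on {y. \<rho> \<le> norm y} U"
    by (rule continuous_at_imp_continuous_on) (use has_derivative_continuous[OF U] in auto)
  show "apply_bcontfun (disp \<xi>) ` {0..1} \<subseteq> {y. \<rho> \<le> norm y}"
    using disp_away[of _ \<rho> \<xi>] assms M_small by force
qed auto

text \<open>The jump of the velocity is the gradient of the reduced action.\<close>

lemma action_expansion:
  assumes far: "\<And>t. t \<in> {0..1} \<Longrightarrow> norm (\<xi> - H t) \<ge> 3 * \<rho>" and near: "norm (\<xi>' - \<xi>) \<le> \<rho>"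
  shows "\<bar>action \<xi>' - action \<xi> - kick \<xi> \<bullet> (\<xi>' - \<xi>)\<bar> \<le> (5 + 4 * vconst 1) * (norm (\<xi>' - \<xi>))\<^sup>2"
proof -
  let ?\<kappa> = "4 * vconst 1" and ?n = "norm (\<xi>' - \<xi>)"
  define w where "w t = disp \<xi>' t - disp \<xi> t" for t
  define \<omega> where "\<omega> t = speed \<xi>' t - speed \<xi> t" for t
  have far': "norm (\<xi>' - H t) \<ge> 2 * \<rho>" "norm (\<xi> - H t) \<ge> 2 * \<rho>" if "t \<in> {0..1}" for t
    using far[OF that] near \<rho> norm_triangle_ineq2[of "\<xi> - H t" "\<xi> - \<xi>'"] by (simp_all add: norm_minus_commute)
  have b: "norm (w t) \<le> ?\<kappa> * ?n" for t
    unfolding w_def using disp_lipschitz[of \<xi>' \<xi>] norm_bounded[of "disp \<xi>' - disp \<xi>" t] by simp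
  have b\<omega>: "norm (\<omega> t) \<le> 3 * ?n" if "t \<in> {0..1}" for t unfolding \<omega>_def by (rule speed_lipschitz[OF that])
  have w': "(w has_vector_derivative \<omega> t) (at t within {0..1})" if "t \<in> {0..1}" for t
    using has_vector_derivative_diff[OF disp_deriv[OF that, of \<xi>'] disp_deriv[OF that, of \<xi>]] by (simp add: w_def[abs_def] \<omega>_def)
  \<comment> \<open>Integration by parts: the derivative of speed \<bullet> w. Since
    \<open>w\<close> takes the same value at both ends, the boundary terms combine to the jump of
    the speed.\<close>
  have "((\<lambda>t. speed \<xi> t \<bullet> \<omega> t + G (disp \<xi> t) \<bullet> w t) has_integral speed \<xi> 1 \<bullet> w 1 - speed \<xi> 0 \<bullet> w 0) {0..1}"
    by (rule fundamental_theorem_of_calculus)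
      (auto simp: has_real_derivative_iff_has_vector_derivative[symmetric] intro!: has_real_derivative_inner speed_deriv w')
  moreover have "w 0 = \<xi>' - \<xi>" "w 1 = \<xi>' - \<xi>"
    using disp_ends(1,2)[of \<xi>'] disp_ends(1,2)[of \<xi>] unfolding w_def by (metis add_diff_cancel_right)+
  ultimately have first: "((\<lambda>t. speed \<xi> t \<bullet> \<omega> t + G (disp \<xi> t) \<bullet> w t) has_integral kick \<xi> \<bullet> (\<xi>' - \<xi>)) {0..1}"
    by (simp add: disp_ends(3) inner_diff_left)
  have act: "((\<lambda>t. (speed \<zeta> t \<bullet> speed \<zeta> t) / 2 + U (disp \<zeta> t)) has_integral action \<zeta>) {0..1}" if "\<zeta> = \<xi> \<or> \<zeta> = \<xi>'" for \<zeta>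
    unfolding action_def using that far'
    by (intro integrable_integral integrable_continuous_real continuous_intros continuous_on_speed continuous_on_U_disp) auto
  \<comment> \<open>What remains is quadratic: 9/2 from the 3-Lipschitz speed, rounded up to 5, and
    \<open>L\<close> times the square of \<open>4 * vconst 1\<close> from the potential, reduced by
    \<open>L_small\<close> to one such factor.\<close>
  have rest: "norm (((speed \<xi>' t \<bullet> speed \<xi>' t) / 2 + U (disp \<xi>' t)) - ((speed \<xi> t \<bullet> speed \<xi> t) / 2 + U (disp \<xi> t))
      - (speed \<xi> t \<bullet> \<omega> t + G (disp \<xi> t) \<bullet> w t)) \<le> (5 + ?\<kappa>) * ?n\<^sup>2" if t: "t \<in> {0..1}" for t
  proof -
    have k: "(speed \<xi>' t \<bullet> speed \<xi>' t) / 2 - (speed \<xi> t \<bullet> speed \<xi> t) / 2 - speed \<xi> t \<bullet> \<omega> t = (norm (\<omega> t))\<^sup>2 / 2"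
      by (simp add: \<omega>_def power2_norm_eq_inner inner_diff inner_commute field_simps)
    have k2: "(norm (\<omega> t))\<^sup>2 \<le> 9 * ?n\<^sup>2" using power_mono[OF b\<omega>[OF t], of 2] by (simp add: power_mult_distrib)
    have "\<bar>U (disp \<xi>' t) - U (disp \<xi> t) - G (disp \<xi> t) \<bullet> (disp \<xi>' t - disp \<xi> t)\<bar> \<le> L * (norm (disp \<xi>' t - disp \<xi> t))\<^sup>2"
    proof (rule gradient_remainder[where S="cball (\<xi> - H t) (2 * \<rho>)"])
      show "(U has_derivative (\<lambda>k. G y \<bullet> k)) (at y)" if "y \<in> cball (\<xi> - H t) (2 * \<rho>)" for y
        by (rule U) (use that far[OF t] norm_triangle_ineq2[of "\<xi> - H t" "\<xi> - H t - y"] in \<open>simp add: dist_norm\<close>)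
      have "norm (\<xi> - H t - disp \<zeta> t) \<le> norm (\<xi> - \<zeta>) + 2 * M" for \<zeta>
        using norm_triangle_ineq4[of "\<xi> - \<zeta>" "disp \<zeta> t + H t - \<zeta>"] speed_bound(2)[OF t, of \<zeta>]
        by (simp add: algebra_simps)
      from this[of \<xi>] this[of \<xi>'] show "disp \<xi> t \<in> cball (\<xi> - H t) (2 * \<rho>)" "disp \<xi>' t \<in> cball (\<xi> - H t) (2 * \<rho>)"
        using near M_small \<rho> by (simp_all add: dist_norm norm_minus_commute)
    qed (auto intro: G_lipschitz L_nonneg)
    also have "\<dots> \<le> L * (?\<kappa> * ?n)\<^sup>2"
      using b[of t] by (intro mult_left_mono power_mono L_nonneg) (auto simp: w_def)
    also have "\<dots> = (?\<kappa> * L) * (?\<kappa> * ?n\<^sup>2)" by (simp add: power2_eq_square)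
    also have "\<dots> \<le> 1 * (?\<kappa> * ?n\<^sup>2)" using L_small(2) vconst_pos[of 1] by (intro mult_right_mono) auto
    finally have "\<bar>U (disp \<xi>' t) - U (disp \<xi> t) - G (disp \<xi> t) \<bullet> w t\<bar> \<le> ?\<kappa> * ?n\<^sup>2" by (simp add: w_def)
    moreover have "(5 + ?\<kappa>) * ?n\<^sup>2 = 5 * ?n\<^sup>2 + ?\<kappa> * ?n\<^sup>2" by (simp add: algebra_simps)
    ultimately show ?thesis using k k2 zero_le_power2[of ?n] zero_le_power2[of "norm (\<omega> t)"] unfolding real_norm_def by linarith
  qed
  have "norm (action \<xi>' - action \<xi> - kick \<xi> \<bullet> (\<xi>' - \<xi>)) \<le> (5 + ?\<kappa>) * ?n\<^sup>2 * measure lborel {0..1::real}"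
    by (rule has_integral_bound_real[where f="\<lambda>t. ((speed \<xi>' t \<bullet> speed \<xi>' t) / 2 + U (disp \<xi>' t)) - ((speed \<xi> t \<bullet> speed \<xi> t) / 2 + U (disp \<xi> t))
      - (speed \<xi> t \<bullet> \<omega> t + G (disp \<xi> t) \<bullet> w t)" and S="{}"])
      (use vconst_pos[of 1] in \<open>auto intro!: has_integral_diff act first rest[unfolded real_norm_def]\<close>)
  then show ?thesis by simp
qed

text \<open>The speed is at most \<open>2 * M\<close> and the orbit stays within
  \<open>2 * M\<close> of \<xi> - H: at most 2 M^2 from the kinetic term, and \<open>M\<close> times
  \<open>2 * M\<close> from the potential.\<close>

lemma action_approx:
  assumes far: "\<And>t. t \<in> {0..1} \<Longrightarrow> norm (\<xi> - H t) \<ge> 3 * \<rho>"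
  shows "\<bar>action \<xi> - integral {0..1} (\<lambda>t. U (\<xi> - H t))\<bar> \<le> 4 * M\<^sup>2"
proof -
  have far2: "norm (\<xi> - H t) \<ge> 2 * \<rho>" if "t \<in> {0..1}" for t using far[OF that] \<rho> by linarith
  have cH: "continuous_on {0..1} H" by (rule continuous_on_vector_derivative[OF H])
  have cU: "continuous_on {0..1} (\<lambda>t. U (\<xi> - H t))"
  proof (rule continuous_on_compose2[where g=U and t="{y. norm y \<ge> \<rho>}"])
    show "continuous_on {y. \<rho> \<le> norm y} U"
      by (rule continuous_at_imp_continuous_on) (use has_derivative_continuous[OF U] in auto)
    show "(\<lambda>t. \<xi> - H t) ` {0..1} \<subseteq> {y. \<rho> \<le> norm y}" using far2 \<rho> by force
  qed (intro continuous_intros cH)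
  have bound: "norm ((speed \<xi> t \<bullet> speed \<xi> t) / 2 + U (disp \<xi> t) - U (\<xi> - H t)) \<le> 4 * M\<^sup>2" if t: "t \<in> {0..1}" for t
  proof -
    have "(norm (speed \<xi> t))\<^sup>2 \<le> (2 * M)\<^sup>2" by (intro power_mono speed_bound t) simp
    then have 1: "speed \<xi> t \<bullet> speed \<xi> t \<le> 4 * M\<^sup>2" by (simp add: power2_norm_eq_inner power_mult_distrib)
    have "norm (U (disp \<xi> t) - U (\<xi> - H t)) \<le> M * norm (disp \<xi> t - (\<xi> - H t))"
    proof (rule differentiable_bound[where f'="\<lambda>y k. G y \<bullet> k" and S="cball (\<xi> - H t) (2 * \<rho>)"])
      show "(U has_derivative (\<lambda>k. G y \<bullet> k)) (at y within cball (\<xi> - H t) (2 * \<rho>))" if "y \<in> cball (\<xi> - H t) (2 * \<rho>)" for y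
        by (rule has_derivative_at_withinI, rule U)
          (use that far[OF t] norm_triangle_ineq2[of "\<xi> - H t" "\<xi> - H t - y"] in \<open>simp add: dist_norm\<close>)
      show "onorm (\<lambda>k. G y \<bullet> k) \<le> M" for y
        by (rule onorm_bound[OF M_nonneg])
          (metis Cauchy_Schwarz_ineq2 G_bound mult_right_mono norm_ge_zero order_trans real_norm_def)
      have "norm (\<xi> - H t - disp \<xi> t) = norm (disp \<xi> t + H t - \<xi>)" by (subst norm_minus_commute) (simp add: algebra_simps)
      also have "\<dots> \<le> 2 * \<rho>" using speed_bound(2)[OF t, of \<xi>] M_small \<rho> by linarith
      finally show "disp \<xi> t \<in> cball (\<xi> - H t) (2 * \<rho>)" by (simp add: dist_norm)
    qed (use \<rho> in auto)
    also have "disp \<xi> t - (\<xi> - H t) = disp \<xi> t + H t - \<xi>" by simp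
    also have "M * norm \<dots> \<le> M * (2 * M)" by (intro mult_left_mono speed_bound t M_nonneg)
    finally have 2: "\<bar>U (disp \<xi> t) - U (\<xi> - H t)\<bar> \<le> 2 * M\<^sup>2" by (simp add: power2_eq_square)
    then show ?thesis using 1 inner_ge_zero[of "speed \<xi> t"] unfolding real_norm_def by linarith
  qed
  have i1: "((\<lambda>t. (speed \<xi> t \<bullet> speed \<xi> t) / 2 + U (disp \<xi> t)) has_integral action \<xi>) {0..1}"
    unfolding action_def
    by (intro integrable_integral integrable_continuous_real continuous_intros continuous_on_speed continuous_on_U_disp far2) auto
  have i2: "((\<lambda>t. U (\<xi> - H t)) has_integral integral {0..1} (\<lambda>t. U (\<xi> - H t))) {0..1}"
    by (intro integrable_integral integrable_continuous_real cU)
  have "norm (action \<xi> - integral {0..1} (\<lambda>t. U (\<xi> - H t))) \<le> 4 * M\<^sup>2 * measure lborel {0..1::real}"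
    by (rule has_integral_bound_real[where f="\<lambda>t. (speed \<xi> t \<bullet> speed \<xi> t) / 2 + U (disp \<xi> t) - U (\<xi> - H t)" and S="{}"])
      (auto intro!: has_integral_diff i1 i2 bound[unfolded real_norm_def])
  then show ?thesis by simp
qed

lemma action_deriv:
  assumes far: "\<And>t. t \<in> {0..1} \<Longrightarrow> norm (\<xi> - H t) \<ge> 3 * \<rho>"
  shows "(action has_derivative (\<lambda>k. kick \<xi> \<bullet> k)) (at \<xi>)"
  unfolding has_derivative_at_alt
proof (intro conjI allI impI)
  show "bounded_linear (\<lambda>k. kick \<xi> \<bullet> k)" by (rule bounded_linear_inner_right)
  fix e :: real assume e: "e > 0"
  let ?C = "5 + 4 * vconst 1"
  have C: "?C > 0" using vconst_pos[of 1] by simp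
  show "\<exists>d>0. \<forall>y. norm (y - \<xi>) < d \<longrightarrow> norm (action y - action \<xi> - kick \<xi> \<bullet> (y - \<xi>)) \<le> e * norm (y - \<xi>)"
  proof (intro exI conjI allI impI)
    show "min \<rho> (e / ?C) > 0" using \<rho> e C by simp
    fix y assume y: "norm (y - \<xi>) < min \<rho> (e / ?C)"
    have "norm (action y - action \<xi> - kick \<xi> \<bullet> (y - \<xi>)) \<le> ?C * (norm (y - \<xi>))\<^sup>2"
      using action_expansion[OF far, of y] y by simp
    also have "\<dots> = (?C * norm (y - \<xi>)) * norm (y - \<xi>)" by (simp add: power2_eq_square)
    also have "\<dots> \<le> e * norm (y - \<xi>)"
      using y C by (intro mult_right_mono) (auto simp: pos_less_divide_eq mult.commute)
    finally show "norm (action y - action \<xi> - kick \<xi> \<bullet> (y - \<xi>)) \<le> e * norm (y - \<xi>)" .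
  qed
qed

lemma action_line_deriv:
  assumes far: "\<And>t. t \<in> {0..1} \<Longrightarrow> norm (\<xi> + \<tau> *\<^sub>R e - H t) \<ge> 3 * \<rho>"
  shows "((\<lambda>\<tau>. action (\<xi> + \<tau> *\<^sub>R e)) has_real_derivative kick (\<xi> + \<tau> *\<^sub>R e) \<bullet> e) (at \<tau>)"
proof -
  have "((\<lambda>\<tau>. \<xi> + \<tau> *\<^sub>R e) has_derivative (\<lambda>h. h *\<^sub>R e)) (at \<tau>)"
    by (auto intro!: derivative_eq_intros)
  from has_derivative_compose[OF this action_deriv[OF far]]
  have "((\<lambda>\<tau>. action (\<xi> + \<tau> *\<^sub>R e)) has_derivative (\<lambda>h. kick (\<xi> + \<tau> *\<^sub>R e) \<bullet> h *\<^sub>R e)) (at \<tau>)" by simp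
  then show ?thesis unfolding has_field_derivative_def by (rule has_derivative_eq_rhs) (auto simp: mult.commute)
qed

lemma far_line:
  assumes far: "\<And>t. t \<in> {0..1} \<Longrightarrow> norm (\<xi> - H t) \<ge> 4 * \<rho>" and "norm (\<tau> *\<^sub>R e) \<le> \<rho>" "t \<in> {0..1}"
  shows "norm (\<xi> + \<tau> *\<^sub>R e - H t) \<ge> 3 * \<rho>"
  using far[OF assms(3)] assms(2) norm_triangle_ineq4[of "\<xi> + \<tau> *\<^sub>R e - H t" "\<tau> *\<^sub>R e"] by simp

text \<open>Stated for a ray so that it serves both orders: with e the gradient it excludes a
  nonzero \<open>kick\<close>, and with e a direction of positive curvature it gives the
  second-order condition.\<close>

lemma local_max_no_increase:
  assumes far: "\<And>t. t \<in> {0..1} \<Longrightarrow> norm (\<xi> - H t) \<ge> 4 * \<rho>"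
    and max: "\<eta> > 0" "\<And>\<xi>'. norm (\<xi>' - \<xi>) \<le> \<eta> \<Longrightarrow> action \<xi>' \<le> action \<xi>"
    and pos: "\<theta> > 0" "\<And>\<tau>. 0 < \<tau> \<Longrightarrow> \<tau> < \<theta> \<Longrightarrow> kick (\<xi> + \<tau> *\<^sub>R e) \<bullet> e > 0"
  shows False
proof -
  define c where "c = min (\<theta> / 2) (min (\<eta> / (norm e + 1)) (\<rho> / (norm e + 1)))"
  have n: "norm e + 1 > 0" using norm_ge_zero[of e] by linarith
  have c: "c > 0" "c < \<theta>" using max(1) pos(1) \<rho> n by (auto simp: c_def)
  have "c \<le> \<eta> / (norm e + 1)" "c \<le> \<rho> / (norm e + 1)" by (simp_all add: c_def)
  then have c': "c * (norm e + 1) \<le> \<eta>" "c * (norm e + 1) \<le> \<rho>"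
    using pos_le_divide_eq[OF n] by blast+
  have ce: "\<tau> * norm e \<le> c * (norm e + 1)" if "0 \<le> \<tau>" "\<tau> \<le> c" for \<tau>
    using that by (intro mult_mono) auto
  have small: "norm (\<tau> *\<^sub>R e) \<le> \<rho>" "norm (\<tau> *\<^sub>R e) \<le> \<eta>" if "0 \<le> \<tau>" "\<tau> \<le> c" for \<tau>
    using ce[OF that] c' that(1) by simp_all
  note d = action_line_deriv[OF far_line[OF far small(1)]]
  have "action (\<xi> + 0 *\<^sub>R e) < action (\<xi> + c *\<^sub>R e)"
  proof (rule DERIV_pos_imp_increasing_open[OF c(1)])
    show "\<exists>y. ((\<lambda>\<tau>. action (\<xi> + \<tau> *\<^sub>R e)) has_real_derivative y) (at \<tau>) \<and> 0 < y" if "0 < \<tau>" "\<tau> < c" for \<tau>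
      using d[of \<tau>] pos(2)[of \<tau>] that c(2) by auto
    show "continuous_on {0..c} (\<lambda>\<tau>. action (\<xi> + \<tau> *\<^sub>R e))"
      by (intro continuous_at_imp_continuous_on ballI DERIV_isCont[OF d]) auto
  qed
  moreover have "action (\<xi> + c *\<^sub>R e) \<le> action \<xi>" by (rule max(2)) (use small(2)[of c] c(1) in simp)
  ultimately show False by simp
qed

text \<open>The linearisation of \<open>kick\<close> is the Schur complement \<open>S\<close> of the
  linearised shooting map, so the determinant factors into that of \<open>S\<close>, whose form is
  nonpositive, and that of the nearly identical block \<open>b\<close>.\<close>

lemma local_max_jac:
  assumes far: "\<And>t. t \<in> {0..1} \<Longrightarrow> norm (\<xi> - H t) \<ge> 4 * \<rho>"
    and max: "\<eta> > 0" "\<And>\<xi>'. norm (\<xi>' - \<xi>) \<le> \<eta> \<Longrightarrow> action \<xi>' \<le> action \<xi>"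
  shows "kick \<xi> = 0" "jac (\<lambda>k. lin_shoot (dflow (start \<xi>) f) k 0) \<ge> 0"
proof -
  have kick_cont: "\<exists>\<theta>>0. \<forall>\<tau>. 0 < \<tau> \<and> \<tau> < \<theta> \<longrightarrow> kick (\<xi> + \<tau> *\<^sub>R e) \<bullet> e > 0" if "kick \<xi> \<bullet> e > 0" for e
  proof -
    have "continuous_on UNIV start"
    proof (rule continuous_at_imp_continuous_on, rule ballI)
      show "isCont start x" for x
        unfolding continuous_at_eps_delta dist_norm
      proof (intro allI impI)
        fix \<epsilon> :: real assume "\<epsilon> > 0"
        then show "\<exists>d>0. \<forall>y. norm (y - x) < d \<longrightarrow> norm (start y - start x) < \<epsilon>"
          by (intro exI[of _ "\<epsilon> / 2"]) (auto intro: le_less_trans[OF start_lipschitz])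
      qed
    qed
    then have "continuous_on UNIV (\<lambda>\<tau>. start (\<xi> + \<tau> *\<^sub>R e))"
      by (rule continuous_on_compose2) (auto intro!: continuous_intros)
    then have "continuous_on UNIV (\<lambda>\<tau>. (start (\<xi> + \<tau> *\<^sub>R e), f))"
      by (intro continuous_on_Pair continuous_on_const)
    from continuous_on_compose2[OF continuous_on_shoot this]
    have "continuous_on UNIV (\<lambda>\<tau>. shoot (start (\<xi> + \<tau> *\<^sub>R e)) f)" by simp
    then have "continuous_on UNIV (\<lambda>\<tau>. kick (\<xi> + \<tau> *\<^sub>R e) \<bullet> e)"
      unfolding kick_def by (intro continuous_on_inner continuous_on_const bounded_linear.continuous_on[OF bounded_linear_vel])
    then have "open ((\<lambda>\<tau>. kick (\<xi> + \<tau> *\<^sub>R e) \<bullet> e) -` {0<..})"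
      by (rule open_vimage[OF open_greaterThan])
    moreover have "0 \<in> (\<lambda>\<tau>. kick (\<xi> + \<tau> *\<^sub>R e) \<bullet> e) -` {0<..}" using that by simp
    ultimately obtain \<theta> where \<theta>: "\<theta> > 0" "ball 0 \<theta> \<subseteq> (\<lambda>\<tau>. kick (\<xi> + \<tau> *\<^sub>R e) \<bullet> e) -` {0<..}"
      using open_contains_ball by blast
    have "kick (\<xi> + \<tau> *\<^sub>R e) \<bullet> e > 0" if "0 < \<tau>" "\<tau> < \<theta>" for \<tau>
    proof -
      have "\<tau> \<in> ball 0 \<theta>" using that by simp
      then show ?thesis using \<theta>(2) by auto
    qed
    then show ?thesis using \<theta>(1) by blast
  qed
  show k0: "kick \<xi> = 0"
  proof (rule ccontr)
    assume "kick \<xi> \<noteq> 0"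
    then obtain \<theta> where "\<theta> > 0" "\<And>\<tau>. 0 < \<tau> \<Longrightarrow> \<tau> < \<theta> \<Longrightarrow> kick (\<xi> + \<tau> *\<^sub>R kick \<xi>) \<bullet> kick \<xi> > 0"
      using kick_cont[of "kick \<xi>"] by auto
    then show False by (intro local_max_no_increase[OF far max, of \<theta> "kick \<xi>"]) auto
  qed
  define D where "D k = lin_shoot (dflow (start \<xi>) f) k 0" for k
  have D: "linear D" unfolding D_def[abs_def] by (rule linear_lin_shoot_left)
  define b where "b w = pos (D (pack 0 w))" for w
  have lb: "linear b"
    by (rule linearI) (auto simp: b_def pos_linear(1,3)[symmetric] linear_add[OF D, symmetric] linear_scale[OF D, symmetric] pack_add pack_scaleR)
  have la: "linear (\<lambda>e. pos (D (pack e 0)))"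
    by (rule linearI) (auto simp: pos_linear(1,3)[symmetric] linear_add[OF D, symmetric] linear_scale[OF D, symmetric] pack_add pack_scaleR)
  have near: "norm (b w - w) \<le> 1 / 2 * norm w" for w
    using pos_lin_shoot[of "start \<xi>" "pack 0 w"] norm_pack[of 0 w] by (simp add: b_def D_def)
  note bij = linear_near_id_bij[OF lb near]
  \<comment> \<open>The change of the initial velocity that, to first order, keeps the position
    periodic when the initial position moves by \<open>e\<close>.\<close>
  define m where "m e = inv b (- pos (D (pack e 0)))" for e
  have bm: "b (m e) = - pos (D (pack e 0))" for e
    unfolding m_def by (rule surj_f_inv_f) (rule bij_is_surj[OF bij(1)])
  have m: "linear m"
  proof (rule linearI)
    have inj: "inj b" by (rule bij_is_inj[OF bij(1)])
    show "m (x + y) = m x + m y" for x y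
      by (rule injD[OF inj]) (simp add: linear_add[OF lb] bm linear_add[OF la])
    show "m (c *\<^sub>R x) = c *\<^sub>R m x" for c x
      by (rule injD[OF inj]) (simp add: linear_scale[OF lb] bm linear_scale[OF la])
  qed
  have Dm: "pos (D (pack e (m e))) = 0" for e
  proof -
    have "pack e (m e) = pack e 0 + pack 0 (m e)" by (simp add: pack_add)
    then show ?thesis using bm[of e] by (simp add: linear_add[OF D] pos_linear b_def)
  qed
  define S where "S e = vel (D (pack e (m e)))" for e
  have S: "linear S"
    by (rule linearI)
      (auto simp: S_def vel_linear(1,3)[symmetric] linear_add[OF D, symmetric] linear_scale[OF D, symmetric] pack_add pack_scaleR linear_add[OF m] linear_scale[OF m])
  have neg: "e \<bullet> S e \<le> 0" for e
  proof (rule ccontr)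
    assume "\<not> e \<bullet> S e \<le> 0"
    then have eS: "e \<bullet> S e > 0" by simp
    then have e: "norm e > 0" by auto
    obtain K where K: "K > 0" "\<And>k. norm (D k) \<le> norm k * K"
      using bounded_linear.pos_bounded[OF linear_conv_bounded_linear[THEN iffD1, OF D]] by blast
    \<comment> \<open>The remainder reaches \<open>kick\<close> with a factor
      \<open>2 * K + 1\<close> and a displacement of at most \<open>2 * \<tau> * norm e\<close>;
      this \<epsilon> makes its contribution at most half of the leading term \<tau> (e \<bullet> S
      e).\<close>
    define \<epsilon> where "\<epsilon> = (e \<bullet> S e) / (4 * (2 * K + 1) * (norm e)\<^sup>2)"
    have \<epsilon>: "\<epsilon> > 0" "norm e * ((2 * K + 1) * (\<epsilon> * (2 * norm e))) = (e \<bullet> S e) / 2"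
    proof -
      have "s / (4 * p * n\<^sup>2) > 0 \<and> n * (p * (s / (4 * p * n\<^sup>2) * (2 * n))) = s / 2" if "s > 0" "p > 0" "n > 0" for s p n :: real
        using that by (simp add: power2_eq_square)
      from this[OF eS _ e, of "2 * K + 1"] show "\<epsilon> > 0" "norm e * ((2 * K + 1) * (\<epsilon> * (2 * norm e))) = (e \<bullet> S e) / 2"
        using K(1) unfolding \<epsilon>_def by auto
    qed
    have "((\<lambda>z. shoot z f) has_derivative D) (at (start \<xi>))"
      using has_derivative_shoot_left by (simp add: D_def[abs_def])
    then obtain d where d: "d > 0" "\<And>z. norm (z - start \<xi>) < d \<Longrightarrow>
        norm (shoot z f - shoot (start \<xi>) f - D (z - start \<xi>)) \<le> \<epsilon> * norm (z - start \<xi>)"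
      using \<epsilon>(1) unfolding has_derivative_at_alt by blast
    have z0: "shoot (start \<xi>) f = 0"
      using start(2)[of \<xi>] k0 unfolding kick_def by (metis pack_simps(3) pack_eq_0_iff)
    have "kick (\<xi> + \<tau> *\<^sub>R e) \<bullet> e > 0" if \<tau>: "0 < \<tau>" "\<tau> < d / (2 * norm e)" for \<tau>
    proof -
      define z k where "z = start (\<xi> + \<tau> *\<^sub>R e)" and "k = start (\<xi> + \<tau> *\<^sub>R e) - start \<xi>"
      have kn: "norm k \<le> 2 * (\<tau> * norm e)" using start_lipschitz[of "\<xi> + \<tau> *\<^sub>R e" \<xi>] \<tau> by (simp add: k_def)
      also have "\<dots> < d" using \<tau>(2) e by (simp add: field_simps)
      finally have "norm k < d" .
      define r where "r = shoot z f - D k"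
      have "norm r \<le> \<epsilon> * norm k" using d(2)[of z] \<open>norm k < d\<close> z0 by (simp add: r_def k_def z_def)
      also have "\<dots> \<le> \<epsilon> * (2 * (\<tau> * norm e))" using kn \<epsilon>(1) by (intro mult_left_mono) auto
      finally have r: "norm r \<le> \<tau> * (\<epsilon> * (2 * norm e))" by (simp only: mult_ac)
      \<comment> \<open>The deviation of the true velocity change from its first-order value. Since
        positions return exactly along \<open>start\<close>, \<open>b y\<close> is minus the
        position part of the remainder, and inverting \<open>b\<close> bounds
        \<open>y\<close>.\<close>
      define y where "y = vel k - \<tau> *\<^sub>R m e"
      have pk: "pos k = \<tau> *\<^sub>R e" by (simp add: k_def pos_linear start)
      have ky: "k = \<tau> *\<^sub>R pack e (m e) + pack 0 y"
        using pack_simps(3)[of k] by (simp add: pack_add pack_scaleR y_def pk)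
      have Dk: "D k = \<tau> *\<^sub>R D (pack e (m e)) + D (pack 0 y)"
        by (subst ky) (simp add: linear_add[OF D] linear_scale[OF D])
      have "b y = pos (D k)" by (simp add: Dk pos_linear Dm b_def)
      also have "\<dots> = - pos r" by (simp add: r_def pos_linear z_def start)
      finally have "norm (b y) \<le> norm r" using norm_pos[of r] by simp
      then have "norm y \<le> 2 * norm r" using bij(2)[of y] by linarith
      then have "norm (pack 0 y) \<le> 2 * norm r" using norm_pack[of 0 y] by simp
      then have "norm (D (pack 0 y)) \<le> 2 * norm r * K"
        using K(1) by (intro order_trans[OF K(2)] mult_right_mono) auto
      then have "norm (vel (D (pack 0 y) + r)) \<le> 2 * norm r * K + norm r"
        by (intro order_trans[OF norm_vel] order_trans[OF norm_triangle_ineq] add_mono) auto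
      also have "\<dots> = (2 * K + 1) * norm r" by (simp add: algebra_simps)
      also have "\<dots> \<le> (2 * K + 1) * (\<tau> * (\<epsilon> * (2 * norm e)))" using r K(1) by (intro mult_left_mono) auto
      finally have v: "norm (vel (D (pack 0 y) + r)) \<le> (2 * K + 1) * (\<tau> * (\<epsilon> * (2 * norm e)))" .
      have "kick (\<xi> + \<tau> *\<^sub>R e) = vel (D k + r)" by (simp add: r_def kick_def z_def)
      then have "kick (\<xi> + \<tau> *\<^sub>R e) = \<tau> *\<^sub>R S e + vel (D (pack 0 y) + r)" by (simp add: Dk vel_linear S_def)
      then have "kick (\<xi> + \<tau> *\<^sub>R e) \<bullet> e = \<tau> * (e \<bullet> S e) + e \<bullet> vel (D (pack 0 y) + r)"
        by (simp add: inner_add_left inner_add_right inner_commute)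
      moreover have "\<bar>e \<bullet> vel (D (pack 0 y) + r)\<bar> \<le> norm e * ((2 * K + 1) * (\<tau> * (\<epsilon> * (2 * norm e))))"
        by (rule order_trans[OF Cauchy_Schwarz_ineq2]) (intro mult_left_mono v norm_ge_zero)
      moreover have "norm e * ((2 * K + 1) * (\<tau> * (\<epsilon> * (2 * norm e)))) = \<tau> * ((e \<bullet> S e) / 2)"
        unfolding \<epsilon>(2)[symmetric] by (simp only: mult_ac)
      moreover have "\<tau> * (e \<bullet> S e) > 0" using \<tau> eS by simp
      ultimately show ?thesis by (auto simp: abs_le_iff)
    qed
    moreover have "d / (2 * norm e) > 0" using d(1) e by simp
    ultimately show False by (intro local_max_no_increase[OF far max, of "d / (2 * norm e)" e]) auto
  qed
  have "det (matrix b) \<ge> 0"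
  proof (rule det_2_psd[OF lb])
    fix w
    have "\<bar>w \<bullet> (b w - w)\<bar> \<le> norm w * (1 / 2 * norm w)"
      by (rule order_trans[OF Cauchy_Schwarz_ineq2]) (intro mult_left_mono near norm_ge_zero)
    then have "w \<bullet> (b w - w) \<ge> - ((norm w)\<^sup>2 / 2)" by (simp add: power2_eq_square abs_le_iff)
    then show "w \<bullet> b w \<ge> 0" using inner_ge_zero[of w] unfolding inner_diff_right power2_norm_eq_inner by linarith
  qed
  moreover have "det (matrix S) \<ge> 0"
    unfolding det_2_neg[OF S, symmetric]
    by (rule det_2_psd) (use neg S linear_compose_neg in auto)
  ultimately have "jac D \<ge> 0"
    unfolding jac_schur[OF D m Dm] b_def[abs_def, symmetric] S_def[abs_def, symmetric] by simp
  then show "jac (\<lambda>k. lin_shoot (dflow (start \<xi>) f) k 0) \<ge> 0" by (simp add: D_def[abs_def])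
qed

text \<open>The reduced action is maximised over the points at distance at least
  \<open>3 * \<rho>\<close> from the curve. The gap of 8 M^2 is twice the error in
  \<open>action_approx\<close>, so the maximum lies beyond \<open>6 * \<rho>\<close> and is a local
  maximum in the plane.\<close>

lemma exists_periodic:
  assumes C: "open C" "compact {\<xi>\<in>C. infdist \<xi> (H ` {0..1}) \<ge> 3 * \<rho>}"
    and \<xi>0: "\<xi>0 \<in> C" "infdist \<xi>0 (H ` {0..1}) \<ge> 3 * \<rho>"
    and gap: "\<And>\<xi>. \<xi> \<in> C \<Longrightarrow> infdist \<xi> (H ` {0..1}) \<ge> 3 * \<rho> \<Longrightarrow> infdist \<xi> (H ` {0..1}) < 6 * \<rho> \<Longrightarrow>
      integral {0..1} (\<lambda>t. U (\<xi> - H t)) + 8 * M\<^sup>2 < integral {0..1} (\<lambda>t. U (\<xi>0 - H t))"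
  shows "\<exists>\<xi>\<in>C. \<exists>z. pos z = \<xi> - H 0 \<and> shoot z f = 0 \<and> (\<forall>t. norm (flow z f t) \<ge> \<rho>) \<and>
    jac (\<lambda>k. lin_shoot (dflow z f) k 0) \<ge> 0"
proof -
  let ?I = "H ` {0..1}"
  let ?Q = "{\<xi>\<in>C. infdist \<xi> ?I \<ge> 3 * \<rho>}"
  have far: "norm (\<xi> - H t) \<ge> infdist \<xi> ?I" if "t \<in> {0..1}" for \<xi> t
    using infdist_le[of "H t" ?I \<xi>] that by (auto simp: dist_norm)
  have far3: "norm (\<xi> - H t) \<ge> 3 * \<rho>" if "\<xi> \<in> ?Q" "t \<in> {0..1}" for \<xi> t
    using far[OF that(2), of \<xi>] that(1) by simp
  have "continuous_on ?Q action"
    by (rule continuous_at_imp_continuous_on) (use has_derivative_continuous[OF action_deriv] far3 in blast)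
  then obtain \<xi> where \<xi>: "\<xi> \<in> ?Q" "\<And>\<xi>'. \<xi>' \<in> ?Q \<Longrightarrow> action \<xi>' \<le> action \<xi>"
    using continuous_attains_sup[OF C(2)] \<xi>0 by blast
  have i6: "infdist \<xi> ?I \<ge> 6 * \<rho>"
  proof (rule ccontr)
    assume "\<not> infdist \<xi> ?I \<ge> 6 * \<rho>"
    then have "integral {0..1} (\<lambda>t. U (\<xi> - H t)) + 8 * M\<^sup>2 < integral {0..1} (\<lambda>t. U (\<xi>0 - H t))"
      using \<xi>(1) by (intro gap) auto
    moreover have "\<bar>action \<xi> - integral {0..1} (\<lambda>t. U (\<xi> - H t))\<bar> \<le> 4 * M\<^sup>2" by (rule action_approx[OF far3[OF \<xi>(1)]])
    moreover have "\<bar>action \<xi>0 - integral {0..1} (\<lambda>t. U (\<xi>0 - H t))\<bar> \<le> 4 * M\<^sup>2"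
      by (rule action_approx[OF far3]) (use \<xi>0 in auto)
    moreover have "action \<xi>0 \<le> action \<xi>" using \<xi>(2) \<xi>0 by blast
    ultimately show False by linarith
  qed
  obtain e where e: "e > 0" "ball \<xi> e \<subseteq> C" using C(1) \<xi>(1) open_contains_ball by blast
  have lm: "action \<xi>' \<le> action \<xi>" if n: "norm (\<xi>' - \<xi>) \<le> min (e / 2) \<rho>" for \<xi>'
  proof (rule \<xi>(2), intro CollectI conjI)
    have "dist \<xi> \<xi>' < e" using n e(1) by (simp add: dist_norm norm_minus_commute)
    then show "\<xi>' \<in> C" using e(2) by auto
    have "infdist \<xi> ?I \<le> infdist \<xi>' ?I + dist \<xi> \<xi>'" by (rule infdist_triangle)
    then show "infdist \<xi>' ?I \<ge> 3 * \<rho>" using i6 n \<rho> by (simp add: dist_norm norm_minus_commute)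
  qed
  have far4: "norm (\<xi> - H t) \<ge> 4 * \<rho>" if "t \<in> {0..1}" for t using far[OF that, of \<xi>] i6 \<rho> by linarith
  have "min (e / 2) \<rho> > 0" using e(1) \<rho> by simp
  note c = local_max_jac[OF far4 this lm]
  have "shoot (start \<xi>) f = 0"
    using start(2)[of \<xi>] c(1) unfolding kick_def by (metis pack_simps(3) pack_eq_0_iff)
  moreover have "norm (flow (start \<xi>) f t) \<ge> \<rho>" for t
  proof -
    have t: "clamp01 t \<in> {0..1}" by (rule clamp01)
    have "norm (disp \<xi> (clamp01 t)) \<ge> \<rho>"
      by (rule disp_away[OF t]) (use far4[OF t] M_small \<rho> in linarith)
    then show ?thesis by (simp add: disp_def flow_clamp01)
  qed
  ultimately show ?thesis using \<xi>(1) c(2) start(1)[of \<xi>] by blast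
qed

end

section \<open>Rescaling to a weak force\<close>

lemma cforce_bound:
  assumes "q \<ge> 2" "d > 0"
  shows "norm (cforce q d y) \<le> cforce_lip q d * d + d powr (- q)"
proof -
  interpret planar_force "cforce q d" "cforce_deriv q d" "cforce_lip q d"
    by (rule planar_force_cforce[OF assms])
  show ?thesis
  proof (cases "norm y \<ge> d")
    case True
    then have y: "norm y > 0" using assms by linarith
    have "norm (cforce q d y) = norm y powr (- (q + 1)) * norm y powr 1"
      using y unfolding cforce_eq[OF assms(2) True] powr_minus_divide by simp
    also have "\<dots> = norm y powr (- q)" unfolding powr_add[symmetric] by simp
    also have "\<dots> \<le> d powr (- q)" using True assms by (intro powr_mono2') auto
    finally show ?thesis using L_nonneg assms(2) by (simp add: add_increasing)
  next
    case False
    have "norm (cforce q d y) \<le> cforce_lip q d * norm y"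
      using G_lipschitz[of y 0] by (simp add: cforce_def)
    also have "\<dots> \<le> cforce_lip q d * d" using False L_nonneg by (intro mult_left_mono) auto
    finally show ?thesis by (simp add: add_increasing2)
  qed
qed

lemma kepler_potential_deriv:
  fixes y :: "real^2"
  assumes "y \<noteq> 0" "q \<ge> 2"
  shows "((\<lambda>y. - (norm y powr (1 - q)) / (q - 1)) has_derivative (\<lambda>k. ((1 / norm y powr (q + 1)) *\<^sub>R y) \<bullet> k)) (at y)"
proof -
  have y: "norm y > 0" using assms by simp
  have "((\<lambda>s. - (s powr (1 - q)) / (q - 1)) has_real_derivative norm y powr (- q)) (at (norm y))"
  proof -
    have "- ((1 - q) * x) / (q - 1) = x" for x using assms(2) by (simp add: field_simps)
    moreover have "1 - q - 1 = - q" by simp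
    ultimately show ?thesis
      using DERIV_cdivide[OF DERIV_minus[OF has_real_derivative_powr[OF y, of "1 - q"]], of "q - 1"] by metis
  qed
  from has_derivative_compose[OF has_derivative_norm[OF assms(1)] this[unfolded has_field_derivative_def]]
  have "((\<lambda>y. - (norm y powr (1 - q)) / (q - 1)) has_derivative (\<lambda>k. norm y powr (- q) * (k \<bullet> sgn y))) (at y)" .
  moreover have "(\<lambda>k. norm y powr (- q) * (k \<bullet> sgn y)) = (\<lambda>k. ((1 / norm y powr (q + 1)) *\<^sub>R y) \<bullet> k)"
    using y by (auto simp: sgn_div_norm powr_minus_divide powr_add inner_commute field_simps)
  ultimately show ?thesis by simp
qed

text \<open>Homogeneity of degree -q, with one factor \<open>lam\<close> kept in front because the
  substitution u = lam y multiplies the acceleration by \<open>lam\<close>.\<close>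

lemma scaled_force:
  fixes y :: "real^2"
  assumes "lam > 0" "d > 0" "norm y \<ge> d"
  shows "cforce q (lam * d) (lam *\<^sub>R y) = lam *\<^sub>R (lam powr (- (q + 1)) *\<^sub>R cforce q d y)"
    and "cforce_deriv_fun q (lam * d) (lam *\<^sub>R y) k = lam powr (- (q + 1)) *\<^sub>R cforce_deriv_fun q d y k"
proof -
  have n: "lam * d > 0" "norm (lam *\<^sub>R y) \<ge> lam * d" using assms by auto
  have nl: "norm (lam *\<^sub>R y) powr c = lam powr c * norm y powr c" for c
    using assms by (simp add: powr_mult)
  show "cforce q (lam * d) (lam *\<^sub>R y) = lam *\<^sub>R (lam powr (- (q + 1)) *\<^sub>R cforce q d y)"
    unfolding cforce_eq[OF n] cforce_eq[OF assms(2,3)] nl powr_minus_divide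
    using assms(1) by simp
  have "lam powr (- (q + 3)) * (lam * lam) = lam powr (- (q + 3)) * lam powr 2" using assms(1) by (simp add: power2_eq_square)
  also have "\<dots> = lam powr (- (q + 1))" unfolding powr_add[symmetric] by (rule arg_cong[where f="\<lambda>c. lam powr c"]) simp
  finally have e: "lam powr (- (q + 3)) * (lam * lam) = lam powr (- (q + 1))" .
  have "(q + 1) * (lam powr (- (q + 3)) * norm y powr (- (q + 3))) * (lam *\<^sub>R y \<bullet> k) * lam
      = (lam powr (- (q + 3)) * (lam * lam)) * ((q + 1) * norm y powr (- (q + 3)) * (y \<bullet> k))"
    by (simp add: mult_ac)
  then show "cforce_deriv_fun q (lam * d) (lam *\<^sub>R y) k = lam powr (- (q + 1)) *\<^sub>R cforce_deriv_fun q d y k"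
    unfolding cforce_deriv_eq[OF n] cforce_deriv_eq[OF assms(2,3)] nl e
    by (simp add: scaleR_diff_right)
qed

text \<open>Scaling by \<open>lam\<close> carries orbits of the weak equation to orbits of the
  original one. Both have the same linearised coefficient along the orbit, so the determinant is
  unchanged.\<close>

lemma scaled_periodic_data:
  fixes p :: "real \<Rightarrow>\<^sub>C (real^2)"
  assumes q: "q \<ge> 2" and lam: "lam > 0" and \<epsilon>: "\<epsilon> = lam powr (- (q + 1))" and d: "d > 0" and L: "planar_force (\<lambda>y. \<epsilon> *\<^sub>R cforce q d y) (\<lambda>y. \<epsilon> *\<^sub>R cforce_deriv q d y) L"
    and shoot: "planar_force.shoot (\<lambda>y. \<epsilon> *\<^sub>R cforce q d y) z p = 0"
    and far: "\<And>t. norm (planar_force.flow (\<lambda>y. \<epsilon> *\<^sub>R cforce q d y) z p t) \<ge> d"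
  shows "periodic_data q (lam *\<^sub>R p) (lam * d) (lam *\<^sub>R z)"
    and "shoot_jac q (lam *\<^sub>R p) (lam * d) (lam *\<^sub>R z) = jac (\<lambda>k. lin_shoot (planar_force.dflow
      (\<lambda>y. \<epsilon> *\<^sub>R cforce q d y) (\<lambda>y. \<epsilon> *\<^sub>R cforce_deriv q d y) z p) k 0)"
proof -
  interpret E: planar_force "\<lambda>y. \<epsilon> *\<^sub>R cforce q d y" "\<lambda>y. \<epsilon> *\<^sub>R cforce_deriv q d y" L
    by (rule L)
  have ld: "lam * d > 0" using lam d by simp
  interpret B: planar_force "cforce q (lam * d)" "cforce_deriv q (lam * d)" "cforce_lip q (lam * d)"
    by (rule planar_force_cforce[OF q ld])
  note sc = scaled_force[where q=q, OF lam d far, folded \<epsilon>]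
  have u: "((\<lambda>t. lam *\<^sub>R E.flow z p t) has_vector_derivative lam *\<^sub>R E.vflow z p t) (at t within {0..1})" if "t \<in> {0..1}" for t
    by (rule bounded_linear.has_vector_derivative[OF bounded_linear_scaleR_right E.flow_deriv(1)[OF that]])
  have v: "((\<lambda>t. lam *\<^sub>R E.vflow z p t) has_vector_derivative cforce q (lam * d) (lam *\<^sub>R E.flow z p t) + (lam *\<^sub>R p) t) (at t within {0..1})" if "t \<in> {0..1}" for t
    using bounded_linear.has_vector_derivative[OF bounded_linear_scaleR_right E.flow_deriv(2)[OF that, of z p], of lam]
    unfolding sc(1) scaleR_bcontfun.rep_eq by (simp only: scaleR_add_right)
  have 0: "E.flow z p 0 = pos z" "E.vflow z p 0 = vel z" using E.flow_deriv(3,4)[of 0 z p] by auto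
  have z: "pack (lam *\<^sub>R E.flow z p 0) (lam *\<^sub>R E.vflow z p 0) = lam *\<^sub>R z"
    unfolding 0 pack_scaleR[symmetric] by simp
  note ode = B.flow_of_ode[OF u v, unfolded z]
  have flow: "B.flow (lam *\<^sub>R z) (lam *\<^sub>R p) t = lam *\<^sub>R E.flow z p t" for t
    using ode(1)[OF _ _ clamp01(1), of t] by (simp add: B.flow_clamp01 E.flow_clamp01)
  have vflow: "B.vflow (lam *\<^sub>R z) (lam *\<^sub>R p) 1 = lam *\<^sub>R E.vflow z p 1"
    by (rule ode(2)) auto
  show "periodic_data q (lam *\<^sub>R p) (lam * d) (lam *\<^sub>R z)"
    unfolding periodic_data_def
  proof (intro conjI allI)
    show "lam * d \<le> norm (B.flow (lam *\<^sub>R z) (lam *\<^sub>R p) t)" for t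
      using far[of t] lam by (simp add: flow)
    show "B.shoot (lam *\<^sub>R z) (lam *\<^sub>R p) = 0"
      using shoot by (simp add: B.shoot_def E.shoot_def flow vflow pos_linear vel_linear pack_eq_0_iff)
  qed
  have "B.dflow (lam *\<^sub>R z) (lam *\<^sub>R p) = E.dflow z p"
  proof (rule bcontfun_eqI, rule blinfun_eqI)
    fix t k
    show "blinfun_apply (B.dflow (lam *\<^sub>R z) (lam *\<^sub>R p) t) k = blinfun_apply (E.dflow z p t) k"
      unfolding B.dflow_def E.dflow_def B.dforce_along_apply E.dforce_along_apply flow
      by (simp add: cforce_deriv_apply scaleR_blinfun.rep_eq sc(2))
  qed
  then show "shoot_jac q (lam *\<^sub>R p) (lam * d) (lam *\<^sub>R z) = jac (\<lambda>k. lin_shoot (E.dflow z p) k 0)"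
    unfolding shoot_jac_def by simp
qed

lemma powr_neg_small:
  assumes "(\<epsilon>::real) > 0" "c > 0" "lam \<ge> \<epsilon> powr (- 1 / c)"
  shows "lam powr (- c) \<le> \<epsilon>"
proof -
  have "lam powr (- c) \<le> (\<epsilon> powr (- 1 / c)) powr (- c)"
    using assms by (intro powr_mono2') auto
  also have "\<dots> = \<epsilon>" using assms by (simp add: powr_powr)
  finally show ?thesis .
qed

lemma bounded_component_orbit:
  fixes f :: "real \<Rightarrow>\<^sub>C (real^2)"
  assumes q: "q \<ge> 2"
    and H: "\<And>t. t \<in> {0..1} \<Longrightarrow> (H has_vector_derivative H1 t) (at t within {0..1})"
    and H1: "\<And>t. t \<in> {0..1} \<Longrightarrow> (H1 has_vector_derivative - f t) (at t within {0..1})"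
    and per: "H 1 = H 0" "H1 1 = H1 0" and C: "C \<in> bounded_components (- (H ` {0..1}))"
  shows "\<exists>lam0>0. \<forall>lam\<ge>lam0. \<exists>\<xi>\<in>C. \<exists>z d. pos z = lam *\<^sub>R (\<xi> - H 0) \<and> d > 0 \<and>
    periodic_data q (lam *\<^sub>R f) d z \<and> shoot_jac q (lam *\<^sub>R f) d z \<ge> 0"
proof -
  have cH: "continuous_on {0..1} H" by (rule continuous_on_vector_derivative[OF H])
  have cH1: "continuous_on {0..1} H1" by (rule continuous_on_vector_derivative[OF H1])
  obtain B where "\<forall>y\<in>H1 ` {0..1}. norm y \<le> B"
    using compact_imp_bounded[OF compact_continuous_image[OF cH1 compact_Icc]] unfolding bounded_iff by blast
  then have B: "norm (H1 t) \<le> B" if "t \<in> {0..1}" for t using that by blast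
  have lip: "norm (H s - H t) \<le> max 1 B * \<bar>s - t\<bar>" if st: "s \<in> {0..1}" "t \<in> {0..1}" for s t
  proof -
    have "norm (H s - H t) \<le> max 1 B * norm (s - t)"
    proof (rule differentiable_bound[where f'="\<lambda>t h. h *\<^sub>R H1 t" and S="{0..1}"])
      show "(H has_derivative (\<lambda>h. h *\<^sub>R H1 x)) (at x within {0..1})" if "x \<in> {0..1}" for x
        using H[OF that] by (simp add: has_vector_derivative_def)
      show "onorm (\<lambda>h. h *\<^sub>R H1 x) \<le> max 1 B" if "x \<in> {0..1}" for x
        by (rule onorm_bound) (use B[OF that] in \<open>auto simp: mult.commute[of "max 1 B"] intro!: mult_left_mono\<close>)
    qed (use st in auto)
    then show ?thesis by simp
  qed
  obtain \<xi>0 \<delta> where w: "\<delta> > 0" "\<xi>0 \<in> C" "infdist \<xi>0 (H ` {0..1}) \<ge> \<delta>" "open C"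
    "compact {\<xi>\<in>C. infdist \<xi> (H ` {0..1}) \<ge> \<delta>}"
    "\<And>\<xi>. \<xi> \<in> C \<Longrightarrow> infdist \<xi> (H ` {0..1}) < 2 * \<delta> \<Longrightarrow> potential q H \<xi> > potential q H \<xi>0 + 1"
    using potential_well[OF q lip _ cH C] by auto
  \<comment> \<open>Then \<open>3 * \<rho>\<close> and \<open>6 * \<rho>\<close> are the distances
    \<delta> and 2 \<delta> of the potential well.\<close>
  define \<rho> where "\<rho> = \<delta> / 3"
  have \<rho>: "\<rho> > 0" "\<delta> = 3 * \<rho>" using w(1) by (auto simp: \<rho>_def)
  define L where "L = cforce_lip q \<rho>"
  define M where "M = L * \<rho> + \<rho> powr (- q)"
  have L0: "L \<ge> 0" using q \<rho>(1) by (simp add: L_def cforce_lip_def)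
  have M0: "M > 0" using L0 \<rho>(1) by (simp add: M_def add_nonneg_pos)
  \<comment> \<open>One summand for each smallness condition on \<epsilon>: the two on the Lipschitz
    constant, the one keeping orbits near \<xi> - H, and the gap in the reduced action.\<close>
  define K where "K = L + 4 * vconst 1 * L + 2 * M / \<rho> + 16 * M\<^sup>2 * (q - 1)"
  have Kparts: "0 \<le> 4 * vconst 1 * L" "0 < 2 * M / \<rho>" "0 < 16 * M\<^sup>2 * (q - 1)"
    using L0 M0 \<rho>(1) q vconst_pos[of 1] by auto
  then have K0: "K > 0" using L0 unfolding K_def by linarith
  show ?thesis
  proof (intro exI conjI allI impI)
    show pos: "(1 / K) powr (- 1 / (q + 1)) > 0" using K0 by simp
    fix lam assume lam: "lam \<ge> (1 / K) powr (- 1 / (q + 1))"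
    then have lam0: "lam > 0" using pos by (rule less_le_trans[rotated])
    define \<epsilon> where "\<epsilon> = lam powr (- (q + 1))"
    have \<epsilon>0: "\<epsilon> > 0" using lam0 by (simp add: \<epsilon>_def)
    have "\<epsilon> \<le> 1 / K" unfolding \<epsilon>_def by (rule powr_neg_small) (use K0 q lam in auto)
    then have "\<epsilon> * K \<le> 1" using K0 by (simp add: pos_le_divide_eq)
    then have "\<epsilon> * L + \<epsilon> * (4 * vconst 1 * L) + \<epsilon> * (2 * M / \<rho>) + \<epsilon> * (16 * M\<^sup>2 * (q - 1)) \<le> 1"
      by (simp add: K_def distrib_left)
    moreover have "\<epsilon> * L \<ge> 0" "\<epsilon> * (4 * vconst 1 * L) \<ge> 0" "\<epsilon> * (2 * M / \<rho>) > 0" "\<epsilon> * (16 * M\<^sup>2 * (q - 1)) > 0"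
      using mult_nonneg_nonneg[OF less_imp_le[OF \<epsilon>0]] mult_pos_pos[OF \<epsilon>0] L0 Kparts by blast+
    ultimately have small: "\<epsilon> * L \<le> 1" "\<epsilon> * (4 * vconst 1 * L) \<le> 1" "\<epsilon> * (2 * M / \<rho>) \<le> 1" "\<epsilon> * (16 * M\<^sup>2 * (q - 1)) \<le> 1"
      by linarith+
    have F: "planar_force (\<lambda>y. \<epsilon> *\<^sub>R cforce q \<rho> y) (\<lambda>y. \<epsilon> *\<^sub>R cforce_deriv q \<rho> y) (\<epsilon> * L)"
      unfolding L_def by (rule planar_force_scale[OF planar_force_cforce[OF q \<rho>(1)] \<epsilon>0])
    define U where "U y = \<epsilon> * (- (norm y powr (1 - q)) / (q - 1))" for y :: "real^2"
    interpret E: planar_force "\<lambda>y. \<epsilon> *\<^sub>R cforce q \<rho> y" "\<lambda>y. \<epsilon> *\<^sub>R cforce_deriv q \<rho> y" "\<epsilon> * L" by (rule F)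
    interpret W: weak_force "\<lambda>y. \<epsilon> *\<^sub>R cforce q \<rho> y" "\<lambda>y. \<epsilon> *\<^sub>R cforce_deriv q \<rho> y" "\<epsilon> * L" U H H1 f \<rho> "\<epsilon> * M"
    proof
      show "(U has_derivative (\<lambda>k. (\<epsilon> *\<^sub>R cforce q \<rho> y) \<bullet> k)) (at y)" if "norm y \<ge> \<rho>" for y
      proof -
        have "y \<noteq> 0" using that \<rho>(1) by auto
        from has_derivative_mult_right[OF kepler_potential_deriv[OF this q], of \<epsilon>]
        show ?thesis unfolding cforce_eq[OF \<rho>(1) that] U_def[abs_def] by simp
      qed
      show "norm (\<epsilon> *\<^sub>R cforce q \<rho> y) \<le> \<epsilon> * M" for y
        using cforce_bound[OF q \<rho>(1), of y] \<epsilon>0 by (simp add: M_def L_def mult_left_mono)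
      show "2 * (\<epsilon> * M) \<le> \<rho>" using small(3) \<rho>(1) by (simp add: pos_divide_le_eq)
      show "4 * vconst 1 * (\<epsilon> * L) \<le> 1" using small(2) by (simp add: mult_ac)
    qed (use H H1 per \<rho> small in auto)
    have "\<exists>\<xi>\<in>C. \<exists>z. pos z = \<xi> - H 0 \<and> E.shoot z f = 0 \<and> (\<forall>t. norm (E.flow z f t) \<ge> \<rho>) \<and>
        jac (\<lambda>k. lin_shoot (E.dflow z f) k 0) \<ge> 0"
    proof (rule W.exists_periodic[OF w(4) _ w(2)])
      show "compact {\<xi> \<in> C. 3 * \<rho> \<le> infdist \<xi> (H ` {0..1})}" "3 * \<rho> \<le> infdist \<xi>0 (H ` {0..1})"
        using w(3,5) \<rho>(2) by auto
      fix \<xi> assume \<xi>: "\<xi> \<in> C" "infdist \<xi> (H ` {0..1}) < 6 * \<rho>"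
      have P: "potential q H \<xi> > potential q H \<xi>0 + 1" using \<xi> \<rho>(2) by (intro w(6)) auto
      have IU: "integral {0..1} (\<lambda>t. U (x - H t)) = - (\<epsilon> / (q - 1)) * potential q H x" for x
      proof -
        have "(\<lambda>t. U (x - H t)) = (\<lambda>t. (- (\<epsilon> / (q - 1))) * (norm (x - H t) powr (1 - q)))"
          by (auto simp: U_def)
        then show ?thesis unfolding potential_def by simp
      qed
      \<comment> \<open>The approximation error is quadratic in \<epsilon>, whereas the unit gap of
        the potential contributes linearly.\<close>
      have "8 * (\<epsilon> * M)\<^sup>2 * (q - 1) = (\<epsilon> / 2) * (\<epsilon> * (16 * M\<^sup>2 * (q - 1)))" by (simp add: power2_eq_square)
      also have "\<dots> \<le> (\<epsilon> / 2) * 1" using small(4) \<epsilon>0 by (intro mult_left_mono) auto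
      also have "\<dots> < \<epsilon> * 1" using \<epsilon>0 by simp
      also have "\<dots> < \<epsilon> * (potential q H \<xi> - potential q H \<xi>0)" using P \<epsilon>0 by (intro mult_strict_left_mono) auto
      finally have "8 * (\<epsilon> * M)\<^sup>2 < \<epsilon> * (potential q H \<xi> - potential q H \<xi>0) / (q - 1)"
        using q by (simp add: pos_less_divide_eq)
      then show "integral {0..1} (\<lambda>t. U (\<xi> - H t)) + 8 * (\<epsilon> * M)\<^sup>2 < integral {0..1} (\<lambda>t. U (\<xi>0 - H t))"
        unfolding IU by (simp add: right_diff_distrib diff_divide_distrib)
    qed
    then obtain \<xi> z where z: "\<xi> \<in> C" "pos z = \<xi> - H 0" "E.shoot z f = 0" "\<And>t. norm (E.flow z f t) \<ge> \<rho>"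
      "jac (\<lambda>k. lin_shoot (E.dflow z f) k 0) \<ge> 0" by blast
    note s = scaled_periodic_data[OF q lam0 \<epsilon>_def \<rho>(1) F z(3,4)]
    have "shoot_jac q (lam *\<^sub>R f) (lam * \<rho>) (lam *\<^sub>R z) \<ge> 0"
      unfolding s(2) by (rule z(5))
    moreover have "lam * \<rho> > 0" using lam0 \<rho>(1) by simp
    moreover have "pos (lam *\<^sub>R z) = lam *\<^sub>R (\<xi> - H 0)" by (simp add: pos_linear z(2))
    ultimately show "\<exists>\<xi>\<in>C. \<exists>z d. pos z = lam *\<^sub>R (\<xi> - H 0) \<and> d > 0 \<and>
        periodic_data q (lam *\<^sub>R f) d z \<and> shoot_jac q (lam *\<^sub>R f) d z \<ge> 0"
      using s(1) z(1) by blast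
  qed
qed

section \<open>Counting over all bounded components\<close>

lemma repulsive_solutions_cong:
  assumes "\<And>t. t \<in> {0..1} \<Longrightarrow> p t = p' t"
  shows "repulsive_solutions q p = repulsive_solutions q p'"
  using assms unfolding repulsive_solutions_def by auto

lemma C2_on01_derivs:
  assumes "C2_on01 H" "t \<in> {0..1}"
  shows "(H has_vector_derivative deriv01 H t) (at t within {0..1})"
    and "(deriv01 H has_vector_derivative deriv01 (deriv01 H) t) (at t within {0..1})"
  using assms unfolding C2_on01_def differentiable_on_def deriv01_def[of H] deriv01_def[of "deriv01 H"]
  by (auto simp: vector_derivative_works[symmetric])

lemma ext01_scaled_restriction:
  fixes h :: "real \<Rightarrow> real^2"
  assumes "continuous_on {0..1} h"
  shows "ext01 (\<lambda>t\<in>{0..1}. lam *\<^sub>R h t) = lam *\<^sub>R ext01 h"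
proof (rule bcontfun_eqI)
  fix t
  have "continuous_on {0..1} (\<lambda>t. lam *\<^sub>R h t)" using assms by (intro continuous_intros)
  then have "continuous_on {0..1} (\<lambda>t\<in>{0..1}. lam *\<^sub>R h t)"
    by (rule continuous_on_eq) auto
  then show "apply_bcontfun (ext01 (\<lambda>t\<in>{0..1}. lam *\<^sub>R h t)) t = apply_bcontfun (lam *\<^sub>R ext01 h) t"
    using clamp01(1)[of t] by (simp add: ext01_apply assms)
qed

text \<open>Any orbit falls under the condition with n + 1 above both 1/d and the norm of its state;
  shrinking the truncation radius does not change its determinant.\<close>

lemma generic_nondegenerate:
  assumes q: "q \<ge> 2" and gen: "x \<in> (\<Inter>n. generic_forcing q n)" and d: "d > 0" and z: "periodic_data q (ext01 x) d z"
  shows "shoot_jac q (ext01 x) d z \<noteq> 0"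
proof -
  obtain n :: nat where n: "1 / d \<le> real (Suc n)" "norm z \<le> real (Suc n)"
    using real_arch_simple[of "max (1 / d) (norm z)"] by (metis le_SucI max.bounded_iff of_nat_le_iff order_trans order_refl)
  have n': "0 < 1 / real (Suc n)" "1 / real (Suc n) \<le> d"
    using n(1) d by (auto simp: divide_simps mult.commute)
  note a = periodic_data_antimono[OF q n' z]
  have "ext01 x \<notin> degenerate_forcing q (1 / real (Suc n)) (real (Suc n))"
    using gen by (auto simp: generic_forcing_def)
  then show ?thesis using a n(2) by (auto simp: degenerate_forcing_def)
qed

theorem corollary1:
  fixes q :: real
  assumes "q \<ge> 2"
  shows "\<exists>\<Sigma>. residual_in (mtopology_of C0_per) \<Sigma> \<and>
    (\<forall>(h :: real \<Rightarrow> real^2) (H :: real \<Rightarrow> real^2) (r :: nat).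
       continuous_on {0..1} h \<and> integral {0..1} h = 0 \<and>
       C2_on01 H \<and> periodic01 H \<and> (\<forall>t\<in>{0..1}. deriv01 (deriv01 H) t = - h t) \<and>
       finite (bounded_components (- (H ` {0..1}))) \<and>
       r = card (bounded_components (- (H ` {0..1})))
       \<longrightarrow> (\<exists>lam0 > 0. \<forall>lam \<ge> lam0.
              (\<lambda>t\<in>{0..1}. lam *\<^sub>R h t) \<in> \<Sigma> \<longrightarrow>
              (\<exists>S \<subseteq> repulsive_solutions q (\<lambda>t. lam *\<^sub>R h t). finite S \<and> card S = 2 * r)))"
proof (intro exI[of _ "\<Inter>n. generic_forcing q n"] conjI allI impI)
  show "residual_in (mtopology_of C0_per) (\<Inter>n. generic_forcing q n)"
    by (rule residual_generic_forcing[OF assms])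
  fix h H :: "real \<Rightarrow> real^2" and r :: nat
  let ?\<C> = "bounded_components (- (H ` {0..1}))"
  assume *: "continuous_on {0..1} h \<and> integral {0..1} h = 0 \<and>
    C2_on01 H \<and> periodic01 H \<and> (\<forall>t\<in>{0..1}. deriv01 (deriv01 H) t = - h t) \<and> finite ?\<C> \<and> r = card ?\<C>"
  then have h: "continuous_on {0..1} h" "integral {0..1} h = 0" and fin: "finite ?\<C>" and r: "r = card ?\<C>" by auto
  have ext: "ext01 h t = h t" if "t \<in> {0..1}" for t using that by (simp add: ext01_apply h clamp01)
  have H: "(H has_vector_derivative deriv01 H t) (at t within {0..1})" if "t \<in> {0..1}" for t
    by (rule C2_on01_derivs) (use * that in auto)
  have H1: "(deriv01 H has_vector_derivative - ext01 h t) (at t within {0..1})" if "t \<in> {0..1}" for t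
    using C2_on01_derivs(2)[of H, OF _ that] * that ext[OF that] by simp
  have per: "H 1 = H 0" "deriv01 H 1 = deriv01 H 0" using * by (auto simp: periodic01_def)
  have "\<forall>C\<in>?\<C>. \<exists>lam0>0. \<forall>lam\<ge>lam0. \<exists>\<xi>\<in>C. \<exists>z d. pos z = lam *\<^sub>R (\<xi> - H 0) \<and> d > 0 \<and>
      periodic_data q (lam *\<^sub>R ext01 h) d z \<and> shoot_jac q (lam *\<^sub>R ext01 h) d z \<ge> 0"
    by (intro ballI bounded_component_orbit[OF assms H H1 per])
  from bchoice[OF this] obtain lam0 where lam0: "\<forall>C\<in>?\<C>. lam0 C > 0 \<and> (\<forall>lam\<ge>lam0 C. \<exists>\<xi>\<in>C. \<exists>z d. pos z = lam *\<^sub>R (\<xi> - H 0) \<and> d > 0 \<and>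
      periodic_data q (lam *\<^sub>R ext01 h) d z \<and> shoot_jac q (lam *\<^sub>R ext01 h) d z \<ge> 0)" by blast
  \<comment> \<open>The inserted 1 keeps the threshold positive when there are no bounded
    components.\<close>
  define \<Lambda> where "\<Lambda> = Max (insert 1 (lam0 ` ?\<C>))"
  have \<Lambda>: "\<Lambda> \<ge> 1" "C \<in> ?\<C> \<Longrightarrow> \<Lambda> \<ge> lam0 C" for C
    using fin by (auto simp: \<Lambda>_def intro: Max_ge)
  show "\<exists>lam0 > 0. \<forall>lam \<ge> lam0. (\<lambda>t\<in>{0..1}. lam *\<^sub>R h t) \<in> (\<Inter>n. generic_forcing q n) \<longrightarrow>
      (\<exists>S \<subseteq> repulsive_solutions q (\<lambda>t. lam *\<^sub>R h t). finite S \<and> card S = 2 * r)"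
  proof (intro exI[of _ \<Lambda>] conjI allI impI)
    show "\<Lambda> > 0" using \<Lambda>(1) by linarith
    fix lam assume lam: "lam \<ge> \<Lambda>" and gen: "(\<lambda>t\<in>{0..1}. lam *\<^sub>R h t) \<in> (\<Inter>n. generic_forcing q n)"
    define p :: "real \<Rightarrow>\<^sub>C (real^2)" where "p = lam *\<^sub>R ext01 h"
    note p_ext = ext01_scaled_restriction[OF h(1), of lam, folded p_def]
    note nondeg = generic_nondegenerate[OF assms gen, unfolded p_ext]
    have p: "p t = lam *\<^sub>R h t" if "t \<in> {0..1}" for t using ext[OF that] by (simp add: p_def)
    have "integral {0..1} (apply_bcontfun p) = integral {0..1} (\<lambda>t. lam *\<^sub>R h t)"
      by (rule integral_cong) (rule p)
    then have p0: "integral {0..1} (apply_bcontfun p) = 0" using h(2) by simp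
    \<comment> \<open>Here genericity turns the weak sign obtained at a maximum into a strict
      one.\<close>
    have "\<forall>C\<in>?\<C>. \<exists>z. \<exists>\<xi>\<in>C. pos z = lam *\<^sub>R (\<xi> - H 0) \<and> (\<exists>d>0. periodic_data q p d z \<and> shoot_jac q p d z > 0)"
    proof
      fix C assume C: "C \<in> ?\<C>"
      then have "lam \<ge> lam0 C" using lam \<Lambda>(2) order_trans by blast
      then obtain \<xi> z d where o: "\<xi> \<in> C" "pos z = lam *\<^sub>R (\<xi> - H 0)" "d > 0" "periodic_data q p d z" "shoot_jac q p d z \<ge> 0"
        using lam0 C unfolding p_def by blast
      then show "\<exists>z. \<exists>\<xi>\<in>C. pos z = lam *\<^sub>R (\<xi> - H 0) \<and> (\<exists>d>0. periodic_data q p d z \<and> shoot_jac q p d z > 0)"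
        using nondeg[OF o(3,4)] by (intro exI[of _ z] bexI[of _ \<xi>] conjI exI[of _ d]) auto
    qed
    from bchoice[OF this] obtain Z where Z: "\<forall>C\<in>?\<C>. \<exists>\<xi>\<in>C. pos (Z C) = lam *\<^sub>R (\<xi> - H 0) \<and> (\<exists>d>0. periodic_data q p d (Z C) \<and> shoot_jac q p d (Z C) > 0)"
      by blast
    \<comment> \<open>The initial position determines \<xi>, since \<open>lam\<close> is nonzero,
      and distinct components are disjoint.\<close>
    have "inj_on Z ?\<C>"
    proof (rule inj_onI)
      fix C C' assume C: "C \<in> ?\<C>" "C' \<in> ?\<C>" "Z C = Z C'"
      obtain \<xi> \<xi>' where \<xi>: "\<xi> \<in> C" "\<xi>' \<in> C'" "pos (Z C) = lam *\<^sub>R (\<xi> - H 0)" "pos (Z C') = lam *\<^sub>R (\<xi>' - H 0)"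
        using Z C(1,2) by blast
      have "\<xi> = \<xi>'" using \<xi>(3,4) C(3) lam \<Lambda>(1) by auto
      then show "C = C'" using \<xi>(1,2) C(1,2) components_nonoverlap[of C "- (H ` {0..1})" C']
        by (auto simp: bounded_components_def)
    qed
    then have card: "card (Z ` ?\<C>) = r" using r by (simp add: card_image)
    have "\<exists>W d. finite W \<and> card W = 2 * card (Z ` ?\<C>) \<and> d > 0 \<and> (\<forall>z\<in>W. periodic_data q p d z)"
      by (rule periodic_count[OF assms p0]) (use nondeg Z in auto)
    then obtain W d where W: "finite W" "card W = 2 * r" "d > 0" "\<And>z. z \<in> W \<Longrightarrow> periodic_data q p d z"
      unfolding card by blast
    have "repulsive_solutions q (apply_bcontfun p) = repulsive_solutions q (\<lambda>t. lam *\<^sub>R h t)"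
      by (rule repulsive_solutions_cong) (rule p)
    with repulsive_solutions_card[OF assms W(1,3,4)] W(2) show "\<exists>S \<subseteq> repulsive_solutions q (\<lambda>t. lam *\<^sub>R h t). finite S \<and> card S = 2 * r"
      by simp
  qed
qed

end
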